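(* Let $0<T<1$. For $F\in C([0,T];H^s(\mathbb R_{x_1}\times\mathbb R_{x_2}))$ let $$ W(x_1,x_2,t)=-\frac{i}{(2\pi)^2}\int_{t'=0}^t\int_{k_1\in\mathbb R}\int_{k_2\in\mathbb R}e^{ik_1x_1+ik_2x_2-i(k_1^2+k_2^2)(t-t')}\,\widehat F(k_1,k_2,t')\,dk_2dk_1dt' $$ be the solution of the forced linear Schrödinger initial value problem $$ iW_t+W_{x_1x_1}+W_{x_2x_2}=F(x_1,x_2,t),\qquad W(x_1,x_2,0)=0,\qquad (x_1,x_2)\in\mathbb R\times\mathbb R . $$ Then $$ \sup_{t\in[0,T]}\|W(t)\|_{H^s(\mathbb R_{x_1}\times\mathbb R_{x_2})}\leqslant T\sup_{t\in[0,T]}\|F(t)\|_{H^s(\mathbb R_{x_1}\times\mathbb R_{x_2})},\qquad s\in\mathbb R, $$ and $$ \sup_{x_2\in\mathbb R}\|W(x_2)\|_{B_T^s}\leqslant c_s\sqrt T\sup_{t\in[0,T]}\|F(t)\|_{H^s(\mathbb R_{x_1}\times\mathbb R_{x_2})},\qquad \tfrac12<s\leqslant\tfrac32, $$ where $c_s>0$ depends only on $s$ and $W(x_2)$ denotes the function $(x_1,t)\mapsto W(x_1,x_2,t)$.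
   Context: $\widehat F(k_1,k_2,t)=\int_{\mathbb R}\int_{\mathbb R}e^{-ik_1x_1-ik_2x_2}F(x_1,x_2,t)\,dx_2dx_1$, and $\|\phi\|_{H^s(\mathbb R^2)}^2=\int_{\mathbb R}\int_{\mathbb R}(1+k_1^2+k_2^2)^s|\widehat \phi(k_1,k_2)|^2dk_2dk_1$. $H_t^m(0,T)$ is the usual Sobolev space of restrictions to $(0,T)$ of elements of $H^m(\mathbb R_t)$, with the infimum norm. With $\widehat g^{x_1}(k_1,t)=\int_{\mathbb R}e^{-ik_1x_1}g(x_1,t)\,dx_1$, the space $B_T^s$ consists of the $g\in L^2(\mathbb R_{x_1}\times[0,T])$ with $$ \|g\|_{B_T^s}=\left(\int_{\mathbb R}\big\|e^{ik_1^2t}\,\widehat g^{x_1}(k_1,t)\big\|^2_{H_t^{\frac{2s+1}{4}}(0,T)}dk_1\right)^{\frac12}+\left(\int_{\mathbb R}(1+k_1^2)^s\big\|e^{ik_1^2t}\,\widehat g^{x_1}(k_1,t)\big\|^2_{H_t^{\frac14}(0,T)}dk_1\right)^{\frac12}<\infty . $$ *)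

theory Defs
  imports "HOL-Analysis.Analysis"
begin

section \<open>Tempered distributions\<close>

fun iter_partial :: "'a::euclidean_space list \<Rightarrow> ('a \<Rightarrow> complex) \<Rightarrow> 'a \<Rightarrow> complex" where
  "iter_partial [] f = f"
| "iter_partial (b # bs) f = (\<lambda>x. frechet_derivative (iter_partial bs f) (at x) b)"

definition schwartz :: "('a::euclidean_space \<Rightarrow> complex) \<Rightarrow> bool" where
  "schwartz \<phi> \<longleftrightarrow>
     (\<forall>bs. set bs \<subseteq> Basis \<longrightarrow>
        (\<forall>x. iter_partial bs \<phi> differentiable (at x)) \<and>
        (\<forall>n::nat. bounded (range (\<lambda>x. (1 + norm x) ^ n *\<^sub>R iter_partial bs \<phi> x))))"

definition schwartz_seminorm :: "nat \<Rightarrow> ('a::euclidean_space \<Rightarrow> complex) \<Rightarrow> real" where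
  "schwartz_seminorm N \<phi> =
     (SUP (bs, x) \<in> {bs. set bs \<subseteq> Basis \<and> length bs \<le> N} \<times> UNIV.
        (1 + norm x) ^ N * cmod (iter_partial bs \<phi> x))"

text \<open>
  A distribution is a functional on test functions; only its values on Schwartz functions
  are meaningful. Its pairing with test functions is bilinear (no complex conjugation).
\<close>

type_synonym 'a distribution = "('a \<Rightarrow> complex) \<Rightarrow> complex"

definition tempered :: "'a::euclidean_space distribution \<Rightarrow> bool" where
  "tempered u \<longleftrightarrow>
     (\<forall>\<phi> \<psi> a b. schwartz \<phi> \<longrightarrow> schwartz \<psi> \<longrightarrow>
        u (\<lambda>x. a * \<phi> x + b * \<psi> x) = a * u \<phi> + b * u \<psi>) \<and>
     (\<exists>C N. \<forall>\<phi>. schwartz \<phi> \<longrightarrow> cmod (u \<phi>) \<le> C * schwartz_seminorm N \<phi>)"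

definition regular :: "('a::euclidean_space \<Rightarrow> complex) \<Rightarrow> 'a distribution" where
  "regular f \<phi> = (LINT x|lborel. f x * \<phi> x)"

definition fourier :: "('a::euclidean_space \<Rightarrow> complex) \<Rightarrow> 'a \<Rightarrow> complex" where
  "fourier \<phi> k = (LINT x|lborel. exp (- \<i> * complex_of_real (k \<bullet> x)) * \<phi> x)"

text \<open>
  The Fourier transform of \<open>u\<close>, defined by duality, is the function \<open>h\<close>. For integrable
  functions this is the usual integral, for square-integrable functions the
  Plancherel extension; \<open>h\<close> is determined almost everywhere.
\<close>

definition has_fourier :: "'a::euclidean_space distribution \<Rightarrow> ('a \<Rightarrow> complex) \<Rightarrow> bool" where
  "has_fourier u h \<longleftrightarrow>
     h \<in> borel_measurable borel \<and>
     (\<forall>\<phi>. schwartz \<phi> \<longrightarrow>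
        integrable lborel (\<lambda>k. h k * \<phi> k) \<and> u (fourier \<phi>) = (LINT k|lborel. h k * \<phi> k))"

definition fourier_of :: "'a::euclidean_space distribution \<Rightarrow> 'a \<Rightarrow> complex" where
  "fourier_of u = (SOME h. has_fourier u h)"


section \<open>Sobolev spaces\<close>

definition sobolev :: "real \<Rightarrow> 'a::euclidean_space distribution set" where
  "sobolev s = {u. tempered u \<and>
     (\<exists>h. has_fourier u h \<and>
        integrable lborel (\<lambda>k. (1 + (norm k)\<^sup>2) powr s * (cmod (h k))\<^sup>2))}"

definition sobolev_norm :: "real \<Rightarrow> 'a::euclidean_space distribution \<Rightarrow> real" where
  "sobolev_norm s u =
     sqrt (LINT k|lborel. (1 + (norm k)\<^sup>2) powr s * (cmod (fourier_of u k))\<^sup>2)"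

definition continuous_sobolev ::
    "real \<Rightarrow> real \<Rightarrow> (real \<Rightarrow> 'a::euclidean_space distribution) \<Rightarrow> bool" where
  "continuous_sobolev T s F \<longleftrightarrow>
     (\<forall>t\<in>{0..T}. F t \<in> sobolev s \<and>
        ((\<lambda>\<tau>. sobolev_norm s (\<lambda>\<phi>. F \<tau> \<phi> - F t \<phi>)) \<longlongrightarrow> 0) (at t within {0..T}))"

text \<open>
  The infimum norm on restrictions to \<open>(0,T)\<close> of elements of \<open>H\<^sup>m(\<real>)\<close>, for \<open>m \<ge> 0\<close>, when all
  these elements are square-integrable functions. The value is \<open>\<infinity>\<close> when \<open>f\<close> has no extension.
\<close>

definition sobolev_interval_norm :: "real \<Rightarrow> real \<Rightarrow> (real \<Rightarrow> complex) \<Rightarrow> ennreal" where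
  "sobolev_interval_norm m T f =
     (INF v \<in> {v. v \<in> borel_measurable borel \<and> integrable lborel (\<lambda>t. (cmod (v t))\<^sup>2) \<and>
                  regular v \<in> sobolev m \<and>
                  (AE t in lborel. t \<in> {0<..<T} \<longrightarrow> v t = f t)}.
        ennreal (sobolev_norm m (regular v)))"


section \<open>The boundary space\<close>

text \<open>Functions on \<open>\<real> \<times> [0,T]\<close> are functions of the pair \<open>(x\<^sub>1, t)\<close>.\<close>

definition strip_L2 :: "real \<Rightarrow> (real \<times> real \<Rightarrow> complex) set" where
  "strip_L2 T = {g. g \<in> borel_measurable borel \<and>
     set_integrable lborel (UNIV \<times> {0..T}) (\<lambda>z. (cmod (g z))\<^sup>2)}"

text \<open>
  The Fourier transform in the first variable has to be taken as a jointly measurable function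
  of \<open>(k\<^sub>1, t)\<close>, because it is then considered as a function of \<open>t\<close> for almost every fixed \<open>k\<^sub>1\<close>.
\<close>

definition partial_fourier ::
    "real \<Rightarrow> (real \<times> real \<Rightarrow> complex) \<Rightarrow> real \<times> real \<Rightarrow> complex" where
  "partial_fourier T g =
     (SOME G. G \<in> strip_L2 T \<and>
        (AE t in lborel. t \<in> {0..T} \<longrightarrow>
           has_fourier (regular (\<lambda>x\<^sub>1. g (x\<^sub>1, t))) (\<lambda>k\<^sub>1. G (k\<^sub>1, t))))"

definition B_time_norm ::
    "real \<Rightarrow> real \<Rightarrow> (real \<times> real \<Rightarrow> complex) \<Rightarrow> real \<Rightarrow> ennreal" where
  "B_time_norm m T g k\<^sub>1 =
     sobolev_interval_norm m T
       (\<lambda>t. exp (\<i> * complex_of_real (k\<^sub>1\<^sup>2 * t)) * partial_fourier T g (k\<^sub>1, t))"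

definition B_sq1 :: "real \<Rightarrow> real \<Rightarrow> (real \<times> real \<Rightarrow> complex) \<Rightarrow> ennreal" where
  "B_sq1 s T g = (\<integral>\<^sup>+ k\<^sub>1. (B_time_norm ((2 * s + 1) / 4) T g k\<^sub>1)\<^sup>2 \<partial>lborel)"

definition B_sq2 :: "real \<Rightarrow> real \<Rightarrow> (real \<times> real \<Rightarrow> complex) \<Rightarrow> ennreal" where
  "B_sq2 s T g =
     (\<integral>\<^sup>+ k\<^sub>1. ennreal ((1 + k\<^sub>1\<^sup>2) powr s) * (B_time_norm (1 / 4) T g k\<^sub>1)\<^sup>2 \<partial>lborel)"

definition B_space :: "real \<Rightarrow> real \<Rightarrow> (real \<times> real \<Rightarrow> complex) set" where
  "B_space s T = {g \<in> strip_L2 T. B_sq1 s T g < \<infinity> \<and> B_sq2 s T g < \<infinity>}"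

definition B_norm :: "real \<Rightarrow> real \<Rightarrow> (real \<times> real \<Rightarrow> complex) \<Rightarrow> real" where
  "B_norm s T g = sqrt (enn2real (B_sq1 s T g)) + sqrt (enn2real (B_sq2 s T g))"


section \<open>The Duhamel integral\<close>

text \<open>
  For general \<open>F \<in> C([0,T]; H\<^sup>s(\<real>\<^sup>2))\<close> the integral over \<open>(k\<^sub>1, k\<^sub>2)\<close> in
  \[ W(x,t) = -\frac{i}{(2\pi)^2} \int_0^t \int_{\mathbb{R}^2}
       e^{i k \cdot x - i |k|^2 (t-t')} \widehat F(k,t') \, dk \, dt' \]
  does not converge pointwise in \<open>x\<close>, and \<open>W(t)\<close> is a distribution: the formula is paired with
  a test function \<open>\<phi>(x)\<close>, and the integration over \<open>x\<close>, which only involves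
  \<open>e\<^bsup>ik\<cdot>x\<^esup> \<phi>(x)\<close>, is carried out first. All integrals then converge absolutely, and no joint
  measurability of the representatives of the Fourier transforms in \<open>(k, t')\<close> is needed.
\<close>

definition duhamel ::
    "(real \<Rightarrow> (real \<times> real) distribution) \<Rightarrow> real \<Rightarrow> (real \<times> real) distribution" where
  "duhamel F t \<phi> =
     - (\<i> / (2 * complex_of_real pi)\<^sup>2) *
     (LINT t':{0..t}|lborel. LINT k|lborel.
        exp (- \<i> * complex_of_real ((norm k)\<^sup>2 * (t - t'))) * fourier_of (F t') k *
        (LINT x|lborel. exp (\<i> * complex_of_real (k \<bullet> x)) * \<phi> x))"

text \<open>
  The restrictions of a distribution in \<open>(x\<^sub>1, x\<^sub>2)\<close> to the lines \<open>x\<^sub>2 = y\<close>: \<open>u\<close> is the (weakly)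
  continuous function \<open>v\<close> of \<open>x\<^sub>2\<close> with values in the distributions in \<open>x\<^sub>1\<close>. On Schwartz
  functions \<open>v\<close> is unique; it exists for every \<open>u \<in> H\<^sup>s(\<real>\<^sup>2)\<close> with \<open>s > 1/2\<close>, and \<open>v y\<close> is then
  the trace of \<open>u\<close> on the line \<open>x\<^sub>2 = y\<close>.
\<close>

definition has_restrictions ::
    "(real \<times> real) distribution \<Rightarrow> (real \<Rightarrow> real distribution) \<Rightarrow> bool" where
  "has_restrictions u v \<longleftrightarrow>
     (\<forall>y. tempered (v y)) \<and>
     (\<forall>\<phi>. schwartz \<phi> \<longrightarrow>
        continuous_on UNIV (\<lambda>y. v y \<phi>) \<and>
        (\<forall>\<psi>. schwartz \<psi> \<longrightarrow>
           integrable lborel (\<lambda>y. v y \<phi> * \<psi> y) \<and>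
           u (\<lambda>(x\<^sub>1, x\<^sub>2). \<phi> x\<^sub>1 * \<psi> x\<^sub>2) = (LINT y|lborel. v y \<phi> * \<psi> y)))"

text \<open>
  \<open>g\<close> represents \<open>(x\<^sub>1, t) \<mapsto> W(x\<^sub>1, x\<^sub>2, t)\<close> in \<open>L\<^sup>2(\<real> \<times> [0,T])\<close>, for fixed \<open>x\<^sub>2\<close>. This determines
  \<open>g\<close> almost everywhere.
\<close>

definition is_slice ::
    "real \<Rightarrow> (real \<Rightarrow> (real \<times> real) distribution) \<Rightarrow> real \<Rightarrow> (real \<times> real \<Rightarrow> complex) \<Rightarrow> bool" where
  "is_slice T W x\<^sub>2 g \<longleftrightarrow>
     g \<in> strip_L2 T \<and>
     (AE t in lborel. t \<in> {0..T} \<longrightarrow>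
        (\<exists>v. has_restrictions (W t) v \<and>
           (\<forall>\<phi>. schwartz \<phi> \<longrightarrow> v x\<^sub>2 \<phi> = regular (\<lambda>x\<^sub>1. g (x\<^sub>1, t)) \<phi>)))"

end

theory Submission
  imports Defs "HOL-Probability.Probability"
begin

text \<open>
  On the Fourier side \<open>W(t)\<close> is the function \<open>u(k,t)\<close> given by \<open>- i\<close> times the integral of
  \<open>e\<^bsup>-i|k|\<^sup>2(t-t')\<^esup> F(k,t')\<close> over \<open>0 \<le> t' \<le> t\<close>, so the first estimate is the Cauchy-Schwarz inequality in \<open>t'\<close>.
  For the second one, fix \<open>k\<^sub>1\<close>. Multiplied by \<open>e\<^bsup>ik\<^sub>1\<^sup>2t\<^esup>\<close>, the partial Fourier transform of \<open>W\<close> on the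
  line \<open>x\<^sub>2 = y\<close> is the solution at the point \<open>y\<close> of a one-dimensional forced Schroedinger equation whose
  data have the Fourier transform \<open>e\<^bsup>ik\<^sub>1\<^sup>2t\<^esup> F(k\<^sub>1,k\<^sub>2,t)\<close> in \<open>k\<^sub>2\<close>. The change of variables \<open>\<tau> = k\<^sub>2\<^sup>2\<close> bounds
  it in \<open>L\<^sup>2\<close> in time by the data in \<open>H\<close> with exponent \<open>-1/2\<close> (Kato smoothing), and the equation bounds its time
  derivative by the data with exponent \<open>3/2\<close>. As the solution vanishes at \<open>t = 0\<close>, its even reflection
  about \<open>t = T\<close> is an extension to the real line for which both bounds persist. Splitting the data into low
  and high frequencies, depending on the dyadic size of \<open>\<tau>\<close>, interpolates between them and gives the
  exponent \<open>(2s+1)/4\<close> in time for data in \<open>H\<^sup>s\<close> with \<open>0 \<le> s \<le> 3/2\<close>. It is used with \<open>s\<close> and with \<open>0\<close>, and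
  integration over \<open>k\<^sub>1\<close> gives the two parts of the norm.
\<close>

section \<open>Schwartz functions\<close>

text \<open>The obstacle that shapes the proof is that \<open>fourier_of\<close> is a choice, made
  separately for every time and fixed only almost everywhere, so Fubini cannot be applied to it.
  Continuity in time is used to glue the transforms of \<open>F t\<close> into one jointly
  measurable \<open>G\<close>. Every bound proved for \<open>G\<close> is carried back by uniqueness
  of Fourier transforms, that is, by the fact that Schwartz functions separate functions; the first
  sections serve this purpose. The factor sqrt T has a simple origin: the data enter the second
  estimate only through their squared norm in H^s integrated over [0,T]. The assumption T < 1 keeps
  all other constants independent of T. The weight of H^s in (k1,k2) dominates both the weight in k1
  and the weight in k2, so one time estimate serves both parts of the norm. The condition s > 1/2
  makes the integrals in k2 absolutely convergent, hence the traces continuous; s = 3/2 corresponds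
  to one full time derivative.\<close>

text \<open>Partials of all orders would otherwise call for a closed formula. It is enough to name
  one class \<open>S\<close> that contains \<open>f\<close>, is closed under first partials and
  consists of differentiable, rapidly decaying functions: every \<open>iter_partial\<close> of
  \<open>f\<close> then lies in \<open>S\<close>.\<close>

lemma schwartz_coinduct:
  assumes "f \<in> S"
    and "\<And>g x. g \<in> S \<Longrightarrow> g differentiable (at x)"
    and "\<And>g n. g \<in> S \<Longrightarrow> \<exists>C. \<forall>x. (1 + norm x) ^ n * cmod (g x) \<le> C"
    and "\<And>g b. g \<in> S \<Longrightarrow> b \<in> Basis \<Longrightarrow> (\<lambda>x. frechet_derivative g (at x) b) \<in> S"
  shows "schwartz f"
proof -
  have S: "iter_partial bs f \<in> S" if "set bs \<subseteq> Basis" for bs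
    using that by (induction bs) (auto intro: assms)
  have "bounded (range (\<lambda>x. (1 + norm x) ^ n *\<^sub>R g x))" if g: "g \<in> S" for g n
  proof -
    obtain C where "\<forall>x. (1 + norm x) ^ n * cmod (g x) \<le> C" using assms(3)[OF g] by blast
    then show ?thesis by (auto simp: bounded_iff intro!: exI[of _ C])
  qed
  then show ?thesis unfolding schwartz_def using S assms(2) by blast
qed

lemma iter_partial_append: "iter_partial (bs @ cs) f = iter_partial bs (iter_partial cs f)"
  by (induction bs) auto

lemma schwartz_iter_partial:
  assumes "schwartz \<phi>" "set bs \<subseteq> Basis"
  shows "schwartz (iter_partial bs \<phi>)"
  unfolding schwartz_def
proof (intro allI impI)
  fix cs :: "'a list" assume "set cs \<subseteq> Basis"
  then have "set (cs @ bs) \<subseteq> Basis" using assms(2) by auto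
  then show "(\<forall>x. iter_partial cs (iter_partial bs \<phi>) differentiable at x) \<and>
      (\<forall>n. bounded (range (\<lambda>x. (1 + norm x) ^ n *\<^sub>R iter_partial cs (iter_partial bs \<phi>) x)))"
    using assms(1) unfolding schwartz_def iter_partial_append[symmetric] by blast
qed

lemma schwartz_partial:
  "schwartz \<phi> \<Longrightarrow> b \<in> Basis \<Longrightarrow> schwartz (\<lambda>x. frechet_derivative \<phi> (at x) b)"
  using schwartz_iter_partial[of \<phi> "[b]"] by simp

lemma schwartz_has_derivative:
  "schwartz \<phi> \<Longrightarrow> (\<phi> has_derivative frechet_derivative \<phi> (at x)) (at x)"
  unfolding schwartz_def using frechet_derivative_works
  by (metis empty_set empty_subsetI iter_partial.simps(1))

lemma schwartz_differentiable: "schwartz \<phi> \<Longrightarrow> \<phi> differentiable (at x)"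
  using schwartz_has_derivative unfolding differentiable_def by blast

lemma schwartz_continuous: "schwartz \<phi> \<Longrightarrow> continuous_on A \<phi>"
  using schwartz_has_derivative
  by (metis continuous_at_imp_continuous_on has_derivative_continuous)

lemma schwartz_measurable: "schwartz \<phi> \<Longrightarrow> \<phi> \<in> borel_measurable borel"
  by (intro borel_measurable_continuous_onI schwartz_continuous)

lemma schwartz_decay:
  assumes "schwartz \<phi>" shows "\<exists>C\<ge>0. \<forall>x. (1 + norm x) ^ n * cmod (\<phi> x) \<le> C"
proof -
  have "bounded (range (\<lambda>x. (1 + norm x) ^ n *\<^sub>R \<phi> x))"
    using assms unfolding schwartz_def by (metis empty_set empty_subsetI iter_partial.simps(1))
  then obtain C where C: "\<forall>x. norm ((1 + norm x) ^ n *\<^sub>R \<phi> x) \<le> C"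
    unfolding bounded_iff by auto
  then show ?thesis by (intro exI[of _ "max C 0"]) (auto simp: le_max_iff_disj)
qed

lemma frechet_lincomb:
  fixes \<xi> \<theta> :: "'a::euclidean_space \<Rightarrow> complex"
  assumes "schwartz \<xi>" "schwartz \<theta>"
  shows "((\<lambda>x. a * \<xi> x + b * \<theta> x) has_derivative
      (\<lambda>v. a * frechet_derivative \<xi> (at x) v + b * frechet_derivative \<theta> (at x) v)) (at x)"
  by (intro has_derivative_add has_derivative_mult_right schwartz_has_derivative assms)

lemma schwartz_lincomb:
  fixes \<phi> \<psi> :: "'a::euclidean_space \<Rightarrow> complex"
  assumes "schwartz \<phi>" "schwartz \<psi>"
  shows "schwartz (\<lambda>x. a * \<phi> x + b * \<psi> x)"
proof (rule schwartz_coinduct)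
  \<comment> \<open>Only the two functions vary in this class; \<open>a\<close> and \<open>b\<close>
    stay fixed, and this makes it closed under partial derivatives.\<close>
  let ?S = "{f. \<exists>(\<xi>::'a \<Rightarrow> complex) \<theta>. schwartz \<xi> \<and> schwartz \<theta> \<and> f = (\<lambda>x. a * \<xi> x + b * \<theta> x)}"
  show "(\<lambda>x. a * \<phi> x + b * \<psi> x) \<in> ?S" using assms by blast
  fix g assume "g \<in> ?S"
  then obtain \<xi> \<theta> where S: "schwartz \<xi>" "schwartz \<theta>" and g: "g = (\<lambda>x. a * \<xi> x + b * \<theta> x)" by blast
  note d = frechet_lincomb[OF S, of a b]
  show "g differentiable (at x)" for x using d unfolding g differentiable_def by blast
  show "\<exists>C. \<forall>x. (1 + norm x) ^ n * cmod (g x) \<le> C" for n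
  proof -
    obtain C D where C: "\<forall>x. (1 + norm x) ^ n * cmod (\<xi> x) \<le> C" and D: "\<forall>x. (1 + norm x) ^ n * cmod (\<theta> x) \<le> D"
      using schwartz_decay S by metis
    have "(1 + norm x) ^ n * cmod (g x) \<le> cmod a * C + cmod b * D" for x
    proof -
      have "cmod (g x) \<le> cmod a * cmod (\<xi> x) + cmod b * cmod (\<theta> x)"
        unfolding g by (metis norm_mult norm_triangle_ineq)
      then have "(1 + norm x) ^ n * cmod (g x) \<le> (1 + norm x) ^ n * (cmod a * cmod (\<xi> x) + cmod b * cmod (\<theta> x))"
        by (intro mult_left_mono) auto
      also have "\<dots> = cmod a * ((1 + norm x) ^ n * cmod (\<xi> x)) + cmod b * ((1 + norm x) ^ n * cmod (\<theta> x))"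
        by (simp add: algebra_simps)
      also have "\<dots> \<le> cmod a * C + cmod b * D"
        using C D by (intro add_mono mult_left_mono) auto
      finally show ?thesis .
    qed
    then show ?thesis by blast
  qed
  fix c :: 'a assume c: "c \<in> Basis"
  have "(\<lambda>x. frechet_derivative g (at x) c) = (\<lambda>x. a * frechet_derivative \<xi> (at x) c + b * frechet_derivative \<theta> (at x) c)"
    using frechet_derivative_at[OF d] unfolding g by metis
  then show "(\<lambda>x. frechet_derivative g (at x) c) \<in> ?S"
    using schwartz_partial[OF S(1) c] schwartz_partial[OF S(2) c] by auto
qed

lemma schwartz_scale: "schwartz \<phi> \<Longrightarrow> schwartz (\<lambda>x. a * \<phi> x)"
  using schwartz_lincomb[of \<phi> \<phi> a 0] by simp

lemma schwartz_coord_mult: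
  fixes \<phi> :: "'a::euclidean_space \<Rightarrow> complex"
  assumes "schwartz \<phi>"
  shows "schwartz (\<lambda>x. complex_of_real (x \<bullet> e) * \<phi> x)"
proof (rule schwartz_coinduct)
  \<comment> \<open>The product rule leaves a term without the coordinate factor, so the class
    admits an added Schwartz function \<xi>; the function of interest is the case \<xi> = 0.\<close>
  let ?S = "{f. \<exists>(\<xi>::'a \<Rightarrow> complex) \<theta>. schwartz \<xi> \<and> schwartz \<theta> \<and> f = (\<lambda>x. \<xi> x + complex_of_real (x \<bullet> e) * \<theta> x)}"
  have z: "schwartz (\<lambda>x::'a. 0)" using schwartz_scale[OF assms, of 0] by simp
  show "(\<lambda>x. complex_of_real (x \<bullet> e) * \<phi> x) \<in> ?S"
    using z assms by (intro CollectI exI[of _ "\<lambda>x. 0"] exI[of _ \<phi>]) auto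
  fix g assume "g \<in> ?S"
  then obtain \<xi> \<theta> where S: "schwartz \<xi>" "schwartz \<theta>" and g: "g = (\<lambda>x. \<xi> x + complex_of_real (x \<bullet> e) * \<theta> x)" by blast
  have d: "(g has_derivative (\<lambda>v. frechet_derivative \<xi> (at x) v +
      (complex_of_real (x \<bullet> e) * frechet_derivative \<theta> (at x) v + complex_of_real (v \<bullet> e) * \<theta> x))) (at x)" for x
    unfolding g by (intro has_derivative_add has_derivative_mult schwartz_has_derivative S derivative_intros)
  show "g differentiable (at x)" for x using d unfolding differentiable_def by blast
  show "\<exists>C. \<forall>x. (1 + norm x) ^ n * cmod (g x) \<le> C" for n
  proof -
    obtain C D where C: "\<forall>x. (1 + norm x) ^ n * cmod (\<xi> x) \<le> C" and D: "\<forall>x. (1 + norm x) ^ Suc n * cmod (\<theta> x) \<le> D"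
      using schwartz_decay S by metis
    have "(1 + norm x) ^ n * cmod (g x) \<le> C + norm e * D" for x
    proof -
      have "\<bar>x \<bullet> e\<bar> \<le> norm x * norm e" by (rule Cauchy_Schwarz_ineq2)
      also have "\<dots> \<le> (1 + norm x) * norm e" by (simp add: mult_right_mono)
      finally have e: "\<bar>x \<bullet> e\<bar> \<le> (1 + norm x) * norm e" .
      have "cmod (g x) \<le> cmod (\<xi> x) + \<bar>x \<bullet> e\<bar> * cmod (\<theta> x)"
        unfolding g by (metis norm_mult norm_of_real norm_triangle_ineq)
      also have "\<dots> \<le> cmod (\<xi> x) + ((1 + norm x) * norm e) * cmod (\<theta> x)"
        by (intro add_mono order_refl mult_right_mono e) auto
      finally have "(1 + norm x) ^ n * cmod (g x) \<le> (1 + norm x) ^ n * (cmod (\<xi> x) + ((1 + norm x) * norm e) * cmod (\<theta> x))"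
        by (intro mult_left_mono) auto
      also have "\<dots> = (1 + norm x) ^ n * cmod (\<xi> x) + norm e * ((1 + norm x) ^ Suc n * cmod (\<theta> x))"
        by (simp add: algebra_simps)
      also have "\<dots> \<le> C + norm e * D"
        using C D by (intro add_mono mult_left_mono) auto
      finally show ?thesis .
    qed
    then show ?thesis by blast
  qed
  fix c :: 'a assume c: "c \<in> Basis"
  have "(\<lambda>x. frechet_derivative g (at x) c) = (\<lambda>x. (1 * frechet_derivative \<xi> (at x) c + complex_of_real (c \<bullet> e) * \<theta> x)
       + complex_of_real (x \<bullet> e) * frechet_derivative \<theta> (at x) c)"
    using frechet_derivative_at[OF d, symmetric] by (simp add: algebra_simps)
  moreover have "schwartz (\<lambda>x. 1 * frechet_derivative \<xi> (at x) c + complex_of_real (c \<bullet> e) * \<theta> x)"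
    by (intro schwartz_lincomb schwartz_partial S c)
  ultimately show "(\<lambda>x. frechet_derivative g (at x) c) \<in> ?S"
    using schwartz_partial[OF S(2) c] by blast
qed

section \<open>Gaussian test functions and bounds by seminorms\<close>

text \<open>These are real polynomials times one Gaussian, generated so that closure under
  derivatives and decay, as \<open>schwartz_coinduct\<close> requires them, follow by rule
  induction. The linear term in the exponent admits Gaussians centred away from the origin, on which
  \<open>schwartz_separates\<close> relies.\<close>

inductive_set gauss_span :: "real \<Rightarrow> 'a::euclidean_space \<Rightarrow> ('a \<Rightarrow> complex) set"
  for \<alpha> :: real and \<beta> :: 'a where
  base: "(\<lambda>x. complex_of_real (exp (\<beta> \<bullet> x - \<alpha> * (x \<bullet> x)))) \<in> gauss_span \<alpha> \<beta>"
| add: "f \<in> gauss_span \<alpha> \<beta> \<Longrightarrow> g \<in> gauss_span \<alpha> \<beta> \<Longrightarrow> (\<lambda>x. f x + g x) \<in> gauss_span \<alpha> \<beta>"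
| scale: "f \<in> gauss_span \<alpha> \<beta> \<Longrightarrow> (\<lambda>x. complex_of_real a * f x) \<in> gauss_span \<alpha> \<beta>"
| coord: "f \<in> gauss_span \<alpha> \<beta> \<Longrightarrow> (\<lambda>x. complex_of_real (x \<bullet> b) * f x) \<in> gauss_span \<alpha> \<beta>"

text \<open>Since 1 + r <= exp r, the left side is at most exp((n + |\<beta>|) r - \<alpha> r^2)
  with r = norm x; completing the square shows that this exponent never exceeds (n + |\<beta>|)^2 /
  (4 \<alpha>).\<close>

lemma gauss_decay:
  fixes \<beta> x :: "'a::euclidean_space"
  assumes "\<alpha> > 0"
  shows "(1 + norm x) ^ n * exp (\<beta> \<bullet> x - \<alpha> * (x \<bullet> x)) \<le> exp ((real n + norm \<beta>)\<^sup>2 / (4 * \<alpha>))"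
proof -
  have "(1 + norm x) ^ n \<le> exp (norm x) ^ n"
    by (intro power_mono) (auto simp: exp_ge_add_one_self)
  also have "\<dots> = exp (real n * norm x)" by (simp add: exp_of_nat_mult)
  finally have "(1 + norm x) ^ n * exp (\<beta> \<bullet> x - \<alpha> * (x \<bullet> x)) \<le> exp (real n * norm x) * exp (\<beta> \<bullet> x - \<alpha> * (x \<bullet> x))"
    by (intro mult_right_mono) auto
  also have "\<dots> = exp (real n * norm x + \<beta> \<bullet> x - \<alpha> * (x \<bullet> x))" by (simp add: exp_add[symmetric] algebra_simps)
  also have "\<dots> \<le> exp ((real n + norm \<beta>)\<^sup>2 / (4 * \<alpha>))"
  proof -
    have "\<beta> \<bullet> x \<le> norm \<beta> * norm x" by (rule norm_cauchy_schwarz)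
    then have "real n * norm x + \<beta> \<bullet> x - \<alpha> * (x \<bullet> x) \<le> (real n + norm \<beta>) * norm x - \<alpha> * (norm x)\<^sup>2"
      by (simp add: power2_norm_eq_inner algebra_simps)
    also have "\<dots> \<le> (real n + norm \<beta>)\<^sup>2 / (4 * \<alpha>)"
    proof -
      have "0 \<le> (2 * \<alpha> * norm x - (real n + norm \<beta>))\<^sup>2" by simp
      then have "((real n + norm \<beta>) * norm x - \<alpha> * (norm x)\<^sup>2) * (4 * \<alpha>) \<le> (real n + norm \<beta>)\<^sup>2"
        by (simp add: power2_eq_square algebra_simps)
      then show ?thesis using assms by (simp add: pos_le_divide_eq)
    qed
    finally show ?thesis by simp
  qed
  finally show ?thesis .
qed

lemma gauss_span_derivative:
  assumes "f \<in> gauss_span \<alpha> \<beta>"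
  shows "\<exists>D. (\<forall>x. (f has_derivative D x) (at x)) \<and> (\<forall>b. (\<lambda>x. D x b) \<in> gauss_span \<alpha> \<beta>)"
  using assms
proof induction
  case base
  let ?E = "\<lambda>x. complex_of_real (exp (\<beta> \<bullet> x - \<alpha> * (x \<bullet> x)))"
  let ?D = "\<lambda>x v. complex_of_real (exp (\<beta> \<bullet> x - \<alpha> * (x \<bullet> x)) * (\<beta> \<bullet> v - \<alpha> * (x \<bullet> v + v \<bullet> x)))"
  have "(?E has_derivative ?D x) (at x)" for x
    by (rule derivative_eq_intros refl | simp)+ (auto simp: algebra_simps)
  moreover have "(\<lambda>x. ?D x b) \<in> gauss_span \<alpha> \<beta>" for b
  proof -
    have "(\<lambda>x. ?D x b) = (\<lambda>x. complex_of_real (\<beta> \<bullet> b) * ?E x + complex_of_real (- 2 * \<alpha>) * (complex_of_real (x \<bullet> b) * ?E x))"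
      by (auto simp: algebra_simps inner_commute)
    then show ?thesis
      by (simp only:) (intro gauss_span.add gauss_span.scale gauss_span.coord gauss_span.base)
  qed
  ultimately show ?case by (intro exI[of _ ?D]) blast
next
  case (add f g)
  then obtain D D' where D: "\<forall>x. (f has_derivative D x) (at x)" "\<forall>b. (\<lambda>x. D x b) \<in> gauss_span \<alpha> \<beta>"
    "\<forall>x. (g has_derivative D' x) (at x)" "\<forall>b. (\<lambda>x. D' x b) \<in> gauss_span \<alpha> \<beta>" by blast
  then show ?case
    by (intro exI[of _ "\<lambda>x v. D x v + D' x v"]) (auto intro: gauss_span.intros has_derivative_add)
next
  case (scale f a)
  then obtain D where D: "\<forall>x. (f has_derivative D x) (at x)" "\<forall>b. (\<lambda>x. D x b) \<in> gauss_span \<alpha> \<beta>" by blast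
  then show ?case
    by (intro exI[of _ "\<lambda>x v. complex_of_real a * D x v"]) (auto intro: gauss_span.intros has_derivative_mult_right)
next
  case (coord f b)
  then obtain D where D: "\<forall>x. (f has_derivative D x) (at x)" "\<forall>b. (\<lambda>x. D x b) \<in> gauss_span \<alpha> \<beta>" by blast
  have "((\<lambda>x. complex_of_real (x \<bullet> b) * f x) has_derivative
     (\<lambda>v. complex_of_real (x \<bullet> b) * D x v + complex_of_real (v \<bullet> b) * f x)) (at x)" for x
    using D(1) by (intro has_derivative_mult derivative_intros) auto
  then show ?case using D(2) coord(1)
    by (intro exI[of _ "\<lambda>x v. complex_of_real (x \<bullet> b) * D x v + complex_of_real (v \<bullet> b) * f x"])
       (auto intro!: gauss_span.intros)
qed

lemma gauss_span_decay:
  assumes "f \<in> gauss_span \<alpha> \<beta>" "\<alpha> > 0"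
  shows "\<exists>C. \<forall>x. (1 + norm x) ^ n * cmod (f x) \<le> C"
  using assms(1)
proof (induction arbitrary: n)
  case base
  show ?case using gauss_decay[OF assms(2), of _ n \<beta>] by (auto intro!: exI)
next
  case (add f g)
  obtain C D where CD: "\<forall>x. (1 + norm x) ^ n * cmod (f x) \<le> C" "\<forall>x. (1 + norm x) ^ n * cmod (g x) \<le> D"
    using add by metis
  have "(1 + norm x) ^ n * cmod (f x + g x) \<le> C + D" for x
  proof -
    have "(1 + norm x) ^ n * cmod (f x + g x) \<le> (1 + norm x) ^ n * (cmod (f x) + cmod (g x))"
      by (intro mult_left_mono norm_triangle_ineq) auto
    then show ?thesis using CD by (smt (verit) distrib_left)
  qed
  then show ?case by blast
next
  case (scale f a)
  obtain C where C: "\<forall>x. (1 + norm x) ^ n * cmod (f x) \<le> C" using scale by metis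
  have "(1 + norm x) ^ n * cmod (complex_of_real a * f x) \<le> \<bar>a\<bar> * C" for x
    using mult_left_mono[OF C[rule_format, of x], of "\<bar>a\<bar>"] by (simp add: norm_mult algebra_simps)
  then show ?case by blast
next
  case (coord f b)
  \<comment> \<open>A coordinate factor costs one power of 1 + norm x, so the induction hypothesis
    is used at \<open>Suc n\<close>; this is why \<open>n\<close> is kept arbitrary.\<close>
  obtain C where C: "\<forall>x. (1 + norm x) ^ Suc n * cmod (f x) \<le> C" using coord by metis
  have "(1 + norm x) ^ n * cmod (complex_of_real (x \<bullet> b) * f x) \<le> norm b * C" for x
  proof -
    have "\<bar>x \<bullet> b\<bar> \<le> norm x * norm b" by (rule Cauchy_Schwarz_ineq2)
    also have "\<dots> \<le> (1 + norm x) * norm b" by (simp add: mult_right_mono)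
    finally have "(1 + norm x) ^ n * (\<bar>x \<bullet> b\<bar> * cmod (f x)) \<le> (1 + norm x) ^ n * (((1 + norm x) * norm b) * cmod (f x))"
      by (intro mult_left_mono mult_right_mono) auto
    also have "\<dots> = norm b * ((1 + norm x) ^ Suc n * cmod (f x))" by (simp add: algebra_simps)
    also have "\<dots> \<le> norm b * C" using C by (intro mult_left_mono) auto
    finally show ?thesis by (simp add: norm_mult)
  qed
  then show ?case by blast
qed

lemma schwartz_gauss:
  fixes \<beta> :: "'a::euclidean_space"
  assumes "\<alpha> > 0"
  shows "schwartz (\<lambda>x. complex_of_real (exp (\<beta> \<bullet> x - \<alpha> * (x \<bullet> x))))"
proof (rule schwartz_coinduct[where S = "gauss_span \<alpha> \<beta>"])
  fix g b assume g: "g \<in> gauss_span \<alpha> \<beta>"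
  then obtain D where D: "\<forall>x. (g has_derivative D x) (at x)" "\<forall>b. (\<lambda>x. D x b) \<in> gauss_span \<alpha> \<beta>"
    using gauss_span_derivative by blast
  show "g differentiable (at x)" for x using D unfolding differentiable_def by blast
  show "\<exists>C. \<forall>x. (1 + norm x) ^ n * cmod (g x) \<le> C" for n using gauss_span_decay[OF g assms] .
  have "(\<lambda>x. frechet_derivative g (at x) b) = (\<lambda>x. D x b)"
    using frechet_derivative_at D(1) by metis
  then show "(\<lambda>x. frechet_derivative g (at x) b) \<in> gauss_span \<alpha> \<beta>" using D(2) by simp
qed (rule gauss_span.base)

text \<open>A real supremum says something about its members only if the set is bounded. It is
  bounded here because there are finitely many lists of length at most \<open>N\<close> over the
  finite \<open>Basis\<close>, and each contributes one decay constant.\<close>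

lemma schwartz_seminorm_upper:
  fixes \<phi> :: "'a::euclidean_space \<Rightarrow> complex"
  assumes "schwartz \<phi>" "set bs \<subseteq> Basis" "length bs \<le> N"
  shows "(1 + norm x) ^ N * cmod (iter_partial bs \<phi> x) \<le> schwartz_seminorm N \<phi>"
proof -
  let ?A = "{bs. set bs \<subseteq> (Basis :: 'a set) \<and> length bs \<le> N}"
  let ?f = "\<lambda>(bs, x). (1 + norm x) ^ N * cmod (iter_partial bs \<phi> x)"
  have fin: "finite ?A" by (rule finite_lists_length_le) simp
  have "\<exists>C. \<forall>bs\<in>?A. C bs \<ge> 0 \<and> (\<forall>x. (1 + norm x) ^ N * cmod (iter_partial bs \<phi> x) \<le> C bs)"
    using schwartz_decay[OF schwartz_iter_partial[OF assms(1)]] by (intro bchoice) blast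
  then obtain C where C: "\<And>bs. bs \<in> ?A \<Longrightarrow> C bs \<ge> 0"
    "\<And>bs x. bs \<in> ?A \<Longrightarrow> (1 + norm x) ^ N * cmod (iter_partial bs \<phi> x) \<le> C bs" by blast
  have "bdd_above (?f ` (?A \<times> UNIV))"
  proof (rule bdd_aboveI2[where M = "\<Sum>bs\<in>?A. C bs"], clarify)
    fix bs x assume b: "set bs \<subseteq> (Basis :: 'a set)" "length bs \<le> N"
    have "C bs \<le> (\<Sum>bs\<in>?A. C bs)" using b C(1) fin by (intro member_le_sum) auto
    then show "(1 + norm x) ^ N * cmod (iter_partial bs \<phi> x) \<le> (\<Sum>bs\<in>?A. C bs)"
      using C(2)[of bs x] b by auto
  qed
  from cSUP_upper[OF _ this, of "(bs, x)"] show ?thesis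
    using assms unfolding schwartz_seminorm_def by auto
qed

section \<open>The Fourier transform of Schwartz functions\<close>

lemma norm_exp_neg_ii [simp]: "cmod (exp (- (\<i> * complex_of_real r))) = 1"
  by simp

text \<open>Lebesgue measure on a Euclidean space is the image of the product measure over
  \<open>Basis\<close>, which reduces products of functions of the coordinates to one-dimensional
  integrals.\<close>

lemma lborel_integrable_prod:
  fixes f :: "'a::euclidean_space \<Rightarrow> real \<Rightarrow> 'b::{real_normed_field,banach,second_countable_topology}"
  assumes "\<And>b. b \<in> Basis \<Longrightarrow> integrable lborel (f b)"
  shows "integrable lborel (\<lambda>x::'a. \<Prod>b\<in>Basis. f b (x \<bullet> b))" (is ?I)
    and "(LINT x|lborel. (\<Prod>b\<in>Basis. f b (x \<bullet> b))) = (\<Prod>b\<in>Basis. LINT x|lborel. f b x)" (is ?E)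
proof -
  interpret product_sigma_finite "\<lambda>_::'a. lborel :: real measure" ..
  have [measurable]: "f b \<in> borel_measurable borel" if "b \<in> Basis" for b
    using borel_measurable_integrable[OF assms[OF that]] by simp
  have eq: "(\<Prod>b\<in>Basis. f b ((\<Sum>c\<in>Basis. g c *\<^sub>R c) \<bullet> b)) = (\<Prod>b\<in>Basis. f b (g b))" for g
    by simp
  show ?I
    by (subst lborel_eq, subst integrable_distr_eq) (auto simp: eq intro!: product_integrable_prod assms)
  have "(LINT x|lborel. (\<Prod>b\<in>Basis. f b (x \<bullet> b))) = (LINT g|Pi\<^sub>M (Basis::'a set) (\<lambda>_. lborel). (\<Prod>b\<in>Basis. f b (g b)))"
    by (subst lborel_eq, subst integral_distr) (auto simp: eq)
  also have "\<dots> = (\<Prod>b\<in>Basis. LINT x|lborel. f b x)"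
    by (intro product_integral_prod assms) auto
  finally show ?E .
qed

lemma integrable_inverse_1_square: "integrable lborel (\<lambda>x::real. inverse (1 + x\<^sup>2))"
  using integrable_inverse_1_plus_square by (simp add: set_integrable_def)

text \<open>Each coordinate satisfies 1 + (x . b)^2 <= (1 + norm x)^2. Multiplying over the basis
  compares the power \<open>2 * DIM('a)\<close> with a product of one-dimensional functions 1 / (1 +
  t^2).\<close>

lemma integrable_inverse_power_norm:
  "integrable lborel (\<lambda>x::'a::euclidean_space. 1 / (1 + norm x) ^ (2 * DIM('a)))"
proof (rule Bochner_Integration.integrable_bound[OF lborel_integrable_prod(1)])
  show "integrable lborel (\<lambda>x::real. inverse (1 + x\<^sup>2))" by (rule integrable_inverse_1_square)
  show "AE x::'a in lborel. norm (1 / (1 + norm x) ^ (2 * DIM('a))) \<le> norm (\<Prod>b\<in>Basis. inverse (1 + (x \<bullet> b)\<^sup>2))"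
  proof (rule AE_I2)
    fix x :: 'a
    have "inverse ((1 + norm x)\<^sup>2) \<le> inverse (1 + (x \<bullet> b)\<^sup>2)" if "b \<in> Basis" for b
    proof (rule le_imp_inverse_le)
      have "(x \<bullet> b)\<^sup>2 \<le> (norm x)\<^sup>2" using Basis_le_norm[OF that, of x] by (metis abs_le_square_iff abs_norm_cancel)
      then show "1 + (x \<bullet> b)\<^sup>2 \<le> (1 + norm x)\<^sup>2" by (simp add: power2_sum add_increasing2)
      show "0 < 1 + (x \<bullet> b)\<^sup>2" by (smt (verit) zero_le_power2)
    qed
    then have "(\<Prod>b\<in>(Basis::'a set). inverse ((1 + norm x)\<^sup>2)) \<le> (\<Prod>b\<in>Basis. inverse (1 + (x \<bullet> b)\<^sup>2))"
      by (intro prod_mono) auto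
    then show "norm (1 / (1 + norm x) ^ (2 * DIM('a))) \<le> norm (\<Prod>b\<in>Basis. inverse (1 + (x \<bullet> b)\<^sup>2))"
      by (simp add: power_mult power_inverse divide_inverse)
  qed
qed simp

definition decay_integral :: "'a::euclidean_space itself \<Rightarrow> real" where
  "decay_integral _ = (LINT x::'a|lborel. 1 / (1 + norm x) ^ (2 * DIM('a)))"

lemma decay_integral_nonneg: "decay_integral TYPE('a::euclidean_space) \<ge> 0"
  unfolding decay_integral_def by (intro integral_nonneg_AE) auto

lemma integrable_decay:
  fixes f :: "'a::euclidean_space \<Rightarrow> complex"
  assumes "f \<in> borel_measurable borel" "\<And>x. (1 + norm x) ^ (2 * DIM('a)) * cmod (f x) \<le> C"
  shows "integrable lborel f" "(LINT x|lborel. cmod (f x)) \<le> C * decay_integral TYPE('a)"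
proof -
  have le: "cmod (f x) \<le> C * (1 / (1 + norm x) ^ (2 * DIM('a)))" for x
  proof -
    have "0 < (1 + norm x) ^ (2 * DIM('a))" by (metis add_pos_nonneg norm_ge_zero zero_less_one zero_less_power)
    then show ?thesis using assms(2)[of x] by (simp add: field_simps)
  qed
  have i: "integrable lborel (\<lambda>x::'a. C * (1 / (1 + norm x) ^ (2 * DIM('a))))"
    by (intro integrable_mult_right integrable_inverse_power_norm)
  show *: "integrable lborel f"
    by (rule Bochner_Integration.integrable_bound[OF i]) (use assms(1) order_trans[OF le abs_ge_self] in auto)
  have "(LINT x|lborel. cmod (f x)) \<le> (LINT x::'a|lborel. C * (1 / (1 + norm x) ^ (2 * DIM('a))))"
    by (intro integral_mono i integrable_norm * le)
  then show "(LINT x|lborel. cmod (f x)) \<le> C * decay_integral TYPE('a)"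
    by (simp only: decay_integral_def integral_mult_right_zero)
qed

lemma schwartz_integrable:
  assumes "schwartz \<phi>" shows "integrable lborel \<phi>"
proof -
  obtain C where "\<forall>x. (1 + norm x) ^ (2 * DIM('a)) * cmod (\<phi> x) \<le> C" using schwartz_decay[OF assms] by blast
  then show ?thesis by (intro integrable_decay[where C = C] schwartz_measurable assms) auto
qed

lemma integrable_exp_mult:
  fixes f :: "'a::euclidean_space \<Rightarrow> complex"
  assumes "integrable lborel f" "g \<in> borel_measurable borel"
  shows "integrable lborel (\<lambda>x. exp (- \<i> * complex_of_real (g x)) * f x)"
  by (rule Bochner_Integration.integrable_bound[OF assms(1)])
     (use assms in \<open>auto simp: norm_mult dest: borel_measurable_integrable\<close>)

lemma fourier_bound:
  assumes "integrable lborel f"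
  shows "cmod (fourier f k) \<le> (LINT x|lborel. cmod (f x))"
  unfolding fourier_def
  by (rule order_trans[OF integral_norm_bound]) (simp add: norm_mult)

lemma fourier_measurable:
  assumes "f \<in> borel_measurable borel"
  shows "fourier f \<in> borel_measurable borel"
  unfolding fourier_def[abs_def] using assms by measurable

lemma schwartz_line_derivative:
  assumes "schwartz \<phi>"
  shows "((\<lambda>t. \<phi> (x + t *\<^sub>R b)) has_vector_derivative frechet_derivative \<phi> (at (x + t *\<^sub>R b)) b) (at t)"
proof -
  let ?D = "frechet_derivative \<phi> (at (x + t *\<^sub>R b))"
  have "((\<lambda>t. x + t *\<^sub>R b) has_derivative (\<lambda>s. s *\<^sub>R b)) (at t)"
    by (auto intro!: derivative_eq_intros)
  from has_derivative_compose[OF this schwartz_has_derivative[OF assms]]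
  have "((\<lambda>t. \<phi> (x + t *\<^sub>R b)) has_derivative (\<lambda>s. ?D (s *\<^sub>R b))) (at t)" .
  moreover have "?D (s *\<^sub>R b) = s *\<^sub>R ?D b" for s
    using linear_frechet_derivative[OF schwartz_differentiable[OF assms]] linear_scale by blast
  ultimately show ?thesis unfolding has_vector_derivative_def by simp
qed

lemma lborel_integral_translate:
  fixes f :: "'a::euclidean_space \<Rightarrow> 'b::{banach, second_countable_topology}"
  assumes "f \<in> borel_measurable borel"
  shows "(LINT x|lborel. f (x + c)) = (LINT x|lborel. f x)"
proof -
  have "(LINT x|lborel. f x) = (LINT x|distr lborel borel ((+) c). f x)" by (simp add: lborel_distr_plus)
  also have "\<dots> = (LINT x|lborel. f (c + x))" using assms by (intro integral_distr) auto
  finally show ?thesis by (simp add: add.commute)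
qed

text \<open>Instead of integrating by parts, the partial derivative is approximated by difference
  quotients \<open>q n\<close>. By translation invariance their transforms are exactly (exp(i k.b h)
  - 1) / h times the transform of \<phi>, and both sides of this identity converge as h tends to 0,
  the integrals by dominated convergence.\<close>

lemma fourier_partial:
  fixes \<phi> :: "'a::euclidean_space \<Rightarrow> complex"
  assumes \<phi>: "schwartz \<phi>" and b: "b \<in> Basis"
  shows "fourier (\<lambda>x. frechet_derivative \<phi> (at x) b) k = \<i> * complex_of_real (k \<bullet> b) * fourier \<phi> k"
proof -
  let ?D = "\<lambda>x. frechet_derivative \<phi> (at x) b"
  let ?e = "\<lambda>x. exp (- \<i> * complex_of_real (k \<bullet> x))"
  define h where "h n = inverse (real (Suc n))" for n
  have h0: "h n > 0" "h n \<le> 1" for n by (auto simp: h_def inverse_le_1_iff)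
  have hlim: "h \<longlonglongrightarrow> 0" unfolding h_def by (rule LIMSEQ_inverse_real_of_nat)
  have hat: "filterlim h (at 0) sequentially"
    using hlim h0(1) by (auto simp: filterlim_at less_imp_neq[symmetric] eventually_sequentially)
  define q where "q n x = (\<phi> (x + h n *\<^sub>R b) - \<phi> x) / complex_of_real (h n)" for n x
  have [measurable]: "\<phi> \<in> borel_measurable borel" using schwartz_measurable[OF \<phi>] .
  have [measurable]: "?D \<in> borel_measurable borel" using schwartz_measurable[OF schwartz_partial[OF \<phi> b]] .
  have qlim: "(\<lambda>n. q n x) \<longlonglongrightarrow> ?D x" for x
  proof -
    have "((\<lambda>t. \<phi> (x + t *\<^sub>R b)) has_derivative (\<lambda>s. s *\<^sub>R ?D x)) (at 0)"
      using schwartz_line_derivative[OF \<phi>, of x b 0] by (simp add: has_vector_derivative_def)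
    then have "((\<lambda>y. ((\<phi> (x + y *\<^sub>R b) - \<phi> x) - y *\<^sub>R ?D x) /\<^sub>R \<bar>y\<bar>) \<longlongrightarrow> 0) (at 0)"
      unfolding has_derivative_def by (auto simp: netlimit_at)
    from filterlim_compose[OF this hat]
    have "(\<lambda>n. ((\<phi> (x + h n *\<^sub>R b) - \<phi> x) - h n *\<^sub>R ?D x) /\<^sub>R \<bar>h n\<bar>) \<longlonglongrightarrow> 0" .
    moreover have "((\<phi> (x + h n *\<^sub>R b) - \<phi> x) - h n *\<^sub>R ?D x) /\<^sub>R \<bar>h n\<bar> = q n x - ?D x" for n
      using h0(1)[of n] by (simp add: q_def scaleR_conv_of_real field_simps)
    ultimately have "(\<lambda>n. q n x - ?D x) \<longlonglongrightarrow> 0" by simp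
    then show ?thesis by (simp add: LIM_zero_iff)
  qed
  let ?M = "2 * DIM('a)"
  obtain C where C0: "C \<ge> 0" and C: "\<And>x. (1 + norm x) ^ ?M * cmod (?D x) \<le> C"
    using schwartz_decay[OF schwartz_partial[OF \<phi> b]] by blast
  \<comment> \<open>The mean value inequality bounds the quotient by the derivative on a segment of
    length at most 1. Moving the base point by at most 1 changes 1 + norm x by a factor of at most
    2, whence the constant 2^M.\<close>
  have qb: "cmod (q n x) \<le> C * 2 ^ ?M * (1 / (1 + norm x) ^ ?M)" for n x
  proof -
    let ?B = "C * 2 ^ ?M * (1 / (1 + norm x) ^ ?M)"
    have Db: "cmod (?D (x + t *\<^sub>R b)) \<le> ?B" if t: "t \<in> {0..h n}" for t
    proof -
      have "norm x \<le> norm (x + t *\<^sub>R b) + norm (t *\<^sub>R b)" by (metis add_diff_cancel norm_triangle_ineq4)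
      moreover have "norm (t *\<^sub>R b) \<le> 1" using t h0[of n] b by simp
      ultimately have "1 + norm x \<le> 2 + norm (x + t *\<^sub>R b)" by linarith
      also have "\<dots> \<le> 2 * (1 + norm (x + t *\<^sub>R b))" by simp
      finally have "1 + norm x \<le> 2 * (1 + norm (x + t *\<^sub>R b))" .
      then have "(1 + norm x) ^ ?M \<le> (2 * (1 + norm (x + t *\<^sub>R b))) ^ ?M" by (intro power_mono) auto
      also have "\<dots> = 2 ^ ?M * (1 + norm (x + t *\<^sub>R b)) ^ ?M" by (rule power_mult_distrib)
      finally have "(1 + norm x) ^ ?M * cmod (?D (x + t *\<^sub>R b)) \<le> 2 ^ ?M * (1 + norm (x + t *\<^sub>R b)) ^ ?M * cmod (?D (x + t *\<^sub>R b))"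
        by (intro mult_right_mono) auto
      also have "\<dots> = 2 ^ ?M * ((1 + norm (x + t *\<^sub>R b)) ^ ?M * cmod (?D (x + t *\<^sub>R b)))" by (simp only: mult.assoc)
      also have "\<dots> \<le> 2 ^ ?M * C" by (intro mult_left_mono C) auto
      finally have *: "(1 + norm x) ^ ?M * cmod (?D (x + t *\<^sub>R b)) \<le> 2 ^ ?M * C" .
      have "0 < (1 + norm x) ^ ?M" by (metis add_pos_nonneg norm_ge_zero zero_less_one zero_less_power)
      then show ?thesis using * by (simp add: field_simps)
    qed
    have B0: "?B \<ge> 0" using C0 by simp
    have "norm (\<phi> (x + h n *\<^sub>R b) - \<phi> (x + 0 *\<^sub>R b)) \<le> ?B * norm (h n - 0)"
    proof (rule differentiable_bound[where S = "{0..h n}" and f = "\<lambda>t. \<phi> (x + t *\<^sub>R b)"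
          and f' = "\<lambda>t s. s *\<^sub>R ?D (x + t *\<^sub>R b)"])
      fix t assume t: "t \<in> {0..h n}"
      show "((\<lambda>t. \<phi> (x + t *\<^sub>R b)) has_derivative (\<lambda>s. s *\<^sub>R ?D (x + t *\<^sub>R b))) (at t within {0..h n})"
        using schwartz_line_derivative[OF \<phi>, of x b t]
        unfolding has_vector_derivative_def by (rule has_derivative_at_withinI)
      show "onorm (\<lambda>s::real. s *\<^sub>R ?D (x + t *\<^sub>R b)) \<le> ?B"
      proof (rule onorm_le)
        fix s :: real
        show "norm (s *\<^sub>R ?D (x + t *\<^sub>R b)) \<le> ?B * norm s"
          using mult_right_mono[OF Db[OF t], of "\<bar>s\<bar>"]
          by (simp only: norm_scaleR real_norm_def mult.commute[of "\<bar>s\<bar>"] abs_ge_zero)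
      qed
    qed (use h0[of n] in auto)
    then show ?thesis using h0[of n] by (simp add: q_def norm_divide field_simps)
  qed
  have qi: "integrable lborel (\<lambda>x. ?e x * q n x)" for n
  proof (rule Bochner_Integration.integrable_bound[OF integrable_mult_right[OF integrable_inverse_power_norm, of "C * 2 ^ ?M"]])
    show "(\<lambda>x. ?e x * q n x) \<in> borel_measurable lborel" unfolding q_def by measurable
    show "AE x in lborel. norm (?e x * q n x) \<le> norm (C * 2 ^ ?M * (1 / (1 + norm x) ^ ?M))"
      using order_trans[OF qb[of n] abs_ge_self] by (intro AE_I2) (simp add: norm_mult)
  qed
  have "(\<lambda>n. LINT x|lborel. ?e x * q n x) \<longlonglongrightarrow> (LINT x|lborel. ?e x * ?D x)"
  proof (rule integral_dominated_convergence[where w = "\<lambda>x. C * 2 ^ ?M * (1 / (1 + norm x) ^ ?M)"])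
    show "AE x in lborel. (\<lambda>n. ?e x * q n x) \<longlonglongrightarrow> ?e x * ?D x"
      by (intro AE_I2 tendsto_intros qlim)
    show "integrable lborel (\<lambda>x::'a. C * 2 ^ ?M * (1 / (1 + norm x) ^ ?M))"
      by (intro integrable_mult_right integrable_inverse_power_norm)
    show "AE x in lborel. norm (?e x * q n x) \<le> C * 2 ^ ?M * (1 / (1 + norm x) ^ ?M)" for n
      using qb[of n] by (intro AE_I2) (simp add: norm_mult)
  qed (auto simp: q_def)
  then have L1: "(\<lambda>n. LINT x|lborel. ?e x * q n x) \<longlonglongrightarrow> fourier ?D k" by (simp add: fourier_def)
  have "(LINT x|lborel. ?e x * q n x) = (exp (\<i> * complex_of_real (k \<bullet> b) * complex_of_real (h n)) - 1) / complex_of_real (h n) * fourier \<phi> k" for n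
  proof -
    have i1: "integrable lborel (\<lambda>x. ?e x * \<phi> x)" using integrable_exp_mult[OF schwartz_integrable[OF \<phi>], of "\<lambda>x. k \<bullet> x"] by simp
    have t: "fourier \<phi> k = (LINT x|lborel. ?e (x + h n *\<^sub>R b) * \<phi> (x + h n *\<^sub>R b))"
      unfolding fourier_def by (rule lborel_integral_translate[symmetric]) simp
    have it: "integrable lborel (\<lambda>x. ?e (x + h n *\<^sub>R b) * \<phi> (x + h n *\<^sub>R b))"
    proof -
      have "integrable (distr lborel borel ((+) (h n *\<^sub>R b))) (\<lambda>x. ?e x * \<phi> x)" using i1 by (simp add: lborel_distr_plus)
      then show ?thesis by (subst (asm) integrable_distr_eq) (auto simp: add.commute)
    qed
    have ee: "?e x = exp (\<i> * complex_of_real (k \<bullet> b) * complex_of_real (h n)) * ?e (x + h n *\<^sub>R b)" for x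
      by (simp add: exp_add[symmetric] inner_add_right algebra_simps)
    have eq: "?e x * q n x = (exp (\<i> * complex_of_real (k \<bullet> b) * complex_of_real (h n)) * (?e (x + h n *\<^sub>R b) * \<phi> (x + h n *\<^sub>R b)) - ?e x * \<phi> x) / complex_of_real (h n)" for x
    proof -
      have "?e x * q n x = (?e x * \<phi> (x + h n *\<^sub>R b) - ?e x * \<phi> x) / complex_of_real (h n)"
        by (simp add: q_def right_diff_distrib)
      also have "?e x * \<phi> (x + h n *\<^sub>R b) = exp (\<i> * complex_of_real (k \<bullet> b) * complex_of_real (h n)) * (?e (x + h n *\<^sub>R b) * \<phi> (x + h n *\<^sub>R b))"
        by (subst ee) (simp only: mult.assoc)
      finally show ?thesis .
    qed
    have "(LINT x|lborel. ?e x * q n x) = (exp (\<i> * complex_of_real (k \<bullet> b) * complex_of_real (h n)) * fourier \<phi> k - fourier \<phi> k) / complex_of_real (h n)"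
      by (simp only: eq integral_divide_zero Bochner_Integration.integral_diff[OF integrable_mult_right[OF it] i1]
          integral_mult_right_zero t[symmetric] fourier_def[of \<phi> k, symmetric])
    then show ?thesis by (simp add: left_diff_distrib)
  qed
  moreover have "(\<lambda>n. (exp (\<i> * complex_of_real (k \<bullet> b) * complex_of_real (h n)) - 1) / complex_of_real (h n)) \<longlonglongrightarrow> \<i> * complex_of_real (k \<bullet> b)"
  proof -
    have "((\<lambda>z. exp (\<i> * complex_of_real (k \<bullet> b) * z)) has_field_derivative \<i> * complex_of_real (k \<bullet> b)) (at 0)"
      by (auto intro!: derivative_eq_intros)
    then have *: "((\<lambda>z. (exp (\<i> * complex_of_real (k \<bullet> b) * z) - 1) / z) \<longlongrightarrow> \<i> * complex_of_real (k \<bullet> b)) (at 0)"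
      by (simp add: has_field_derivative_iff)
    have "filterlim (\<lambda>n. complex_of_real (h n)) (at 0) sequentially"
      using tendsto_of_real[OF hlim, where 'a = complex] h0(1)
      by (auto simp: filterlim_at less_imp_neq[symmetric] eventually_sequentially)
    from filterlim_compose[OF * this] show ?thesis .
  qed
  ultimately have "(\<lambda>n. LINT x|lborel. ?e x * q n x) \<longlonglongrightarrow> \<i> * complex_of_real (k \<bullet> b) * fourier \<phi> k"
    by (simp only: tendsto_mult_right)
  then show ?thesis using L1 LIMSEQ_unique by blast
qed

lemma fourier_iter_partial:
  assumes "schwartz \<phi>" "b \<in> Basis"
  shows "fourier (iter_partial (replicate m b) \<phi>) k = (\<i> * complex_of_real (k \<bullet> b)) ^ m * fourier \<phi> k"
proof (induction m)
  case (Suc m)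
  have "schwartz (iter_partial (replicate m b) \<phi>)"
    using assms by (intro schwartz_iter_partial) auto
  from fourier_partial[OF this assms(2)] Suc show ?case by (simp add: algebra_simps)
qed simp

text \<open>The order of the quantifiers is the point: \<open>C\<close> and \<open>N\<close> depend
  on \<open>M\<close> but not on the test function, so the transform is continuous for the
  seminorms, as \<open>tempered_inverse_fourier\<close> requires. A power of one coordinate of k is
  absorbed by as many partial derivatives of \<phi>, whose transforms are bounded by L^1
  norms.\<close>

lemma fourier_decay:
  fixes M :: nat
  obtains C N where "C \<ge> 0"
    "\<And>(\<phi>::'a::euclidean_space \<Rightarrow> complex) k. schwartz \<phi> \<Longrightarrow> (1 + norm k) ^ M * cmod (fourier \<phi> k) \<le> C * schwartz_seminorm N \<phi>"
proof
  define N where "N = max M (2 * DIM('a))"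
  define I where "I = decay_integral TYPE('a)"
  define C where "C = (1 + real DIM('a)) ^ M * ((1 + real DIM('a)) * I)"
  have I0: "I \<ge> 0" unfolding I_def by (rule decay_integral_nonneg)
  show "C \<ge> 0" unfolding C_def using I0 by simp
  fix \<phi> :: "'a \<Rightarrow> complex" and k :: 'a
  assume \<phi>: "schwartz \<phi>"
  define S where "S = schwartz_seminorm N \<phi>"
  have b: "cmod (fourier (iter_partial bs \<phi>) k) \<le> S * I" if "set bs \<subseteq> Basis" "length bs \<le> N" for bs
  proof -
    have sc: "schwartz (iter_partial bs \<phi>)" using schwartz_iter_partial[OF \<phi> that(1)] .
    have "(1 + norm x) ^ (2 * DIM('a)) * cmod (iter_partial bs \<phi> x) \<le> S" for x
    proof -
      have "(1 + norm x) ^ (2 * DIM('a)) \<le> (1 + norm x) ^ N"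
        unfolding N_def by (intro power_increasing) auto
      then have "(1 + norm x) ^ (2 * DIM('a)) * cmod (iter_partial bs \<phi> x) \<le> (1 + norm x) ^ N * cmod (iter_partial bs \<phi> x)"
        by (intro mult_right_mono) auto
      also have "\<dots> \<le> S" unfolding S_def by (rule schwartz_seminorm_upper[OF \<phi> that])
      finally show ?thesis .
    qed
    note d = integrable_decay[OF schwartz_measurable[OF sc] this]
    show ?thesis using fourier_bound[OF d(1), of k] d(2) unfolding I_def by linarith
  qed
  have b0: "cmod (fourier \<phi> k) \<le> S * I" using b[of "[]"] by simp
  have bM: "\<bar>k \<bullet> b\<bar> ^ M * cmod (fourier \<phi> k) \<le> S * I" if "b \<in> Basis" for b
    using b[of "replicate M b"] that fourier_iter_partial[OF \<phi> that, of M k]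
    by (simp add: N_def norm_mult norm_power set_replicate_conv_if)
  \<comment> \<open>The norm is at most DIM times the largest coordinate, whose M-th power is one of
    the terms of the sum; the summand 1 covers the case in which that coordinate is below 1.\<close>
  have "(1 + norm k) ^ M \<le> (1 + real DIM('a)) ^ M * (1 + (\<Sum>b\<in>Basis. \<bar>k \<bullet> b\<bar> ^ M))"
  proof -
    define t where "t = Max ((\<lambda>b. \<bar>k \<bullet> b\<bar>) ` (Basis :: 'a set))"
    have "t \<in> (\<lambda>b. \<bar>k \<bullet> b\<bar>) ` (Basis :: 'a set)" unfolding t_def by (intro Max_in) auto
    then obtain b0 where b0: "b0 \<in> Basis" "t = \<bar>k \<bullet> b0\<bar>" by blast
    have le: "\<bar>k \<bullet> b\<bar> \<le> t" if "b \<in> Basis" for b unfolding t_def using that by (intro Max_ge) auto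
    have "norm k \<le> (\<Sum>b\<in>Basis. \<bar>k \<bullet> b\<bar>)" by (rule norm_le_l1)
    also have "\<dots> \<le> real DIM('a) * t" using sum_bounded_above[of Basis "\<lambda>b. \<bar>k \<bullet> b\<bar>" t] le by simp
    finally have "1 + norm k \<le> 1 + real DIM('a) * t" by simp
    also have "\<dots> \<le> (1 + real DIM('a)) * max 1 t"
    proof -
      have "real DIM('a) * t \<le> real DIM('a) * max 1 t" by (intro mult_left_mono) auto
      moreover have "1 \<le> max 1 t" by simp
      ultimately show ?thesis unfolding distrib_right mult_1_left by linarith
    qed
    finally have "(1 + norm k) ^ M \<le> ((1 + real DIM('a)) * max 1 t) ^ M" by (intro power_mono) auto
    also have "\<dots> = (1 + real DIM('a)) ^ M * (max 1 t) ^ M" by (rule power_mult_distrib)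
    also have "(max 1 t) ^ M \<le> 1 + \<bar>k \<bullet> b0\<bar> ^ M"
      using b0(2) by (cases "1 \<le> t") (auto simp: max_def)
    also have "\<bar>k \<bullet> b0\<bar> ^ M \<le> (\<Sum>b\<in>Basis. \<bar>k \<bullet> b\<bar> ^ M)" using b0(1) by (intro member_le_sum) auto
    finally show ?thesis by simp
  qed
  then have "(1 + norm k) ^ M * cmod (fourier \<phi> k) \<le> (1 + real DIM('a)) ^ M * (1 + (\<Sum>b\<in>Basis. \<bar>k \<bullet> b\<bar> ^ M)) * cmod (fourier \<phi> k)"
    by (intro mult_right_mono) auto
  also have "\<dots> = (1 + real DIM('a)) ^ M * (cmod (fourier \<phi> k) + (\<Sum>b\<in>Basis. \<bar>k \<bullet> b\<bar> ^ M * cmod (fourier \<phi> k)))"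
    by (simp add: distrib_right sum_distrib_right mult.assoc)
  also have "\<dots> \<le> (1 + real DIM('a)) ^ M * (S * I + (\<Sum>b\<in>(Basis::'a set). S * I))"
    by (intro mult_left_mono add_mono sum_mono b0 bM) auto
  also have "\<dots> = C * S" by (simp add: C_def algebra_simps)
  finally show "(1 + norm k) ^ M * cmod (fourier \<phi> k) \<le> C * schwartz_seminorm N \<phi>" unfolding S_def .
qed

lemma fourier_decay1:
  assumes "schwartz \<phi>"
  shows "\<exists>C. \<forall>k. (1 + norm k) ^ M * cmod (fourier \<phi> k) \<le> C"
proof -
  obtain C N where "\<And>(\<phi>::'a \<Rightarrow> complex) k. schwartz \<phi> \<Longrightarrow> (1 + norm k) ^ M * cmod (fourier \<phi> k) \<le> C * schwartz_seminorm N \<phi>"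
    using fourier_decay[of M] by metis
  then show ?thesis using assms by blast
qed

lemma norm_integral_le:
  fixes f :: "'a \<Rightarrow> 'b::{banach, second_countable_topology}"
  assumes "integrable M f" "integrable M g" "\<And>x. norm (f x) \<le> g x"
  shows "norm (integral\<^sup>L M f) \<le> (LINT x|M. g x)"
  by (rule order_trans[OF integral_norm_bound integral_mono]) (use assms in auto)

lemma schwartz_power_norm_integrable:
  fixes \<phi> :: "'a::euclidean_space \<Rightarrow> complex"
  assumes "schwartz \<phi>"
  shows "integrable lborel (\<lambda>x. (norm x) ^ m * cmod (\<phi> x))"
proof -
  obtain C where C: "\<forall>x. (1 + norm x) ^ (2 * DIM('a) + m) * cmod (\<phi> x) \<le> C" using schwartz_decay[OF assms] by blast
  have [measurable]: "\<phi> \<in> borel_measurable borel" by (rule schwartz_measurable[OF assms])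
  have "integrable lborel (\<lambda>x. complex_of_real ((norm x) ^ m * cmod (\<phi> x)))"
  proof (rule integrable_decay(1))
    fix x :: 'a
    have "(1 + norm x) ^ (2 * DIM('a)) * ((norm x) ^ m * cmod (\<phi> x)) \<le> (1 + norm x) ^ (2 * DIM('a)) * ((1 + norm x) ^ m * cmod (\<phi> x))"
      by (intro mult_left_mono mult_right_mono power_mono) auto
    also have "\<dots> \<le> C" using C by (simp add: power_add mult.assoc)
    finally show "(1 + norm x) ^ (2 * DIM('a)) * cmod (complex_of_real ((norm x) ^ m * cmod (\<phi> x))) \<le> C"
      by (simp add: norm_mult norm_power)
  qed measurable
  then have "integrable lborel (\<lambda>x. Re (complex_of_real ((norm x) ^ m * cmod (\<phi> x))))" by (rule integrable_Re)
  then show ?thesis by simp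
qed

text \<open>Differentiation under the integral sign with an explicit remainder: |exp(-i \<theta>) -
  1 + i \<theta>| is at most \<theta>^2 / 2 with \<theta> = (y - k).x, so the error is bounded by
  norm (y - k)^2 times the second absolute moment of \<phi>, which rapid decay makes finite.\<close>

lemma fourier_has_derivative:
  fixes \<phi> :: "'a::euclidean_space \<Rightarrow> complex"
  assumes \<phi>: "schwartz \<phi>"
  shows "(fourier \<phi> has_derivative (\<lambda>v. fourier (\<lambda>x. - \<i> * (complex_of_real (x \<bullet> v) * \<phi> x)) k)) (at k)"
proof -
  let ?e = "\<lambda>k x. exp (- \<i> * complex_of_real (k \<bullet> x))"
  let ?D = "\<lambda>v. fourier (\<lambda>x. - \<i> * (complex_of_real (x \<bullet> v) * \<phi> x)) k"
  have [measurable]: "\<phi> \<in> borel_measurable borel" by (rule schwartz_measurable[OF \<phi>])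
  have i0: "integrable lborel (\<lambda>x. ?e k x * \<phi> x)" for k
    using integrable_exp_mult[OF schwartz_integrable[OF \<phi>], of "\<lambda>x. k \<bullet> x"] by simp
  have i1: "integrable lborel (\<lambda>x. ?e k x * (- \<i> * (complex_of_real (x \<bullet> v) * \<phi> x)))" for v
    using integrable_exp_mult[OF schwartz_integrable[OF schwartz_scale[OF schwartz_coord_mult[OF \<phi>], of "- \<i>" v]], of "\<lambda>x. k \<bullet> x"] by simp
  have n1: "integrable lborel (\<lambda>x. norm x * cmod (\<phi> x))" using schwartz_power_norm_integrable[OF \<phi>, of 1] by simp
  have n2: "integrable lborel (\<lambda>x. (norm x)\<^sup>2 * cmod (\<phi> x))" by (rule schwartz_power_norm_integrable[OF \<phi>])
  show ?thesis
  proof (rule has_derivativeI_sandwich[where e = 1 and H = "\<lambda>y. norm (y - k) * (LINT x|lborel. (norm x)\<^sup>2 * cmod (\<phi> x))"])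
    show "bounded_linear ?D"
    proof (rule bounded_linear_intro[where K = "LINT x|lborel. norm x * cmod (\<phi> x)"])
      show "?D (v + w) = ?D v + ?D w" for v w
        unfolding fourier_def
        by (subst Bochner_Integration.integral_add[OF i1 i1, symmetric]) (simp add: inner_add_right algebra_simps)
      show "?D (r *\<^sub>R v) = r *\<^sub>R ?D v" for r v
        unfolding fourier_def
        by (subst integral_scaleR_right[symmetric]) (simp add: scaleR_conv_of_real algebra_simps)
      show "norm (?D v) \<le> norm v * (LINT x|lborel. norm x * cmod (\<phi> x))" for v
      proof -
        have "norm (?D v) \<le> (LINT x|lborel. norm v * (norm x * cmod (\<phi> x)))"
          unfolding fourier_def
        proof (rule norm_integral_le)
          show "norm (?e k x * (- \<i> * (complex_of_real (x \<bullet> v) * \<phi> x))) \<le> norm v * (norm x * cmod (\<phi> x))" for x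
            using mult_right_mono[OF Cauchy_Schwarz_ineq2[of x v], of "cmod (\<phi> x)"]
            by (simp add: norm_mult algebra_simps)
        qed (intro i1 integrable_mult_right n1)+
        then show ?thesis by (simp only: integral_mult_right_zero)
      qed
    qed
    fix y assume "y \<noteq> k"
    have "cmod (fourier \<phi> y - fourier \<phi> k - ?D (y - k)) \<le> (LINT x|lborel. (norm (y - k))\<^sup>2 * ((norm x)\<^sup>2 * cmod (\<phi> x)))"
    proof -
      have "fourier \<phi> y - fourier \<phi> k - ?D (y - k) =
         (LINT x|lborel. ?e y x * \<phi> x - ?e k x * \<phi> x - ?e k x * (- \<i> * (complex_of_real (x \<bullet> (y - k)) * \<phi> x)))"
        unfolding fourier_def by (simp only: Bochner_Integration.integral_diff i0 i1 Bochner_Integration.integrable_diff)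
      also have "cmod \<dots> \<le> (LINT x|lborel. (norm (y - k))\<^sup>2 * ((norm x)\<^sup>2 * cmod (\<phi> x)))"
      proof (rule norm_integral_le)
        fix x :: 'a
        define \<theta> where "\<theta> = (y - k) \<bullet> x"
        have e: "?e y x = ?e k x * exp (\<i> * complex_of_real (- \<theta>))"
          unfolding \<theta>_def by (simp add: exp_add[symmetric] inner_diff_left algebra_simps)
        have "cmod (exp (\<i> * complex_of_real (- \<theta>)) - (\<Sum>k\<le>1. (\<i> * complex_of_real (- \<theta>)) ^ k / fact k)) \<le> \<bar>- \<theta>\<bar> ^ Suc 1 / fact (Suc 1)"
          by (rule iexp_approx1)
        then have "cmod (exp (\<i> * complex_of_real (- \<theta>)) - 1 + \<i> * complex_of_real \<theta>) \<le> \<bar>\<theta>\<bar>\<^sup>2 / 2"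
          by (simp add: power2_eq_square algebra_simps)
        also have "\<dots> \<le> (norm (y - k) * norm x)\<^sup>2"
        proof -
          have "\<bar>\<theta>\<bar>\<^sup>2 \<le> (norm (y - k) * norm x)\<^sup>2" unfolding \<theta>_def by (intro power_mono Cauchy_Schwarz_ineq2) auto
          then show ?thesis by (smt (verit) field_sum_of_halves zero_le_power2)
        qed
        finally have b: "cmod (exp (\<i> * complex_of_real (- \<theta>)) - 1 + \<i> * complex_of_real \<theta>) \<le> (norm (y - k) * norm x)\<^sup>2" .
        have "?e y x * \<phi> x - ?e k x * \<phi> x - ?e k x * (- \<i> * (complex_of_real (x \<bullet> (y - k)) * \<phi> x)) =
          ?e k x * ((exp (\<i> * complex_of_real (- \<theta>)) - 1 + \<i> * complex_of_real \<theta>) * \<phi> x)"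
          unfolding e unfolding \<theta>_def by (simp add: inner_commute algebra_simps)
        then have "norm (?e y x * \<phi> x - ?e k x * \<phi> x - ?e k x * (- \<i> * (complex_of_real (x \<bullet> (y - k)) * \<phi> x))) =
          cmod (exp (\<i> * complex_of_real (- \<theta>)) - 1 + \<i> * complex_of_real \<theta>) * cmod (\<phi> x)"
          by (simp add: norm_mult)
        also have "\<dots> \<le> (norm (y - k) * norm x)\<^sup>2 * cmod (\<phi> x)" by (intro mult_right_mono b) auto
        finally show "norm (?e y x * \<phi> x - ?e k x * \<phi> x - ?e k x * (- \<i> * (complex_of_real (x \<bullet> (y - k)) * \<phi> x)))
          \<le> (norm (y - k))\<^sup>2 * ((norm x)\<^sup>2 * cmod (\<phi> x))" by (simp add: power_mult_distrib mult.assoc)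
      qed (intro i0 i1 Bochner_Integration.integrable_diff integrable_mult_right n2)+
      finally show ?thesis .
    qed
    also have "\<dots> = norm (y - k) * (norm (y - k) * (LINT x|lborel. (norm x)\<^sup>2 * cmod (\<phi> x)))"
      by (simp only: integral_mult_right_zero power2_eq_square mult.assoc)
    finally show "norm (fourier \<phi> y - fourier \<phi> k - ?D (y - k)) / norm (y - k) \<le> norm (y - k) * (LINT x|lborel. (norm x)\<^sup>2 * cmod (\<phi> x))"
      using \<open>y \<noteq> k\<close> by (simp add: divide_le_eq mult.commute)
  next
    have "((\<lambda>y. norm (y - k) * (LINT x|lborel. (norm x)\<^sup>2 * cmod (\<phi> x))) \<longlongrightarrow> norm (k - k) * (LINT x|lborel. (norm x)\<^sup>2 * cmod (\<phi> x))) (at k)"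
      by (intro tendsto_intros)
    then show "((\<lambda>y. norm (y - k) * (LINT x|lborel. (norm x)\<^sup>2 * cmod (\<phi> x))) \<longlongrightarrow> 0) (at k)" by simp
  qed simp
qed

text \<open>With all transforms of Schwartz functions as the class, a partial derivative becomes
  multiplication by -i times a coordinate before the transform, so
  \<open>schwartz_coord_mult\<close> gives closure and \<open>fourier_decay1\<close> gives
  decay.\<close>

lemma fourier_schwartz:
  fixes \<phi> :: "'a::euclidean_space \<Rightarrow> complex"
  assumes "schwartz \<phi>"
  shows "schwartz (fourier \<phi>)"
proof (rule schwartz_coinduct)
  let ?S = "{f. \<exists>\<psi>::'a \<Rightarrow> complex. schwartz \<psi> \<and> f = fourier \<psi>}"
  show "fourier \<phi> \<in> ?S" using assms by blast
  fix g assume "g \<in> ?S"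
  then obtain \<psi> :: "'a \<Rightarrow> complex" where \<psi>: "schwartz \<psi>" "g = fourier \<psi>" by blast
  note d = fourier_has_derivative[OF \<psi>(1)]
  show "g differentiable (at x)" for x using d \<psi>(2) unfolding differentiable_def by blast
  show "\<exists>C. \<forall>x. (1 + norm x) ^ n * cmod (g x) \<le> C" for n
    using fourier_decay1[OF \<psi>(1)] \<psi>(2) by blast
  fix b :: 'a assume "b \<in> Basis"
  have "(\<lambda>x. frechet_derivative g (at x) b) = fourier (\<lambda>x. - \<i> * (complex_of_real (x \<bullet> b) * \<psi> x))"
    using frechet_derivative_at[OF d, symmetric] \<psi>(2) by auto
  then show "(\<lambda>x. frechet_derivative g (at x) b) \<in> ?S"
    using schwartz_scale[OF schwartz_coord_mult[OF \<psi>(1)], of "- \<i>" b] by blast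
qed

subsection \<open>Gaussians and Fourier inversion\<close>

definition gauss :: "'a::euclidean_space \<Rightarrow> real" where
  "gauss x = exp (- (x \<bullet> x) / 2)"

lemma gauss_measurable [measurable]: "gauss \<in> borel_measurable borel"
  unfolding gauss_def[abs_def] by measurable

lemma gauss_pos: "gauss x > 0" and gauss_le_1: "gauss x \<le> 1"
  by (auto simp: gauss_def)

lemma continuous_gauss: "continuous_on A gauss"
  unfolding gauss_def[abs_def] by (intro continuous_intros) auto

lemma schwartz_gauss_scale:
  assumes "\<delta> \<noteq> 0"
  shows "schwartz (\<lambda>x::'a::euclidean_space. complex_of_real (gauss (\<delta> *\<^sub>R x)))"
proof -
  have "0 < \<delta>\<^sup>2 / 2" using assms by simp
  from schwartz_gauss[OF this, of "0::'a"] show ?thesis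
    by (simp add: gauss_def power2_eq_square mult.assoc)
qed

lemma integrable_gauss_scale:
  assumes "\<delta> \<noteq> 0" shows "integrable lborel (\<lambda>x::'a::euclidean_space. gauss (\<delta> *\<^sub>R x))"
  using integrable_Re[OF schwartz_integrable[OF schwartz_gauss_scale[OF assms]]] by simp

lemma integrable_gauss: "integrable lborel (gauss :: 'a::euclidean_space \<Rightarrow> real)"
  using integrable_gauss_scale[of 1] by simp

text \<open>Read off from the characteristic function of the standard normal distribution, whose
  density is this Gaussian divided by sqrt (2 pi).\<close>

lemma fourier_gauss_real:
  "integrable lborel (\<lambda>x. exp (- \<i> * complex_of_real (t * x)) * complex_of_real (exp (- (x * x) / 2)))"
  "(LINT x|lborel. exp (- \<i> * complex_of_real (t * x)) * complex_of_real (exp (- (x * x) / 2)))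
    = complex_of_real (sqrt (2 * pi) * exp (- (t * t) / 2))"
proof -
  have "integrable lborel (\<lambda>x::real. complex_of_real (gauss x))" using integrable_gauss by (rule integrable_of_real)
  from integrable_exp_mult[OF this, of "\<lambda>x. t * x"]
  show "integrable lborel (\<lambda>x. exp (- \<i> * complex_of_real (t * x)) * complex_of_real (exp (- (x * x) / 2)))"
    by (simp add: gauss_def)
  have "complex_of_real (exp (- (t * t) / 2)) = char std_normal_distribution (- t)"
    by (simp add: char_std_normal_distribution power2_eq_square)
  also have "\<dots> = (LINT x|lborel. std_normal_density x *\<^sub>R exp (\<i> * complex_of_real (- t * x)))"
    unfolding char_def by (subst integral_density) auto
  also have "\<dots> = (LINT x|lborel. complex_of_real (1 / sqrt (2 * pi)) * (exp (- \<i> * complex_of_real (t * x)) * complex_of_real (exp (- (x * x) / 2))))"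
    by (intro Bochner_Integration.integral_cong) (auto simp: std_normal_density_def scaleR_conv_of_real power2_eq_square field_simps)
  also have "\<dots> = complex_of_real (1 / sqrt (2 * pi)) * (LINT x|lborel. exp (- \<i> * complex_of_real (t * x)) * complex_of_real (exp (- (x * x) / 2)))"
    by (rule integral_mult_right_zero)
  finally show "(LINT x|lborel. exp (- \<i> * complex_of_real (t * x)) * complex_of_real (exp (- (x * x) / 2)))
    = complex_of_real (sqrt (2 * pi) * exp (- (t * t) / 2))"
    by (simp add: field_simps)
qed

lemma fourier_gauss:
  fixes k :: "'a::euclidean_space"
  shows "fourier (\<lambda>x. complex_of_real (gauss x)) k = complex_of_real (sqrt (2 * pi) ^ DIM('a) * gauss k)"
proof -
  have e: "exp (- \<i> * complex_of_real (k \<bullet> x)) * complex_of_real (gauss x) =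
    (\<Prod>b\<in>Basis. exp (- \<i> * complex_of_real ((k \<bullet> b) * (x \<bullet> b))) * complex_of_real (exp (- ((x \<bullet> b) * (x \<bullet> b)) / 2)))" for x :: 'a
  proof -
    have "exp (- \<i> * complex_of_real (k \<bullet> x)) = (\<Prod>b\<in>Basis. exp (- \<i> * complex_of_real ((k \<bullet> b) * (x \<bullet> b))))"
      by (subst euclidean_inner) (simp add: exp_sum[symmetric] sum_distrib_left sum_negf)
    moreover have "gauss x = (\<Prod>b\<in>Basis. exp (- ((x \<bullet> b) * (x \<bullet> b)) / 2))"
      unfolding gauss_def by (subst euclidean_inner) (simp add: exp_sum[symmetric] sum_divide_distrib sum_negf)
    ultimately show ?thesis by (simp add: prod.distrib)
  qed
  have g: "gauss k = (\<Prod>b\<in>Basis. exp (- ((k \<bullet> b) * (k \<bullet> b)) / 2))"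
    unfolding gauss_def by (subst euclidean_inner) (simp add: exp_sum[symmetric] sum_divide_distrib sum_negf)
  show ?thesis
    unfolding fourier_def e
    by (subst lborel_integrable_prod(2)[OF fourier_gauss_real(1)]) (simp only: fourier_gauss_real(2) g of_real_prod[symmetric] prod.distrib prod_constant)
qed

lemma integral_gauss: "(LINT x::'a::euclidean_space|lborel. gauss x) = sqrt (2 * pi) ^ DIM('a)"
proof -
  have "complex_of_real (LINT x::'a|lborel. gauss x) = fourier (\<lambda>x. complex_of_real (gauss x)) (0::'a)"
    by (simp add: fourier_def)
  also have "\<dots> = complex_of_real (sqrt (2 * pi) ^ DIM('a))"
    unfolding fourier_gauss by (simp add: gauss_def)
  finally show ?thesis by (simp only: of_real_eq_iff)
qed

lemma lborel_integral_scale: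
  fixes g :: "'a::euclidean_space \<Rightarrow> 'b::{banach, second_countable_topology}"
  assumes [measurable]: "g \<in> borel_measurable borel" and "\<delta> > 0"
  shows "(LINT z|lborel. g z) = \<delta> ^ DIM('a) *\<^sub>R (LINT z|lborel. g (t + \<delta> *\<^sub>R z))"
proof -
  have "(LINT z|lborel. g z) = (LINT z|density (distr lborel borel (\<lambda>x. t + \<delta> *\<^sub>R x)) (\<lambda>_. \<bar>\<delta>\<bar> ^ DIM('a)). g z)"
    using lborel_affine[of \<delta> t] assms(2) by simp
  also have "\<dots> = (LINT z|distr lborel borel (\<lambda>x. t + \<delta> *\<^sub>R x). \<bar>\<delta>\<bar> ^ DIM('a) *\<^sub>R g z)"
    by (rule integral_density) auto
  also have "\<dots> = (LINT z|lborel. \<bar>\<delta>\<bar> ^ DIM('a) *\<^sub>R g (t + \<delta> *\<^sub>R z))"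
    by (rule integral_distr) auto
  finally show ?thesis using assms(2) by simp
qed

lemma fourier_gauss_scale:
  fixes \<xi> :: "'a::euclidean_space"
  assumes "\<delta> > 0"
  shows "fourier (\<lambda>x. complex_of_real (gauss (\<delta> *\<^sub>R x))) \<xi> =
    complex_of_real (sqrt (2 * pi) ^ DIM('a) * gauss (\<xi> /\<^sub>R \<delta>) / \<delta> ^ DIM('a))"
proof -
  let ?c = "sqrt (2 * pi) ^ DIM('a)"
  have "complex_of_real (?c * gauss (\<xi> /\<^sub>R \<delta>)) = (LINT x|lborel. exp (- \<i> * complex_of_real ((\<xi> /\<^sub>R \<delta>) \<bullet> x)) * complex_of_real (gauss x))"
    unfolding fourier_gauss[symmetric] fourier_def ..
  also have "\<dots> = \<delta> ^ DIM('a) *\<^sub>R (LINT x|lborel. exp (- \<i> * complex_of_real ((\<xi> /\<^sub>R \<delta>) \<bullet> (0 + \<delta> *\<^sub>R x))) * complex_of_real (gauss (0 + \<delta> *\<^sub>R x)))"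
    by (rule lborel_integral_scale) (use assms in auto)
  also have "\<dots> = \<delta> ^ DIM('a) *\<^sub>R (LINT x|lborel. exp (- \<i> * complex_of_real (\<xi> \<bullet> x)) * complex_of_real (gauss (\<delta> *\<^sub>R x)))"
  proof -
    have "(\<xi> /\<^sub>R \<delta>) \<bullet> (0 + \<delta> *\<^sub>R x) = (inverse (\<delta>) * \<delta>) * (\<xi> \<bullet> x)" for x
      by (simp only: add_0 inner_scaleR_left inner_scaleR_right mult_ac)
    then have "(\<xi> /\<^sub>R \<delta>) \<bullet> (0 + \<delta> *\<^sub>R x) = \<xi> \<bullet> x" for x
      using assms by (simp only: left_inverse[OF less_imp_neq[OF assms, symmetric]] mult_1_left)
    then show ?thesis by (simp only:) (simp only: add_0)
  qed
  finally have e: "complex_of_real (?c * gauss (\<xi> /\<^sub>R \<delta>)) = \<delta> ^ DIM('a) *\<^sub>R (LINT x|lborel. exp (- \<i> * complex_of_real (\<xi> \<bullet> x)) * complex_of_real (gauss (\<delta> *\<^sub>R x)))" .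
  have aux: "L = complex_of_real (a / r)" if "complex_of_real a = r *\<^sub>R L" "r \<noteq> 0" for a r L
    using that by (simp add: scaleR_conv_of_real)
  show ?thesis unfolding fourier_def by (rule aux[OF e]) (use assms in simp)
qed

text \<open>Fubini in the form used for many of the interchanges below: domination of the kernel by
  a product A(x) B(y) settles integrability on the product space at once.\<close>

lemma fubini_prod_bound:
  fixes K :: "'a::euclidean_space \<Rightarrow> 'b::euclidean_space \<Rightarrow> complex"
  assumes K: "case_prod K \<in> borel_measurable (borel \<Otimes>\<^sub>M borel)"
    and A: "integrable lborel A" and B: "integrable lborel B" and le: "\<And>x y. cmod (K x y) \<le> A x * B y"
  shows "integrable (lborel \<Otimes>\<^sub>M lborel) (case_prod K)"
    "(LINT y|lborel. LINT x|lborel. K x y) = (LINT x|lborel. LINT y|lborel. K x y)"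
proof -
  have [measurable]: "A \<in> borel_measurable borel" "B \<in> borel_measurable borel"
    using A B borel_measurable_integrable by fastforce+
  have "integrable (lborel \<Otimes>\<^sub>M lborel) (\<lambda>(x, y). A x * B y)"
  proof (rule lborel_pair.Fubini_integrable)
    have "integrable lborel (\<lambda>x. \<bar>A x\<bar> * (LINT y|lborel. \<bar>B y\<bar>))"
      using A by (intro integrable_mult_left integrable_abs)
    then show "integrable lborel (\<lambda>x. LINT y|lborel. norm (case (x, y) of (x, y) \<Rightarrow> A x * B y))"
      by (simp add: abs_mult)
    show "AE x in lborel. integrable lborel (\<lambda>y. case (x, y) of (x, y) \<Rightarrow> A x * B y)"
      using B by simp
  qed measurable
  then show *: "integrable (lborel \<Otimes>\<^sub>M lborel) (case_prod K)"
    by (rule Bochner_Integration.integrable_bound)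
       (use K le in \<open>auto intro!: AE_I2 intro: order_trans[OF _ abs_ge_self]\<close>)
  show "(LINT y|lborel. LINT x|lborel. K x y) = (LINT x|lborel. LINT y|lborel. K x y)"
    by (rule lborel_pair.Fubini_integral[OF *])
qed

lemma gauss_approximate_identity:
  fixes f :: "'a::euclidean_space \<Rightarrow> complex"
  assumes f: "continuous_on UNIV f" and B: "\<And>x. cmod (f x) \<le> B" and \<delta>: "\<delta> \<longlonglongrightarrow> 0"
  shows "(\<lambda>n. LINT z|lborel. f (x + \<delta> n *\<^sub>R z) * complex_of_real (gauss z)) \<longlonglongrightarrow> f x * complex_of_real (sqrt (2 * pi) ^ DIM('a))"
proof -
  have [measurable]: "f \<in> borel_measurable borel" by (rule borel_measurable_continuous_onI[OF f])
  have "(\<lambda>n. LINT z|lborel. f (x + \<delta> n *\<^sub>R z) * complex_of_real (gauss z)) \<longlonglongrightarrow> (LINT z::'a|lborel. f x * complex_of_real (gauss z))"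
  proof (rule integral_dominated_convergence[where w = "\<lambda>z::'a. B * gauss z"])
    show "integrable lborel (\<lambda>z::'a. B * gauss z)" by (intro integrable_mult_right integrable_gauss)
    show "AE z in lborel. (\<lambda>n. f (x + \<delta> n *\<^sub>R z) * complex_of_real (gauss z)) \<longlonglongrightarrow> f x * complex_of_real (gauss z)"
    proof (rule AE_I2)
      fix z
      have "(\<lambda>n. x + \<delta> n *\<^sub>R z) \<longlonglongrightarrow> x + 0 *\<^sub>R z" by (intro tendsto_intros \<delta>)
      then have "(\<lambda>n. f (x + \<delta> n *\<^sub>R z)) \<longlonglongrightarrow> f x"
        using f by (intro continuous_on_tendsto_compose[OF f]) auto
      then show "(\<lambda>n. f (x + \<delta> n *\<^sub>R z) * complex_of_real (gauss z)) \<longlonglongrightarrow> f x * complex_of_real (gauss z)"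
        by (intro tendsto_intros)
    qed
    show "AE z in lborel. norm (f (x + \<delta> n *\<^sub>R z) * complex_of_real (gauss z)) \<le> B * gauss z" for n
    proof (rule AE_I2)
      fix z :: 'a
      show "norm (f (x + \<delta> n *\<^sub>R z) * complex_of_real (gauss z)) \<le> B * gauss z"
        using mult_right_mono[OF B[of "x + \<delta> n *\<^sub>R z"], of "gauss z"] gauss_pos[of z] by (simp add: norm_mult)
    qed
  qed measurable
  also have "(LINT z::'a|lborel. f x * complex_of_real (gauss z)) = f x * complex_of_real (LINT z::'a|lborel. gauss z)" by simp
  finally show ?thesis by (simp only: integral_gauss)
qed

text \<open>The double integral behind inversion does not converge absolutely, so the factor
  gauss(\<delta> x) is inserted. Fubini then turns the integral into an average of \<open>f\<close>
  against a Gaussian of width \<delta> around k, and \<delta> tends to 0 on both sides.\<close>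

theorem fourier_inversion:
  fixes f :: "'a::euclidean_space \<Rightarrow> complex"
  assumes cont: "continuous_on UNIV f" and bdd: "\<And>x. cmod (f x) \<le> B"
    and i: "integrable lborel f" and i': "integrable lborel (fourier f)"
  shows "(LINT x|lborel. exp (\<i> * complex_of_real (k \<bullet> x)) * fourier f x) = complex_of_real ((2 * pi) ^ DIM('a)) * f k"
proof -
  have [measurable]: "f \<in> borel_measurable borel" "fourier f \<in> borel_measurable borel"
    using borel_measurable_integrable[OF i] borel_measurable_integrable[OF i'] by simp_all
  define \<delta> where "\<delta> n = inverse (real (Suc n))" for n
  have \<delta>0: "\<delta> n > 0" for n by (simp add: \<delta>_def)
  have \<delta>lim: "\<delta> \<longlonglongrightarrow> 0" unfolding \<delta>_def by (rule LIMSEQ_inverse_real_of_nat)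
  let ?c = "sqrt (2 * pi) ^ DIM('a)"
  let ?A = "\<lambda>n. LINT x|lborel. (exp (\<i> * complex_of_real (k \<bullet> x)) * complex_of_real (gauss (\<delta> n *\<^sub>R x))) * fourier f x"
  have "?A \<longlonglongrightarrow> (LINT x|lborel. exp (\<i> * complex_of_real (k \<bullet> x)) * fourier f x)"
  proof (rule integral_dominated_convergence[where w = "\<lambda>x. cmod (fourier f x)"])
    show "AE x in lborel. (\<lambda>n. (exp (\<i> * complex_of_real (k \<bullet> x)) * complex_of_real (gauss (\<delta> n *\<^sub>R x))) * fourier f x) \<longlonglongrightarrow>
       exp (\<i> * complex_of_real (k \<bullet> x)) * fourier f x"
    proof (rule AE_I2)
      fix x :: 'a
      have "(\<lambda>n. \<delta> n *\<^sub>R x) \<longlonglongrightarrow> 0 *\<^sub>R x" by (intro tendsto_intros \<delta>lim)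
      then have "(\<lambda>n. gauss (\<delta> n *\<^sub>R x)) \<longlonglongrightarrow> gauss (0 *\<^sub>R x)"
        by (rule continuous_on_tendsto_compose[OF continuous_gauss[of UNIV]]) auto
      from tendsto_of_real[OF this, where 'a = complex]
      have "(\<lambda>n. complex_of_real (gauss (\<delta> n *\<^sub>R x))) \<longlonglongrightarrow> 1"
        by (simp add: gauss_def)
      from tendsto_mult[OF tendsto_mult[OF tendsto_const this] tendsto_const]
      show "(\<lambda>n. (exp (\<i> * complex_of_real (k \<bullet> x)) * complex_of_real (gauss (\<delta> n *\<^sub>R x))) * fourier f x) \<longlonglongrightarrow>
         exp (\<i> * complex_of_real (k \<bullet> x)) * fourier f x" by simp
    qed
    show "AE x in lborel. norm ((exp (\<i> * complex_of_real (k \<bullet> x)) * complex_of_real (gauss (\<delta> n *\<^sub>R x))) * fourier f x) \<le> cmod (fourier f x)" for n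
    proof (rule AE_I2)
      fix x :: 'a
      have "\<bar>gauss (\<delta> n *\<^sub>R x)\<bar> \<le> 1" using gauss_pos[of "\<delta> n *\<^sub>R x"] gauss_le_1[of "\<delta> n *\<^sub>R x"] by simp
      then show "norm ((exp (\<i> * complex_of_real (k \<bullet> x)) * complex_of_real (gauss (\<delta> n *\<^sub>R x))) * fourier f x) \<le> cmod (fourier f x)"
        using mult_right_mono[of "\<bar>gauss (\<delta> n *\<^sub>R x)\<bar>" 1 "cmod (fourier f x)"] by (simp add: norm_mult)
    qed
  qed (use i' in auto)
  \<comment> \<open>The final constant (2 pi)^DIM is a product of two equal factors: this ?c comes
    from the transform of the Gaussian, the other one from its total mass in
    \<open>gauss_approximate_identity\<close>.\<close>
  moreover have Aeq: "?A n = complex_of_real ?c * (LINT z|lborel. f (k + \<delta> n *\<^sub>R z) * complex_of_real (gauss z))" for n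
  proof -
    let ?K = "\<lambda>x y. (exp (\<i> * complex_of_real (k \<bullet> x)) * complex_of_real (gauss (\<delta> n *\<^sub>R x))) * (exp (- \<i> * complex_of_real (x \<bullet> y)) * f y)"
    have "?A n = (LINT x|lborel. LINT y|lborel. ?K x y)"
      unfolding fourier_def by simp
    also have "\<dots> = (LINT y|lborel. LINT x|lborel. ?K x y)"
    proof (rule fubini_prod_bound(2)[symmetric])
      show "integrable lborel (\<lambda>x::'a. gauss (\<delta> n *\<^sub>R x))" using \<delta>0[of n] by (intro integrable_gauss_scale) auto
      show "integrable lborel (\<lambda>y. cmod (f y))" using i by simp
      show "cmod (?K x y) \<le> gauss (\<delta> n *\<^sub>R x) * cmod (f y)" for x y
        using gauss_pos[of "\<delta> n *\<^sub>R x"] by (simp add: norm_mult)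
    qed measurable
    also have "\<dots> = (LINT y|lborel. f y * complex_of_real (?c * gauss ((y - k) /\<^sub>R \<delta> n) / \<delta> n ^ DIM('a)))"
    proof (intro Bochner_Integration.integral_cong refl)
      fix y
      have "(LINT x|lborel. ?K x y) = (LINT x|lborel. f y * (exp (- \<i> * complex_of_real ((y - k) \<bullet> x)) * complex_of_real (gauss (\<delta> n *\<^sub>R x))))"
      proof (intro Bochner_Integration.integral_cong refl)
        fix x :: 'a
        have "\<i> * complex_of_real (k \<bullet> x) + - \<i> * complex_of_real (x \<bullet> y) = - \<i> * complex_of_real ((y - k) \<bullet> x)"
          unfolding inner_diff_left inner_commute[of x y] by (simp add: algebra_simps)
        then have e: "exp (\<i> * complex_of_real (k \<bullet> x)) * exp (- \<i> * complex_of_real (x \<bullet> y)) = exp (- \<i> * complex_of_real ((y - k) \<bullet> x))"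
          unfolding exp_add[symmetric] by (rule arg_cong)
        have "?K x y = f y * ((exp (\<i> * complex_of_real (k \<bullet> x)) * exp (- \<i> * complex_of_real (x \<bullet> y))) * complex_of_real (gauss (\<delta> n *\<^sub>R x)))"
          by (simp only: mult_ac)
        then show "?K x y = f y * (exp (- \<i> * complex_of_real ((y - k) \<bullet> x)) * complex_of_real (gauss (\<delta> n *\<^sub>R x)))"
          unfolding e .
      qed
      also have "\<dots> = f y * (LINT x|lborel. exp (- \<i> * complex_of_real ((y - k) \<bullet> x)) * complex_of_real (gauss (\<delta> n *\<^sub>R x)))"
        by (rule integral_mult_right_zero)
      also have "(LINT x|lborel. exp (- \<i> * complex_of_real ((y - k) \<bullet> x)) * complex_of_real (gauss (\<delta> n *\<^sub>R x))) =
        complex_of_real (?c * gauss ((y - k) /\<^sub>R \<delta> n) / \<delta> n ^ DIM('a))"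
        using fourier_gauss_scale[OF \<delta>0[of n], of "y - k"] unfolding fourier_def .
      finally show "(LINT x|lborel. ?K x y) = f y * complex_of_real (?c * gauss ((y - k) /\<^sub>R \<delta> n) / \<delta> n ^ DIM('a))" .
    qed
    also have "\<dots> = \<delta> n ^ DIM('a) *\<^sub>R (LINT z|lborel. f (k + \<delta> n *\<^sub>R z) * complex_of_real (?c * gauss (((k + \<delta> n *\<^sub>R z) - k) /\<^sub>R \<delta> n) / \<delta> n ^ DIM('a)))"
      by (rule lborel_integral_scale) (use \<delta>0 in auto)
    also have "\<dots> = (LINT z|lborel. complex_of_real ?c * (f (k + \<delta> n *\<^sub>R z) * complex_of_real (gauss z)))"
    proof -
      have "((k + \<delta> n *\<^sub>R z) - k) /\<^sub>R \<delta> n = z" for z using \<delta>0[of n] by simp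
      then have "\<delta> n ^ DIM('a) *\<^sub>R (f (k + \<delta> n *\<^sub>R z) * complex_of_real (?c * gauss (((k + \<delta> n *\<^sub>R z) - k) /\<^sub>R \<delta> n) / \<delta> n ^ DIM('a)))
          = complex_of_real ?c * (f (k + \<delta> n *\<^sub>R z) * complex_of_real (gauss z))" for z
        using \<delta>0[of n] by (simp only:) (simp add: scaleR_conv_of_real)
      then show ?thesis by (simp only: integral_scaleR_right[symmetric])
    qed
    also have "\<dots> = complex_of_real ?c * (LINT z|lborel. f (k + \<delta> n *\<^sub>R z) * complex_of_real (gauss z))"
      by (rule integral_mult_right_zero)
    finally show ?thesis .
  qed
  then have "?A \<longlonglongrightarrow> complex_of_real ?c * (f k * complex_of_real ?c)"
    unfolding Aeq by (intro tendsto_intros gauss_approximate_identity[OF cont bdd \<delta>lim])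
  ultimately have "(LINT x|lborel. exp (\<i> * complex_of_real (k \<bullet> x)) * fourier f x) = complex_of_real ?c * (f k * complex_of_real ?c)"
    by (rule LIMSEQ_unique)
  also have "\<dots> = complex_of_real (?c * ?c) * f k" by simp
  also have "?c * ?c = (sqrt (2 * pi) * sqrt (2 * pi)) ^ DIM('a)" by (rule power_mult_distrib[symmetric])
  also have "sqrt (2 * pi) * sqrt (2 * pi) = 2 * pi" using pi_ge_zero by (intro real_sqrt_mult_self[THEN trans]) simp
  finally show ?thesis .
qed

lemma fourier_inversion_schwartz:
  fixes \<phi> :: "'a::euclidean_space \<Rightarrow> complex"
  assumes "schwartz \<phi>"
  shows "fourier (fourier \<phi>) (- k) = complex_of_real ((2 * pi) ^ DIM('a)) * \<phi> k"
proof -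
  obtain B where "\<forall>x. (1 + norm x) ^ 0 * cmod (\<phi> x) \<le> B" using schwartz_decay[OF assms] by blast
  then have "\<And>x. cmod (\<phi> x) \<le> B" by simp
  from fourier_inversion[OF schwartz_continuous[OF assms] this schwartz_integrable[OF assms] schwartz_integrable[OF fourier_schwartz[OF assms]], of k]
  show ?thesis unfolding fourier_def[of "fourier \<phi>"] by simp
qed

subsection \<open>Schwartz functions separate functions\<close>

lemma abs_gauss [simp]: "\<bar>gauss x\<bar> = gauss x"
  using gauss_pos[of x] by simp

text \<open>Up to the factor ?c, a continuous \<Psi> is the limit of its convolutions
  \<open>P n\<close> with narrow Gaussians, and each convolution is a superposition of Gaussian
  translates, to which \<open>F\<close> is orthogonal. The Gaussian bound on \<Psi> makes the
  superposition absolutely integrable, so that Fubini applies, and keeps the \<open>P n\<close>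
  bounded.\<close>

lemma integral_gauss_translates_zero:
  fixes F :: "'a::euclidean_space \<Rightarrow> complex" and \<Psi> :: "'a \<Rightarrow> complex"
  assumes F: "integrable lborel F"
    and z: "\<And>a d. d > 0 \<Longrightarrow> (LINT x|lborel. F x * complex_of_real (gauss (d *\<^sub>R (x - a)))) = 0"
    and \<Psi>: "continuous_on UNIV \<Psi>" "\<And>x. cmod (\<Psi> x) \<le> gauss x"
  shows "(LINT x|lborel. F x * \<Psi> x) = 0"
proof -
  have [measurable]: "F \<in> borel_measurable borel" using borel_measurable_integrable[OF F] by simp
  have [measurable]: "\<Psi> \<in> borel_measurable borel" by (rule borel_measurable_continuous_onI[OF \<Psi>(1)])
  let ?c = "sqrt (2 * pi) ^ DIM('a)"
  define \<delta> where "\<delta> n = inverse (real (Suc n))" for n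
  have \<delta>0: "\<delta> n > 0" for n by (simp add: \<delta>_def)
  have \<delta>lim: "\<delta> \<longlonglongrightarrow> 0" unfolding \<delta>_def by (rule LIMSEQ_inverse_real_of_nat)
  define P where "P n x = (LINT z|lborel. \<Psi> (x + \<delta> n *\<^sub>R z) * complex_of_real (gauss z))" for n x
  have bd: "cmod (\<Psi> x) \<le> 1" for x using \<Psi>(2)[of x] gauss_le_1[of x] by linarith
  have P0: "(LINT x|lborel. F x * P n x) = 0" for n
  proof -
    let ?K = "\<lambda>x a. F x * (\<Psi> a * complex_of_real (gauss ((1 / \<delta> n) *\<^sub>R (x - a))))"
    have sw: "(LINT a|lborel. LINT x|lborel. ?K x a) = (LINT x|lborel. LINT a|lborel. ?K x a)"
    proof (rule fubini_prod_bound(2))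
      show "integrable lborel (\<lambda>x. cmod (F x))" using F by simp
      show "integrable lborel (\<lambda>a::'a. gauss a)" by (rule integrable_gauss)
      show "cmod (?K x a) \<le> cmod (F x) * gauss a" for x a
      proof -
        have "cmod (\<Psi> a) * \<bar>gauss ((1 / \<delta> n) *\<^sub>R (x - a))\<bar> \<le> gauss a * 1"
          using gauss_pos[of "(1 / \<delta> n) *\<^sub>R (x - a)"] gauss_le_1[of "(1 / \<delta> n) *\<^sub>R (x - a)"] \<Psi>(2)[of a] gauss_pos[of a]
          by (intro mult_mono) auto
        then show ?thesis by (simp add: norm_mult mult_left_mono)
      qed
    qed measurable
    have z0: "(LINT x|lborel. ?K x a) = 0" for a
    proof -
      have "(LINT x|lborel. ?K x a) = (LINT x|lborel. \<Psi> a * (F x * complex_of_real (gauss ((1 / \<delta> n) *\<^sub>R (x - a)))))"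
        by (simp add: algebra_simps)
      also have "\<dots> = 0" using z[of "1 / \<delta> n" a] \<delta>0[of n] by (simp only: integral_mult_right_zero) simp
      finally show ?thesis .
    qed
    have e: "(LINT a|lborel. ?K x a) = complex_of_real (\<delta> n ^ DIM('a)) * (F x * P n x)" for x
    proof -
      have "(LINT a|lborel. ?K x a) = \<delta> n ^ DIM('a) *\<^sub>R (LINT z|lborel. ?K x (x + \<delta> n *\<^sub>R z))"
        by (rule lborel_integral_scale) (use \<delta>0 in auto)
      also have "(LINT z|lborel. ?K x (x + \<delta> n *\<^sub>R z)) = (LINT z|lborel. F x * (\<Psi> (x + \<delta> n *\<^sub>R z) * complex_of_real (gauss z)))"
        using \<delta>0[of n] by (intro Bochner_Integration.integral_cong refl) (simp add: gauss_def)
      also have "\<dots> = F x * P n x" unfolding P_def by (rule integral_mult_right_zero)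
      finally show ?thesis by (simp add: scaleR_conv_of_real)
    qed
    have "(LINT x|lborel. complex_of_real (\<delta> n ^ DIM('a)) * (F x * P n x)) = (LINT x|lborel. LINT a|lborel. ?K x a)"
      by (simp only: e)
    also have "\<dots> = (LINT a|lborel. LINT x|lborel. ?K x a)" by (rule sw[symmetric])
    also have "\<dots> = 0" unfolding z0 by simp
    finally have "complex_of_real (\<delta> n ^ DIM('a)) * (LINT x|lborel. (F x * P n x)) = 0" by (simp only: integral_mult_right_zero)
    then show ?thesis using \<delta>0[of n] by simp
  qed
  have [measurable]: "P n \<in> borel_measurable borel" for n
    unfolding P_def[abs_def] by measurable
  have Pb: "cmod (P n x) \<le> ?c" for n x
  proof -
    have "cmod (P n x) \<le> (LINT z::'a|lborel. gauss z)"
      unfolding P_def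
    proof (rule norm_integral_le)
      show le: "cmod (\<Psi> (x + \<delta> n *\<^sub>R z) * complex_of_real (gauss z)) \<le> gauss z" for z
        using mult_right_mono[OF bd[of "x + \<delta> n *\<^sub>R z"], of "gauss z"] gauss_pos[of z] by (simp add: norm_mult)
      show "integrable lborel (\<lambda>z. \<Psi> (x + \<delta> n *\<^sub>R z) * complex_of_real (gauss z))"
        by (rule Bochner_Integration.integrable_bound[OF integrable_gauss]) (use order_trans[OF le abs_ge_self] in auto)
    qed (rule integrable_gauss)
    then show ?thesis by (simp only: integral_gauss)
  qed
  have "(\<lambda>n. LINT x|lborel. F x * P n x) \<longlonglongrightarrow> (LINT x|lborel. F x * (\<Psi> x * complex_of_real ?c))"
  proof (rule integral_dominated_convergence[where w = "\<lambda>x. cmod (F x) * ?c"])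
    show "AE x in lborel. (\<lambda>n. F x * P n x) \<longlonglongrightarrow> F x * (\<Psi> x * complex_of_real ?c)"
      unfolding P_def by (intro AE_I2 tendsto_intros gauss_approximate_identity[OF \<Psi>(1) bd \<delta>lim])
    show "AE x in lborel. norm (F x * P n x) \<le> cmod (F x) * ?c" for n
      using Pb by (intro AE_I2) (auto simp: norm_mult intro!: mult_left_mono)
  qed (use F in auto)
  then have "(LINT x|lborel. F x * (\<Psi> x * complex_of_real ?c)) = 0" using P0 LIMSEQ_unique[OF _ tendsto_const] by fastforce
  moreover have "(LINT x|lborel. F x * (\<Psi> x * complex_of_real ?c)) = (LINT x|lborel. F x * \<Psi> x) * complex_of_real ?c"
    by (simp only: mult.assoc[symmetric] integral_mult_left_zero)
  ultimately show ?thesis by simp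
qed

text \<open>The source of all uniqueness statements below. \<open>f\<close> is damped by a Gaussian
  to become integrable; the damped function is orthogonal to Gaussians of all widths and centres,
  hence to damped indicators of open sets, and a Dynkin argument then gives integral 0 over every
  Borel set.\<close>

theorem schwartz_separates:
  fixes f :: "'a::euclidean_space \<Rightarrow> complex"
  assumes [measurable]: "f \<in> borel_measurable borel"
    and i: "\<And>\<phi>. schwartz \<phi> \<Longrightarrow> integrable lborel (\<lambda>x. f x * \<phi> x)"
    and z: "\<And>\<phi>. schwartz \<phi> \<Longrightarrow> (LINT x|lborel. f x * \<phi> x) = 0"
  shows "AE x in lborel. f x = 0"
proof -
  \<comment> \<open>Two Gaussian factors are spent. One makes \<open>F\<close> integrable, because
    the Gaussian is itself a test function; the other is moved onto the cut-off
    \<open>\<psi> n\<close>, which then satisfies the bound that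
    \<open>integral_gauss_translates_zero\<close> asks for.\<close>
  define F where "F x = f x * complex_of_real (gauss x)" for x
  define H where "H x = F x * complex_of_real (gauss x)" for x
  have [measurable]: "F \<in> borel_measurable borel" "H \<in> borel_measurable borel"
    unfolding F_def[abs_def] H_def[abs_def] by measurable
  have sg: "schwartz (\<lambda>x::'a. complex_of_real (gauss x))" using schwartz_gauss_scale[of 1] by simp
  have iF: "integrable lborel F" unfolding F_def by (rule i[OF sg])
  have iH: "integrable lborel H"
    by (rule Bochner_Integration.integrable_bound[OF iF])
       (use gauss_pos gauss_le_1 in \<open>auto simp: H_def norm_mult abs_of_pos intro!: AE_I2 mult_left_le\<close>)
  have F0: "(LINT x|lborel. F x * complex_of_real (gauss (d *\<^sub>R (x - a)))) = 0" if "d > 0" for a d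
  proof -
    \<comment> \<open>The damping factor times a translated Gaussian is, up to the constant ?c,
      again a function covered by \<open>schwartz_gauss\<close>; adding the two exponents gives
      these parameters.\<close>
    let ?\<alpha> = "(1 + d\<^sup>2) / 2" and ?\<beta> = "d\<^sup>2 *\<^sub>R a" and ?c = "exp (- d\<^sup>2 * (a \<bullet> a) / 2)"
    let ?E = "\<lambda>x. complex_of_real (exp (?\<beta> \<bullet> x - ?\<alpha> * (x \<bullet> x)))"
    have "gauss x * gauss (d *\<^sub>R (x - a)) = ?c * exp (?\<beta> \<bullet> x - ?\<alpha> * (x \<bullet> x))" for x
    proof -
      have "- (x \<bullet> x) / 2 + - ((d *\<^sub>R (x - a)) \<bullet> (d *\<^sub>R (x - a))) / 2 = (- d\<^sup>2 * (a \<bullet> a) / 2) + (?\<beta> \<bullet> x - ?\<alpha> * (x \<bullet> x))"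
        by (simp add: inner_diff_left inner_diff_right inner_commute power2_eq_square field_simps)
      then show ?thesis unfolding gauss_def by (metis exp_add)
    qed
    then have "F x * complex_of_real (gauss (d *\<^sub>R (x - a))) = complex_of_real ?c * (f x * ?E x)" for x
      unfolding F_def by (metis (no_types, lifting) mult.assoc mult.left_commute of_real_mult)
    then have "(LINT x|lborel. F x * complex_of_real (gauss (d *\<^sub>R (x - a)))) = complex_of_real ?c * (LINT x|lborel. f x * ?E x)"
      by (simp only: integral_mult_right_zero)
    also have "(LINT x|lborel. f x * ?E x) = 0"
      by (intro z schwartz_gauss) (simp add: add_pos_nonneg)
    finally show ?thesis by simp
  qed
  have op: "(LINT x:U|lborel. H x) = 0" if "open U" for U
  proof -
    \<comment> \<open>Continuous functions increasing to the indicator of U. The whole space is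
      treated apart because \<open>infdist\<close> to the empty set is 0, which would make the
      cut-off vanish.\<close>
    define \<psi> where "\<psi> n x = (if U = UNIV then 1 else min 1 (real n * infdist x (- U)))" for n :: nat and x
    have \<psi>01: "0 \<le> \<psi> n x" "\<psi> n x \<le> 1" for n x by (auto simp: \<psi>_def infdist_nonneg)
    have \<psi>c: "continuous_on UNIV (\<psi> n)" for n
      by (cases "U = UNIV") (auto simp: \<psi>_def[abs_def] intro!: continuous_intros)
    have [measurable]: "\<psi> n \<in> borel_measurable borel" for n by (rule borel_measurable_continuous_onI[OF \<psi>c])
    have lim: "(\<lambda>n. \<psi> n x) \<longlonglongrightarrow> indicator U x" for x
    proof (cases "U = UNIV \<or> x \<notin> U")
      case True
      then have "\<psi> n x = indicator U x" for n by (auto simp: \<psi>_def)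
      then show ?thesis by simp
    next
      case False
      then have d: "infdist x (- U) > 0"
        using that infdist_pos_not_in_closed[of "- U" x] by auto
      obtain N :: nat where N: "1 / infdist x (- U) < real N" using reals_Archimedean2 by blast
      have "\<psi> n x = 1" if "n \<ge> N" for n
      proof -
        have "1 / infdist x (- U) \<le> real n" using N that by linarith
        then have "1 \<le> real n * infdist x (- U)" using d by (simp add: field_simps)
        then show ?thesis by (simp add: \<psi>_def)
      qed
      then have "eventually (\<lambda>n. \<psi> n x = indicator U x) sequentially"
        using False by (auto simp: eventually_sequentially)
      then show ?thesis by (rule tendsto_eventually)
    qed
    have "(\<lambda>n. LINT x|lborel. \<psi> n x *\<^sub>R H x) \<longlonglongrightarrow> (LINT x|lborel. indicator U x *\<^sub>R H x)"
    proof (rule integral_dominated_convergence[where w = "\<lambda>x. cmod (H x)"])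
      show "AE x in lborel. (\<lambda>n. \<psi> n x *\<^sub>R H x) \<longlonglongrightarrow> indicator U x *\<^sub>R H x"
        by (intro AE_I2 tendsto_intros lim)
      show "AE x in lborel. norm (\<psi> n x *\<^sub>R H x) \<le> cmod (H x)" for n
      proof (rule AE_I2)
        fix x
        show "norm (\<psi> n x *\<^sub>R H x) \<le> cmod (H x)"
          using \<psi>01[where n=n and x=x] mult_right_mono[of "\<bar>\<psi> n x\<bar>" 1 "cmod (H x)"] by simp
      qed
    qed (use iH that in auto)
    moreover have "(LINT x|lborel. \<psi> n x *\<^sub>R H x) = 0" for n
    proof -
      have "(LINT x|lborel. F x * complex_of_real (\<psi> n x * gauss x)) = 0"
      proof (rule integral_gauss_translates_zero[OF iF F0])
        show "continuous_on UNIV (\<lambda>x. complex_of_real (\<psi> n x * gauss x))"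
          by (intro continuous_intros \<psi>c continuous_gauss)
        show "cmod (complex_of_real (\<psi> n x * gauss x)) \<le> gauss x" for x
          using \<psi>01[where n=n and x=x] gauss_pos[of x] mult_right_mono[of "\<bar>\<psi> n x\<bar>" 1 "gauss x"] by (simp add: norm_mult)
      qed
      then show ?thesis by (simp add: H_def scaleR_conv_of_real algebra_simps)
    qed
    ultimately show ?thesis unfolding set_lebesgue_integral_def using LIMSEQ_unique[OF _ tendsto_const] by fastforce
  qed
  have si: "set_integrable lborel A H" if "A \<in> sets borel" for A
    unfolding set_integrable_def using that by (intro integrable_mult_indicator iH) auto
  have all: "(LINT x:A|lborel. H x) = 0" if "A \<in> sets borel" for A
  proof -
    \<comment> \<open>Open sets form an intersection-stable generator, so the vanishing of the
      integral spreads through complements and countable disjoint unions to all Borel sets.\<close>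
    have "Int_stable {S::'a set. open S}" by (auto simp: Int_stable_def)
    moreover have "{S::'a set. open S} \<subseteq> Pow UNIV" by auto
    moreover have "A \<in> sigma_sets UNIV {S. open S}" using that by (simp add: borel_def)
    ultimately show ?thesis
    proof (induction rule: sigma_sets_induct_disjoint)
      case (basic A) then show ?case using op by simp
    next
      case empty then show ?case by (simp add: set_lebesgue_integral_def)
    next
      case (compl A)
      have A: "A \<in> sets borel" using compl(1) by (simp add: borel_def)
      have "(LINT x:A \<union> (UNIV - A)|lborel. H x) = (LINT x:A|lborel. H x) + (LINT x:UNIV - A|lborel. H x)"
        using A by (intro set_integral_Un si) auto
      moreover have "(LINT x:A \<union> (UNIV - A)|lborel. H x) = 0" using op[of UNIV] by simp
      ultimately show ?case using compl(2) by simp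
    next
      case (union A)
      have A: "A i \<in> sets borel" for i using union(2) by (auto simp: borel_def)
      have "(LINT x:(\<Union>i. A i)|lborel. H x) = (\<Sum>i. (LINT x:A i|lborel. H x))"
        using A union(1) by (intro lebesgue_integral_countable_add si) (auto simp: disjoint_family_on_def)
      then show ?case using union(3) by simp
    qed
  qed
  have "AE x in lborel. H x = 0" by (rule sigma_finite_measure.density_zero[OF sigma_finite_lborel iH]) (use all in auto)
  then show ?thesis
  proof eventually_elim
    case (elim x)
    then show ?case using gauss_pos[of x] by (simp add: H_def F_def)
  qed
qed

section \<open>Distributions given by their Fourier transform\<close>

definition sob_weight :: "real \<Rightarrow> 'a::euclidean_space \<Rightarrow> real" where
  "sob_weight s k = (1 + (norm k)\<^sup>2) powr s"

lemma one_plus_norm_pos: "0 < 1 + (norm k)\<^sup>2"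
  by (simp add: add_pos_nonneg)

lemma sob_weight_pos: "sob_weight s k > 0"
  unfolding sob_weight_def using one_plus_norm_pos[of k] by simp

lemma sob_weight_nonneg [simp]: "sob_weight s k \<ge> 0"
  using sob_weight_pos less_imp_le by blast

lemma sob_weight_measurable [measurable]: "sob_weight s \<in> borel_measurable borel"
  unfolding sob_weight_def[abs_def] by measurable

lemma sob_weight_minus: "sob_weight (- s) k = 1 / sob_weight s k"
  by (simp add: sob_weight_def powr_minus_divide)

lemma sob_weight_mono: "r \<le> s \<Longrightarrow> sob_weight r k \<le> sob_weight s k"
  unfolding sob_weight_def by (intro powr_mono) auto

lemma sob_weight_0 [simp]: "sob_weight 0 k = 1"
  unfolding sob_weight_def using one_plus_norm_pos[of k] by simp

lemma sob_weight_le_power: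
  "sob_weight s k \<le> (1 + norm k) ^ (2 * nat \<lceil>\<bar>s\<bar>\<rceil>)"
proof -
  have "sob_weight s k \<le> sob_weight (real (nat \<lceil>\<bar>s\<bar>\<rceil>)) k" by (intro sob_weight_mono) linarith
  also have "\<dots> = (1 + (norm k)\<^sup>2) ^ nat \<lceil>\<bar>s\<bar>\<rceil>"
    unfolding sob_weight_def by (rule powr_realpow[OF one_plus_norm_pos])
  also have "\<dots> \<le> ((1 + norm k)\<^sup>2) ^ nat \<lceil>\<bar>s\<bar>\<rceil>"
    by (intro power_mono) (auto simp: power2_sum)
  finally show ?thesis by (simp add: power_mult)
qed

text \<open>Young's inequality with a weight. It replaces the Cauchy-Schwarz inequality wherever
  only finiteness is at stake, since it splits a product pointwise into two integrable
  terms.\<close>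

lemma amgm_weight:
  fixes a b w :: real
  assumes "w > 0" shows "a * b \<le> w * a\<^sup>2 + b\<^sup>2 / w"
proof -
  have "0 \<le> (w * a - b)\<^sup>2" "0 \<le> (w * a)\<^sup>2 + b\<^sup>2" by auto
  then have "(a * b) * w \<le> (w * a)\<^sup>2 + b\<^sup>2" by (simp add: power2_eq_square algebra_simps)
  then show ?thesis using assms by (simp add: power2_eq_square field_simps)
qed

text \<open>Young's inequality separates the weighted square of \<open>h\<close> from (1 + norm
  k)^(-2M) divided by the weight. In \<open>M\<close>, the summand DIM makes the second term
  integrable, and the summand with |s| compensates for the growth of the inverse weight.\<close>

lemma weighted_L2_decay_integrable:
  fixes h :: "'a::euclidean_space \<Rightarrow> complex"
  assumes [measurable]: "h \<in> borel_measurable borel"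
    and h: "integrable lborel (\<lambda>k. sob_weight s k * (cmod (h k))\<^sup>2)"
  defines "M \<equiv> DIM('a) + nat \<lceil>\<bar>s\<bar>\<rceil>"
  shows "integrable lborel (\<lambda>k. cmod (h k) / (1 + norm k) ^ M)"
proof (rule Bochner_Integration.integrable_bound)
  show "integrable lborel (\<lambda>k::'a. sob_weight s k * (cmod (h k))\<^sup>2 + 1 / (1 + norm k) ^ (2 * DIM('a)))"
    by (intro Bochner_Integration.integrable_add h integrable_inverse_power_norm)
  show "AE k in lborel. norm (cmod (h k) / (1 + norm k) ^ M) \<le> norm (sob_weight s k * (cmod (h k))\<^sup>2 + 1 / (1 + norm k) ^ (2 * DIM('a)))"
  proof (rule AE_I2)
    fix k :: 'a
    have p: "0 < 1 + norm k" by (simp add: add_pos_nonneg)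
    have "cmod (h k) / (1 + norm k) ^ M = cmod (h k) * (1 / (1 + norm k) ^ M)" by simp
    also have "\<dots> \<le> sob_weight s k * (cmod (h k))\<^sup>2 + (1 / (1 + norm k) ^ M)\<^sup>2 / sob_weight s k"
      by (rule amgm_weight[OF sob_weight_pos])
    also have "(1 / (1 + norm k) ^ M)\<^sup>2 / sob_weight s k \<le> 1 / (1 + norm k) ^ (2 * DIM('a))"
    proof -
      have "(1 / (1 + norm k) ^ M)\<^sup>2 / sob_weight s k = sob_weight (- s) k / (1 + norm k) ^ (2 * M)"
        by (simp add: sob_weight_minus power_divide power_mult mult.commute)
      also have "\<dots> \<le> (1 + norm k) ^ (2 * nat \<lceil>\<bar>s\<bar>\<rceil>) / (1 + norm k) ^ (2 * M)"
        using p sob_weight_le_power[of "- s" k] by (intro divide_right_mono) auto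
      also have "\<dots> = 1 / (1 + norm k) ^ (2 * DIM('a))"
        using p by (simp add: M_def power_add add_mult_distrib2)
      finally show ?thesis .
    qed
    finally show "norm (cmod (h k) / (1 + norm k) ^ M) \<le> norm (sob_weight s k * (cmod (h k))\<^sup>2 + 1 / (1 + norm k) ^ (2 * DIM('a)))"
      by simp
  qed
qed simp

lemma weighted_L2_pairing:
  fixes h \<psi> :: "'a::euclidean_space \<Rightarrow> complex"
  assumes [measurable]: "h \<in> borel_measurable borel" "\<psi> \<in> borel_measurable borel"
    and h: "integrable lborel (\<lambda>k. sob_weight s k * (cmod (h k))\<^sup>2)"
    and \<psi>: "\<And>k. (1 + norm k) ^ (DIM('a) + nat \<lceil>\<bar>s\<bar>\<rceil>) * cmod (\<psi> k) \<le> C"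
  shows "integrable lborel (\<lambda>k. h k * \<psi> k)"
    "cmod (LINT k|lborel. h k * \<psi> k) \<le> C * (LINT k|lborel. cmod (h k) / (1 + norm k) ^ (DIM('a) + nat \<lceil>\<bar>s\<bar>\<rceil>))"
proof -
  let ?M = "DIM('a) + nat \<lceil>\<bar>s\<bar>\<rceil>"
  have le: "cmod (h k * \<psi> k) \<le> C * (cmod (h k) / (1 + norm k) ^ ?M)" for k
  proof -
    have "0 < (1 + norm k) ^ ?M" by (simp add: add_pos_nonneg)
    then have "cmod (\<psi> k) \<le> C / (1 + norm k) ^ ?M" using \<psi>[of k] by (simp add: field_simps)
    from mult_left_mono[OF this, of "cmod (h k)"] show ?thesis by (simp add: norm_mult mult.commute)
  qed
  have i: "integrable lborel (\<lambda>k. C * (cmod (h k) / (1 + norm k) ^ ?M))"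
    by (intro integrable_mult_right weighted_L2_decay_integrable h) simp
  show *: "integrable lborel (\<lambda>k. h k * \<psi> k)"
    by (rule Bochner_Integration.integrable_bound[OF i]) (use order_trans[OF le abs_ge_self] in auto)
  have "cmod (LINT k|lborel. h k * \<psi> k) \<le> (LINT k|lborel. C * (cmod (h k) / (1 + norm k) ^ ?M))"
    by (rule norm_integral_le[OF * i le])
  then show "cmod (LINT k|lborel. h k * \<psi> k) \<le> C * (LINT k|lborel. cmod (h k) / (1 + norm k) ^ ?M)"
    by (simp only: integral_mult_right_zero)
qed

text \<open>The transpose of the inverse transform on Schwartz functions. The pairing lives on the
  frequency side, where it converges for every \<open>h\<close> in a weighted L^2 space, although
  the inverse transform of such an \<open>h\<close> need not be a function.\<close>

definition inverse_fourier :: "('a::euclidean_space \<Rightarrow> complex) \<Rightarrow> 'a distribution" where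
  "inverse_fourier h \<phi> = (LINT k|lborel. h k * fourier \<phi> (- k)) / complex_of_real ((2 * pi) ^ DIM('a))"

lemma fourier_lincomb:
  assumes "schwartz \<phi>" "schwartz \<psi>"
  shows "fourier (\<lambda>x. a * \<phi> x + b * \<psi> x) k = a * fourier \<phi> k + b * fourier \<psi> k"
proof -
  have i: "integrable lborel (\<lambda>x. exp (- \<i> * complex_of_real (k \<bullet> x)) * \<theta> x)" if "schwartz \<theta>" for \<theta>
    using integrable_exp_mult[OF schwartz_integrable[OF that], of "\<lambda>x. k \<bullet> x"] by simp
  have "fourier (\<lambda>x. a * \<phi> x + b * \<psi> x) k =
    (LINT x|lborel. a * (exp (- \<i> * complex_of_real (k \<bullet> x)) * \<phi> x) + b * (exp (- \<i> * complex_of_real (k \<bullet> x)) * \<psi> x))"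
    unfolding fourier_def by (simp add: algebra_simps)
  also have "\<dots> = a * fourier \<phi> k + b * fourier \<psi> k"
    unfolding fourier_def
    by (simp only: Bochner_Integration.integral_add integrable_mult_right i assms integral_mult_right_zero)
  finally show ?thesis .
qed

lemma inverse_fourier_pairing:
  fixes h :: "'a::euclidean_space \<Rightarrow> complex"
  assumes [measurable]: "h \<in> borel_measurable borel"
    and h: "integrable lborel (\<lambda>k. sob_weight s k * (cmod (h k))\<^sup>2)" and \<phi>: "schwartz \<phi>"
  shows "integrable lborel (\<lambda>k. h k * fourier \<phi> (- k))"
proof -
  have [measurable]: "fourier \<phi> \<in> borel_measurable borel" by (intro fourier_measurable schwartz_measurable \<phi>)
  obtain C where "\<forall>k. (1 + norm k) ^ (DIM('a) + nat \<lceil>\<bar>s\<bar>\<rceil>) * cmod (fourier \<phi> k) \<le> C" using fourier_decay1[OF \<phi>] by blast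
  then have "(1 + norm k) ^ (DIM('a) + nat \<lceil>\<bar>s\<bar>\<rceil>) * cmod (fourier \<phi> (- k)) \<le> C" for k by (metis norm_minus_cancel)
  from weighted_L2_pairing(1)[OF _ _ h this] show ?thesis by simp
qed

text \<open>Continuity rests on \<open>fourier_decay\<close>: the decay of
  \<open>fourier \<phi>\<close> is controlled by one seminorm of \<phi>, with constants common to
  all \<phi>.\<close>

lemma tempered_inverse_fourier:
  fixes h :: "'a::euclidean_space \<Rightarrow> complex"
  assumes m[measurable]: "h \<in> borel_measurable borel"
    and h: "integrable lborel (\<lambda>k. sob_weight s k * (cmod (h k))\<^sup>2)"
  shows "tempered (inverse_fourier h)"
  unfolding tempered_def
proof (intro conjI allI impI)
  fix \<phi> \<psi> :: "'a \<Rightarrow> complex" and a b :: complex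
  assume S: "schwartz \<phi>" "schwartz \<psi>"
  have "(LINT k|lborel. h k * fourier (\<lambda>x. a * \<phi> x + b * \<psi> x) (- k)) =
    (LINT k|lborel. a * (h k * fourier \<phi> (- k)) + b * (h k * fourier \<psi> (- k)))"
    by (simp add: fourier_lincomb[OF S] algebra_simps)
  also have "\<dots> = a * (LINT k|lborel. h k * fourier \<phi> (- k)) + b * (LINT k|lborel. h k * fourier \<psi> (- k))"
    by (simp only: Bochner_Integration.integral_add integrable_mult_right inverse_fourier_pairing[OF m h] S integral_mult_right_zero)
  finally show "inverse_fourier h (\<lambda>x. a * \<phi> x + b * \<psi> x) = a * inverse_fourier h \<phi> + b * inverse_fourier h \<psi>"
    unfolding inverse_fourier_def by (simp add: add_divide_distrib)
next
  let ?M = "DIM('a) + nat \<lceil>\<bar>s\<bar>\<rceil>"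
  let ?I = "LINT k|lborel. cmod (h k) / (1 + norm k) ^ ?M"
  obtain C N where C: "C \<ge> 0"
    "\<And>(\<phi>::'a \<Rightarrow> complex) k. schwartz \<phi> \<Longrightarrow> (1 + norm k) ^ ?M * cmod (fourier \<phi> k) \<le> C * schwartz_seminorm N \<phi>"
    using fourier_decay[of ?M] by metis
  show "\<exists>C N. \<forall>\<phi>. schwartz \<phi> \<longrightarrow> cmod (inverse_fourier h \<phi>) \<le> C * schwartz_seminorm N \<phi>"
  proof (intro exI allI impI)
    fix \<phi> :: "'a \<Rightarrow> complex" assume \<phi>: "schwartz \<phi>"
    have [measurable]: "fourier \<phi> \<in> borel_measurable borel" by (intro fourier_measurable schwartz_measurable \<phi>)
    have "(1 + norm k) ^ ?M * cmod (fourier \<phi> (- k)) \<le> C * schwartz_seminorm N \<phi>" for k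
      using C(2)[OF \<phi>, of "- k"] by simp
    from weighted_L2_pairing(2)[OF _ _ h this]
    have "cmod (LINT k|lborel. h k * fourier \<phi> (- k)) \<le> C * schwartz_seminorm N \<phi> * ?I" by simp
    then have "cmod (LINT k|lborel. h k * fourier \<phi> (- k)) / (2 * pi) ^ DIM('a) \<le> C * schwartz_seminorm N \<phi> * ?I / (2 * pi) ^ DIM('a)"
      by (intro divide_right_mono) auto
    then show "cmod (inverse_fourier h \<phi>) \<le> (C * ?I / (2 * pi) ^ DIM('a)) * schwartz_seminorm N \<phi>"
      unfolding inverse_fourier_def by (simp add: norm_divide norm_power norm_mult mult_ac)
  qed
qed

lemma weighted_L2_schwartz_integrable:
  fixes h :: "'a::euclidean_space \<Rightarrow> complex"
  assumes m[measurable]: "h \<in> borel_measurable borel"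
    and h: "integrable lborel (\<lambda>k. sob_weight s k * (cmod (h k))\<^sup>2)" and \<phi>: "schwartz \<phi>"
  shows "integrable lborel (\<lambda>k. h k * \<phi> k)"
proof -
  have [measurable]: "\<phi> \<in> borel_measurable borel" by (intro schwartz_measurable \<phi>)
  obtain C where "\<forall>k. (1 + norm k) ^ (DIM('a) + nat \<lceil>\<bar>s\<bar>\<rceil>) * cmod (\<phi> k) \<le> C" using schwartz_decay[OF \<phi>] by blast
  then have "(1 + norm k) ^ (DIM('a) + nat \<lceil>\<bar>s\<bar>\<rceil>) * cmod (\<phi> k) \<le> C" for k by blast
  from weighted_L2_pairing(1)[OF _ _ h this] show ?thesis by simp
qed

text \<open>Testing with \<open>fourier \<phi>\<close> applies the transform twice, and inversion
  returns (2 pi)^DIM times \<phi>, which the normalisation of \<open>inverse_fourier\<close>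
  cancels.\<close>

lemma has_fourier_inverse_fourier:
  fixes h :: "'a::euclidean_space \<Rightarrow> complex"
  assumes m[measurable]: "h \<in> borel_measurable borel"
    and h: "integrable lborel (\<lambda>k. sob_weight s k * (cmod (h k))\<^sup>2)"
  shows "has_fourier (inverse_fourier h) h"
  unfolding has_fourier_def
proof (intro conjI allI impI)
  fix \<phi> :: "'a \<Rightarrow> complex" assume \<phi>: "schwartz \<phi>"
  show "integrable lborel (\<lambda>k. h k * \<phi> k)" by (rule weighted_L2_schwartz_integrable[OF m h \<phi>])
  have "(LINT k|lborel. h k * fourier (fourier \<phi>) (- k)) = (LINT k|lborel. (h k * \<phi> k) * complex_of_real ((2 * pi) ^ DIM('a)))"
    unfolding fourier_inversion_schwartz[OF \<phi>] by (simp only: mult_ac)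
  also have "\<dots> = (LINT k|lborel. h k * \<phi> k) * complex_of_real ((2 * pi) ^ DIM('a))" by (rule integral_mult_left_zero)
  finally show "inverse_fourier h (fourier \<phi>) = (LINT k|lborel. h k * \<phi> k)"
    unfolding inverse_fourier_def by simp
qed (rule m)

text \<open>\<open>fourier_of\<close> is a choice, so nothing can be computed with it until two
  candidates are known to agree almost everywhere; \<open>schwartz_separates\<close> shows this for
  their difference.\<close>

lemma has_fourier_unique:
  assumes "has_fourier u h" "has_fourier u h'"
  shows "AE k in lborel. h k = h' k"
proof -
  have [measurable]: "h \<in> borel_measurable borel" "h' \<in> borel_measurable borel"
    using assms unfolding has_fourier_def by auto
  have "AE k in lborel. h k - h' k = 0"
  proof (rule schwartz_separates)
    show "(\<lambda>k. h k - h' k) \<in> borel_measurable borel" by measurable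
    fix \<phi> :: "'a \<Rightarrow> complex" assume \<phi>: "schwartz \<phi>"
    then have i: "integrable lborel (\<lambda>k. h k * \<phi> k)" "integrable lborel (\<lambda>k. h' k * \<phi> k)"
      and e: "(LINT k|lborel. h k * \<phi> k) = (LINT k|lborel. h' k * \<phi> k)"
      using assms unfolding has_fourier_def by metis+
    show "integrable lborel (\<lambda>k. (h k - h' k) * \<phi> k)" using i by (simp add: left_diff_distrib)
    show "(LINT k|lborel. (h k - h' k) * \<phi> k) = 0" using i e by (simp add: left_diff_distrib)
  qed
  then show ?thesis by simp
qed

lemma has_fourier_fourier_of: "has_fourier u h \<Longrightarrow> has_fourier u (fourier_of u)"
  unfolding fourier_of_def by (rule someI[of "has_fourier u"])

text \<open>Makes the norm computable from whatever transform is at hand, instead of the chosen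
  one.\<close>

lemma sobolev_norm_eq:
  assumes "has_fourier u h"
  shows "sobolev_norm s u = sqrt (LINT k|lborel. sob_weight s k * (cmod (h k))\<^sup>2)"
proof -
  have f: "has_fourier u (fourier_of u)" using has_fourier_fourier_of[OF assms] .
  then have [measurable]: "h \<in> borel_measurable borel" "fourier_of u \<in> borel_measurable borel"
    using assms unfolding has_fourier_def by auto
  have "AE k in lborel. fourier_of u k = h k" by (rule has_fourier_unique[OF f assms])
  then have "(LINT k|lborel. sob_weight s k * (cmod (fourier_of u k))\<^sup>2) = (LINT k|lborel. sob_weight s k * (cmod (h k))\<^sup>2)"
    by (intro integral_cong_AE) auto
  then show ?thesis unfolding sobolev_norm_def sob_weight_def by simp
qed

lemma sobolevI:
  "tempered u \<Longrightarrow> has_fourier u h \<Longrightarrow> integrable lborel (\<lambda>k. sob_weight s k * (cmod (h k))\<^sup>2) \<Longrightarrow> u \<in> sobolev s"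
  unfolding sobolev_def sob_weight_def by blast

lemma sobolevD:
  assumes "u \<in> sobolev s"
  shows "has_fourier u (fourier_of u)" "integrable lborel (\<lambda>k. sob_weight s k * (cmod (fourier_of u k))\<^sup>2)"
    "fourier_of u \<in> borel_measurable borel"
proof -
  obtain h where h: "has_fourier u h" "integrable lborel (\<lambda>k. sob_weight s k * (cmod (h k))\<^sup>2)"
    using assms unfolding sobolev_def sob_weight_def by blast
  show f: "has_fourier u (fourier_of u)" using has_fourier_fourier_of[OF h(1)] .
  then show [measurable]: "fourier_of u \<in> borel_measurable borel" unfolding has_fourier_def by blast
  have [measurable]: "h \<in> borel_measurable borel" using h unfolding has_fourier_def by blast
  have "AE k in lborel. fourier_of u k = h k" by (rule has_fourier_unique[OF f h(1)])
  then have "integrable lborel (\<lambda>k. sob_weight s k * (cmod (fourier_of u k))\<^sup>2) = integrable lborel (\<lambda>k. sob_weight s k * (cmod (h k))\<^sup>2)"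
    by (intro integrable_cong_AE) auto
  then show "integrable lborel (\<lambda>k. sob_weight s k * (cmod (fourier_of u k))\<^sup>2)" using h(2) by simp
qed

text \<open>The multiplication formula: by Fubini, pairing \<open>v\<close> with
  \<open>fourier \<phi>\<close> is pairing \<open>fourier v\<close> with \<phi>. It will certify
  that the reflected solution belongs to H^m in time.\<close>

lemma regular_L1:
  fixes v :: "'a::euclidean_space \<Rightarrow> complex"
  assumes v: "integrable lborel v"
  shows "tempered (regular v)" "has_fourier (regular v) (fourier v)"
proof -
  have [measurable]: "v \<in> borel_measurable borel" using borel_measurable_integrable[OF v] by simp
  have vb: "integrable lborel (\<lambda>x. v x * \<phi> x) \<and> cmod (LINT x|lborel. v x * \<phi> x) \<le> C * (LINT x|lborel. cmod (v x))"
    if [measurable]: "\<phi> \<in> borel_measurable borel" and C: "\<And>x. cmod (\<phi> x) \<le> C" for C and \<phi> :: "'a \<Rightarrow> complex"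
  proof -
    have le: "cmod (v x * \<phi> x) \<le> C * cmod (v x)" for x
      using mult_left_mono[OF C[of x], of "cmod (v x)"] by (simp add: norm_mult mult.commute)
    have i: "integrable lborel (\<lambda>x. C * cmod (v x))" using v by simp
    have *: "integrable lborel (\<lambda>x. v x * \<phi> x)"
      by (rule Bochner_Integration.integrable_bound[OF i]) (use order_trans[OF le abs_ge_self] in auto)
    have "cmod (LINT x|lborel. v x * \<phi> x) \<le> (LINT x|lborel. C * cmod (v x))" by (rule norm_integral_le[OF * i le])
    then show ?thesis using * by simp
  qed
  have vS: "integrable lborel (\<lambda>x. v x * \<phi> x)" if \<phi>: "schwartz \<phi>" for \<phi>
  proof -
    obtain C where "\<forall>x. (1 + norm x) ^ 0 * cmod (\<phi> x) \<le> C" using schwartz_decay[OF \<phi>] by blast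
    then show ?thesis using vb[OF schwartz_measurable[OF \<phi>], of C] by simp
  qed
  show "tempered (regular v)"
    unfolding tempered_def
  proof (intro conjI allI impI)
    fix \<phi> \<psi> :: "'a \<Rightarrow> complex" and a b :: complex
    assume S: "schwartz \<phi>" "schwartz \<psi>"
    have "(LINT x|lborel. v x * (a * \<phi> x + b * \<psi> x)) = (LINT x|lborel. a * (v x * \<phi> x) + b * (v x * \<psi> x))"
      by (simp add: algebra_simps)
    then show "regular v (\<lambda>x. a * \<phi> x + b * \<psi> x) = a * regular v \<phi> + b * regular v \<psi>"
      unfolding regular_def
      by (simp only: Bochner_Integration.integral_add integrable_mult_right vS S integral_mult_right_zero)
  next
    show "\<exists>C N. \<forall>\<phi>. schwartz \<phi> \<longrightarrow> cmod (regular v \<phi>) \<le> C * schwartz_seminorm N \<phi>"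
    proof (intro exI allI impI)
      fix \<phi> :: "'a \<Rightarrow> complex" assume \<phi>: "schwartz \<phi>"
      have "cmod (\<phi> x) \<le> schwartz_seminorm 0 \<phi>" for x using schwartz_seminorm_upper[OF \<phi>, of "[]" 0 x] by simp
      then show "cmod (regular v \<phi>) \<le> (LINT x|lborel. cmod (v x)) * schwartz_seminorm 0 \<phi>"
        unfolding regular_def using vb[OF schwartz_measurable[OF \<phi>], of "schwartz_seminorm 0 \<phi>"] by (simp add: mult.commute)
    qed
  qed
  show "has_fourier (regular v) (fourier v)"
    unfolding has_fourier_def
  proof (intro conjI allI impI)
    show fm[measurable]: "fourier v \<in> borel_measurable borel" by (rule fourier_measurable) simp
    fix \<phi> :: "'a \<Rightarrow> complex" assume \<phi>: "schwartz \<phi>"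
    have [measurable]: "\<phi> \<in> borel_measurable borel" by (rule schwartz_measurable[OF \<phi>])
    let ?K = "\<lambda>x k. v x * (exp (- \<i> * complex_of_real (x \<bullet> k)) * \<phi> k)"
    have sw: "(LINT k|lborel. LINT x|lborel. ?K x k) = (LINT x|lborel. LINT k|lborel. ?K x k)"
      by (rule fubini_prod_bound(2)[where A = "\<lambda>x. cmod (v x)" and B = "\<lambda>k. cmod (\<phi> k)"])
         (use v schwartz_integrable[OF \<phi>] in \<open>auto simp: norm_mult\<close>)
    have e1: "(LINT k|lborel. ?K x k) = v x * fourier \<phi> x" for x
      unfolding fourier_def by (rule integral_mult_right_zero)
    have e2: "(LINT x|lborel. ?K x k) = fourier v k * \<phi> k" for k
    proof -
      have "(LINT x|lborel. ?K x k) = (LINT x|lborel. (exp (- \<i> * complex_of_real (k \<bullet> x)) * v x) * \<phi> k)"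
        by (simp add: inner_commute mult_ac)
      also have "\<dots> = fourier v k * \<phi> k" unfolding fourier_def by (rule integral_mult_left_zero)
      finally show ?thesis .
    qed
    show "regular v (fourier \<phi>) = (LINT k|lborel. fourier v k * \<phi> k)"
      unfolding regular_def using sw by (simp only: e1 e2)
    show "integrable lborel (\<lambda>k. fourier v k * \<phi> k)"
    proof (rule Bochner_Integration.integrable_bound[of _ "\<lambda>k. (LINT x|lborel. cmod (v x)) * cmod (\<phi> k)"])
      show "integrable lborel (\<lambda>k. (LINT x|lborel. cmod (v x)) * cmod (\<phi> k))" using schwartz_integrable[OF \<phi>] by simp
      show "AE k in lborel. norm (fourier v k * \<phi> k) \<le> norm ((LINT x|lborel. cmod (v x)) * cmod (\<phi> k))"
        using fourier_bound[OF v] by (intro AE_I2) (auto simp: norm_mult intro!: mult_right_mono intro: order_trans[OF _ abs_ge_self])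
    qed simp
  qed
qed

section \<open>The Duhamel integral on the Fourier side\<close>

text \<open>Integrability need not be known beforehand, since the Bochner integral of a
  non-integrable function is 0; this allows absolute values to be taken inside before any finiteness
  is established.\<close>

lemma ennreal_norm_integral:
  fixes f :: "'a \<Rightarrow> 'b::{banach, second_countable_topology}"
  shows "ennreal (norm (integral\<^sup>L M f)) \<le> (\<integral>\<^sup>+x. ennreal (norm (f x)) \<partial>M)"
  by (cases "integrable M f") (auto simp: integral_norm_bound_ennreal not_integrable_integral_eq)

lemma ennreal_square: "x \<ge> 0 \<Longrightarrow> (ennreal x)\<^sup>2 = ennreal (x\<^sup>2)"
  by (simp add: ennreal_power)

lemma cmod_diff_square: "(cmod (a - b))\<^sup>2 \<le> 2 * (cmod a)\<^sup>2 + 2 * (cmod b)\<^sup>2"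
proof -
  have "(cmod (a - b))\<^sup>2 \<le> (cmod a + cmod b)\<^sup>2"
    by (intro power_mono norm_triangle_ineq4) auto
  also have "\<dots> \<le> 2 * (cmod a)\<^sup>2 + 2 * (cmod b)\<^sup>2"
    using sum_squares_bound[of "cmod a" "cmod b"] by (simp add: power2_sum)
  finally show ?thesis .
qed

lemma cmod_add_square: "(cmod (a + b))\<^sup>2 \<le> 2 * (cmod a)\<^sup>2 + 2 * (cmod b)\<^sup>2"
  using cmod_diff_square[of a "- b"] by simp

section \<open>A jointly measurable version of the transforms of the data\<close>

text \<open>The functions \<open>h t\<close> are unrelated choices for different t. Rounding t down
  to a grid gives functions measurable in (k,t), and uniform continuity makes them close to
  \<open>h t\<close> in weighted L^2 at a summable rate. Summability upgrades this to pointwise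
  convergence for almost every k, at every fixed t.\<close>

lemma joint_representative:
  fixes h :: "real \<Rightarrow> 'a::euclidean_space \<Rightarrow> complex"
  assumes T: "T > 0"
    and meas: "\<And>t. t \<in> {0..T} \<Longrightarrow> h t \<in> borel_measurable borel"
    and uc: "\<And>\<epsilon>. \<epsilon> > 0 \<Longrightarrow> \<exists>e>0. \<forall>t\<in>{0..T}. \<forall>t'\<in>{0..T}. \<bar>t - t'\<bar> < e \<longrightarrow>
       (\<integral>\<^sup>+k. ennreal (sob_weight s k * (cmod (h t k - h t' k))\<^sup>2) \<partial>lborel) \<le> ennreal \<epsilon>"
  obtains G :: "'a \<times> real \<Rightarrow> complex" where "G \<in> borel_measurable borel"
    "\<And>t. t \<in> {0..T} \<Longrightarrow> AE k in lborel. G (k, t) = h t k"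
proof -
  \<comment> \<open>The grid index runs over all integers in the measurability argument below, so
    grid points outside [0,T] need a measurable dummy value.\<close>
  define h' where "h' c = (if c \<in> {0..T} then h c else (\<lambda>k. 0))" for c
  have [measurable]: "h' c \<in> borel_measurable borel" for c using meas by (auto simp: h'_def)
  define P where "P \<epsilon> t t' \<longleftrightarrow> (\<integral>\<^sup>+k. ennreal (sob_weight s k * (cmod (h t k - h t' k))\<^sup>2) \<partial>lborel) \<le> ennreal \<epsilon>" for \<epsilon> t t'
  have "\<exists>m::nat. m > 0 \<and> (\<forall>t\<in>{0..T}. \<forall>t'\<in>{0..T}. \<bar>t - t'\<bar> \<le> T / real m \<longrightarrow> P ((1/2) ^ n) t t')" for n
  proof -
    obtain e where e: "e > 0" "\<forall>t\<in>{0..T}. \<forall>t'\<in>{0..T}. \<bar>t - t'\<bar> < e \<longrightarrow> P ((1/2) ^ n) t t'"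
      using uc[of "(1/2) ^ n"] unfolding P_def by auto
    obtain m :: nat where m: "T / e < real m" using reals_Archimedean2 by blast
    have "0 < T / e" using T e(1) by simp
    then have m0: "0 < real m" using m by linarith
    have Tm: "T / real m < e" using m m0 e(1) by (simp add: divide_less_eq mult.commute)
    show ?thesis
    proof (intro exI[of _ m] conjI ballI impI)
      show "m > 0" using m0 by simp
      fix t t' assume "t \<in> {0..T}" "t' \<in> {0..T}" "\<bar>t - t'\<bar> \<le> T / real m"
      then show "P ((1/2) ^ n) t t'" using e(2) Tm by auto
    qed
  qed
  then obtain m :: "nat \<Rightarrow> nat" where m: "\<And>n. m n > 0"
    "\<And>n t t'. t \<in> {0..T} \<Longrightarrow> t' \<in> {0..T} \<Longrightarrow> \<bar>t - t'\<bar> \<le> T / real (m n) \<Longrightarrow> P ((1/2) ^ n) t t'"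
    by metis
  define r where "r n t = T * of_int \<lfloor>t * real (m n) / T\<rfloor> / real (m n)" for n t
  have r: "r n t \<in> {0..T}" "\<bar>r n t - t\<bar> \<le> T / real (m n)" if t: "t \<in> {0..T}" for n t
  proof -
    define i :: real where "i = of_int \<lfloor>t * real (m n) / T\<rfloor>"
    have i: "i \<le> t * real (m n) / T" "t * real (m n) / T < i + 1" unfolding i_def by linarith+
    have "0 \<le> t * real (m n) / T" using t T by simp
    then have i0: "0 \<le> i" unfolding i_def by simp
    have p: "0 < real (m n)" using m(1)[of n] by simp
    have rn: "r n t = T * i / real (m n)" unfolding r_def i_def ..
    have "T * i \<le> t * real (m n)" using i(1) T by (simp add: field_simps)
    then have 1: "r n t \<le> t" unfolding rn using p by (simp add: divide_le_eq)
    have "t * real (m n) \<le> T * i + T" using i(2) T by (simp add: field_simps)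
    then have "t \<le> (T * i + T) / real (m n)" using p by (simp add: le_divide_eq)
    then have 2: "t \<le> r n t + T / real (m n)" unfolding rn by (simp add: add_divide_distrib)
    have 3: "0 \<le> r n t" unfolding rn using i0 T p by simp
    show "r n t \<in> {0..T}" "\<bar>r n t - t\<bar> \<le> T / real (m n)" using 1 2 3 t by auto
  qed
  \<comment> \<open>Only countably many functions \<open>h' c\<close> occur, one for each grid
    point, so joint measurability reduces to measurability of each of them in k alone.\<close>
  define F where "F n z = h' (r n (snd z)) (fst z)" for n and z :: "'a \<times> real"
  have [measurable]: "F n \<in> borel_measurable borel" for n
  proof -
    have "(\<lambda>z::'a \<times> real. h' (T * of_int \<lfloor>snd z * real (m n) / T\<rfloor> / real (m n)) (fst z)) \<in> borel_measurable (borel \<Otimes>\<^sub>M borel)"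
      by (rule measurable_compose_countable[where f = "\<lambda>i z. h' (T * of_int i / real (m n)) (fst z)" and g = "\<lambda>z. \<lfloor>snd z * real (m n) / T\<rfloor>"])
         measurable
    then show ?thesis unfolding F_def r_def by (simp add: borel_prod)
  qed
  have lim: "AE k in lborel. (\<lambda>n. F n (k, t)) \<longlonglongrightarrow> h t k" if t: "t \<in> {0..T}" for t
  proof -
    have [measurable]: "h t \<in> borel_measurable borel" by (rule meas[OF t])
    have Fn: "F n (k, t) = h (r n t) k" for n k using r(1)[OF t] by (simp add: F_def h'_def)
    have [measurable]: "h (r n t) \<in> borel_measurable borel" for n by (rule meas[OF r(1)[OF t]])
    let ?f = "\<lambda>n k. sob_weight s k * (cmod (h (r n t) k - h t k))\<^sup>2"
    have "(\<integral>\<^sup>+k. (\<Sum>n. ennreal (?f n k)) \<partial>lborel) = (\<Sum>n. \<integral>\<^sup>+k. ennreal (?f n k) \<partial>lborel)"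
      by (rule nn_integral_suminf) measurable
    also have "\<dots> \<le> (\<Sum>n. ennreal ((1/2) ^ n))"
    proof (intro suminf_le)
      show "(\<integral>\<^sup>+k. ennreal (?f n k) \<partial>lborel) \<le> ennreal ((1/2) ^ n)" for n
        using m(2)[OF r(1)[OF t] t r(2)[OF t], of n] unfolding P_def by simp
    qed auto
    also have "\<dots> < \<infinity>"
      by (subst suminf_ennreal2) (auto simp: summable_geometric)
    finally have "(\<integral>\<^sup>+k. (\<Sum>n. ennreal (?f n k)) \<partial>lborel) \<noteq> \<infinity>" by simp
    then have "AE k in lborel. (\<Sum>n. ennreal (?f n k)) \<noteq> \<infinity>" by (intro nn_integral_noteq_infinite) auto
    then show ?thesis
    proof eventually_elim
      case (elim k)
      then have "summable (\<lambda>n. ?f n k)" by (intro summable_suminf_not_top) auto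
      then have "(\<lambda>n. ?f n k) \<longlonglongrightarrow> 0" by (rule summable_LIMSEQ_zero)
      from tendsto_mult_left[OF this, of "1 / sob_weight s k"]
      have "(\<lambda>n. (cmod (h (r n t) k - h t k))\<^sup>2) \<longlonglongrightarrow> 0"
        using sob_weight_pos[of s k] by simp
      from tendsto_real_sqrt[OF this] have "(\<lambda>n. cmod (h (r n t) k - h t k)) \<longlonglongrightarrow> 0" by simp
      then have "(\<lambda>n. h (r n t) k - h t k) \<longlonglongrightarrow> 0" by (rule tendsto_norm_zero_cancel)
      then show ?case unfolding Fn by (simp add: LIM_zero_iff)
    qed
  qed
  \<comment> \<open>\<open>lim\<close> is total, so \<open>G\<close> is measurable everywhere; where
    the sequence diverges its value is arbitrary, which for each t in [0,T] concerns a null set of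
    k.\<close>
  define G where "G z = lim (\<lambda>n. F n z)" for z
  show thesis
  proof (rule that)
    show "G \<in> borel_measurable borel" unfolding G_def[abs_def] by (rule borel_measurable_lim_metric) measurable
    fix t assume "t \<in> {0..T}"
    from lim[OF this] show "AE k in lborel. G (k, t) = h t k"
      by eventually_elim (auto simp: G_def intro: limI)
  qed
qed

lemma sobolev_diff:
  assumes "u \<in> sobolev s" "v \<in> sobolev s"
  shows "has_fourier (\<lambda>\<phi>. u \<phi> - v \<phi>) (\<lambda>k. fourier_of u k - fourier_of v k)"
    "integrable lborel (\<lambda>k. sob_weight s k * (cmod (fourier_of u k - fourier_of v k))\<^sup>2)"
proof -
  note u = sobolevD[OF assms(1)] and v = sobolevD[OF assms(2)]
  have [measurable]: "fourier_of u \<in> borel_measurable borel" "fourier_of v \<in> borel_measurable borel" by (rule u v)+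
  show "has_fourier (\<lambda>\<phi>. u \<phi> - v \<phi>) (\<lambda>k. fourier_of u k - fourier_of v k)"
    unfolding has_fourier_def
  proof (intro conjI allI impI)
    fix \<phi> :: "'a \<Rightarrow> complex" assume \<phi>: "schwartz \<phi>"
    have i: "integrable lborel (\<lambda>k. fourier_of u k * \<phi> k)" "integrable lborel (\<lambda>k. fourier_of v k * \<phi> k)"
      and e: "u (fourier \<phi>) = (LINT k|lborel. fourier_of u k * \<phi> k)" "v (fourier \<phi>) = (LINT k|lborel. fourier_of v k * \<phi> k)"
      using u(1) v(1) \<phi> unfolding has_fourier_def by metis+
    show "integrable lborel (\<lambda>k. (fourier_of u k - fourier_of v k) * \<phi> k)" using i by (simp add: left_diff_distrib)
    show "u (fourier \<phi>) - v (fourier \<phi>) = (LINT k|lborel. (fourier_of u k - fourier_of v k) * \<phi> k)"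
      using i e by (simp add: left_diff_distrib)
  qed measurable
  show "integrable lborel (\<lambda>k. sob_weight s k * (cmod (fourier_of u k - fourier_of v k))\<^sup>2)"
  proof (rule Bochner_Integration.integrable_bound)
    show "integrable lborel (\<lambda>k. 2 * (sob_weight s k * (cmod (fourier_of u k))\<^sup>2) + 2 * (sob_weight s k * (cmod (fourier_of v k))\<^sup>2))"
      using u(2) v(2) by simp
    show "AE k in lborel. norm (sob_weight s k * (cmod (fourier_of u k - fourier_of v k))\<^sup>2) \<le>
       norm (2 * (sob_weight s k * (cmod (fourier_of u k))\<^sup>2) + 2 * (sob_weight s k * (cmod (fourier_of v k))\<^sup>2))"
    proof (rule AE_I2)
      fix k
      have "sob_weight s k * (cmod (fourier_of u k - fourier_of v k))\<^sup>2 \<le> sob_weight s k * (2 * (cmod (fourier_of u k))\<^sup>2 + 2 * (cmod (fourier_of v k))\<^sup>2)"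
        by (intro mult_left_mono cmod_diff_square) simp
      then show "norm (sob_weight s k * (cmod (fourier_of u k - fourier_of v k))\<^sup>2) \<le>
       norm (2 * (sob_weight s k * (cmod (fourier_of u k))\<^sup>2) + 2 * (sob_weight s k * (cmod (fourier_of v k))\<^sup>2))"
        by (simp add: algebra_simps)
    qed
  qed measurable
qed

text \<open>A squared distance: with squares, Minkowski's inequality is replaced by a triangle
  inequality with factor 2 that holds pointwise under the integral.\<close>

definition sob_dist :: "real \<Rightarrow> 'a::euclidean_space distribution \<Rightarrow> 'a distribution \<Rightarrow> real" where
  "sob_dist s u v = (LINT k|lborel. sob_weight s k * (cmod (fourier_of u k - fourier_of v k))\<^sup>2)"

lemma sob_dist_triangle:
  assumes "u \<in> sobolev s" "v \<in> sobolev s" "w \<in> sobolev s"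
  shows "sob_dist s u w \<le> 2 * sob_dist s u v + 2 * sob_dist s w v"
proof -
  have "sob_dist s u w \<le> (LINT k|lborel. 2 * (sob_weight s k * (cmod (fourier_of u k - fourier_of v k))\<^sup>2)
     + 2 * (sob_weight s k * (cmod (fourier_of w k - fourier_of v k))\<^sup>2))"
    unfolding sob_dist_def
  proof (rule integral_mono)
    fix k
    have "(cmod (fourier_of u k - fourier_of w k))\<^sup>2 \<le> 2 * (cmod (fourier_of u k - fourier_of v k))\<^sup>2 + 2 * (cmod (fourier_of w k - fourier_of v k))\<^sup>2"
      using cmod_diff_square[of "fourier_of u k - fourier_of v k" "fourier_of w k - fourier_of v k"] by simp
    from mult_left_mono[OF this, of "sob_weight s k"]
    show "sob_weight s k * (cmod (fourier_of u k - fourier_of w k))\<^sup>2 \<le> 2 * (sob_weight s k * (cmod (fourier_of u k - fourier_of v k))\<^sup>2)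
     + 2 * (sob_weight s k * (cmod (fourier_of w k - fourier_of v k))\<^sup>2)"
      by (simp add: algebra_simps)
  qed (intro sobolev_diff(2) Bochner_Integration.integrable_add integrable_mult_right assms)+
  also have "\<dots> = 2 * sob_dist s u v + 2 * sob_dist s w v"
    unfolding sob_dist_def using sobolev_diff(2) assms by (subst Bochner_Integration.integral_add) auto
  finally show ?thesis .
qed

lemma sobolev_norm_square_le:
  assumes "u \<in> sobolev s" "v \<in> sobolev s"
  shows "(sobolev_norm s u)\<^sup>2 \<le> 2 * sob_dist s u v + 2 * (sobolev_norm s v)\<^sup>2"
proof -
  note u = sobolevD[OF assms(1)] and v = sobolevD[OF assms(2)]
  have sq: "(sobolev_norm s x)\<^sup>2 = (LINT k|lborel. sob_weight s k * (cmod (fourier_of x k))\<^sup>2)" if "x \<in> sobolev s" for x :: "'a distribution"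
    unfolding sobolev_norm_eq[OF sobolevD(1)[OF that]] by (simp add: integral_nonneg_AE)
  have "(sobolev_norm s u)\<^sup>2 \<le> (LINT k|lborel. 2 * (sob_weight s k * (cmod (fourier_of u k - fourier_of v k))\<^sup>2)
     + 2 * (sob_weight s k * (cmod (fourier_of v k))\<^sup>2))"
    unfolding sq[OF assms(1)]
  proof (rule integral_mono)
    fix k
    have "(cmod (fourier_of u k))\<^sup>2 \<le> 2 * (cmod (fourier_of u k - fourier_of v k))\<^sup>2 + 2 * (cmod (fourier_of v k))\<^sup>2"
      using cmod_add_square[of "fourier_of u k - fourier_of v k" "fourier_of v k"] by simp
    from mult_left_mono[OF this, of "sob_weight s k"]
    show "sob_weight s k * (cmod (fourier_of u k))\<^sup>2 \<le> 2 * (sob_weight s k * (cmod (fourier_of u k - fourier_of v k))\<^sup>2)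
     + 2 * (sob_weight s k * (cmod (fourier_of v k))\<^sup>2)"
      by (simp add: algebra_simps)
  qed (intro sobolev_diff(2) Bochner_Integration.integrable_add integrable_mult_right assms u v)+
  also have "\<dots> = 2 * sob_dist s u v + 2 * (sobolev_norm s v)\<^sup>2"
    unfolding sq[OF assms(2)] sob_dist_def using sobolev_diff(2) u v assms by (subst Bochner_Integration.integral_add) auto
  finally show ?thesis .
qed

text \<open>\<open>continuous_sobolev\<close> is a condition at each single time, whereas
  \<open>joint_representative\<close> asks for uniformity. The balls obtained at each time cover the
  compact interval, and a Lebesgue number of this covering is a modulus of continuity.\<close>

lemma continuous_sobolev_uniform:
  assumes F: "continuous_sobolev T s F" and \<epsilon>: "\<epsilon> > 0"
  shows "\<exists>e>0. \<forall>t\<in>{0..T}. \<forall>t'\<in>{0..T}. \<bar>t - t'\<bar> < e \<longrightarrow> sob_dist s (F t) (F t') \<le> \<epsilon>"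
proof -
  have S: "F t \<in> sobolev s" if "t \<in> {0..T}" for t using F that unfolding continuous_sobolev_def by blast
  have nd: "sobolev_norm s (\<lambda>\<phi>. F \<tau> \<phi> - F t \<phi>) = sqrt (sob_dist s (F \<tau>) (F t))" if "\<tau> \<in> {0..T}" "t \<in> {0..T}" for \<tau> t
    unfolding sob_dist_def by (rule sobolev_norm_eq[OF sobolev_diff(1)[OF S[OF that(1)] S[OF that(2)]]])
  \<comment> \<open>The triangle inequality through the centre of a ball costs twice \<epsilon>/4
    for each of the two points, hence the quarter.\<close>
  have "\<exists>d>0. \<forall>\<tau>\<in>{0..T}. \<bar>\<tau> - t\<bar> < d \<longrightarrow> sob_dist s (F \<tau>) (F t) \<le> \<epsilon> / 4" if t: "t \<in> {0..T}" for t
  proof -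
    have "((\<lambda>\<tau>. sobolev_norm s (\<lambda>\<phi>. F \<tau> \<phi> - F t \<phi>)) \<longlongrightarrow> 0) (at t within {0..T})"
      using F t unfolding continuous_sobolev_def by blast
    then obtain d where d: "d > 0" "\<And>\<tau>. \<tau> \<in> {0..T} \<Longrightarrow> 0 < dist \<tau> t \<Longrightarrow> dist \<tau> t < d \<Longrightarrow> dist (sobolev_norm s (\<lambda>\<phi>. F \<tau> \<phi> - F t \<phi>)) 0 < sqrt (\<epsilon> / 4)"
      unfolding Lim_within using \<epsilon> by (metis real_sqrt_gt_zero zero_less_divide_iff zero_less_numeral)
    have "sob_dist s (F \<tau>) (F t) \<le> \<epsilon> / 4" if \<tau>: "\<tau> \<in> {0..T}" "\<bar>\<tau> - t\<bar> < d" for \<tau>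
    proof (cases "\<tau> = t")
      case True then show ?thesis using \<epsilon> by (simp add: sob_dist_def)
    next
      case False
      then have "\<bar>sqrt (sob_dist s (F \<tau>) (F t))\<bar> < sqrt (\<epsilon> / 4)"
        using d(2)[OF \<tau>(1)] \<tau>(2) unfolding nd[OF \<tau>(1) t] by (simp only: dist_real_def diff_0_right)
      then have "sqrt (sob_dist s (F \<tau>) (F t)) < sqrt (\<epsilon> / 4)" by (rule order.strict_trans1[OF abs_ge_self])
      then show ?thesis by simp
    qed
    then show ?thesis using d(1) by blast
  qed
  then obtain d where d: "\<And>t. t \<in> {0..T} \<Longrightarrow> d t > 0"
    "\<And>t \<tau>. t \<in> {0..T} \<Longrightarrow> \<tau> \<in> {0..T} \<Longrightarrow> \<bar>\<tau> - t\<bar> < d t \<Longrightarrow> sob_dist s (F \<tau>) (F t) \<le> \<epsilon> / 4"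
    by metis
  have cov: "{0..T} \<subseteq> \<Union>((\<lambda>t. ball t (d t)) ` {0..T})" using d(1) by force
  have op: "\<And>B. B \<in> (\<lambda>t. ball t (d t)) ` {0..T} \<Longrightarrow> open B" by auto
  then obtain e where e: "e > 0" "\<And>x. x \<in> {0..T} \<Longrightarrow> \<exists>B\<in>(\<lambda>t. ball t (d t)) ` {0..T}. ball x e \<subseteq> B"
    using Heine_Borel_lemma[OF compact_Icc cov op] by blast
  show ?thesis
  proof (intro exI[of _ e] conjI e(1) ballI impI)
    fix t t' assume t: "t \<in> {0..T}" "t' \<in> {0..T}" "\<bar>t - t'\<bar> < e"
    obtain c where c: "c \<in> {0..T}" "ball t e \<subseteq> ball c (d c)" using e(2)[OF t(1)] by auto
    have "t \<in> ball t e" "t' \<in> ball t e" using t(3) e(1) by (auto simp: dist_real_def)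
    then have "\<bar>t - c\<bar> < d c" "\<bar>t' - c\<bar> < d c" using c(2) by (auto simp: dist_real_def abs_minus_commute dest!: subsetD)
    then have "sob_dist s (F t) (F c) \<le> \<epsilon> / 4" "sob_dist s (F t') (F c) \<le> \<epsilon> / 4"
      using d(2)[OF c(1)] t by auto
    then show "sob_dist s (F t) (F t') \<le> \<epsilon>"
      using sob_dist_triangle[OF S[OF t(1)] S[OF c(1)] S[OF t(2)]] by linarith
  qed
qed

lemma sobolev_norm_nonneg [simp]: "sobolev_norm s u \<ge> 0"
  unfolding sobolev_norm_def by (simp add: integral_nonneg_AE)

text \<open>Without boundedness the supremum on the right-hand side of both estimates would be an
  unspecified real number. A finite subcover by intervals of uniform closeness reduces the claim to
  finitely many times.\<close>

lemma continuous_sobolev_bounded: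
  assumes F: "continuous_sobolev T s F" and T: "0 < T"
  shows "bdd_above ((\<lambda>t. sobolev_norm s (F t)) ` {0..T})"
proof -
  have S: "F t \<in> sobolev s" if "t \<in> {0..T}" for t using F that unfolding continuous_sobolev_def by blast
  obtain e where e: "e > 0" "\<forall>t\<in>{0..T}. \<forall>t'\<in>{0..T}. \<bar>t - t'\<bar> < e \<longrightarrow> sob_dist s (F t) (F t') \<le> 1"
    using continuous_sobolev_uniform[OF F, of 1] by auto
  have "{0..T} \<subseteq> (\<Union>t\<in>{0..T}. ball t e)" using e(1) by force
  then obtain C where C: "C \<subseteq> {0..T}" "finite C" "{0..T} \<subseteq> (\<Union>t\<in>C. ball t e)"
    using compactE_image[OF compact_Icc, of "{0..T}" "\<lambda>t. ball t e" 0 T] by auto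
  have "(sobolev_norm s (F t))\<^sup>2 \<le> 2 + 2 * (\<Sum>c\<in>C. (sobolev_norm s (F c))\<^sup>2)" if t: "t \<in> {0..T}" for t
  proof -
    obtain c where c: "c \<in> C" "t \<in> ball c e" using C(3) t by auto
    then have "sob_dist s (F t) (F c) \<le> 1" using e(2) C(1) t by (auto simp: dist_real_def abs_minus_commute)
    moreover have "(sobolev_norm s (F t))\<^sup>2 \<le> 2 * sob_dist s (F t) (F c) + 2 * (sobolev_norm s (F c))\<^sup>2"
      using c C(1) t by (intro sobolev_norm_square_le S) auto
    moreover have "(sobolev_norm s (F c))\<^sup>2 \<le> (\<Sum>c\<in>C. (sobolev_norm s (F c))\<^sup>2)"
      using c C(2) by (intro member_le_sum) auto
    ultimately show ?thesis by linarith
  qed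
  then have "sobolev_norm s (F t) \<le> sqrt (2 + 2 * (\<Sum>c\<in>C. (sobolev_norm s (F c))\<^sup>2))" if "t \<in> {0..T}" for t
    using that by (intro real_le_rsqrt) auto
  then show ?thesis by (intro bdd_aboveI2) auto
qed

section \<open>The Duhamel integral in frequency variables and the first estimate\<close>

text \<open>\<open>G\<close> is the joint version of the transforms of \<open>F t\<close>, set to 0
  off [0,T] so that time integrals can run over the whole line. \<open>K\<close> is a bound for the
  norms in H^s, later their supremum; the bound is stated with a nonnegative integral, ready for
  Tonelli.\<close>

locale duhamel_data =
  fixes s T K :: real and F :: "real \<Rightarrow> (real \<times> real) distribution"
    and G :: "(real \<times> real) \<times> real \<Rightarrow> complex"
  assumes T0: "0 < T" and T1: "T < 1" and K0: "0 \<le> K"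
    and G_meas [measurable]: "G \<in> borel_measurable borel"
    and G_outside: "t \<notin> {0..T} \<Longrightarrow> G (k, t) = 0"
    and G_bound: "(\<integral>\<^sup>+k. ennreal (sob_weight s k * (cmod (G (k, t)))\<^sup>2) \<partial>lborel) \<le> ennreal (K\<^sup>2)"
    and F_meas: "t \<in> {0..T} \<Longrightarrow> fourier_of (F t) \<in> borel_measurable borel"
    and G_fourier: "t \<in> {0..T} \<Longrightarrow> AE k in lborel. G (k, t) = fourier_of (F t) k"

lemma duhamel_data_exists:
  assumes F: "continuous_sobolev T s F" and T: "0 < T" "T < 1"
  shows "\<exists>G. duhamel_data s T (SUP t\<in>{0..T}. sobolev_norm s (F t)) F G"
proof -
  let ?K = "SUP t\<in>{0..T}. sobolev_norm s (F t)"
  have S: "F t \<in> sobolev s" if "t \<in> {0..T}" for t using F that unfolding continuous_sobolev_def by blast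
  have le: "sobolev_norm s (F t) \<le> ?K" if "t \<in> {0..T}" for t
    using that continuous_sobolev_bounded[OF F T(1)] by (intro cSUP_upper) auto
  have K0: "0 \<le> ?K" using le[of 0] T sobolev_norm_nonneg[of s "F 0"] by (metis atLeastAtMost_iff less_eq_real_def order_trans)
  obtain G0 where G0[measurable]: "G0 \<in> borel_measurable borel"
    and AE: "\<And>t. t \<in> {0..T} \<Longrightarrow> AE k in lborel. G0 (k, t) = fourier_of (F t) k"
  proof (rule joint_representative[OF T(1), of "\<lambda>t. fourier_of (F t)" s])
    show "fourier_of (F t) \<in> borel_measurable borel" if "t \<in> {0..T}" for t by (rule sobolevD[OF S[OF that]])
    fix \<epsilon> :: real assume "\<epsilon> > 0"
    then obtain e where e: "e > 0" "\<forall>t\<in>{0..T}. \<forall>t'\<in>{0..T}. \<bar>t - t'\<bar> < e \<longrightarrow> sob_dist s (F t) (F t') \<le> \<epsilon>"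
      using continuous_sobolev_uniform[OF F] by blast
    show "\<exists>e>0. \<forall>t\<in>{0..T}. \<forall>t'\<in>{0..T}. \<bar>t - t'\<bar> < e \<longrightarrow>
       (\<integral>\<^sup>+k. ennreal (sob_weight s k * (cmod (fourier_of (F t) k - fourier_of (F t') k))\<^sup>2) \<partial>lborel) \<le> ennreal \<epsilon>"
    proof (intro exI[of _ e] conjI e(1) ballI impI)
      fix t t' assume t: "t \<in> {0..T}" "t' \<in> {0..T}" "\<bar>t - t'\<bar> < e"
      have "(\<integral>\<^sup>+k. ennreal (sob_weight s k * (cmod (fourier_of (F t) k - fourier_of (F t') k))\<^sup>2) \<partial>lborel) = ennreal (sob_dist s (F t) (F t'))"
        unfolding sob_dist_def by (intro nn_integral_eq_integral sobolev_diff S t) auto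
      then show "(\<integral>\<^sup>+k. ennreal (sob_weight s k * (cmod (fourier_of (F t) k - fourier_of (F t') k))\<^sup>2) \<partial>lborel) \<le> ennreal \<epsilon>"
        using e(2) t by (simp add: ennreal_leI)
    qed
  qed blast
  define G where "G z = (if snd z \<in> {0..T} then G0 z else 0)" for z
  have Gm: "G \<in> borel_measurable borel"
    unfolding G_def[abs_def]
  proof (rule measurable_If)
    have "{z \<in> space borel. snd z \<in> {0..T}} = (UNIV :: (real \<times> real) set) \<times> {0..T}" by auto
    then show "{z \<in> space borel. snd (z :: (real \<times> real) \<times> real) \<in> {0..T}} \<in> sets borel"
      by (simp add: borel_closed closed_Times)
  qed (use G0 in simp_all)
  have AEG: "AE k in lborel. G (k, t) = fourier_of (F t) k" if "t \<in> {0..T}" for t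
    using AE[OF that] that by (simp add: G_def)
  have "(\<integral>\<^sup>+k. ennreal (sob_weight s k * (cmod (G (k, t)))\<^sup>2) \<partial>lborel) \<le> ennreal (?K\<^sup>2)" for t
  proof (cases "t \<in> {0..T}")
    case True
    have "(\<integral>\<^sup>+k. ennreal (sob_weight s k * (cmod (G (k, t)))\<^sup>2) \<partial>lborel) = (\<integral>\<^sup>+k. ennreal (sob_weight s k * (cmod (fourier_of (F t) k))\<^sup>2) \<partial>lborel)"
      by (rule nn_integral_cong_AE) (use AEG[OF True] in \<open>auto elim: eventually_mono\<close>)
    also have "\<dots> = ennreal (LINT k|lborel. sob_weight s k * (cmod (fourier_of (F t) k))\<^sup>2)"
      by (intro nn_integral_eq_integral sobolevD S True) auto
    also have "\<dots> = ennreal ((sobolev_norm s (F t))\<^sup>2)"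
      unfolding sobolev_norm_eq[OF sobolevD(1)[OF S[OF True]]] by (simp add: integral_nonneg_AE)
    also have "\<dots> \<le> ennreal (?K\<^sup>2)"
      by (intro ennreal_leI power_mono le True) simp
    finally show ?thesis .
  qed (auto simp: G_def)
  then have "duhamel_data s T ?K F G"
    using T K0 Gm AEG sobolevD(3)[OF S] by unfold_locales (auto simp: G_def)
  then show ?thesis by blast
qed

lemma integrable_pair_nn:
  fixes f :: "'a::euclidean_space \<Rightarrow> 'b::euclidean_space \<Rightarrow> complex"
  assumes [measurable]: "case_prod f \<in> borel_measurable (borel \<Otimes>\<^sub>M borel)"
    and fin: "(\<integral>\<^sup>+y. \<integral>\<^sup>+x. ennreal (cmod (f x y)) \<partial>lborel \<partial>lborel) < \<infinity>"
  shows "integrable (lborel \<Otimes>\<^sub>M lborel) (case_prod f)"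
proof (rule integrableI_bounded)
  have "(\<integral>\<^sup>+y. \<integral>\<^sup>+x. ennreal (cmod (case_prod f (x, y))) \<partial>lborel \<partial>lborel) = (\<integral>\<^sup>+z. ennreal (cmod (case_prod f z)) \<partial>(lborel \<Otimes>\<^sub>M lborel))"
    by (rule lborel_pair.nn_integral_snd) measurable
  then show "(\<integral>\<^sup>+z. ennreal (norm (case_prod f z)) \<partial>(lborel \<Otimes>\<^sub>M lborel)) < \<infinity>" using fin by simp
qed measurable

lemma weight_decay_square_integrable:
  fixes \<kappa> :: "'a::euclidean_space \<Rightarrow> complex"
  assumes [measurable]: "\<kappa> \<in> borel_measurable borel"
    and \<kappa>: "\<And>k. (1 + norm k) ^ (DIM('a) + nat \<lceil>\<bar>r\<bar>\<rceil>) * cmod (\<kappa> k) \<le> C"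
  shows "integrable lborel (\<lambda>k. sob_weight r k * (cmod (\<kappa> k))\<^sup>2)"
proof -
  have "integrable lborel (\<lambda>k. complex_of_real (sob_weight r k * (cmod (\<kappa> k))\<^sup>2))"
  proof (rule integrable_decay(1))
    fix k :: 'a
    let ?N = "nat \<lceil>\<bar>r\<bar>\<rceil>"
    have "sob_weight r k * (cmod (\<kappa> k))\<^sup>2 \<le> (1 + norm k) ^ (2 * ?N) * (cmod (\<kappa> k))\<^sup>2"
      by (intro mult_right_mono sob_weight_le_power) auto
    then have "(1 + norm k) ^ (2 * DIM('a)) * (sob_weight r k * (cmod (\<kappa> k))\<^sup>2) \<le> (1 + norm k) ^ (2 * DIM('a)) * ((1 + norm k) ^ (2 * ?N) * (cmod (\<kappa> k))\<^sup>2)"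
      by (intro mult_left_mono) auto
    also have "\<dots> = ((1 + norm k) ^ (DIM('a) + ?N) * cmod (\<kappa> k))\<^sup>2"
      by (simp add: power_mult_distrib power_add power_mult[symmetric] mult_ac)
    also have "\<dots> \<le> C\<^sup>2" by (intro power_mono \<kappa>) auto
    finally show "(1 + norm k) ^ (2 * DIM('a)) * cmod (complex_of_real (sob_weight r k * (cmod (\<kappa> k))\<^sup>2)) \<le> C\<^sup>2"
      by (simp add: norm_mult norm_power)
  qed measurable
  from integrable_Re[OF this] show ?thesis by simp
qed

lemma fourier_weight_integrable:
  fixes \<phi> :: "'a::euclidean_space \<Rightarrow> complex"
  assumes \<phi>: "schwartz \<phi>"
  shows "integrable lborel (\<lambda>k. sob_weight r k * (cmod (fourier \<phi> (- k)))\<^sup>2)"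
proof -
  have [measurable]: "fourier \<phi> \<in> borel_measurable borel" by (intro fourier_measurable schwartz_measurable \<phi>)
  obtain C where "\<forall>k. (1 + norm k) ^ (DIM('a) + nat \<lceil>\<bar>r\<bar>\<rceil>) * cmod (fourier \<phi> k) \<le> C" using fourier_decay1[OF \<phi>] by blast
  then have "(1 + norm k) ^ (DIM('a) + nat \<lceil>\<bar>r\<bar>\<rceil>) * cmod (fourier \<phi> (- k)) \<le> C" for k by (metis norm_minus_cancel)
  from weight_decay_square_integrable[OF _ this] show ?thesis by simp
qed

lemma tempered_cong:
  assumes "\<And>\<phi>. schwartz \<phi> \<Longrightarrow> u \<phi> = v \<phi>"
  shows "tempered u = tempered v"
  unfolding tempered_def using assms by (simp add: schwartz_lincomb)

lemma has_fourier_cong: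
  assumes "\<And>\<phi>. schwartz \<phi> \<Longrightarrow> u \<phi> = v \<phi>"
  shows "has_fourier u h = has_fourier v h"
  unfolding has_fourier_def using assms by (simp add: fourier_schwartz)

context duhamel_data
begin

definition duh :: "real \<times> real \<Rightarrow> real \<Rightarrow> complex" where
  "duh k t = - \<i> * (LINT t'|lborel. (if 0 \<le> t' \<and> t' \<le> t then exp (- \<i> * complex_of_real ((norm k)\<^sup>2 * (t - t'))) * G (k, t') else 0))"

lemma duh_measurable [measurable]: "(\<lambda>z. duh (fst z) (snd z)) \<in> borel_measurable borel"
proof -
  have "(\<lambda>z. duh (fst z) (snd z)) \<in> borel_measurable (borel \<Otimes>\<^sub>M borel)"
    unfolding duh_def by measurable
  then show ?thesis by (simp add: borel_prod)
qed

lemma duh_measurable_fst [measurable]: "(\<lambda>k. duh k t) \<in> borel_measurable borel"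
  using measurable_compose[OF _ duh_measurable, of "\<lambda>k. (k, t)" borel] by simp

lemma duh_pairing:
  assumes [measurable]: "\<kappa> \<in> borel_measurable borel"
    and \<kappa>: "integrable lborel (\<lambda>k. sob_weight (- s) k * (cmod (\<kappa> k))\<^sup>2)"
  shows "integrable lborel (\<lambda>k. duh k t * \<kappa> k)"
    and "- \<i> * (LINT t':{0..t}|lborel. LINT k|lborel. exp (- \<i> * complex_of_real ((norm k)\<^sup>2 * (t - t'))) * G (k, t') * \<kappa> k)
      = (LINT k|lborel. duh k t * \<kappa> k)"
proof -
  let ?e = "\<lambda>k t'. exp (- \<i> * complex_of_real ((norm k)\<^sup>2 * (t - t')))"
  define f where "f k t' = (if 0 \<le> t' \<and> t' \<le> t then ?e k t' * G (k, t') else 0) * \<kappa> k" for k t'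
  have [measurable]: "case_prod f \<in> borel_measurable (borel \<Otimes>\<^sub>M borel)"
    unfolding f_def[abs_def] case_prod_beta' by measurable
  let ?X = "LINT k|lborel. sob_weight (- s) k * (cmod (\<kappa> k))\<^sup>2"
  have X: "(\<integral>\<^sup>+k. ennreal (sob_weight (- s) k * (cmod (\<kappa> k))\<^sup>2) \<partial>lborel) = ennreal ?X"
    by (intro nn_integral_eq_integral \<kappa>) auto
  have b: "(\<integral>\<^sup>+k. ennreal (cmod (f k t')) \<partial>lborel) \<le> indicator {0..T} t' * (ennreal (K\<^sup>2) + ennreal ?X)" for t'
  proof (cases "t' \<in> {0..T}")
    case True
    have "(\<integral>\<^sup>+k. ennreal (cmod (f k t')) \<partial>lborel) \<le>
       (\<integral>\<^sup>+k. ennreal (sob_weight s k * (cmod (G (k, t')))\<^sup>2) + ennreal (sob_weight (- s) k * (cmod (\<kappa> k))\<^sup>2) \<partial>lborel)"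
    proof (rule nn_integral_mono)
      fix k
      have "cmod (f k t') \<le> cmod (G (k, t')) * cmod (\<kappa> k)" by (simp add: f_def norm_mult)
      also have "\<dots> \<le> sob_weight s k * (cmod (G (k, t')))\<^sup>2 + (cmod (\<kappa> k))\<^sup>2 / sob_weight s k"
        by (rule amgm_weight[OF sob_weight_pos])
      finally have "cmod (f k t') \<le> sob_weight s k * (cmod (G (k, t')))\<^sup>2 + sob_weight (- s) k * (cmod (\<kappa> k))\<^sup>2"
        by (simp add: sob_weight_minus)
      then have "ennreal (cmod (f k t')) \<le> ennreal (sob_weight s k * (cmod (G (k, t')))\<^sup>2 + sob_weight (- s) k * (cmod (\<kappa> k))\<^sup>2)"
        by (rule ennreal_leI)
      also have "\<dots> = ennreal (sob_weight s k * (cmod (G (k, t')))\<^sup>2) + ennreal (sob_weight (- s) k * (cmod (\<kappa> k))\<^sup>2)"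
        by (rule ennreal_plus) auto
      finally show "ennreal (cmod (f k t')) \<le> ennreal (sob_weight s k * (cmod (G (k, t')))\<^sup>2) + ennreal (sob_weight (- s) k * (cmod (\<kappa> k))\<^sup>2)" .
    qed
    also have "\<dots> = (\<integral>\<^sup>+k. ennreal (sob_weight s k * (cmod (G (k, t')))\<^sup>2) \<partial>lborel) + ennreal ?X"
      unfolding X[symmetric] by (rule nn_integral_add) measurable
    also have "\<dots> \<le> ennreal (K\<^sup>2) + ennreal ?X" by (intro add_mono G_bound order_refl)
    finally show ?thesis using True by simp
  next
    case False
    then have "f k t' = 0" for k unfolding f_def using G_outside by simp
    then show ?thesis by simp
  qed
  have "(\<integral>\<^sup>+t'. \<integral>\<^sup>+k. ennreal (cmod (f k t')) \<partial>lborel \<partial>lborel) \<le> (\<integral>\<^sup>+t'. indicator {0..T} t' * (ennreal (K\<^sup>2) + ennreal ?X) \<partial>lborel)"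
    by (intro nn_integral_mono b)
  also have "\<dots> = ennreal T * (ennreal (K\<^sup>2) + ennreal ?X)"
    using T0 by (subst nn_integral_multc) auto
  also have "\<dots> < \<infinity>" by (simp add: ennreal_mult_less_top)
  finally have I: "integrable (lborel \<Otimes>\<^sub>M lborel) (case_prod f)" by (intro integrable_pair_nn) auto
  have d: "duh k t * \<kappa> k = - \<i> * (LINT t'|lborel. f k t')" for k
    unfolding duh_def f_def by (simp only: integral_mult_left_zero mult.assoc)
  have "integrable lborel (\<lambda>k. LINT t'|lborel. f k t')"
    by (rule lborel_pair.integrable_fst[OF I])
  then show "integrable lborel (\<lambda>k. duh k t * \<kappa> k)" unfolding d by (rule integrable_mult_right)
  have "(LINT t':{0..t}|lborel. LINT k|lborel. ?e k t' * G (k, t') * \<kappa> k) = (LINT t'|lborel. LINT k|lborel. f k t')"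
    unfolding set_lebesgue_integral_def f_def
    by (intro Bochner_Integration.integral_cong refl) (auto simp: indicator_def)
  also have "\<dots> = (LINT k|lborel. LINT t'|lborel. f k t')"
    by (rule lborel_pair.Fubini_integral[OF I])
  finally show "- \<i> * (LINT t':{0..t}|lborel. LINT k|lborel. ?e k t' * G (k, t') * \<kappa> k) = (LINT k|lborel. duh k t * \<kappa> k)"
    unfolding d by (simp only: integral_mult_right_zero)
qed

text \<open>\<open>fourier_of (F t')\<close> is replaced by \<open>G\<close> for each t' separately,
  which is possible because \<open>duhamel\<close> integrates over k first. The test function enters
  through \<kappa> alone, so products \<phi>(x1) \<psi>(x2) can be inserted without showing that
  they are Schwartz functions.\<close>

lemma duhamel_eq:
  assumes t: "t \<in> {0..T}" and m[measurable]: "\<kappa> \<in> borel_measurable borel"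
    and \<kappa>: "integrable lborel (\<lambda>k. sob_weight (- s) k * (cmod (\<kappa> k))\<^sup>2)"
    and eq: "\<And>k. (LINT x|lborel. exp (\<i> * complex_of_real (k \<bullet> x)) * \<phi> x) = \<kappa> k"
  shows "duhamel F t \<phi> = (LINT k|lborel. duh k t * \<kappa> k) / complex_of_real ((2 * pi)\<^sup>2)"
proof -
  have "(LINT t':{0..t}|lborel. LINT k|lborel. exp (- \<i> * complex_of_real ((norm k)\<^sup>2 * (t - t'))) * fourier_of (F t') k * \<kappa> k)
    = (LINT t':{0..t}|lborel. LINT k|lborel. exp (- \<i> * complex_of_real ((norm k)\<^sup>2 * (t - t'))) * G (k, t') * \<kappa> k)"
  proof (rule set_lebesgue_integral_cong, simp, intro allI impI)
    fix t' assume "t' \<in> {0..t}"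
    then have t': "t' \<in> {0..T}" using t by auto
    note [measurable] = F_meas[OF t']
    show "(LINT k|lborel. exp (- \<i> * complex_of_real ((norm k)\<^sup>2 * (t - t'))) * fourier_of (F t') k * \<kappa> k) =
      (LINT k|lborel. exp (- \<i> * complex_of_real ((norm k)\<^sup>2 * (t - t'))) * G (k, t') * \<kappa> k)"
      by (rule integral_cong_AE) (use G_fourier[OF t'] in \<open>auto elim: eventually_mono\<close>)
  qed
  then show ?thesis
    unfolding duhamel_def eq duh_pairing(2)[OF m \<kappa>, symmetric] by simp
qed

lemma duhamel_inverse_fourier:
  assumes t: "t \<in> {0..T}" and \<phi>: "schwartz \<phi>"
  shows "duhamel F t \<phi> = inverse_fourier (\<lambda>k. duh k t) \<phi>"
proof -
  have [measurable]: "fourier \<phi> \<in> borel_measurable borel" by (intro fourier_measurable schwartz_measurable \<phi>)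
  have "duhamel F t \<phi> = (LINT k|lborel. duh k t * fourier \<phi> (- k)) / complex_of_real ((2 * pi)\<^sup>2)"
  proof (rule duhamel_eq[OF t _ fourier_weight_integrable[OF \<phi>]])
    show "(LINT x|lborel. exp (\<i> * complex_of_real (k \<bullet> x)) * \<phi> x) = fourier \<phi> (- k)" for k
      by (simp add: fourier_def)
  qed measurable
  then show ?thesis unfolding inverse_fourier_def by (simp add: power2_eq_square)
qed

lemma duh_pointwise:
  assumes "t \<ge> 0"
  shows "ennreal ((cmod (duh k t))\<^sup>2) \<le> ennreal t * (\<integral>\<^sup>+t'. indicator {0..t} t' * ennreal ((cmod (G (k, t')))\<^sup>2) \<partial>lborel)"
proof -
  have [measurable]: "(\<lambda>t'. G (k, t')) \<in> borel_measurable borel"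
    using measurable_compose[OF _ G_meas, of "\<lambda>t'. (k, t')" borel] by simp
  have "ennreal (cmod (duh k t)) \<le> (\<integral>\<^sup>+t'. indicator {0..t} t' * ennreal (cmod (G (k, t'))) \<partial>lborel)"
    unfolding duh_def norm_mult
    by (simp, rule order_trans[OF ennreal_norm_integral])
       (auto intro!: nn_integral_mono simp: norm_mult indicator_def)
  then have "(ennreal (cmod (duh k t)))\<^sup>2 \<le> (\<integral>\<^sup>+t'. indicator {0..t} t' * ennreal (cmod (G (k, t'))) \<partial>lborel)\<^sup>2"
    by (intro power_mono) auto
  also have "\<dots> = (\<integral>\<^sup>+t'. indicator {0..t} t' * (indicator {0..t} t' * ennreal (cmod (G (k, t')))) \<partial>lborel)\<^sup>2"
    by (intro arg_cong[where f = "\<lambda>x. x\<^sup>2"] nn_integral_cong) (auto simp: indicator_def)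
  also have "\<dots> \<le> (\<integral>\<^sup>+t'. (indicator {0..t} t')\<^sup>2 \<partial>lborel) * (\<integral>\<^sup>+t'. (indicator {0..t} t' * ennreal (cmod (G (k, t'))))\<^sup>2 \<partial>lborel)"
    by (rule Cauchy_Schwarz_nn_integral) measurable
  also have "(\<integral>\<^sup>+t'. (indicator {0..t} t' :: ennreal)\<^sup>2 \<partial>lborel) = (\<integral>\<^sup>+t'. indicator {0..t} t' \<partial>lborel)"
    by (intro nn_integral_cong) (auto simp: indicator_def)
  also have "\<dots> = ennreal t" using assms by simp
  also have "(\<integral>\<^sup>+t'. (indicator {0..t} t' * ennreal (cmod (G (k, t'))))\<^sup>2 \<partial>lborel) = (\<integral>\<^sup>+t'. indicator {0..t} t' * ennreal ((cmod (G (k, t')))\<^sup>2) \<partial>lborel)"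
    by (intro nn_integral_cong) (auto simp: indicator_def ennreal_square)
  finally show ?thesis by (simp add: ennreal_square)
qed

text \<open>One factor t comes from the Cauchy-Schwarz inequality in t', the other from integrating
  the uniform bound on \<open>G\<close> over 0 <= t' <= t once the integrals are exchanged.\<close>

lemma duh_bound:
  assumes "t \<ge> 0"
  shows "(\<integral>\<^sup>+k. ennreal (sob_weight s k * (cmod (duh k t))\<^sup>2) \<partial>lborel) \<le> ennreal ((t * K)\<^sup>2)"
proof -
  have [measurable]: "(\<lambda>t'. G (k, t')) \<in> borel_measurable borel" for k
    using measurable_compose[OF _ G_meas, of "\<lambda>t'. (k, t')" borel] by simp
  have "(\<integral>\<^sup>+k. ennreal (sob_weight s k * (cmod (duh k t))\<^sup>2) \<partial>lborel) \<le>
    (\<integral>\<^sup>+k. ennreal t * (\<integral>\<^sup>+t'. indicator {0..t} t' * ennreal (sob_weight s k * (cmod (G (k, t')))\<^sup>2) \<partial>lborel) \<partial>lborel)"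
  proof (rule nn_integral_mono)
    fix k
    have "ennreal (sob_weight s k * (cmod (duh k t))\<^sup>2) = ennreal (sob_weight s k) * ennreal ((cmod (duh k t))\<^sup>2)"
      by (rule ennreal_mult) auto
    also have "\<dots> \<le> ennreal (sob_weight s k) * (ennreal t * (\<integral>\<^sup>+t'. indicator {0..t} t' * ennreal ((cmod (G (k, t')))\<^sup>2) \<partial>lborel))"
      by (intro mult_left_mono duh_pointwise assms) auto
    also have "\<dots> = ennreal t * (ennreal (sob_weight s k) * (\<integral>\<^sup>+t'. indicator {0..t} t' * ennreal ((cmod (G (k, t')))\<^sup>2) \<partial>lborel))"
      by (simp only: mult_ac)
    also have "ennreal (sob_weight s k) * (\<integral>\<^sup>+t'. indicator {0..t} t' * ennreal ((cmod (G (k, t')))\<^sup>2) \<partial>lborel) =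
      (\<integral>\<^sup>+t'. ennreal (sob_weight s k) * (indicator {0..t} t' * ennreal ((cmod (G (k, t')))\<^sup>2)) \<partial>lborel)"
      by (rule nn_integral_cmult[symmetric]) measurable
    also have "\<dots> = (\<integral>\<^sup>+t'. indicator {0..t} t' * ennreal (sob_weight s k * (cmod (G (k, t')))\<^sup>2) \<partial>lborel)"
      by (intro nn_integral_cong) (simp add: ennreal_mult mult_ac)
    finally show "ennreal (sob_weight s k * (cmod (duh k t))\<^sup>2) \<le> ennreal t * (\<integral>\<^sup>+t'. indicator {0..t} t' * ennreal (sob_weight s k * (cmod (G (k, t')))\<^sup>2) \<partial>lborel)" .
  qed
  also have "\<dots> = ennreal t * (\<integral>\<^sup>+k. (\<integral>\<^sup>+t'. indicator {0..t} t' * ennreal (sob_weight s k * (cmod (G (k, t')))\<^sup>2) \<partial>lborel) \<partial>lborel)"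
    by (rule nn_integral_cmult) measurable
  also have "(\<integral>\<^sup>+k. (\<integral>\<^sup>+t'. indicator {0..t} t' * ennreal (sob_weight s k * (cmod (G (k, t')))\<^sup>2) \<partial>lborel) \<partial>lborel)
    = (\<integral>\<^sup>+t'. (\<integral>\<^sup>+k. indicator {0..t} t' * ennreal (sob_weight s k * (cmod (G (k, t')))\<^sup>2) \<partial>lborel) \<partial>lborel)"
    by (rule lborel_pair.Fubini'[symmetric]) measurable
  also have "\<dots> \<le> (\<integral>\<^sup>+t'. indicator {0..t} t' * ennreal (K\<^sup>2) \<partial>lborel)"
    using G_bound by (intro nn_integral_mono) (auto simp: indicator_def)
  also have "\<dots> = ennreal t * ennreal (K\<^sup>2)" using assms by (subst nn_integral_multc) auto
  finally have "(\<integral>\<^sup>+k. ennreal (sob_weight s k * (cmod (duh k t))\<^sup>2) \<partial>lborel) \<le> ennreal t * (ennreal t * ennreal (K\<^sup>2))"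
    by (simp add: mult_left_mono)
  also have "\<dots> = ennreal ((t * K)\<^sup>2)"
    using assms K0 by (simp add: ennreal_mult[symmetric] power2_eq_square mult_ac)
  finally show ?thesis .
qed

lemma duh_weight_integrable:
  assumes "t \<ge> 0"
  shows "integrable lborel (\<lambda>k. sob_weight s k * (cmod (duh k t))\<^sup>2)"
    "(LINT k|lborel. sob_weight s k * (cmod (duh k t))\<^sup>2) \<le> (t * K)\<^sup>2"
proof -
  show *: "integrable lborel (\<lambda>k. sob_weight s k * (cmod (duh k t))\<^sup>2)"
    using duh_bound[OF assms] by (intro integrableI_nonneg) (auto simp: le_less_trans)
  have "ennreal (LINT k|lborel. sob_weight s k * (cmod (duh k t))\<^sup>2) \<le> ennreal ((t * K)\<^sup>2)"
    using duh_bound[OF assms] by (subst (asm) nn_integral_eq_integral[OF *]) auto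
  then show "(LINT k|lborel. sob_weight s k * (cmod (duh k t))\<^sup>2) \<le> (t * K)\<^sup>2" by (simp add: ennreal_le_iff)
qed

lemma duhamel_sobolev:
  assumes t: "t \<in> {0..T}"
  shows "has_fourier (duhamel F t) (\<lambda>k. duh k t)" "duhamel F t \<in> sobolev s" "sobolev_norm s (duhamel F t) \<le> T * K"
proof -
  have t0: "t \<ge> 0" using t by simp
  note i = duh_weight_integrable[OF t0]
  have "has_fourier (duhamel F t) (\<lambda>k. duh k t) = has_fourier (inverse_fourier (\<lambda>k. duh k t)) (\<lambda>k. duh k t)"
    by (rule has_fourier_cong) (rule duhamel_inverse_fourier[OF t])
  then show hf: "has_fourier (duhamel F t) (\<lambda>k. duh k t)"
    using has_fourier_inverse_fourier[OF duh_measurable_fst i(1)] by simp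
  have "tempered (duhamel F t) = tempered (inverse_fourier (\<lambda>k. duh k t))"
    by (rule tempered_cong) (rule duhamel_inverse_fourier[OF t])
  then have "tempered (duhamel F t)"
    using tempered_inverse_fourier[OF duh_measurable_fst i(1)] by simp
  then show "duhamel F t \<in> sobolev s" by (rule sobolevI[OF _ hf i(1)])
  have "sobolev_norm s (duhamel F t) \<le> sqrt ((t * K)\<^sup>2)"
    unfolding sobolev_norm_eq[OF hf] by (rule real_sqrt_le_mono[OF i(2)])
  also have "\<dots> = t * K" using t0 K0 by simp
  also have "\<dots> \<le> T * K" using t K0 by (intro mult_right_mono) auto
  finally show "sobolev_norm s (duhamel F t) \<le> T * K" .
qed

end

lemma duhamel_sobolev_estimate:
  assumes F: "continuous_sobolev T s F" and T: "0 < T" "T < 1"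
  shows "\<forall>t\<in>{0..T}. duhamel F t \<in> sobolev s"
    "bdd_above ((\<lambda>t. sobolev_norm s (duhamel F t)) ` {0..T})"
    "(SUP t\<in>{0..T}. sobolev_norm s (duhamel F t)) \<le> T * (SUP t\<in>{0..T}. sobolev_norm s (F t))"
proof -
  obtain G where "duhamel_data s T (SUP t\<in>{0..T}. sobolev_norm s (F t)) F G"
    using duhamel_data_exists[OF F T] by blast
  then interpret duhamel_data s T "SUP t\<in>{0..T}. sobolev_norm s (F t)" F G .
  show "\<forall>t\<in>{0..T}. duhamel F t \<in> sobolev s" using duhamel_sobolev(2) by blast
  show "bdd_above ((\<lambda>t. sobolev_norm s (duhamel F t)) ` {0..T})"
    using duhamel_sobolev(3) by (intro bdd_aboveI2) auto
  show "(SUP t\<in>{0..T}. sobolev_norm s (duhamel F t)) \<le> T * (SUP t\<in>{0..T}. sobolev_norm s (F t))"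
    using duhamel_sobolev(3) T by (intro cSUP_least) auto
qed

section \<open>Smoothing in time\<close>

lemma nn_integral_fatou_bound:
  assumes [measurable]: "\<And>n. u n \<in> borel_measurable M"
    and lim: "\<And>x. (\<lambda>n. u n x) \<longlonglongrightarrow> v x" and le: "\<And>n::nat. (\<integral>\<^sup>+x. u n x \<partial>M) \<le> (X::ennreal)"
  shows "(\<integral>\<^sup>+x. v x \<partial>M) \<le> X"
proof -
  have "v x = liminf (\<lambda>n. u n x)" for x using lim_imp_Liminf[OF _ lim] by simp
  then have "(\<integral>\<^sup>+x. v x \<partial>M) \<le> liminf (\<lambda>n. \<integral>\<^sup>+x. u n x \<partial>M)"
    using nn_integral_liminf[of u M] by simp
  also have "\<dots> \<le> liminf (\<lambda>n. X)" by (intro Liminf_mono always_eventually allI le)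
  finally show ?thesis by (simp add: Liminf_const)
qed

section \<open>Plancherel's inequality and Kato smoothing\<close>

lemma gauss_minus [simp]: "gauss (- x) = gauss x"
  by (simp add: gauss_def)

lemma gauss_nonneg [simp]: "0 \<le> gauss x"
  using gauss_pos less_imp_le by blast

lemma nn_integral_gauss_real: "(\<integral>\<^sup>+x. ennreal (gauss x) \<partial>(lborel :: real measure)) = ennreal (sqrt (2 * pi))"
proof -
  have "(\<integral>\<^sup>+x. ennreal (gauss x) \<partial>(lborel :: real measure)) = ennreal (LINT x::real|lborel. gauss x)"
    using integrable_gauss by (rule nn_integral_eq_integral) (simp add: gauss_pos less_imp_le)
  then show ?thesis by (simp add: integral_gauss)
qed

text \<open>The integrand is the Fourier transform of t -> gauss(\<delta> t), taken at the frequency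
  difference a - x. Its mass is the same for all \<delta>, so the constant in
  \<open>phase_plancherel\<close> survives the removal of the regularisation.\<close>

lemma gauss_kernel_mass:
  fixes a :: real
  assumes "\<delta> > 0"
  shows "(\<integral>\<^sup>+x. ennreal (sqrt (2 * pi) * gauss ((a - x) / \<delta>) / \<delta>) \<partial>lborel) = ennreal (2 * pi)"
proof -
  have "(\<integral>\<^sup>+x. ennreal (sqrt (2 * pi) * gauss ((a - x) / \<delta>) / \<delta>) \<partial>lborel) =
    \<bar>\<delta>\<bar> * (\<integral>\<^sup>+x. ennreal (sqrt (2 * pi) * gauss ((a - (a + \<delta> * x)) / \<delta>) / \<delta>) \<partial>lborel)"
    by (rule nn_integral_real_affine) (use assms in auto)
  also have "(\<integral>\<^sup>+x. ennreal (sqrt (2 * pi) * gauss ((a - (a + \<delta> * x)) / \<delta>) / \<delta>) \<partial>lborel)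
    = (\<integral>\<^sup>+x. ennreal (sqrt (2 * pi) / \<delta>) * ennreal (gauss x) \<partial>(lborel :: real measure))"
    by (intro nn_integral_cong) (use assms in \<open>simp add: ennreal_mult[symmetric]\<close>)
  also have "\<dots> = ennreal (sqrt (2 * pi) / \<delta>) * ennreal (sqrt (2 * pi))"
    by (subst nn_integral_cmult) (simp_all add: nn_integral_gauss_real)
  finally have "(\<integral>\<^sup>+x. ennreal (sqrt (2 * pi) * gauss ((a - x) / \<delta>) / \<delta>) \<partial>lborel) = ennreal \<delta> * (ennreal (sqrt (2 * pi) / \<delta>) * ennreal (sqrt (2 * pi)))"
    using assms by simp
  also have "\<dots> = ennreal (\<delta> * (sqrt (2 * pi) / \<delta> * sqrt (2 * pi)))"
    using assms by (simp add: ennreal_mult'[symmetric])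
  also have "\<delta> * (sqrt (2 * pi) / \<delta> * sqrt (2 * pi)) = sqrt (2 * pi) * sqrt (2 * pi)" using assms by simp
  also have "\<dots> = 2 * pi" by (rule real_sqrt_mult_self[THEN trans]) simp
  finally show ?thesis .
qed

lemma half_line_square_substitution:
  fixes f :: "real \<Rightarrow> ennreal"
  assumes [measurable]: "f \<in> borel_measurable borel"
  shows "(\<integral>\<^sup>+x. f (x\<^sup>2) * (2 * ennreal x) * indicator {0..} x \<partial>lborel) \<le> (\<integral>\<^sup>+x. f x \<partial>lborel)"
proof (rule nn_integral_fatou_bound[where u = "\<lambda>n x. f (x\<^sup>2) * ennreal (2 * x) * indicator {0..real (Suc n)} x"])
  fix n :: nat
  have "(\<integral>\<^sup>+x. f (x\<^sup>2) * ennreal (2 * x) * indicator {0..real (Suc n)} x \<partial>lborel) = (\<integral>\<^sup>+x. f x * indicator {0\<^sup>2..(real (Suc n))\<^sup>2} x \<partial>lborel)"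
    by (rule nn_integral_substitution_aux[symmetric]) (auto intro!: derivative_eq_intros continuous_intros)
  also have "\<dots> \<le> (\<integral>\<^sup>+x. f x \<partial>lborel)"
    by (intro nn_integral_mono) (auto simp: indicator_def)
  finally show "(\<integral>\<^sup>+x. f (x\<^sup>2) * ennreal (2 * x) * indicator {0..real (Suc n)} x \<partial>lborel) \<le> (\<integral>\<^sup>+x. f x \<partial>lborel)" .
next
  fix x :: real
  obtain N :: nat where N: "x \<le> real N" using real_arch_simple by blast
  have "eventually (\<lambda>n. f (x\<^sup>2) * ennreal (2 * x) * indicator {0..real (Suc n)} x = f (x\<^sup>2) * (2 * ennreal x) * indicator {0..} x) sequentially"
    using eventually_ge_at_top[of N] by eventually_elim (use N in \<open>auto simp: indicator_def ennreal_mult\<close>)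
  then show "(\<lambda>n. f (x\<^sup>2) * ennreal (2 * x) * indicator {0..real (Suc n)} x) \<longlonglongrightarrow> f (x\<^sup>2) * (2 * ennreal x) * indicator {0..} x"
    by (rule tendsto_eventually)
qed measurable

text \<open>Under \<tau> = x^2 one has d\<tau> = 2 |x| dx, so each of the two half lines contributes
  half of the integral of \<open>f\<close> over the positive axis.\<close>

lemma square_substitution:
  fixes f :: "real \<Rightarrow> ennreal"
  assumes [measurable]: "f \<in> borel_measurable borel"
  shows "(\<integral>\<^sup>+x. ennreal \<bar>x\<bar> * f (x\<^sup>2) \<partial>lborel) \<le> (\<integral>\<^sup>+x. f x \<partial>lborel)"
proof -
  let ?h = "\<lambda>x. f (x\<^sup>2) * (2 * ennreal x) * indicator {0..} x"
  have "2 * (\<integral>\<^sup>+x. ennreal \<bar>x\<bar> * f (x\<^sup>2) \<partial>lborel) = (\<integral>\<^sup>+x. 2 * (ennreal \<bar>x\<bar> * f (x\<^sup>2)) \<partial>lborel)"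
    by (rule nn_integral_cmult[symmetric]) measurable
  also have "\<dots> \<le> (\<integral>\<^sup>+x. ?h x + ?h (- x) \<partial>lborel)"
  proof (rule nn_integral_mono)
    fix x :: real
    show "2 * (ennreal \<bar>x\<bar> * f (x\<^sup>2)) \<le> ?h x + ?h (- x)"
      by (cases "x \<ge> 0") (auto simp: mult_ac indicator_def)
  qed
  also have "\<dots> = (\<integral>\<^sup>+x. ?h x \<partial>lborel) + (\<integral>\<^sup>+x. ?h (- x) \<partial>lborel)"
    by (rule nn_integral_add) measurable
  also have "(\<integral>\<^sup>+x. ?h (- x) \<partial>lborel) = (\<integral>\<^sup>+x. ?h x \<partial>lborel)"
    using nn_integral_real_affine[of ?h "-1" 0] by simp
  also have "(\<integral>\<^sup>+x. ?h x \<partial>lborel) + (\<integral>\<^sup>+x. ?h x \<partial>lborel) \<le> (\<integral>\<^sup>+x. f x \<partial>lborel) + (\<integral>\<^sup>+x. f x \<partial>lborel)"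
    by (intro add_mono half_line_square_substitution) auto
  also have "\<dots> = 2 * (\<integral>\<^sup>+x. f x \<partial>lborel)" by (simp add: mult_2)
  finally show ?thesis
    by (subst (asm) ennreal_mult_le_mult_iff) auto
qed

lemma cnj_measurable [measurable]: "cnj \<in> borel_measurable borel"
  by (intro borel_measurable_continuous_onI continuous_intros)

text \<open>Schur's test against a Gaussian regularisation in \<open>t\<close>: only the inequality in Plancherel's theorem is needed.\<close>

lemma phase_plancherel:
  fixes p w :: "real \<Rightarrow> real" and b :: "real \<Rightarrow> complex"
  assumes [measurable]: "p \<in> borel_measurable borel" "w \<in> borel_measurable borel"
    and b: "integrable lborel b"
    and w: "\<And>k. w k \<ge> 0" "\<And>k. b k \<noteq> 0 \<Longrightarrow> w k > 0"
    and C: "\<And>k \<delta>. \<delta> > 0 \<Longrightarrow> (\<integral>\<^sup>+k'. ennreal (w k' * (sqrt (2 * pi) * gauss ((p k - p k') / \<delta>) / \<delta>)) \<partial>lborel) \<le> ennreal C"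
  shows "(\<integral>\<^sup>+t. ennreal ((cmod (LINT k|lborel. exp (- \<i> * complex_of_real (p k * t)) * b k))\<^sup>2) \<partial>lborel)
    \<le> ennreal C * (\<integral>\<^sup>+k. ennreal ((cmod (b k))\<^sup>2 / w k) \<partial>lborel)" (is "?L \<le> ?R")
proof -
  have [measurable]: "b \<in> borel_measurable borel" using borel_measurable_integrable[OF b] by simp
  define B where "B t = (LINT k|lborel. exp (- \<i> * complex_of_real (p k * t)) * b k)" for t
  have [measurable]: "B \<in> borel_measurable borel" unfolding B_def[abs_def] by measurable
  have ie: "integrable lborel (\<lambda>k. exp (- \<i> * complex_of_real (p k * t)) * b k)" for t
    by (rule integrable_exp_mult[OF b]) measurable
  define I where "I = (LINT k|lborel. cmod (b k))"
  have Bb: "cmod (B t) \<le> I" for t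
    unfolding B_def I_def by (rule norm_integral_le[OF ie]) (use b in \<open>auto simp: norm_mult\<close>)
  have I0: "I \<ge> 0" using Bb[of 0] norm_ge_zero order_trans by blast
  define \<gamma> where "\<gamma> \<delta> x = sqrt (2 * pi) * gauss (x / \<delta>) / \<delta>" for \<delta> x :: real
  have [measurable]: "\<gamma> \<delta> \<in> borel_measurable borel" for \<delta> unfolding \<gamma>_def[abs_def] by measurable
  have \<gamma>0: "\<gamma> \<delta> x \<ge> 0" if "\<delta> > 0" for \<delta> x using that gauss_pos[of "x / \<delta>"] by (simp add: \<gamma>_def)
  define q where "q z = p (fst z) - p (snd z)" for z :: "real \<times> real"
  define \<beta> where "\<beta> z = b (fst z) * cnj (b (snd z))" for z :: "real \<times> real"
  have m2: "q \<in> borel_measurable (borel \<Otimes>\<^sub>M borel)" "\<beta> \<in> borel_measurable (borel \<Otimes>\<^sub>M borel)"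
    unfolding q_def[abs_def] \<beta>_def[abs_def] by measurable
  have [measurable]: "q \<in> borel_measurable borel" "\<beta> \<in> borel_measurable borel"
    using m2 by (simp_all only: borel_prod)
  have icnj: "integrable lborel (\<lambda>k. cmod (b k))" using b by simp
  have i\<beta>: "integrable lborel \<beta>"
  proof -
    have "integrable (lborel \<Otimes>\<^sub>M lborel) (case_prod (\<lambda>k k'. b k * cnj (b k')))"
      by (rule fubini_prod_bound(1)[OF _ icnj icnj]) (auto simp: norm_mult)
    then show ?thesis unfolding lborel_prod \<beta>_def[abs_def] by (simp add: case_prod_beta')
  qed
  \<comment> \<open>As one integral over pairs z of frequencies, the squared modulus can be
    integrated in t against a Gaussian, which produces a kernel in the phase difference
    \<open>q z\<close>.\<close>
  have sq: "complex_of_real ((cmod (B t))\<^sup>2) = (LINT z|lborel. exp (- \<i> * complex_of_real (q z * t)) * \<beta> z)" for t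
  proof -
    let ?K = "\<lambda>k k'. (exp (- \<i> * complex_of_real (p k * t)) * b k) * cnj (exp (- \<i> * complex_of_real (p k' * t)) * b k')"
    have iK: "integrable (lborel \<Otimes>\<^sub>M lborel) (case_prod ?K)"
      by (rule fubini_prod_bound(1)[OF _ icnj icnj]) (auto simp: norm_mult)
    have "complex_of_real ((cmod (B t))\<^sup>2) = B t * cnj (B t)" by (rule complex_norm_square)
    also have "cnj (B t) = (LINT k'|lborel. cnj (exp (- \<i> * complex_of_real (p k' * t)) * b k'))"
      unfolding B_def by (simp only: Bochner_Integration.integral_cnj)
    also have "B t * (LINT k'|lborel. cnj (exp (- \<i> * complex_of_real (p k' * t)) * b k')) = (LINT k|lborel. LINT k'|lborel. ?K k k')"
      unfolding B_def by (simp only: integral_mult_right_zero integral_mult_left_zero)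
    also have "\<dots> = integral\<^sup>L (lborel \<Otimes>\<^sub>M lborel) (case_prod ?K)"
      by (rule lborel_pair.integral_fst[OF iK])
    also have "case_prod ?K = (\<lambda>z. exp (- \<i> * complex_of_real (q z * t)) * \<beta> z)"
    proof
      fix z :: "real \<times> real"
      have "exp (- \<i> * complex_of_real (p (fst z) * t)) * cnj (exp (- \<i> * complex_of_real (p (snd z) * t))) = exp (- \<i> * complex_of_real (q z * t))"
        by (simp add: q_def exp_cnj exp_add[symmetric] algebra_simps)
      then show "case_prod ?K z = exp (- \<i> * complex_of_real (q z * t)) * \<beta> z"
        unfolding case_prod_beta' \<beta>_def complex_cnj_mult by (metis (no_types, lifting) mult.assoc mult.left_commute)
    qed
    finally show ?thesis by (simp add: lborel_prod)
  qed
  \<comment> \<open>The weight gauss(\<delta> t) makes the t-integral of the bounded function |B|^2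
    converge, and its transform is the nonnegative kernel \<gamma>; the bound obtained is free of
    \<delta>.\<close>
  have reg: "(\<integral>\<^sup>+t. ennreal (gauss (\<delta> * t) * (cmod (B t))\<^sup>2) \<partial>lborel) \<le> ?R" if \<delta>: "\<delta> > 0" for \<delta>
  proof -
    have ig: "integrable lborel (\<lambda>t. gauss (\<delta> * t))" using integrable_gauss_scale[of \<delta>, where 'a = real] \<delta> by simp
    have gB: "integrable lborel (\<lambda>t. gauss (\<delta> * t) * (cmod (B t))\<^sup>2)"
    proof (rule Bochner_Integration.integrable_bound[of _ "\<lambda>t. gauss (\<delta> * t) * I\<^sup>2"])
      show "integrable lborel (\<lambda>t. gauss (\<delta> * t) * I\<^sup>2)" using ig by simp
      show "AE t in lborel. norm (gauss (\<delta> * t) * (cmod (B t))\<^sup>2) \<le> norm (gauss (\<delta> * t) * I\<^sup>2)"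
        using Bb gauss_pos by (intro AE_I2) (auto simp: abs_mult less_imp_le intro!: mult_left_mono power_mono)
    qed measurable
    have "complex_of_real (LINT t|lborel. gauss (\<delta> * t) * (cmod (B t))\<^sup>2) =
       (LINT t|lborel. LINT z|lborel. complex_of_real (gauss (\<delta> * t)) * (exp (- \<i> * complex_of_real (q z * t)) * \<beta> z))"
      unfolding integral_mult_right_zero sq[symmetric] by (simp only: of_real_mult[symmetric] integral_complex_of_real)
    also have "\<dots> = (LINT z|lborel. LINT t|lborel. complex_of_real (gauss (\<delta> * t)) * (exp (- \<i> * complex_of_real (q z * t)) * \<beta> z))"
    proof (rule fubini_prod_bound(2)[symmetric, OF _ ig])
      show "integrable lborel (\<lambda>z. cmod (\<beta> z))" using i\<beta> by simp
    qed (auto simp: norm_mult)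
    also have "\<dots> = (LINT z|lborel. \<beta> z * complex_of_real (\<gamma> \<delta> (q z)))"
    proof (intro Bochner_Integration.integral_cong refl)
      fix z
      have "(LINT t|lborel. complex_of_real (gauss (\<delta> * t)) * (exp (- \<i> * complex_of_real (q z * t)) * \<beta> z))
        = (LINT t|lborel. \<beta> z * (exp (- \<i> * complex_of_real (q z \<bullet> t)) * complex_of_real (gauss (\<delta> *\<^sub>R t))))"
        by (simp add: mult_ac)
      also have "\<dots> = \<beta> z * fourier (\<lambda>t. complex_of_real (gauss (\<delta> *\<^sub>R t))) (q z)"
        unfolding fourier_def by (rule integral_mult_right_zero)
      also have "\<dots> = \<beta> z * complex_of_real (\<gamma> \<delta> (q z))"
        unfolding fourier_gauss_scale[OF \<delta>] \<gamma>_def by (simp add: divide_inverse mult_ac)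
      finally show "(LINT t|lborel. complex_of_real (gauss (\<delta> * t)) * (exp (- \<i> * complex_of_real (q z * t)) * \<beta> z)) = \<beta> z * complex_of_real (\<gamma> \<delta> (q z))" .
    qed
    finally have e: "complex_of_real (LINT t|lborel. gauss (\<delta> * t) * (cmod (B t))\<^sup>2) = (LINT z|lborel. \<beta> z * complex_of_real (\<gamma> \<delta> (q z)))" .
    have nn: "0 \<le> (LINT t|lborel. gauss (\<delta> * t) * (cmod (B t))\<^sup>2)"
      using gauss_pos by (intro integral_nonneg_AE AE_I2) (simp add: less_imp_le)
    have "(\<integral>\<^sup>+t. ennreal (gauss (\<delta> * t) * (cmod (B t))\<^sup>2) \<partial>lborel) = ennreal (LINT t|lborel. gauss (\<delta> * t) * (cmod (B t))\<^sup>2)"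
      using gB by (rule nn_integral_eq_integral) (use gauss_pos in \<open>simp add: less_imp_le\<close>)
    also have "\<dots> = ennreal (cmod (LINT z|lborel. \<beta> z * complex_of_real (\<gamma> \<delta> (q z))))"
      unfolding e[symmetric] using nn by simp
    also have "\<dots> \<le> (\<integral>\<^sup>+z. ennreal (cmod (\<beta> z * complex_of_real (\<gamma> \<delta> (q z)))) \<partial>lborel)"
      by (rule ennreal_norm_integral)
    also have "\<dots> = (\<integral>\<^sup>+z. ennreal (cmod (\<beta> z * complex_of_real (\<gamma> \<delta> (q z)))) \<partial>(lborel \<Otimes>\<^sub>M lborel))"
      by (simp add: lborel_prod)
    also have "\<dots> \<le> (\<integral>\<^sup>+z. ennreal (1/2) * (ennreal ((cmod (b (fst z)))\<^sup>2 / w (fst z)) * ennreal (w (snd z) * \<gamma> \<delta> (p (fst z) - p (snd z))))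
        + ennreal (1/2) * (ennreal ((cmod (b (snd z)))\<^sup>2 / w (snd z)) * ennreal (w (fst z) * \<gamma> \<delta> (p (snd z) - p (fst z)))) \<partial>(lborel \<Otimes>\<^sub>M lborel))"
    proof (rule nn_integral_mono)
      fix z :: "real \<times> real"
      let ?g = "\<gamma> \<delta> (q z)" and ?x = "cmod (b (fst z))" and ?y = "cmod (b (snd z))" and ?u = "w (fst z)" and ?v = "w (snd z)"
      have sym: "\<gamma> \<delta> (p (snd z) - p (fst z)) = ?g"
        unfolding \<gamma>_def q_def by (metis gauss_minus minus_diff_eq minus_divide_left)
      have g0: "?g \<ge> 0" by (rule \<gamma>0[OF \<delta>])
      \<comment> \<open>Young's inequality is balanced with the ratio of the two weights, so that in
        each term one variable carries |b|^2 / w and the other can be integrated by hypothesis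
        \<open>C\<close>. Where \<open>b\<close> vanishes the weight may be 0, but there the left
        side is 0.\<close>
      have "?x * ?y \<le> 1/2 * (?x\<^sup>2 / ?u * ?v) + 1/2 * (?y\<^sup>2 / ?v * ?u)"
      proof (cases "b (fst z) = 0 \<or> b (snd z) = 0")
        case True
        then show ?thesis using w(1) by (auto intro!: add_nonneg_nonneg divide_nonneg_nonneg mult_nonneg_nonneg)
      next
        case False
        then have uv: "?u > 0" "?v > 0" using w(2) by auto
        have "0 \<le> (?x * ?v - ?y * ?u)\<^sup>2" by simp
        then have "2 * (?x * ?y) * (?u * ?v) \<le> ?x\<^sup>2 * ?v\<^sup>2 + ?y\<^sup>2 * ?u\<^sup>2"
          by (simp add: power2_eq_square algebra_simps)
        then have "2 * (?x * ?y) \<le> (?x\<^sup>2 * ?v\<^sup>2 + ?y\<^sup>2 * ?u\<^sup>2) / (?u * ?v)" using uv by (simp add: pos_le_divide_eq)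
        also have "\<dots> = ?x\<^sup>2 / ?u * ?v + ?y\<^sup>2 / ?v * ?u" using uv by (simp add: field_simps power2_eq_square)
        finally have le: "2 * (?x * ?y) \<le> ?x\<^sup>2 / ?u * ?v + ?y\<^sup>2 / ?v * ?u" .
        have half: "x \<le> 1/2 * a + 1/2 * c" if "2 * x \<le> a + c" for x a c :: real using that by simp
        show ?thesis by (rule half[OF le])
      qed
      from mult_right_mono[OF this g0]
      have "cmod (\<beta> z * complex_of_real ?g) \<le> 1/2 * (?x\<^sup>2 / ?u * (?v * ?g)) + 1/2 * (?y\<^sup>2 / ?v * (?u * ?g))"
        using g0 by (simp add: \<beta>_def norm_mult algebra_simps)
      then have "ennreal (cmod (\<beta> z * complex_of_real ?g)) \<le> ennreal (1/2 * (?x\<^sup>2 / ?u * (?v * ?g)) + 1/2 * (?y\<^sup>2 / ?v * (?u * ?g)))"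
        by (rule ennreal_leI)
      also have "\<dots> = ennreal (1/2) * (ennreal (?x\<^sup>2 / ?u) * ennreal (?v * ?g)) + ennreal (1/2) * (ennreal (?y\<^sup>2 / ?v) * ennreal (?u * ?g))"
        using w(1) g0 by (subst ennreal_plus) (auto simp: ennreal_mult[symmetric] simp del: ennreal_half)
      finally show "ennreal (cmod (\<beta> z * complex_of_real (\<gamma> \<delta> (q z)))) \<le>
        ennreal (1/2) * (ennreal (?x\<^sup>2 / ?u) * ennreal (?v * \<gamma> \<delta> (p (fst z) - p (snd z))))
        + ennreal (1/2) * (ennreal (?y\<^sup>2 / ?v) * ennreal (?u * \<gamma> \<delta> (p (snd z) - p (fst z))))"
        unfolding sym unfolding q_def .
    qed
    also have "\<dots> = ennreal (1/2) * (\<integral>\<^sup>+z. ennreal ((cmod (b (fst z)))\<^sup>2 / w (fst z)) * ennreal (w (snd z) * \<gamma> \<delta> (p (fst z) - p (snd z))) \<partial>(lborel \<Otimes>\<^sub>M lborel))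
        + ennreal (1/2) * (\<integral>\<^sup>+z. ennreal ((cmod (b (snd z)))\<^sup>2 / w (snd z)) * ennreal (w (fst z) * \<gamma> \<delta> (p (snd z) - p (fst z))) \<partial>(lborel \<Otimes>\<^sub>M lborel))"
      by (subst nn_integral_add) (auto simp: nn_integral_cmult simp del: ennreal_half)
    also have "(\<integral>\<^sup>+z. ennreal ((cmod (b (fst z)))\<^sup>2 / w (fst z)) * ennreal (w (snd z) * \<gamma> \<delta> (p (fst z) - p (snd z))) \<partial>(lborel \<Otimes>\<^sub>M lborel)) \<le> ?R"
    proof -
      have "(\<integral>\<^sup>+z. ennreal ((cmod (b (fst z)))\<^sup>2 / w (fst z)) * ennreal (w (snd z) * \<gamma> \<delta> (p (fst z) - p (snd z))) \<partial>(lborel \<Otimes>\<^sub>M lborel))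
        = (\<integral>\<^sup>+k. \<integral>\<^sup>+k'. ennreal ((cmod (b k))\<^sup>2 / w k) * ennreal (w k' * \<gamma> \<delta> (p k - p k')) \<partial>lborel \<partial>lborel)"
        by (subst lborel.nn_integral_fst[symmetric]) auto
      also have "\<dots> = (\<integral>\<^sup>+k. ennreal ((cmod (b k))\<^sup>2 / w k) * (\<integral>\<^sup>+k'. ennreal (w k' * \<gamma> \<delta> (p k - p k')) \<partial>lborel) \<partial>lborel)"
        by (subst nn_integral_cmult) auto
      also have "\<dots> \<le> (\<integral>\<^sup>+k. ennreal ((cmod (b k))\<^sup>2 / w k) * ennreal C \<partial>lborel)"
        unfolding \<gamma>_def by (intro nn_integral_mono mult_left_mono C \<delta>) auto
      also have "\<dots> = ?R" by (subst nn_integral_multc) (auto simp: mult.commute)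
      finally show ?thesis .
    qed
    also have "(\<integral>\<^sup>+z. ennreal ((cmod (b (snd z)))\<^sup>2 / w (snd z)) * ennreal (w (fst z) * \<gamma> \<delta> (p (snd z) - p (fst z))) \<partial>(lborel \<Otimes>\<^sub>M lborel)) \<le> ?R"
    proof -
      have "(\<integral>\<^sup>+z. ennreal ((cmod (b (snd z)))\<^sup>2 / w (snd z)) * ennreal (w (fst z) * \<gamma> \<delta> (p (snd z) - p (fst z))) \<partial>(lborel \<Otimes>\<^sub>M lborel))
        = (\<integral>\<^sup>+k. \<integral>\<^sup>+k'. ennreal ((cmod (b k))\<^sup>2 / w k) * ennreal (w k' * \<gamma> \<delta> (p k - p k')) \<partial>lborel \<partial>lborel)"
        by (subst lborel_pair.nn_integral_snd[symmetric]) auto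
      also have "\<dots> = (\<integral>\<^sup>+k. ennreal ((cmod (b k))\<^sup>2 / w k) * (\<integral>\<^sup>+k'. ennreal (w k' * \<gamma> \<delta> (p k - p k')) \<partial>lborel) \<partial>lborel)"
        by (subst nn_integral_cmult) auto
      also have "\<dots> \<le> (\<integral>\<^sup>+k. ennreal ((cmod (b k))\<^sup>2 / w k) * ennreal C \<partial>lborel)"
        unfolding \<gamma>_def by (intro nn_integral_mono mult_left_mono C \<delta>) auto
      also have "\<dots> = ?R" by (subst nn_integral_multc) (auto simp: mult.commute)
      finally show ?thesis .
    qed
    finally have "(\<integral>\<^sup>+t. ennreal (gauss (\<delta> * t) * (cmod (B t))\<^sup>2) \<partial>lborel) \<le> ennreal (1/2) * ?R + ennreal (1/2) * ?R"
      by (simp add: mult_left_mono add_mono)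
    also have "\<dots> = (ennreal (1/2) + ennreal (1/2)) * ?R" by (rule distrib_right[symmetric])
    also have "ennreal (1/2) + ennreal (1/2) = 1" by (subst ennreal_plus[symmetric]) auto
    finally show ?thesis by simp
  qed
  have "(\<integral>\<^sup>+t. ennreal ((cmod (B t))\<^sup>2) \<partial>lborel) \<le> ?R"
  proof (rule nn_integral_fatou_bound[where u = "\<lambda>n t. ennreal (gauss (inverse (real (Suc n)) * t) * (cmod (B t))\<^sup>2)"])
    show "(\<integral>\<^sup>+t. ennreal (gauss (inverse (real (Suc n)) * t) * (cmod (B t))\<^sup>2) \<partial>lborel) \<le> ?R" for n
      by (rule reg) simp
    fix t :: real
    have "(\<lambda>n. inverse (real (Suc n)) * t) \<longlonglongrightarrow> 0 * t"
      by (rule tendsto_mult[OF LIMSEQ_inverse_real_of_nat tendsto_const])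
    then have "(\<lambda>n. gauss (inverse (real (Suc n)) * t)) \<longlonglongrightarrow> gauss (0 * t)"
      by (rule continuous_on_tendsto_compose[OF continuous_gauss[of UNIV]]) auto
    from tendsto_mult[OF this tendsto_const, of "(cmod (B t))\<^sup>2"]
    have "(\<lambda>n. gauss (inverse (real (Suc n)) * t) * (cmod (B t))\<^sup>2) \<longlonglongrightarrow> (cmod (B t))\<^sup>2" by (simp add: gauss_def)
    then show "(\<lambda>n. ennreal (gauss (inverse (real (Suc n)) * t) * (cmod (B t))\<^sup>2)) \<longlonglongrightarrow> ennreal ((cmod (B t))\<^sup>2)"
      by (rule tendsto_ennrealI)
  qed measurable
  then show ?thesis unfolding B_def .
qed

text \<open>The phase p k = k with weight 1, for which the Gaussian kernel has mass 2 pi.\<close>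

lemma plancherel_le:
  fixes b :: "real \<Rightarrow> complex"
  assumes b: "integrable lborel b"
  shows "(\<integral>\<^sup>+t. ennreal ((cmod (fourier b t))\<^sup>2) \<partial>lborel) \<le> ennreal (2 * pi) * (\<integral>\<^sup>+k. ennreal ((cmod (b k))\<^sup>2) \<partial>lborel)"
proof -
  have "(\<integral>\<^sup>+t. ennreal ((cmod (LINT k|lborel. exp (- \<i> * complex_of_real (k * t)) * b k))\<^sup>2) \<partial>lborel)
    \<le> ennreal (2 * pi) * (\<integral>\<^sup>+k. ennreal ((cmod (b k))\<^sup>2 / 1) \<partial>lborel)"
    by (rule phase_plancherel[OF _ _ b]) (simp_all add: gauss_kernel_mass)
  then show ?thesis by (simp add: fourier_def mult.commute)
qed

text \<open>Twice the low-frequency constant 2 sqrt 2 plus twice the high-frequency constant 2 pi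
  sqrt 2 of \<open>kato_smoothing\<close>; the factors 2 come from squaring a sum.\<close>

definition kato_const :: real where
  "kato_const = 4 * sqrt 2 * (1 + pi)"

text \<open>The phase k^2 admits the weight |k| in Schur's test, because 2 |k| dk is d(k^2). This
  weight degenerates at k = 0, so the frequencies |k| <= 1 are split off and bounded by
  Cauchy-Schwarz uniformly in t; for that part the time interval has to be bounded.\<close>

lemma kato_smoothing:
  fixes b :: "real \<Rightarrow> complex"
  assumes b: "integrable lborel b"
  shows "(\<integral>\<^sup>+t. indicator {0..1} t * ennreal ((cmod (LINT k|lborel. exp (- \<i> * complex_of_real (k\<^sup>2 * t)) * b k))\<^sup>2) \<partial>lborel)
    \<le> ennreal kato_const * (\<integral>\<^sup>+k. ennreal (sob_weight (- 1 / 2) k * (cmod (b k))\<^sup>2) \<partial>lborel)"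
proof -
  have [measurable]: "b \<in> borel_measurable borel" using borel_measurable_integrable[OF b] by simp
  define N where "N = (\<integral>\<^sup>+k. ennreal (sob_weight (- 1 / 2) k * (cmod (b k))\<^sup>2) \<partial>lborel)"
  define b1 where "b1 k = (if \<bar>k\<bar> \<le> 1 then b k else 0)" for k
  define b2 where "b2 k = (if \<bar>k\<bar> \<le> 1 then 0 else b k)" for k
  have [measurable]: "b1 \<in> borel_measurable borel" "b2 \<in> borel_measurable borel"
    unfolding b1_def[abs_def] b2_def[abs_def] by measurable
  have ib: "integrable lborel b1" "integrable lborel b2"
    by (rule Bochner_Integration.integrable_bound[OF b]; auto simp: b1_def b2_def)+
  define B where "B b t = (LINT k|lborel. exp (- \<i> * complex_of_real (k\<^sup>2 * t)) * b k)" for b t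
  have [measurable]: "B b1 \<in> borel_measurable borel" "B b2 \<in> borel_measurable borel" unfolding B_def[abs_def] by measurable
  have Bs: "B b t = B b1 t + B b2 t" for t
  proof -
    have "B b t = (LINT k|lborel. exp (- \<i> * complex_of_real (k\<^sup>2 * t)) * b1 k + exp (- \<i> * complex_of_real (k\<^sup>2 * t)) * b2 k)"
      unfolding B_def by (intro Bochner_Integration.integral_cong) (auto simp: b1_def b2_def)
    also have "\<dots> = B b1 t + B b2 t"
      unfolding B_def by (intro Bochner_Integration.integral_add integrable_exp_mult ib) measurable
    finally show ?thesis .
  qed
  have w1: "1 \<le> sqrt 2 * sob_weight (- 1 / 2) k" if "\<bar>k\<bar> \<le> 1" for k :: real
  proof -
    have "sqrt (1 + k\<^sup>2) \<le> sqrt 2" using that by (simp add: abs_square_le_1)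
    moreover have "sqrt (1 + k\<^sup>2) > 0" by (simp add: add_pos_nonneg)
    moreover have "sob_weight (- 1 / 2) k = 1 / sqrt (1 + k\<^sup>2)"
      unfolding sob_weight_def using powr_half_sqrt[of "1 + k\<^sup>2"] by (simp add: powr_minus_divide)
    ultimately show ?thesis by simp
  qed
  have w2: "1 / \<bar>k\<bar> \<le> sqrt 2 * sob_weight (- 1 / 2) k" if "\<bar>k\<bar> > 1" for k :: real
  proof -
    have "1 \<le> k\<^sup>2" using that by (metis abs_ge_zero less_imp_le one_le_power power2_abs)
    then have "sqrt (1 + k\<^sup>2) \<le> sqrt (2 * k\<^sup>2)" by simp
    then have "sqrt (1 + k\<^sup>2) \<le> sqrt 2 * \<bar>k\<bar>" by (simp add: real_sqrt_mult)
    moreover have "sqrt (1 + k\<^sup>2) > 0" by (simp add: add_pos_nonneg)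
    moreover have "sob_weight (- 1 / 2) k = 1 / sqrt (1 + k\<^sup>2)"
      unfolding sob_weight_def using powr_half_sqrt[of "1 + k\<^sup>2"] by (simp add: powr_minus_divide)
    ultimately have "1 / \<bar>k\<bar> \<le> sqrt 2 / sqrt (1 + k\<^sup>2)" "sqrt 2 * sob_weight (- 1 / 2) k = sqrt 2 / sqrt (1 + k\<^sup>2)"
      using that by (simp_all add: pos_le_divide_eq pos_divide_le_eq)
    then show ?thesis by simp
  qed
  \<comment> \<open>The interval [-1,1] has length 2, and on it the weight of exponent -1/2 is at
    least 1 / sqrt 2, whence 2 sqrt 2.\<close>
  have e1: "ennreal ((cmod (B b1 t))\<^sup>2) \<le> ennreal (2 * sqrt 2) * N" for t
  proof -
    have "ennreal (cmod (B b1 t)) \<le> (\<integral>\<^sup>+k. indicator {-1..1} k * ennreal (cmod (b1 k)) \<partial>lborel)"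
      unfolding B_def by (rule order_trans[OF ennreal_norm_integral])
        (auto intro!: nn_integral_mono simp: norm_mult b1_def indicator_def)
    then have "(ennreal (cmod (B b1 t)))\<^sup>2 \<le> (\<integral>\<^sup>+k. indicator {-1..1} k * ennreal (cmod (b1 k)) \<partial>lborel)\<^sup>2"
      by (intro power_mono) auto
    also have "\<dots> \<le> (\<integral>\<^sup>+k. (indicator {-1..1::real} k)\<^sup>2 \<partial>lborel) * (\<integral>\<^sup>+k. (ennreal (cmod (b1 k)))\<^sup>2 \<partial>lborel)"
      by (rule Cauchy_Schwarz_nn_integral) measurable
    also have "(\<integral>\<^sup>+k. (indicator {-1..1::real} k :: ennreal)\<^sup>2 \<partial>lborel) = (\<integral>\<^sup>+k. indicator {-1..1::real} k \<partial>lborel)"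
      by (intro nn_integral_cong) (auto simp: indicator_def)
    also have "\<dots> = ennreal 2" by simp
    also have "(\<integral>\<^sup>+k. (ennreal (cmod (b1 k)))\<^sup>2 \<partial>lborel) \<le> (\<integral>\<^sup>+k. ennreal (sqrt 2) * ennreal (sob_weight (- 1 / 2) k * (cmod (b k))\<^sup>2) \<partial>lborel)"
    proof (rule nn_integral_mono)
      fix k :: real
      have "(cmod (b1 k))\<^sup>2 \<le> sqrt 2 * (sob_weight (- 1 / 2) k * (cmod (b k))\<^sup>2)"
        using mult_right_mono[OF w1[of k], of "(cmod (b k))\<^sup>2"] by (auto simp: b1_def mult_ac)
      then show "(ennreal (cmod (b1 k)))\<^sup>2 \<le> ennreal (sqrt 2) * ennreal (sob_weight (- 1 / 2) k * (cmod (b k))\<^sup>2)"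
        by (simp add: ennreal_square ennreal_mult[symmetric] ennreal_leI)
    qed
    also have "\<dots> = ennreal (sqrt 2) * N" unfolding N_def by (rule nn_integral_cmult) measurable
    finally have "(ennreal (cmod (B b1 t)))\<^sup>2 \<le> ennreal 2 * (ennreal (sqrt 2) * N)" by (simp add: mult_left_mono)
    moreover have "ennreal 2 * ennreal (sqrt 2) = ennreal (2 * sqrt 2)" by (rule ennreal_mult[symmetric]) auto
    ultimately show ?thesis by (simp only: ennreal_square[OF norm_ge_zero] mult.assoc[symmetric])
  qed
  have e2: "(\<integral>\<^sup>+t. ennreal ((cmod (B b2 t))\<^sup>2) \<partial>lborel) \<le> ennreal (2 * pi * sqrt 2) * N"
  proof -
    have "(\<integral>\<^sup>+t. ennreal ((cmod (B b2 t))\<^sup>2) \<partial>lborel) \<le> ennreal (2 * pi) * (\<integral>\<^sup>+k. ennreal ((cmod (b2 k))\<^sup>2 / \<bar>k\<bar>) \<partial>lborel)"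
      unfolding B_def
    proof (rule phase_plancherel[OF _ _ ib(2)])
      \<comment> \<open>The Schur condition: substituting x = k'^2 removes the weight |k'| and
        leaves at most the full mass of the Gaussian kernel.\<close>
      fix k \<delta> :: real assume \<delta>: "\<delta> > 0"
      have "(\<integral>\<^sup>+k'. ennreal (\<bar>k'\<bar> * (sqrt (2 * pi) * gauss ((k\<^sup>2 - k'\<^sup>2) / \<delta>) / \<delta>)) \<partial>lborel) =
        (\<integral>\<^sup>+k'. ennreal \<bar>k'\<bar> * (\<lambda>x. ennreal (sqrt (2 * pi) * gauss ((k\<^sup>2 - x) / \<delta>) / \<delta>)) (k'\<^sup>2) \<partial>lborel)"
        by (intro nn_integral_cong ennreal_mult) (use \<delta> in simp_all)
      also have "\<dots> \<le> (\<integral>\<^sup>+x. ennreal (sqrt (2 * pi) * gauss ((k\<^sup>2 - x) / \<delta>) / \<delta>) \<partial>lborel)"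
        by (rule square_substitution) measurable
      also have "\<dots> = ennreal (2 * pi)" by (rule gauss_kernel_mass[OF \<delta>])
      finally show "(\<integral>\<^sup>+k'. ennreal (\<bar>k'\<bar> * (sqrt (2 * pi) * gauss ((k\<^sup>2 - k'\<^sup>2) / \<delta>) / \<delta>)) \<partial>lborel) \<le> ennreal (2 * pi)" .
    qed (auto simp: b2_def split: if_splits)
    also have "(\<integral>\<^sup>+k. ennreal ((cmod (b2 k))\<^sup>2 / \<bar>k\<bar>) \<partial>lborel) \<le> (\<integral>\<^sup>+k. ennreal (sqrt 2) * ennreal (sob_weight (- 1 / 2) k * (cmod (b k))\<^sup>2) \<partial>lborel)"
    proof (rule nn_integral_mono)
      fix k :: real
      have "(cmod (b2 k))\<^sup>2 / \<bar>k\<bar> \<le> sqrt 2 * (sob_weight (- 1 / 2) k * (cmod (b k))\<^sup>2)"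
        using mult_right_mono[OF w2[of k], of "(cmod (b k))\<^sup>2"] by (auto simp: b2_def mult_ac)
      then show "ennreal ((cmod (b2 k))\<^sup>2 / \<bar>k\<bar>) \<le> ennreal (sqrt 2) * ennreal (sob_weight (- 1 / 2) k * (cmod (b k))\<^sup>2)"
        by (simp add: ennreal_mult[symmetric] ennreal_leI)
    qed
    also have "\<dots> = ennreal (sqrt 2) * N" unfolding N_def by (rule nn_integral_cmult) measurable
    finally have "(\<integral>\<^sup>+t. ennreal ((cmod (B b2 t))\<^sup>2) \<partial>lborel) \<le> ennreal (2 * pi) * (ennreal (sqrt 2) * N)" by (simp add: mult_left_mono)
    then show ?thesis by (simp add: mult.assoc[symmetric] ennreal_mult[symmetric])
  qed
  have "(\<integral>\<^sup>+t. indicator {0..1} t * ennreal ((cmod (B b t))\<^sup>2) \<partial>lborel) \<le>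
    (\<integral>\<^sup>+t. indicator {0..1} t * (ennreal (4 * sqrt 2) * N) + ennreal 2 * ennreal ((cmod (B b2 t))\<^sup>2) \<partial>lborel)"
  proof (rule nn_integral_mono)
    fix t :: real
    have "ennreal ((cmod (B b t))\<^sup>2) \<le> ennreal (2 * (cmod (B b1 t))\<^sup>2 + 2 * (cmod (B b2 t))\<^sup>2)"
      unfolding Bs by (intro ennreal_leI cmod_add_square)
    also have "\<dots> = ennreal 2 * ennreal ((cmod (B b1 t))\<^sup>2) + ennreal 2 * ennreal ((cmod (B b2 t))\<^sup>2)"
      by (simp only: ennreal_plus[symmetric] ennreal_mult[symmetric] zero_le_power2 zero_le_numeral mult_nonneg_nonneg)
    also have "\<dots> \<le> ennreal 2 * (ennreal (2 * sqrt 2) * N) + ennreal 2 * ennreal ((cmod (B b2 t))\<^sup>2)"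
      by (intro add_mono mult_left_mono e1) auto
    also have "ennreal 2 * (ennreal (2 * sqrt 2) * N) = ennreal (4 * sqrt 2) * N"
      by (simp only: mult.assoc[symmetric] ennreal_mult[symmetric] zero_le_numeral real_sqrt_ge_zero mult_nonneg_nonneg) simp
    finally show "indicator {0..1} t * ennreal ((cmod (B b t))\<^sup>2) \<le> indicator {0..1} t * (ennreal (4 * sqrt 2) * N) + ennreal 2 * ennreal ((cmod (B b2 t))\<^sup>2)"
      by (auto simp: indicator_def)
  qed
  also have "\<dots> = (\<integral>\<^sup>+t. indicator {0..1::real} t * (ennreal (4 * sqrt 2) * N) \<partial>lborel) + ennreal 2 * (\<integral>\<^sup>+t. ennreal ((cmod (B b2 t))\<^sup>2) \<partial>lborel)"
    by (subst nn_integral_add) (auto simp: nn_integral_cmult)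
  also have "(\<integral>\<^sup>+t. indicator {0..1::real} t * (ennreal (4 * sqrt 2) * N) \<partial>lborel) = ennreal (4 * sqrt 2) * N"
    by (subst nn_integral_multc) auto
  also have "ennreal (4 * sqrt 2) * N + ennreal 2 * (\<integral>\<^sup>+t. ennreal ((cmod (B b2 t))\<^sup>2) \<partial>lborel) \<le> ennreal (4 * sqrt 2) * N + ennreal 2 * (ennreal (2 * pi * sqrt 2) * N)"
    by (intro add_mono mult_left_mono e2) auto
  also have "\<dots> = (ennreal (4 * sqrt 2) + ennreal 2 * ennreal (2 * pi * sqrt 2)) * N"
    by (simp only: distrib_right mult.assoc)
  also have "ennreal (4 * sqrt 2) + ennreal 2 * ennreal (2 * pi * sqrt 2) = ennreal kato_const"
  proof -
    have "ennreal 2 * ennreal (2 * pi * sqrt 2) = ennreal (2 * (2 * pi * sqrt 2))" by (rule ennreal_mult[symmetric]) auto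
    moreover have "ennreal (4 * sqrt 2) + ennreal (2 * (2 * pi * sqrt 2)) = ennreal (4 * sqrt 2 + 2 * (2 * pi * sqrt 2))"
      by (rule ennreal_plus[symmetric]) auto
    ultimately show ?thesis unfolding kato_const_def by (simp only:) (simp add: algebra_simps)
  qed
  finally show ?thesis unfolding B_def N_def .
qed

subsection \<open>The reflected extension\<close>

text \<open>For \<open>a\<close> supported in [0,T] this is the even extension about T, supported in
  [0,2T]. Writing it as a sum doubles the value at the single point T but gives an explicit Fourier
  transform.\<close>

definition reflect :: "real \<Rightarrow> (real \<Rightarrow> complex) \<Rightarrow> real \<Rightarrow> complex" where
  "reflect T a t = a t + a (2 * T - t)"

lemma fourier_reflect:
  assumes a: "integrable lborel a"
  shows "integrable lborel (reflect T a)"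
    "fourier (reflect T a) \<tau> = fourier a \<tau> + exp (- \<i> * complex_of_real (2 * T * \<tau>)) * fourier a (- \<tau>)"
proof -
  have [measurable]: "a \<in> borel_measurable borel" using borel_measurable_integrable[OF a] by simp
  have i: "integrable lborel (\<lambda>t. a (2 * T - t))"
    using lborel_integrable_real_affine[OF a, of "-1" "2 * T"] by simp
  then show "integrable lborel (reflect T a)" unfolding reflect_def[abs_def] using a by simp
  have e: "integrable lborel (\<lambda>t. exp (- \<i> * complex_of_real (\<tau> \<bullet> t)) * b t)" if "integrable lborel b" for b
    using integrable_exp_mult[OF that, of "\<lambda>t. \<tau> \<bullet> t"] by simp
  have "fourier (reflect T a) \<tau> = (LINT t|lborel. exp (- \<i> * complex_of_real (\<tau> \<bullet> t)) * a t + exp (- \<i> * complex_of_real (\<tau> \<bullet> t)) * a (2 * T - t))"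
    unfolding fourier_def reflect_def by (simp add: distrib_left)
  also have "\<dots> = fourier a \<tau> + (LINT t|lborel. exp (- \<i> * complex_of_real (\<tau> \<bullet> t)) * a (2 * T - t))"
    unfolding fourier_def by (rule Bochner_Integration.integral_add[OF e[OF a] e[OF i]])
  also have "(LINT t|lborel. exp (- \<i> * complex_of_real (\<tau> \<bullet> t)) * a (2 * T - t)) =
    (LINT t|lborel. exp (- \<i> * complex_of_real (\<tau> \<bullet> (2 * T + (-1) * t))) * a (2 * T - (2 * T + (-1) * t)))"
    by (subst lborel_integral_real_affine[of "-1" _ "2 * T"]) auto
  also have "\<dots> = (LINT t|lborel. exp (- \<i> * complex_of_real (2 * T * \<tau>)) * (exp (- \<i> * complex_of_real ((- \<tau>) \<bullet> t)) * a t))"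
  proof (intro Bochner_Integration.integral_cong refl)
    fix t
    have "exp (- \<i> * complex_of_real (\<tau> \<bullet> (2 * T + (-1) * t))) = exp (- \<i> * complex_of_real (2 * T * \<tau>)) * exp (- \<i> * complex_of_real ((- \<tau>) \<bullet> t))"
      by (simp add: exp_add[symmetric] algebra_simps)
    then show "exp (- \<i> * complex_of_real (\<tau> \<bullet> (2 * T + (-1) * t))) * a (2 * T - (2 * T + (-1) * t)) =
       exp (- \<i> * complex_of_real (2 * T * \<tau>)) * (exp (- \<i> * complex_of_real ((- \<tau>) \<bullet> t)) * a t)"
      by (simp only: mult.assoc) simp
  qed
  also have "\<dots> = exp (- \<i> * complex_of_real (2 * T * \<tau>)) * fourier a (- \<tau>)"
    unfolding fourier_def by (rule integral_mult_right_zero)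
  finally show "fourier (reflect T a) \<tau> = fourier a \<tau> + exp (- \<i> * complex_of_real (2 * T * \<tau>)) * fourier a (- \<tau>)" .
qed

lemma nn_integral_minus_real:
  fixes g :: "real \<Rightarrow> ennreal"
  assumes [measurable]: "g \<in> borel_measurable borel"
  shows "(\<integral>\<^sup>+x. g (- x) \<partial>lborel) = (\<integral>\<^sup>+x. g x \<partial>lborel)"
  using nn_integral_real_affine[of g "-1" 0] by simp

lemma nn_integral_two_square_sum:
  fixes g :: "real \<Rightarrow> complex"
  assumes [measurable]: "g \<in> borel_measurable borel"
    and le: "\<And>\<tau>. (X \<tau>) \<le> 2 * (cmod (g \<tau>))\<^sup>2 + 2 * (cmod (g (- \<tau>)))\<^sup>2"
  shows "(\<integral>\<^sup>+\<tau>. ennreal (X \<tau>) \<partial>lborel) \<le> ennreal 4 * (\<integral>\<^sup>+\<tau>. ennreal ((cmod (g \<tau>))\<^sup>2) \<partial>lborel)"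
proof -
  let ?N = "\<integral>\<^sup>+\<tau>. ennreal ((cmod (g \<tau>))\<^sup>2) \<partial>lborel"
  have "(\<integral>\<^sup>+\<tau>. ennreal (X \<tau>) \<partial>lborel) \<le> (\<integral>\<^sup>+\<tau>. ennreal 2 * ennreal ((cmod (g \<tau>))\<^sup>2) + ennreal 2 * ennreal ((cmod (g (- \<tau>)))\<^sup>2) \<partial>lborel)"
  proof (rule nn_integral_mono)
    fix \<tau>
    have "ennreal (X \<tau>) \<le> ennreal (2 * (cmod (g \<tau>))\<^sup>2 + 2 * (cmod (g (- \<tau>)))\<^sup>2)" by (rule ennreal_leI[OF le])
    also have "\<dots> = ennreal (2 * (cmod (g \<tau>))\<^sup>2) + ennreal (2 * (cmod (g (- \<tau>)))\<^sup>2)" by (rule ennreal_plus) auto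
    also have "\<dots> = ennreal 2 * ennreal ((cmod (g \<tau>))\<^sup>2) + ennreal 2 * ennreal ((cmod (g (- \<tau>)))\<^sup>2)"
      by (intro arg_cong2[where f = "(+)"] ennreal_mult) auto
    finally show "ennreal (X \<tau>) \<le> ennreal 2 * ennreal ((cmod (g \<tau>))\<^sup>2) + ennreal 2 * ennreal ((cmod (g (- \<tau>)))\<^sup>2)" .
  qed
  also have "\<dots> = (\<integral>\<^sup>+\<tau>. ennreal 2 * ennreal ((cmod (g \<tau>))\<^sup>2) \<partial>lborel) + (\<integral>\<^sup>+\<tau>. ennreal 2 * ennreal ((cmod (g (- \<tau>)))\<^sup>2) \<partial>lborel)"
    by (rule nn_integral_add) measurable
  also have "(\<integral>\<^sup>+\<tau>. ennreal 2 * ennreal ((cmod (g \<tau>))\<^sup>2) \<partial>lborel) = ennreal 2 * ?N"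
    by (rule nn_integral_cmult) measurable
  also have "(\<integral>\<^sup>+\<tau>. ennreal 2 * ennreal ((cmod (g (- \<tau>)))\<^sup>2) \<partial>lborel) = ennreal 2 * (\<integral>\<^sup>+\<tau>. ennreal ((cmod (g (- \<tau>)))\<^sup>2) \<partial>lborel)"
    by (rule nn_integral_cmult) measurable
  also have "(\<integral>\<^sup>+\<tau>. ennreal ((cmod (g (- \<tau>)))\<^sup>2) \<partial>lborel) = ?N"
    by (rule nn_integral_minus_real[of "\<lambda>\<tau>. ennreal ((cmod (g \<tau>))\<^sup>2)"]) measurable
  also have "ennreal 2 * ?N + ennreal 2 * ?N = (ennreal 2 + ennreal 2) * ?N" by (rule distrib_right[symmetric])
  also have "ennreal 2 + ennreal 2 = ennreal 4" by (subst ennreal_plus[symmetric]) auto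
  finally show ?thesis .
qed

lemma reflect_L2:
  assumes a: "integrable lborel a"
  shows "(\<integral>\<^sup>+\<tau>. ennreal ((cmod (fourier (reflect T a) \<tau>))\<^sup>2) \<partial>lborel) \<le> ennreal (8 * pi) * (\<integral>\<^sup>+t. ennreal ((cmod (a t))\<^sup>2) \<partial>lborel)"
proof -
  have [measurable]: "a \<in> borel_measurable borel" using borel_measurable_integrable[OF a] by simp
  have "(\<integral>\<^sup>+\<tau>. ennreal ((cmod (fourier (reflect T a) \<tau>))\<^sup>2) \<partial>lborel) \<le> ennreal 4 * (\<integral>\<^sup>+\<tau>. ennreal ((cmod (fourier a \<tau>))\<^sup>2) \<partial>lborel)"
  proof (rule nn_integral_two_square_sum)
    show "fourier a \<in> borel_measurable borel" by (rule fourier_measurable) simp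
    show "(cmod (fourier (reflect T a) \<tau>))\<^sup>2 \<le> 2 * (cmod (fourier a \<tau>))\<^sup>2 + 2 * (cmod (fourier a (- \<tau>)))\<^sup>2" for \<tau>
      unfolding fourier_reflect(2)[OF a]
      using cmod_add_square[of "fourier a \<tau>" "exp (- \<i> * complex_of_real (2 * T * \<tau>)) * fourier a (- \<tau>)"] by (simp add: norm_mult)
  qed
  also have "\<dots> \<le> ennreal 4 * (ennreal (2 * pi) * (\<integral>\<^sup>+t. ennreal ((cmod (a t))\<^sup>2) \<partial>lborel))"
    by (intro mult_left_mono plancherel_le a) auto
  also have "\<dots> = (ennreal 4 * ennreal (2 * pi)) * (\<integral>\<^sup>+t. ennreal ((cmod (a t))\<^sup>2) \<partial>lborel)" by (rule mult.assoc[symmetric])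
  also have "ennreal 4 * ennreal (2 * pi) = ennreal (8 * pi)" by (subst ennreal_mult[symmetric]) auto
  finally show ?thesis .
qed

text \<open>Cut off at T, the primitive jumps there from the total integral of \<open>D\<close> to
  0, and the last term on the right is due to that jump. As \<open>D\<close> is only integrable, the
  proof exchanges the integrals and integrates the exponential explicitly instead of differentiating
  \<open>a\<close>.\<close>

lemma fourier_primitive:
  assumes T: "T \<ge> 0" and D: "integrable lborel D" and out: "\<And>t. t \<notin> {0..T} \<Longrightarrow> D t = 0"
    and a: "\<And>t. a t = (if 0 \<le> t \<and> t \<le> T then LINT r|lborel. (if 0 \<le> r \<and> r \<le> t then D r else 0) else 0)"
  shows "\<i> * complex_of_real \<tau> * fourier a \<tau> = fourier D \<tau> - exp (- \<i> * complex_of_real (\<tau> * T)) * (LINT r|lborel. D r)"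
proof -
  have [measurable]: "D \<in> borel_measurable borel" using borel_measurable_integrable[OF D] by simp
  let ?e = "\<lambda>t. exp (- \<i> * complex_of_real (\<tau> * t))"
  let ?K = "\<lambda>t r. \<i> * complex_of_real \<tau> * (?e t * (if 0 \<le> r \<and> r \<le> t \<and> t \<le> T then D r else 0))"
  have "\<i> * complex_of_real \<tau> * fourier a \<tau> = (LINT t|lborel. \<i> * complex_of_real \<tau> * (?e t * a t))"
    unfolding fourier_def by simp
  also have "\<dots> = (LINT t|lborel. LINT r|lborel. ?K t r)"
  proof (intro Bochner_Integration.integral_cong refl)
    fix t
    have "a t = (LINT r|lborel. (if 0 \<le> r \<and> r \<le> t \<and> t \<le> T then D r else 0))"
    proof (cases "0 \<le> t \<and> t \<le> T")
      case True then show ?thesis unfolding a by (auto intro!: Bochner_Integration.integral_cong)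
    next
      case False
      then have n: "\<not> (0 \<le> r \<and> r \<le> t \<and> t \<le> T)" for r by linarith
      have z: "(\<lambda>r. if 0 \<le> r \<and> r \<le> t \<and> t \<le> T then D r else 0) = (\<lambda>r. 0)"
        by (rule ext, rule if_not_P, rule n)
      have "a t = 0" unfolding a using False by (rule if_not_P)
      then show ?thesis by (simp only: z) simp
    qed
    then show "\<i> * complex_of_real \<tau> * (?e t * a t) = (LINT r|lborel. ?K t r)"
      by (simp only: integral_mult_right_zero)
  qed
  also have "\<dots> = (LINT r|lborel. LINT t|lborel. ?K t r)"
  proof (rule fubini_prod_bound(2)[symmetric, where A = "\<lambda>t. \<bar>\<tau>\<bar> * indicator {0..T} t" and B = "\<lambda>r. cmod (D r)"])
    show "integrable lborel (\<lambda>t. \<bar>\<tau>\<bar> * indicator {0..T} t)"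
      by (intro integrable_mult_right integrable_real_indicator) (use T in auto)
    show "cmod (?K t r) \<le> \<bar>\<tau>\<bar> * indicator {0..T} t * cmod (D r)" for t r
      by (auto simp: norm_mult indicator_def)
  qed (use D in auto)
  also have "\<dots> = (LINT r|lborel. ?e r * D r - ?e T * D r)"
  proof (intro Bochner_Integration.integral_cong refl)
    fix r
    show "(LINT t|lborel. ?K t r) = ?e r * D r - ?e T * D r"
    proof (cases "r \<in> {0..T}")
      case True
      have "(LINT t|lborel. ?K t r) = (LINT t|lborel. (indicator {r..T} t *\<^sub>R (- \<i> * complex_of_real \<tau> * ?e t)) * (- D r))"
        using True by (intro Bochner_Integration.integral_cong) (auto simp: indicator_def)
      also have "\<dots> = (LINT t|lborel. indicator {r..T} t *\<^sub>R (- \<i> * complex_of_real \<tau> * ?e t)) * (- D r)"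
        by (rule integral_mult_left_zero)
      also have "(LINT t|lborel. indicator {r..T} t *\<^sub>R (- \<i> * complex_of_real \<tau> * ?e t)) = ?e T - ?e r"
      proof (rule integral_FTC_atLeastAtMost)
        show "r \<le> T" using True by simp
        fix x
        have "((\<lambda>t. exp (- \<i> * complex_of_real \<tau> * complex_of_real t)) has_vector_derivative (- \<i> * complex_of_real \<tau> * exp (- \<i> * complex_of_real \<tau> * complex_of_real x))) (at x within {r..T})"
          by (rule has_vector_derivative_real_field) (auto intro!: derivative_eq_intros)
        then show "(?e has_vector_derivative - \<i> * complex_of_real \<tau> * ?e x) (at x within {r..T})"
          by (simp add: mult.assoc)
      qed (intro continuous_intros)
      finally show ?thesis by (simp add: algebra_simps)
    next
      case False
      then have "D r = 0" by (rule out)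
      then show ?thesis by (simp cong: if_cong)
    qed
  qed
  also have "\<dots> = fourier D \<tau> - ?e T * (LINT r|lborel. D r)"
  proof -
    have "integrable lborel (\<lambda>r. ?e r * D r)" using integrable_exp_mult[OF D, of "\<lambda>r. \<tau> * r"] by simp
    then show ?thesis unfolding fourier_def using D by (subst Bochner_Integration.integral_diff) auto
  qed
  finally show ?thesis .
qed

text \<open>The even extension has no jump at T: the boundary terms of the two halves carry the
  factors exp(-i \<tau> T) and exp(-2 i \<tau> T) exp(i \<tau> T), which are equal, and enter with
  opposite signs. There is no jump at 0 because the primitive starts from 0.\<close>

lemma reflect_H1:
  assumes T: "T \<ge> 0" and D: "integrable lborel D" and out: "\<And>t. t \<notin> {0..T} \<Longrightarrow> D t = 0"
    and a: "\<And>t. a t = (if 0 \<le> t \<and> t \<le> T then LINT r|lborel. (if 0 \<le> r \<and> r \<le> t then D r else 0) else 0)"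
    and ia: "integrable lborel a"
  shows "(\<integral>\<^sup>+\<tau>. ennreal (\<tau>\<^sup>2 * (cmod (fourier (reflect T a) \<tau>))\<^sup>2) \<partial>lborel) \<le> ennreal (8 * pi) * (\<integral>\<^sup>+t. ennreal ((cmod (D t))\<^sup>2) \<partial>lborel)"
proof -
  have [measurable]: "D \<in> borel_measurable borel" using borel_measurable_integrable[OF D] by simp
  have "(\<integral>\<^sup>+\<tau>. ennreal (\<tau>\<^sup>2 * (cmod (fourier (reflect T a) \<tau>))\<^sup>2) \<partial>lborel) \<le> ennreal 4 * (\<integral>\<^sup>+\<tau>. ennreal ((cmod (fourier D \<tau>))\<^sup>2) \<partial>lborel)"
  proof (rule nn_integral_two_square_sum)
    show "fourier D \<in> borel_measurable borel" by (rule fourier_measurable) simp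
    fix \<tau>
    let ?E = "exp (- \<i> * complex_of_real (2 * T * \<tau>))"
    have p1: "\<i> * complex_of_real \<tau> * fourier a \<tau> = fourier D \<tau> - exp (- \<i> * complex_of_real (\<tau> * T)) * (LINT r|lborel. D r)"
      by (rule fourier_primitive[OF T D out a])
    have p2: "\<i> * complex_of_real (- \<tau>) * fourier a (- \<tau>) = fourier D (- \<tau>) - exp (- \<i> * complex_of_real ((- \<tau>) * T)) * (LINT r|lborel. D r)"
      by (rule fourier_primitive[OF T D out a])
    have E: "?E * exp (- \<i> * complex_of_real ((- \<tau>) * T)) = exp (- \<i> * complex_of_real (\<tau> * T))"
      by (simp add: exp_add[symmetric] algebra_simps)
    have "\<i> * complex_of_real \<tau> * fourier (reflect T a) \<tau> = \<i> * complex_of_real \<tau> * fourier a \<tau> - ?E * (\<i> * complex_of_real (- \<tau>) * fourier a (- \<tau>))"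
      unfolding fourier_reflect(2)[OF ia] by (simp add: algebra_simps)
    also have "\<dots> = fourier D \<tau> - exp (- \<i> * complex_of_real (\<tau> * T)) * (LINT r|lborel. D r)
      - (?E * fourier D (- \<tau>) - (?E * exp (- \<i> * complex_of_real ((- \<tau>) * T))) * (LINT r|lborel. D r))"
      unfolding p1 p2 by (simp only: right_diff_distrib mult.assoc)
    also have "\<dots> = fourier D \<tau> - ?E * fourier D (- \<tau>)" unfolding E by simp
    finally have e: "\<i> * complex_of_real \<tau> * fourier (reflect T a) \<tau> = fourier D \<tau> - ?E * fourier D (- \<tau>)" .
    have "\<tau>\<^sup>2 * (cmod (fourier (reflect T a) \<tau>))\<^sup>2 = (cmod (\<i> * complex_of_real \<tau> * fourier (reflect T a) \<tau>))\<^sup>2"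
      by (simp add: norm_mult power_mult_distrib)
    also have "\<dots> \<le> 2 * (cmod (fourier D \<tau>))\<^sup>2 + 2 * (cmod (?E * fourier D (- \<tau>)))\<^sup>2"
      unfolding e by (rule cmod_diff_square)
    finally show "\<tau>\<^sup>2 * (cmod (fourier (reflect T a) \<tau>))\<^sup>2 \<le> 2 * (cmod (fourier D \<tau>))\<^sup>2 + 2 * (cmod (fourier D (- \<tau>)))\<^sup>2"
      by (simp add: norm_mult)
  qed
  also have "\<dots> \<le> ennreal 4 * (ennreal (2 * pi) * (\<integral>\<^sup>+t. ennreal ((cmod (D t))\<^sup>2) \<partial>lborel))"
    by (intro mult_left_mono plancherel_le D) auto
  also have "\<dots> = (ennreal 4 * ennreal (2 * pi)) * (\<integral>\<^sup>+t. ennreal ((cmod (D t))\<^sup>2) \<partial>lborel)" by (rule mult.assoc[symmetric])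
  also have "ennreal 4 * ennreal (2 * pi) = ennreal (8 * pi)" by (subst ennreal_mult[symmetric]) auto
  finally show ?thesis .
qed

subsection \<open>The one-dimensional Duhamel integral on a line\<close>

text \<open>The factors -i here and 1/(2 pi) in \<open>dA\<close> are left out;
  \<open>freq_data\<close> puts both into the data.\<close>

definition du :: "(real \<Rightarrow> real \<Rightarrow> complex) \<Rightarrow> real \<Rightarrow> real \<Rightarrow> complex" where
  "du f k t = (LINT t'|lborel. (if 0 \<le> t' \<and> t' \<le> t then exp (- \<i> * complex_of_real (k\<^sup>2 * (t - t'))) * f k t' else 0))"

definition dA :: "(real \<Rightarrow> real \<Rightarrow> complex) \<Rightarrow> real \<Rightarrow> real \<Rightarrow> complex" where
  "dA f y t = (LINT k|lborel. exp (\<i> * complex_of_real (k * y)) * du f k t)"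

text \<open>The square of the norm in L^2 of time with values in H^r, written on the Fourier side
  and without the normalising constant of Plancherel.\<close>

definition wnorm :: "real \<Rightarrow> (real \<Rightarrow> real \<Rightarrow> complex) \<Rightarrow> ennreal" where
  "wnorm r f = (\<integral>\<^sup>+t. \<integral>\<^sup>+k. ennreal (sob_weight r k * (cmod (f k t))\<^sup>2) \<partial>lborel \<partial>lborel)"

definition mass :: "(real \<Rightarrow> real \<Rightarrow> complex) \<Rightarrow> ennreal" where
  "mass f = (\<integral>\<^sup>+k. \<integral>\<^sup>+t. ennreal (cmod (f k t)) \<partial>lborel \<partial>lborel)"

definition dcut :: "real \<Rightarrow> (real \<Rightarrow> real \<Rightarrow> complex) \<Rightarrow> real \<Rightarrow> real \<Rightarrow> complex" where
  "dcut T f y t = (if 0 \<le> t \<and> t \<le> T then dA f y t else 0)"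

text \<open>The data at one frequency in x1, as functions of the second frequency k and of time.
  Joint integrability is qualitative: it justifies the interchanges of integrals, while the
  estimates are in terms of \<open>wnorm\<close>.\<close>

locale time_data =
  fixes T :: real and f :: "real \<Rightarrow> real \<Rightarrow> complex"
  assumes T0: "0 < T" and T1: "T < 1"
    and f_meas [measurable]: "case_prod f \<in> borel_measurable (borel \<Otimes>\<^sub>M borel)"
    and f_int: "integrable (lborel \<Otimes>\<^sub>M lborel) (case_prod f)"
    and f_out: "t \<notin> {0..T} \<Longrightarrow> f k t = 0"
begin

lemma du_meas [measurable]: "case_prod (du f) \<in> borel_measurable (borel \<Otimes>\<^sub>M borel)"
  unfolding du_def by measurable

lemma dA_meas [measurable]: "dA f y \<in> borel_measurable borel"
  unfolding dA_def[abs_def] by measurable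

lemma mass_finite: "mass f < \<infinity>"
proof -
  have "(\<integral>\<^sup>+k. \<integral>\<^sup>+t. ennreal (cmod (case_prod f (k, t))) \<partial>lborel \<partial>lborel) = (\<integral>\<^sup>+z. ennreal (cmod (case_prod f z)) \<partial>(lborel \<Otimes>\<^sub>M lborel))"
    by (rule lborel.nn_integral_fst) measurable
  also have "\<dots> < \<infinity>" using f_int unfolding integrable_iff_bounded by simp
  finally show ?thesis by (simp add: mass_def)
qed

lemma du_bound: "ennreal (cmod (du f k t)) \<le> (\<integral>\<^sup>+t'. ennreal (cmod (f k t')) \<partial>lborel)"
  unfolding du_def by (rule order_trans[OF ennreal_norm_integral]) (auto intro!: nn_integral_mono simp: norm_mult)

lemma du_mass: "(\<integral>\<^sup>+k. ennreal (cmod (du f k t)) \<partial>lborel) \<le> mass f"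
  unfolding mass_def by (intro nn_integral_mono du_bound)

lemma du_integrable: "integrable lborel (\<lambda>k. du f k t)"
  using du_mass mass_finite by (intro integrableI_bounded) (auto intro: le_less_trans)

lemma dA_bound: "ennreal (cmod (dA f y t)) \<le> mass f"
proof -
  have "ennreal (cmod (dA f y t)) \<le> (\<integral>\<^sup>+k. ennreal (cmod (du f k t)) \<partial>lborel)"
    unfolding dA_def by (rule order_trans[OF ennreal_norm_integral]) (auto intro!: nn_integral_mono simp: norm_mult)
  then show ?thesis using du_mass order_trans by blast
qed

lemma dcut_meas [measurable]: "dcut T f y \<in> borel_measurable borel"
  unfolding dcut_def[abs_def] by measurable

lemma dcut_integrable: "integrable lborel (dcut T f y)"
proof (rule integrableI_bounded)
  have "(\<integral>\<^sup>+t. ennreal (norm (dcut T f y t)) \<partial>lborel) \<le> (\<integral>\<^sup>+t. indicator {0..T} t * mass f \<partial>lborel)"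
    using dA_bound by (intro nn_integral_mono) (auto simp: dcut_def)
  also have "\<dots> = ennreal T * mass f" using T0 by (subst nn_integral_multc) auto
  also have "\<dots> < \<infinity>" using mass_finite by (simp add: ennreal_mult_less_top)
  finally show "(\<integral>\<^sup>+t. ennreal (norm (dcut T f y t)) \<partial>lborel) < \<infinity>" .
qed measurable

lemma AE_integrable_space: "AE t in lborel. integrable lborel (\<lambda>k. f k t)"
  by (rule lborel_pair.AE_integrable_snd[OF f_int])

lemma AE_integrable_time: "AE k in lborel. integrable lborel (\<lambda>t. f k t)"
  by (rule lborel_pair.AE_integrable_fst[OF f_int])

text \<open>For fixed t' the k-integral is a free evolution in t of the data exp(i (k y + k^2 t'))
  f(k,t'), which have the modulus of \<open>f\<close>. In this form \<open>kato_smoothing\<close>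
  applies to it.\<close>

lemma dA_swap:
  "dA f y t = (LINT t'|lborel. (if 0 \<le> t' \<and> t' \<le> t then
     LINT k|lborel. exp (- \<i> * complex_of_real (k\<^sup>2 * t)) * (exp (- \<i> * complex_of_real (- (k * y) - k\<^sup>2 * t')) * f k t') else 0))"
proof -
  let ?g = "\<lambda>k t'. exp (\<i> * complex_of_real (k * y)) * (if 0 \<le> t' \<and> t' \<le> t then exp (- \<i> * complex_of_real (k\<^sup>2 * (t - t'))) * f k t' else 0)"
  have g: "integrable (lborel \<Otimes>\<^sub>M lborel) (case_prod ?g)"
    by (rule Bochner_Integration.integrable_bound[OF f_int]) (auto simp: norm_mult)
  have "dA f y t = (LINT k|lborel. LINT t'|lborel. ?g k t')"
    unfolding dA_def du_def by (simp only: integral_mult_right_zero)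
  also have "\<dots> = (LINT t'|lborel. LINT k|lborel. ?g k t')"
    by (rule lborel_pair.Fubini_integral[OF g, symmetric])
  also have "\<dots> = (LINT t'|lborel. (if 0 \<le> t' \<and> t' \<le> t then
     LINT k|lborel. exp (- \<i> * complex_of_real (k\<^sup>2 * t)) * (exp (- \<i> * complex_of_real (- (k * y) - k\<^sup>2 * t')) * f k t') else 0))"
  proof (intro Bochner_Integration.integral_cong refl)
    fix t'
    have "exp (\<i> * complex_of_real (k * y)) * exp (- \<i> * complex_of_real (k\<^sup>2 * (t - t'))) = exp (- \<i> * complex_of_real (k\<^sup>2 * t)) * exp (- \<i> * complex_of_real (- (k * y) - k\<^sup>2 * t'))" for k
      by (simp add: exp_add[symmetric] algebra_simps)
    then have eq: "exp (\<i> * complex_of_real (k * y)) * (exp (- \<i> * complex_of_real (k\<^sup>2 * (t - t'))) * f k t') =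
        exp (- \<i> * complex_of_real (k\<^sup>2 * t)) * (exp (- \<i> * complex_of_real (- (k * y) - k\<^sup>2 * t')) * f k t')" for k
      by (simp only: mult.assoc[symmetric])
    show "(LINT k|lborel. ?g k t') = (if 0 \<le> t' \<and> t' \<le> t then
     LINT k|lborel. exp (- \<i> * complex_of_real (k\<^sup>2 * t)) * (exp (- \<i> * complex_of_real (- (k * y) - k\<^sup>2 * t')) * f k t') else 0)"
    proof (cases "0 \<le> t' \<and> t' \<le> t")
      case True then show ?thesis by (simp only: True simp_thms if_True eq)
    next
      case False then show ?thesis by (simp only: if_not_P[OF False]) simp
    qed
  qed
  finally show ?thesis .
qed

lemma kato_duhamel:
  "(\<integral>\<^sup>+t. ennreal ((cmod (dcut T f y t))\<^sup>2) \<partial>lborel) \<le> ennreal kato_const * wnorm (- 1 / 2) f"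
proof -
  define a where "a t' t = (LINT k|lborel. exp (- \<i> * complex_of_real (k\<^sup>2 * t)) * (exp (- \<i> * complex_of_real (- (k * y) - k\<^sup>2 * t')) * f k t'))" for t' t
  have [measurable]: "case_prod a \<in> borel_measurable (borel \<Otimes>\<^sub>M borel)" unfolding a_def by measurable
  have [measurable]: "indicator {0..T} \<in> borel_measurable borel" by simp
  have 1: "ennreal ((cmod (dcut T f y t))\<^sup>2) \<le> (\<integral>\<^sup>+t'. indicator {0..T} t * (indicator {0..T} t' * ennreal ((cmod (a t' t))\<^sup>2)) \<partial>lborel)" for t
  proof (cases "t \<in> {0..T}")
    case True
    have "ennreal (cmod (dcut T f y t)) \<le> (\<integral>\<^sup>+t'. indicator {0..T} t' * (indicator {0..T} t' * ennreal (cmod (a t' t))) \<partial>lborel)"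
    proof -
      have sw: "dA f y t = (LINT t'|lborel. (if 0 \<le> t' \<and> t' \<le> t then a t' t else 0))"
        unfolding a_def by (rule dA_swap)
      have "dcut T f y t = (LINT t'|lborel. (if 0 \<le> t' \<and> t' \<le> t then a t' t else 0))"
        using True sw by (simp add: dcut_def)
      also have "ennreal (cmod \<dots>) \<le> (\<integral>\<^sup>+t'. indicator {0..T} t' * (indicator {0..T} t' * ennreal (cmod (a t' t))) \<partial>lborel)"
        using True by (intro order_trans[OF ennreal_norm_integral] nn_integral_mono) (auto simp: indicator_def)
      finally show ?thesis .
    qed
    then have "(ennreal (cmod (dcut T f y t)))\<^sup>2 \<le> (\<integral>\<^sup>+t'. indicator {0..T} t' * (indicator {0..T} t' * ennreal (cmod (a t' t))) \<partial>lborel)\<^sup>2"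
      by (intro power_mono) auto
    also have "\<dots> \<le> (\<integral>\<^sup>+t'. (indicator {0..T} t')\<^sup>2 \<partial>lborel) * (\<integral>\<^sup>+t'. (indicator {0..T} t' * ennreal (cmod (a t' t)))\<^sup>2 \<partial>lborel)"
      by (rule Cauchy_Schwarz_nn_integral) measurable
    also have "(\<integral>\<^sup>+t'. (indicator {0..T} t' :: ennreal)\<^sup>2 \<partial>lborel) = (\<integral>\<^sup>+t'. indicator {0..T} t' \<partial>lborel)"
      by (intro nn_integral_cong) (auto simp: indicator_def)
    also have "\<dots> = ennreal T" using T0 by simp
    also have "(\<integral>\<^sup>+t'. (indicator {0..T} t' * ennreal (cmod (a t' t)))\<^sup>2 \<partial>lborel) = (\<integral>\<^sup>+t'. indicator {0..T} t' * ennreal ((cmod (a t' t))\<^sup>2) \<partial>lborel)"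
      by (intro nn_integral_cong) (auto simp: indicator_def ennreal_square)
    also have "ennreal T * (\<integral>\<^sup>+t'. indicator {0..T} t' * ennreal ((cmod (a t' t))\<^sup>2) \<partial>lborel) \<le> 1 * (\<integral>\<^sup>+t'. indicator {0..T} t' * ennreal ((cmod (a t' t))\<^sup>2) \<partial>lborel)"
      using T0 T1 by (intro mult_right_mono) auto
    finally show ?thesis using True by (simp add: ennreal_square)
  next
    case False then show ?thesis by (auto simp: dcut_def)
  qed
  have 2: "AE t' in lborel. (\<integral>\<^sup>+t. indicator {0..T} t * ennreal ((cmod (a t' t))\<^sup>2) \<partial>lborel) \<le> ennreal kato_const * (\<integral>\<^sup>+k. ennreal (sob_weight (- 1 / 2) k * (cmod (f k t'))\<^sup>2) \<partial>lborel)"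
    using AE_integrable_space
  proof eventually_elim
    case (elim t')
    have "integrable lborel (\<lambda>k. exp (- \<i> * complex_of_real (- (k * y) - k\<^sup>2 * t')) * f k t')"
      by (rule integrable_exp_mult[OF elim]) measurable
    from kato_smoothing[OF this]
    have "(\<integral>\<^sup>+t. indicator {0..1} t * ennreal ((cmod (a t' t))\<^sup>2) \<partial>lborel) \<le> ennreal kato_const * (\<integral>\<^sup>+k. ennreal (sob_weight (- 1 / 2) k * (cmod (f k t'))\<^sup>2) \<partial>lborel)"
      unfolding a_def by (simp add: norm_mult)
    moreover have "(\<integral>\<^sup>+t. indicator {0..T} t * ennreal ((cmod (a t' t))\<^sup>2) \<partial>lborel) \<le> (\<integral>\<^sup>+t. indicator {0..1} t * ennreal ((cmod (a t' t))\<^sup>2) \<partial>lborel)"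
      using T1 by (intro nn_integral_mono) (auto simp: indicator_def)
    ultimately show ?case by (rule order_trans[rotated])
  qed
  have "(\<integral>\<^sup>+t. ennreal ((cmod (dcut T f y t))\<^sup>2) \<partial>lborel) \<le> (\<integral>\<^sup>+t. \<integral>\<^sup>+t'. indicator {0..T} t * (indicator {0..T} t' * ennreal ((cmod (a t' t))\<^sup>2)) \<partial>lborel \<partial>lborel)"
    by (intro nn_integral_mono 1)
  also have "\<dots> = (\<integral>\<^sup>+t'. \<integral>\<^sup>+t. indicator {0..T} t * (indicator {0..T} t' * ennreal ((cmod (a t' t))\<^sup>2)) \<partial>lborel \<partial>lborel)"
    by (rule lborel_pair.Fubini') measurable
  also have "\<dots> \<le> (\<integral>\<^sup>+t'. ennreal kato_const * (\<integral>\<^sup>+k. ennreal (sob_weight (- 1 / 2) k * (cmod (f k t'))\<^sup>2) \<partial>lborel) \<partial>lborel)"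
    by (rule nn_integral_mono_AE) (use 2 in \<open>eventually_elim, auto simp: indicator_def\<close>)
  also have "\<dots> = ennreal kato_const * wnorm (- 1 / 2) f"
    unfolding wnorm_def by (rule nn_integral_cmult) measurable
  finally show ?thesis .
qed

end

section \<open>The time derivative on a line\<close>

text \<open>On k >= 0 the inequality (1 + k)^2 / 2 <= 1 + k^2 compares the weight with an explicit
  power of 1 + k, integrable because 2 s > 1.\<close>

lemma integrable_sob_weight_real:
  assumes s: "s > 1 / 2"
  shows "integrable lborel (\<lambda>k::real. sob_weight (- s) k)"
proof (rule integrableI_nonneg)
  let ?g = "\<lambda>k::real. ennreal (sob_weight (- s) k)"
  let ?h = "\<lambda>k::real. 2 powr s * (1 + k) powr (- 2 * s)"
  let ?F = "\<lambda>k::real. 2 powr s * ((1 + k) powr (1 - 2 * s) / (1 - 2 * s))"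
  have half: "(\<integral>\<^sup>+k. ?g k * indicator {0..} k \<partial>lborel) < \<infinity>"
  proof -
    have "(\<integral>\<^sup>+k. ?g k * indicator {0..} k \<partial>lborel) \<le> (\<integral>\<^sup>+k. ennreal (?h k) * indicator {0..} k \<partial>lborel)"
    proof (rule nn_integral_mono)
      fix k :: real
      show "?g k * indicator {0..} k \<le> ennreal (?h k) * indicator {0..} k"
      proof (cases "k \<ge> 0")
        case True
        have "(1 + k)\<^sup>2 / 2 \<le> 1 + k\<^sup>2" using sum_squares_bound[of 1 k] by (simp add: power2_sum field_simps)
        moreover have "0 < (1 + k)\<^sup>2 / 2" using True by simp
        ultimately have "(1 + k\<^sup>2) powr (- s) \<le> ((1 + k)\<^sup>2 / 2) powr (- s)"
          by (intro powr_mono2') (use s in auto)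
        also have "\<dots> = ((1 + k)\<^sup>2) powr (- s) / 2 powr (- s)" by (simp add: powr_divide)
        also have "((1 + k)\<^sup>2) powr (- s) = (1 + k) powr (- 2 * s)"
        proof -
          have e: "(1 + k)\<^sup>2 = (1 + k) powr (real 2)" by (rule powr_realpow[symmetric]) (use True in simp)
          show ?thesis unfolding e powr_powr by simp
        qed
        finally show ?thesis using True
          by (auto simp: sob_weight_def powr_minus field_simps intro!: ennreal_leI)
      qed simp
    qed
    also have "\<dots> = ennreal (0 - ?F 0)"
    proof (rule nn_integral_FTC_atLeast)
      show "(?F has_real_derivative ?h x) (at x)" if "0 \<le> x" for x
      proof -
        have "((\<lambda>k. (1 + k) powr (1 - 2 * s)) has_real_derivative (1 - 2 * s) * (1 + x) powr (- 2 * s)) (at x)"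
          using that by (auto intro!: derivative_eq_intros)
        from DERIV_cmult[OF DERIV_cdivide[OF this, of "1 - 2 * s"], of "2 powr s"]
        show ?thesis using s by simp
      qed
      have "((\<lambda>k::real. (1 + k) powr (1 - 2 * s)) \<longlongrightarrow> 0) at_top"
        using s by (intro tendsto_neg_powr filterlim_tendsto_add_at_top[OF tendsto_const] filterlim_ident) auto
      from tendsto_mult[OF tendsto_const tendsto_divide[OF this tendsto_const]]
      show "(?F \<longlongrightarrow> 0) at_top" using s by fastforce
    qed auto
    finally show ?thesis by (simp add: le_less_trans)
  qed
  have "(\<integral>\<^sup>+k. ?g k \<partial>lborel) \<le> (\<integral>\<^sup>+k. ?g k * indicator {0..} k + ?g (- k) * indicator {0..} (- k) \<partial>lborel)"
    by (intro nn_integral_mono) (auto simp: indicator_def sob_weight_def)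
  also have "\<dots> = (\<integral>\<^sup>+k. ?g k * indicator {0..} k \<partial>lborel) + (\<integral>\<^sup>+k. ?g (- k) * indicator {0..} (- k) \<partial>lborel)"
    by (rule nn_integral_add) measurable
  also have "(\<integral>\<^sup>+k. ?g (- k) * indicator {0..} (- k) \<partial>lborel) = (\<integral>\<^sup>+k. ?g k * indicator {0..} k \<partial>lborel)"
    by (rule nn_integral_minus_real[of "\<lambda>k. ?g k * indicator {0..} k"]) measurable
  also have "(\<integral>\<^sup>+k. ?g k * indicator {0..} k \<partial>lborel) + (\<integral>\<^sup>+k. ?g k * indicator {0..} k \<partial>lborel) < \<infinity>"
    using half by simp
  finally show "(\<integral>\<^sup>+k. ?g k \<partial>lborel) < \<infinity>" .
qed auto

definition weight_mass :: "real \<Rightarrow> real" where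
  "weight_mass s = (LINT k::real|lborel. sob_weight (- s) k)"

lemma weight_mass_nonneg: "weight_mass s \<ge> 0"
  unfolding weight_mass_def by (intro integral_nonneg_AE) auto

text \<open>The quantitative form of the embedding of H^s(R), s > 1/2, into the functions with
  integrable transform: Cauchy-Schwarz against the integrable weight of exponent -s.\<close>

lemma weight_cauchy_schwarz:
  fixes b :: "real \<Rightarrow> complex"
  assumes [measurable]: "b \<in> borel_measurable borel" and s: "s > 1 / 2"
  shows "(\<integral>\<^sup>+k. ennreal (cmod (b k)) \<partial>lborel)\<^sup>2 \<le> ennreal (weight_mass s) * (\<integral>\<^sup>+k. ennreal (sob_weight s k * (cmod (b k))\<^sup>2) \<partial>lborel)"
proof -
  have "(\<integral>\<^sup>+k. ennreal (cmod (b k)) \<partial>lborel) = (\<integral>\<^sup>+k. ennreal (sqrt (sob_weight (- s) k)) * ennreal (sqrt (sob_weight s k) * cmod (b k)) \<partial>lborel)"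
  proof (rule nn_integral_cong)
    fix k :: real
    have "sqrt (sob_weight (- s) k) * (sqrt (sob_weight s k) * cmod (b k)) = cmod (b k)"
      using sob_weight_pos[of s k] by (simp add: sob_weight_minus real_sqrt_divide)
    then show "ennreal (cmod (b k)) = ennreal (sqrt (sob_weight (- s) k)) * ennreal (sqrt (sob_weight s k) * cmod (b k))"
      by (subst ennreal_mult[symmetric]) auto
  qed
  then have "(\<integral>\<^sup>+k. ennreal (cmod (b k)) \<partial>lborel)\<^sup>2 = (\<integral>\<^sup>+k. ennreal (sqrt (sob_weight (- s) k)) * ennreal (sqrt (sob_weight s k) * cmod (b k)) \<partial>lborel)\<^sup>2"
    by simp
  also have "\<dots> \<le> (\<integral>\<^sup>+k. (ennreal (sqrt (sob_weight (- s) (k::real))))\<^sup>2 \<partial>lborel) * (\<integral>\<^sup>+k. (ennreal (sqrt (sob_weight s k) * cmod (b k)))\<^sup>2 \<partial>lborel)"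
    by (rule Cauchy_Schwarz_nn_integral) measurable
  also have "(\<integral>\<^sup>+k. (ennreal (sqrt (sob_weight (- s) (k::real))))\<^sup>2 \<partial>lborel) = (\<integral>\<^sup>+k. ennreal (sob_weight (- s) (k::real)) \<partial>lborel)"
    by (intro nn_integral_cong) (simp add: ennreal_square)
  also have "\<dots> = ennreal (weight_mass s)"
    unfolding weight_mass_def by (rule nn_integral_eq_integral[OF integrable_sob_weight_real[OF s]]) auto
  also have "(\<integral>\<^sup>+k. (ennreal (sqrt (sob_weight s k) * cmod (b k)))\<^sup>2 \<partial>lborel) = (\<integral>\<^sup>+k. ennreal (sob_weight s k * (cmod (b k))\<^sup>2) \<partial>lborel)"
    by (intro nn_integral_cong) (simp add: ennreal_square power_mult_distrib)
  finally show ?thesis .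
qed

context time_data
begin

lemma mass_swap: "(\<integral>\<^sup>+t. \<integral>\<^sup>+k. ennreal (cmod (f k t)) \<partial>lborel \<partial>lborel) = mass f"
  unfolding mass_def by (rule lborel_pair.Fubini') measurable

lemma f_slice_meas [measurable]: "f k \<in> borel_measurable borel"
proof -
  have "(\<lambda>t. case_prod f (k, t)) \<in> borel_measurable borel" by measurable
  then show ?thesis by simp
qed

text \<open>The integrated form of u' = f - i k^2 u. Since \<open>f k\<close> is only integrable in
  time, it is verified by exchanging the integrals in the k^2 term and integrating the exponential
  explicitly.\<close>

lemma du_ode:
  assumes i: "integrable lborel (f k)"
  shows "du f k t = (LINT r|lborel. (if 0 \<le> r \<and> r \<le> t then f k r - \<i> * complex_of_real (k\<^sup>2) * du f k r else 0))"
proof -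
  let ?e = "\<lambda>r t'. exp (- \<i> * complex_of_real (k\<^sup>2 * (r - t')))"
  let ?K = "\<lambda>r t'. (if 0 \<le> t' \<and> t' \<le> r \<and> r \<le> t then - \<i> * complex_of_real (k\<^sup>2) * (?e r t' * f k t') else 0)"
  have fub: "(LINT t'|lborel. LINT r|lborel. ?K r t') = (LINT r|lborel. LINT t'|lborel. ?K r t')"
  proof (rule fubini_prod_bound(2)[where A = "\<lambda>r. k\<^sup>2 * indicator {0..max 0 t} r" and B = "\<lambda>t'. cmod (f k t')"])
    show "integrable lborel (\<lambda>r. k\<^sup>2 * indicator {0..max 0 t} r)"
      by (intro integrable_mult_right integrable_real_indicator) auto
    show "cmod (?K r t') \<le> k\<^sup>2 * indicator {0..max 0 t} r * cmod (f k t')" for r t'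
      by (auto simp: norm_mult norm_power indicator_def)
  qed (use i in auto)
  have r1: "(LINT t'|lborel. ?K r t') = (if 0 \<le> r \<and> r \<le> t then - \<i> * complex_of_real (k\<^sup>2) * du f k r else 0)" for r
  proof (cases "0 \<le> r \<and> r \<le> t")
    case True
    have "(LINT t'|lborel. ?K r t') = (LINT t'|lborel. - \<i> * complex_of_real (k\<^sup>2) * (if 0 \<le> t' \<and> t' \<le> r then ?e r t' * f k t' else 0))"
      using True by (intro Bochner_Integration.integral_cong) auto
    then show ?thesis unfolding du_def if_P[OF True] by (simp only: integral_mult_right_zero)
  next
    case False
    then have n: "\<not> (0 \<le> t' \<and> t' \<le> r \<and> r \<le> t)" for t' by linarith
    have z: "(\<lambda>t'. ?K r t') = (\<lambda>t'. 0)" by (rule ext, rule if_not_P, rule n)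
    show ?thesis unfolding if_not_P[OF False] by (simp only: z) simp
  qed
  have r2: "(LINT r|lborel. ?K r t') = (if 0 \<le> t' \<and> t' \<le> t then ?e t t' * f k t' else 0) - (if 0 \<le> t' \<and> t' \<le> t then f k t' else 0)" for t'
  proof (cases "0 \<le> t' \<and> t' \<le> t")
    case True
    have "(LINT r|lborel. ?K r t') = (LINT r|lborel. (indicator {t'..t} r *\<^sub>R (- \<i> * complex_of_real (k\<^sup>2) * ?e r t')) * f k t')"
      using True by (intro Bochner_Integration.integral_cong) (auto simp: indicator_def)
    also have "\<dots> = (LINT r|lborel. indicator {t'..t} r *\<^sub>R (- \<i> * complex_of_real (k\<^sup>2) * ?e r t')) * f k t'"
      by (rule integral_mult_left_zero)
    also have "(LINT r|lborel. indicator {t'..t} r *\<^sub>R (- \<i> * complex_of_real (k\<^sup>2) * ?e r t')) = ?e t t' - ?e t' t'"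
    proof (rule integral_FTC_atLeastAtMost)
      show "t' \<le> t" using True by simp
      fix x
      have "((\<lambda>r. exp (- \<i> * complex_of_real (k\<^sup>2) * (complex_of_real r - complex_of_real t'))) has_vector_derivative (- \<i> * complex_of_real (k\<^sup>2) * exp (- \<i> * complex_of_real (k\<^sup>2) * (complex_of_real x - complex_of_real t')))) (at x within {t'..t})"
        by (rule has_vector_derivative_real_field) (auto intro!: derivative_eq_intros)
      then show "((\<lambda>r. ?e r t') has_vector_derivative - \<i> * complex_of_real (k\<^sup>2) * ?e x t') (at x within {t'..t})"
        by (simp add: mult.assoc)
    qed (intro continuous_intros)
    finally show ?thesis using True by (simp add: left_diff_distrib)
  next
    case False
    then have n: "\<not> (0 \<le> t' \<and> t' \<le> r \<and> r \<le> t)" for r by linarith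
    have z: "(\<lambda>r. ?K r t') = (\<lambda>r. 0)" by (rule ext, rule if_not_P, rule n)
    show ?thesis unfolding if_not_P[OF False] by (simp only: z) simp
  qed
  have i1: "integrable lborel (\<lambda>t'. if 0 \<le> t' \<and> t' \<le> t then ?e t t' * f k t' else 0)"
    by (rule Bochner_Integration.integrable_bound[OF i]) (auto simp: norm_mult)
  have i2: "integrable lborel (\<lambda>t'. if 0 \<le> t' \<and> t' \<le> t then f k t' else 0)"
    by (rule Bochner_Integration.integrable_bound[OF i]) auto
  have "(LINT r|lborel. LINT t'|lborel. ?K r t') = du f k t - (LINT t'|lborel. (if 0 \<le> t' \<and> t' \<le> t then f k t' else 0))"
    unfolding fub[symmetric] r2 Bochner_Integration.integral_diff[OF i1 i2] du_def ..
  then have e: "(LINT r|lborel. (if 0 \<le> r \<and> r \<le> t then - \<i> * complex_of_real (k\<^sup>2) * du f k r else 0)) = du f k t - (LINT t'|lborel. (if 0 \<le> t' \<and> t' \<le> t then f k t' else 0))"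
    unfolding r1 .
  have dub: "cmod (du f k r) \<le> (LINT t'|lborel. cmod (f k t'))" for r
  proof -
    have "ennreal (cmod (du f k r)) \<le> ennreal (LINT t'|lborel. cmod (f k t'))"
      using du_bound[of k r] i by (subst (asm) nn_integral_eq_integral) auto
    then show ?thesis by (simp add: ennreal_le_iff integral_nonneg_AE)
  qed
  have [measurable]: "du f k \<in> borel_measurable borel"
  proof -
    have "(\<lambda>t. case_prod (du f) (k, t)) \<in> borel_measurable borel" by measurable
    then show ?thesis by simp
  qed
  have i3: "integrable lborel (\<lambda>r. if 0 \<le> r \<and> r \<le> t then - \<i> * complex_of_real (k\<^sup>2) * du f k r else 0)"
  proof (rule Bochner_Integration.integrable_bound[where f = "\<lambda>r. indicator {0..max 0 t} r * (k\<^sup>2 * (LINT t'|lborel. cmod (f k t')))"])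
    show "integrable lborel (\<lambda>r. indicator {0..max 0 t} r * (k\<^sup>2 * (LINT t'|lborel. cmod (f k t'))))"
      by (intro integrable_mult_left integrable_real_indicator) auto
    show "AE r in lborel. norm (if 0 \<le> r \<and> r \<le> t then - \<i> * complex_of_real (k\<^sup>2) * du f k r else 0) \<le> norm (indicator {0..max 0 t} r * (k\<^sup>2 * (LINT t'|lborel. cmod (f k t'))))"
      using dub by (intro AE_I2) (auto simp: norm_mult norm_power indicator_def intro!: mult_left_mono intro: order_trans[OF _ abs_ge_self])
  qed measurable
  have "(LINT r|lborel. (if 0 \<le> r \<and> r \<le> t then f k r - \<i> * complex_of_real (k\<^sup>2) * du f k r else 0)) =
    (LINT r|lborel. (if 0 \<le> r \<and> r \<le> t then f k r else 0) + (if 0 \<le> r \<and> r \<le> t then - \<i> * complex_of_real (k\<^sup>2) * du f k r else 0))"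
    by (intro Bochner_Integration.integral_cong) auto
  also have "\<dots> = (LINT r|lborel. (if 0 \<le> r \<and> r \<le> t then f k r else 0)) + (LINT r|lborel. (if 0 \<le> r \<and> r \<le> t then - \<i> * complex_of_real (k\<^sup>2) * du f k r else 0))"
    by (rule Bochner_Integration.integral_add[OF i2 i3])
  finally show ?thesis unfolding e by simp
qed

end

text \<open>The summands belong to the two terms of f - i k^2 u in \<open>DD_bound\<close>; each
  carries a factor 2 from squaring a sum.\<close>

definition time_H1_const :: real where
  "time_H1_const = 2 * weight_mass (3 / 2) + 2 * kato_const"

lemma kato_const_nonneg: "kato_const \<ge> 0"
  unfolding kato_const_def by simp

text \<open>The time derivative contains k^2 times \<open>du f k t\<close>, which need not be
  integrable in k for general data. Bounded frequency support makes these integrals converge, and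
  the estimates obtained do not involve \<open>R\<close>.\<close>

locale time_data_bounded = time_data +
  fixes R :: real
  assumes R0: "R \<ge> 0" and f_supp: "\<bar>k\<bar> > R \<Longrightarrow> f k t = 0"
begin

text \<open>The time derivative of \<open>dA f y\<close> on [0,T], expressed through the
  differential equation of \<open>du_ode\<close>.\<close>

definition DD :: "real \<Rightarrow> real \<Rightarrow> complex" where
  "DD y r = (if 0 \<le> r \<and> r \<le> T then LINT k|lborel. exp (\<i> * complex_of_real (k * y)) * (f k r - \<i> * complex_of_real (k\<^sup>2) * du f k r) else 0)"

lemma DD_meas [measurable]: "DD y \<in> borel_measurable borel"
  unfolding DD_def[abs_def] by measurable

lemma k2du_bound: "ennreal (cmod (complex_of_real (k\<^sup>2) * du f k r)) \<le> ennreal (R\<^sup>2) * (\<integral>\<^sup>+t'. ennreal (cmod (f k t')) \<partial>lborel)"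
proof (cases "\<bar>k\<bar> \<le> R")
  case True
  then have "k\<^sup>2 \<le> R\<^sup>2" using R0 by (metis abs_le_square_iff abs_of_nonneg)
  have "ennreal (cmod (complex_of_real (k\<^sup>2) * du f k r)) = ennreal (k\<^sup>2) * ennreal (cmod (du f k r))"
    by (subst ennreal_mult[symmetric]) (auto simp: norm_mult norm_power)
  also have "\<dots> \<le> ennreal (R\<^sup>2) * (\<integral>\<^sup>+t'. ennreal (cmod (f k t')) \<partial>lborel)"
    using \<open>k\<^sup>2 \<le> R\<^sup>2\<close> by (intro mult_mono du_bound ennreal_leI) auto
  finally show ?thesis .
next
  case False
  then have "du f k r = 0" unfolding du_def using f_supp by (simp cong: if_cong)
  then show ?thesis by simp
qed

lemma DD_pair_integrable:
  "integrable (lborel \<Otimes>\<^sub>M lborel) (\<lambda>(k, r). (if 0 \<le> r \<and> r \<le> t then exp (\<i> * complex_of_real (k * y)) * (f k r - \<i> * complex_of_real (k\<^sup>2) * du f k r) else 0))"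
proof (rule integrable_pair_nn)
  show "(\<lambda>(k, r). (if 0 \<le> r \<and> r \<le> t then exp (\<i> * complex_of_real (k * y)) * (f k r - \<i> * complex_of_real (k\<^sup>2) * du f k r) else 0)) \<in> borel_measurable (borel \<Otimes>\<^sub>M borel)"
    by measurable
  have "(\<integral>\<^sup>+r. \<integral>\<^sup>+k. ennreal (cmod (if 0 \<le> r \<and> r \<le> t then exp (\<i> * complex_of_real (k * y)) * (f k r - \<i> * complex_of_real (k\<^sup>2) * du f k r) else 0)) \<partial>lborel \<partial>lborel)
    \<le> (\<integral>\<^sup>+r. (\<integral>\<^sup>+k. ennreal (cmod (f k r)) \<partial>lborel) + indicator {0..max 0 t} r * (ennreal (R\<^sup>2) * mass f) \<partial>lborel)"
  proof (rule nn_integral_mono)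
    fix r
    show "(\<integral>\<^sup>+k. ennreal (cmod (if 0 \<le> r \<and> r \<le> t then exp (\<i> * complex_of_real (k * y)) * (f k r - \<i> * complex_of_real (k\<^sup>2) * du f k r) else 0)) \<partial>lborel) \<le>
      (\<integral>\<^sup>+k. ennreal (cmod (f k r)) \<partial>lborel) + indicator {0..max 0 t} r * (ennreal (R\<^sup>2) * mass f)"
    proof (cases "0 \<le> r \<and> r \<le> t")
      case True
      have "(\<integral>\<^sup>+k. ennreal (cmod (if 0 \<le> r \<and> r \<le> t then exp (\<i> * complex_of_real (k * y)) * (f k r - \<i> * complex_of_real (k\<^sup>2) * du f k r) else 0)) \<partial>lborel)
        \<le> (\<integral>\<^sup>+k. ennreal (cmod (f k r)) + ennreal (R\<^sup>2) * (\<integral>\<^sup>+t'. ennreal (cmod (f k t')) \<partial>lborel) \<partial>lborel)"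
      proof (rule nn_integral_mono)
        fix k
        have "cmod (if 0 \<le> r \<and> r \<le> t then exp (\<i> * complex_of_real (k * y)) * (f k r - \<i> * complex_of_real (k\<^sup>2) * du f k r) else 0) \<le> cmod (f k r - \<i> * (complex_of_real (k\<^sup>2) * du f k r))"
          by (simp add: norm_mult mult.assoc)
        also have "\<dots> \<le> cmod (f k r) + cmod (\<i> * (complex_of_real (k\<^sup>2) * du f k r))" by (rule norm_triangle_ineq4)
        also have "\<dots> = cmod (f k r) + cmod (complex_of_real (k\<^sup>2) * du f k r)" by (simp only: norm_mult norm_ii mult_1_left)
        finally have "ennreal (cmod (if 0 \<le> r \<and> r \<le> t then exp (\<i> * complex_of_real (k * y)) * (f k r - \<i> * complex_of_real (k\<^sup>2) * du f k r) else 0)) \<le> ennreal (cmod (f k r) + cmod (complex_of_real (k\<^sup>2) * du f k r))"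
          by (rule ennreal_leI)
        also have "\<dots> = ennreal (cmod (f k r)) + ennreal (cmod (complex_of_real (k\<^sup>2) * du f k r))" by (rule ennreal_plus) auto
        also have "\<dots> \<le> ennreal (cmod (f k r)) + ennreal (R\<^sup>2) * (\<integral>\<^sup>+t'. ennreal (cmod (f k t')) \<partial>lborel)"
          by (intro add_mono k2du_bound order_refl)
        finally show "ennreal (cmod (if 0 \<le> r \<and> r \<le> t then exp (\<i> * complex_of_real (k * y)) * (f k r - \<i> * complex_of_real (k\<^sup>2) * du f k r) else 0)) \<le>
          ennreal (cmod (f k r)) + ennreal (R\<^sup>2) * (\<integral>\<^sup>+t'. ennreal (cmod (f k t')) \<partial>lborel)" .
      qed
      also have "\<dots> = (\<integral>\<^sup>+k. ennreal (cmod (f k r)) \<partial>lborel) + (\<integral>\<^sup>+k. ennreal (R\<^sup>2) * (\<integral>\<^sup>+t'. ennreal (cmod (f k t')) \<partial>lborel) \<partial>lborel)"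
        by (rule nn_integral_add) measurable
      also have "(\<integral>\<^sup>+k. ennreal (R\<^sup>2) * (\<integral>\<^sup>+t'. ennreal (cmod (f k t')) \<partial>lborel) \<partial>lborel) = ennreal (R\<^sup>2) * mass f"
        unfolding mass_def by (rule nn_integral_cmult) measurable
      finally show ?thesis using True by simp
    next
      case False
      then show ?thesis unfolding if_not_P[OF False] by simp
    qed
  qed
  also have "\<dots> = (\<integral>\<^sup>+r. (\<integral>\<^sup>+k. ennreal (cmod (f k r)) \<partial>lborel) \<partial>lborel) + (\<integral>\<^sup>+r. indicator {0..max 0 t} r * (ennreal (R\<^sup>2) * mass f) \<partial>lborel)"
    by (rule nn_integral_add) measurable
  also have "\<dots> = mass f + ennreal (max 0 t) * (ennreal (R\<^sup>2) * mass f)"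
    unfolding mass_swap by (subst nn_integral_multc) auto
  also have "\<dots> < \<infinity>" using mass_finite by (simp add: ennreal_mult_less_top)
  finally show "(\<integral>\<^sup>+r. \<integral>\<^sup>+k. ennreal (cmod (if 0 \<le> r \<and> r \<le> t then exp (\<i> * complex_of_real (k * y)) * (f k r - \<i> * complex_of_real (k\<^sup>2) * du f k r) else 0)) \<partial>lborel \<partial>lborel) < \<infinity>" .
qed

lemma DD_slice: "(LINT k|lborel. (if 0 \<le> r \<and> r \<le> t then exp (\<i> * complex_of_real (k * y)) * (f k r - \<i> * complex_of_real (k\<^sup>2) * du f k r) else 0))
    = (if 0 \<le> r \<and> r \<le> t then DD y r else 0)" if "t \<le> T" for r t y
proof (cases "0 \<le> r \<and> r \<le> t")
  case True
  then have T: "0 \<le> r \<and> r \<le> T" using that by linarith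
  show ?thesis unfolding DD_def if_P[OF True] if_P[OF T] ..
next
  case False
  show ?thesis unfolding if_not_P[OF False] by simp
qed

lemma DD_integrable: "integrable lborel (DD y)"
proof -
  have "integrable lborel (\<lambda>r. LINT k|lborel. (if 0 \<le> r \<and> r \<le> T then exp (\<i> * complex_of_real (k * y)) * (f k r - \<i> * complex_of_real (k\<^sup>2) * du f k r) else 0))"
    using lborel_pair.integrable_snd[OF DD_pair_integrable[of T y]] .
  moreover have "(\<lambda>r. if 0 \<le> r \<and> r \<le> T then DD y r else 0) = DD y" by (auto simp: DD_def)
  ultimately show ?thesis unfolding DD_slice[OF order_refl] by simp
qed

text \<open>\<open>du_ode\<close> is integrated over k and the integrals are exchanged. The equation
  holds for almost every k only, namely where \<open>f k\<close> is integrable in time.\<close>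

lemma dcut_primitive:
  "dcut T f y t = (if 0 \<le> t \<and> t \<le> T then LINT r|lborel. (if 0 \<le> r \<and> r \<le> t then DD y r else 0) else 0)"
proof (cases "0 \<le> t \<and> t \<le> T")
  case True
  let ?g = "\<lambda>k r. (if 0 \<le> r \<and> r \<le> t then exp (\<i> * complex_of_real (k * y)) * (f k r - \<i> * complex_of_real (k\<^sup>2) * du f k r) else 0)"
  have "dA f y t = (LINT k|lborel. LINT r|lborel. ?g k r)"
    unfolding dA_def
  proof (rule integral_cong_AE)
    show "AE k in lborel. exp (\<i> * complex_of_real (k * y)) * du f k t = (LINT r|lborel. ?g k r)"
      using AE_integrable_time
    proof eventually_elim
      case (elim k)
      have g: "?g k r = exp (\<i> * complex_of_real (k * y)) * (if 0 \<le> r \<and> r \<le> t then f k r - \<i> * complex_of_real (k\<^sup>2) * du f k r else 0)" for r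
        by simp
      show ?case unfolding g integral_mult_right_zero by (subst du_ode[OF elim]) (rule refl)
    qed
  qed measurable
  also have "\<dots> = (LINT r|lborel. LINT k|lborel. ?g k r)"
    by (rule lborel_pair.Fubini_integral[OF DD_pair_integrable, symmetric])
  also have "\<dots> = (LINT r|lborel. (if 0 \<le> r \<and> r \<le> t then DD y r else 0))"
    using True by (simp only: DD_slice)
  finally show ?thesis unfolding dcut_def if_P[OF True] .
next
  case False
  show ?thesis unfolding dcut_def if_not_P[OF False] ..
qed

text \<open>The term \<open>f\<close> is bounded at each time by the embedding, as 3/2 > 1/2. The
  term k^2 u is the Duhamel integral of the data k^2 f, which Kato smoothing bounds by these data
  with exponent -1/2; the squared factor k^2 adds at most 2 to the exponent and gives 3/2.\<close>

lemma DD_bound: "(\<integral>\<^sup>+r. ennreal ((cmod (DD y r))\<^sup>2) \<partial>lborel) \<le> ennreal time_H1_const * wnorm (3 / 2) f"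
proof -
  define f2 where "f2 k t = complex_of_real (k\<^sup>2) * f k t" for k t
  have f2m[measurable]: "case_prod f2 \<in> borel_measurable (borel \<Otimes>\<^sub>M borel)" unfolding f2_def[abs_def] by measurable
  have k2: "k\<^sup>2 \<le> R\<^sup>2" if "f k t \<noteq> 0" for k t
  proof -
    have "\<bar>k\<bar> \<le> R" using f_supp[of k t] that by force
    then show ?thesis using R0 by (metis abs_le_square_iff abs_of_nonneg)
  qed
  have f2i: "integrable (lborel \<Otimes>\<^sub>M lborel) (case_prod f2)"
  proof (rule Bochner_Integration.integrable_bound[where f = "\<lambda>z. R\<^sup>2 * cmod (case_prod f z)"])
    show "integrable (lborel \<Otimes>\<^sub>M lborel) (\<lambda>z. R\<^sup>2 * cmod (case_prod f z))" using f_int by simp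
    have "cmod (f2 k t) \<le> R\<^sup>2 * cmod (f k t)" for k t
      using k2[of k t] by (cases "f k t = 0") (auto simp: f2_def norm_mult norm_power intro!: mult_right_mono)
    then show "AE z in lborel \<Otimes>\<^sub>M lborel. norm (case_prod f2 z) \<le> norm (R\<^sup>2 * cmod (case_prod f z))"
      by (intro AE_I2) (auto simp: case_prod_beta' abs_mult)
  qed measurable
  \<comment> \<open>Bounded frequency support keeps k^2 f integrable, so the data k^2 f are
    admissible for Kato smoothing as well.\<close>
  interpret g2: time_data T f2
    using T0 T1 f2m f2i f_out by unfold_locales (auto simp: f2_def)
  have du2: "du f2 k t = complex_of_real (k\<^sup>2) * du f k t" for k t
    unfolding du_def f2_def integral_mult_right_zero[symmetric]
    by (intro Bochner_Integration.integral_cong) auto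
  define E where "E r = (LINT k|lborel. exp (\<i> * complex_of_real (k * y)) * f k r)" for r
  have [measurable]: "E \<in> borel_measurable borel" unfolding E_def[abs_def] by measurable
  have Eb: "ennreal ((cmod (E r))\<^sup>2) \<le> ennreal (weight_mass (3 / 2)) * (\<integral>\<^sup>+k. ennreal (sob_weight (3 / 2) k * (cmod (f k r))\<^sup>2) \<partial>lborel)" for r
  proof -
    have "ennreal (cmod (E r)) \<le> (\<integral>\<^sup>+k. ennreal (cmod (f k r)) \<partial>lborel)"
      unfolding E_def by (rule order_trans[OF ennreal_norm_integral]) (auto intro!: nn_integral_mono simp: norm_mult)
    then have "(ennreal (cmod (E r)))\<^sup>2 \<le> (\<integral>\<^sup>+k. ennreal (cmod (f k r)) \<partial>lborel)\<^sup>2" by (intro power_mono) auto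
    also have "\<dots> \<le> ennreal (weight_mass (3 / 2)) * (\<integral>\<^sup>+k. ennreal (sob_weight (3 / 2) k * (cmod (f k r))\<^sup>2) \<partial>lborel)"
      by (rule weight_cauchy_schwarz) auto
    finally show ?thesis by (simp add: ennreal_square)
  qed
  have "AE r in lborel. ennreal ((cmod (DD y r))\<^sup>2) \<le> ennreal 2 * ennreal ((cmod (E r))\<^sup>2) + ennreal 2 * ennreal ((cmod (dcut T f2 y r))\<^sup>2)"
    using AE_integrable_space
  proof eventually_elim
    case (elim r)
    show ?case
    proof (cases "0 \<le> r \<and> r \<le> T")
      case True
      have i1: "integrable lborel (\<lambda>k. exp (\<i> * complex_of_real (k * y)) * f k r)"
        using integrable_exp_mult[OF elim, of "\<lambda>k. - (k * y)"] by simp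
      have i2: "integrable lborel (\<lambda>k. exp (\<i> * complex_of_real (k * y)) * du f2 k r)"
        using integrable_exp_mult[OF g2.du_integrable, of "\<lambda>k. - (k * y)"] by simp
      have "DD y r = (LINT k|lborel. exp (\<i> * complex_of_real (k * y)) * f k r - \<i> * (exp (\<i> * complex_of_real (k * y)) * du f2 k r))"
        unfolding DD_def if_P[OF True] du2 by (intro Bochner_Integration.integral_cong refl) (simp add: algebra_simps)
      also have "\<dots> = E r - \<i> * dcut T f2 y r"
        unfolding Bochner_Integration.integral_diff[OF i1 integrable_mult_right[OF i2]] integral_mult_right_zero
        unfolding E_def dcut_def if_P[OF True] dA_def ..
      finally have "(cmod (DD y r))\<^sup>2 \<le> 2 * (cmod (E r))\<^sup>2 + 2 * (cmod (\<i> * dcut T f2 y r))\<^sup>2" by (simp only: cmod_diff_square)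
      then have "ennreal ((cmod (DD y r))\<^sup>2) \<le> ennreal (2 * (cmod (E r))\<^sup>2 + 2 * (cmod (dcut T f2 y r))\<^sup>2)"
        by (intro ennreal_leI) (simp add: norm_mult)
      also have "\<dots> = ennreal (2 * (cmod (E r))\<^sup>2) + ennreal (2 * (cmod (dcut T f2 y r))\<^sup>2)" by (rule ennreal_plus) auto
      also have "\<dots> = ennreal 2 * ennreal ((cmod (E r))\<^sup>2) + ennreal 2 * ennreal ((cmod (dcut T f2 y r))\<^sup>2)"
        by (intro arg_cong2[where f = "(+)"] ennreal_mult) auto
      finally show ?thesis .
    next
      case False
      have "DD y r = 0" unfolding DD_def by (rule if_not_P[OF False])
      then show ?thesis by simp
    qed
  qed
  then have "(\<integral>\<^sup>+r. ennreal ((cmod (DD y r))\<^sup>2) \<partial>lborel) \<le> (\<integral>\<^sup>+r. ennreal 2 * ennreal ((cmod (E r))\<^sup>2) + ennreal 2 * ennreal ((cmod (dcut T f2 y r))\<^sup>2) \<partial>lborel)"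
    by (rule nn_integral_mono_AE)
  also have "\<dots> = (\<integral>\<^sup>+r. ennreal 2 * ennreal ((cmod (E r))\<^sup>2) \<partial>lborel) + (\<integral>\<^sup>+r. ennreal 2 * ennreal ((cmod (dcut T f2 y r))\<^sup>2) \<partial>lborel)"
    by (rule nn_integral_add) measurable
  also have "(\<integral>\<^sup>+r. ennreal 2 * ennreal ((cmod (E r))\<^sup>2) \<partial>lborel) \<le> (\<integral>\<^sup>+r. ennreal 2 * (ennreal (weight_mass (3 / 2)) * (\<integral>\<^sup>+k. ennreal (sob_weight (3 / 2) k * (cmod (f k r))\<^sup>2) \<partial>lborel)) \<partial>lborel)"
    by (intro nn_integral_mono mult_left_mono Eb) auto
  also have "\<dots> = ennreal 2 * (\<integral>\<^sup>+r. ennreal (weight_mass (3 / 2)) * (\<integral>\<^sup>+k. ennreal (sob_weight (3 / 2) k * (cmod (f k r))\<^sup>2) \<partial>lborel) \<partial>lborel)"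
    by (rule nn_integral_cmult) measurable
  also have "(\<integral>\<^sup>+r. ennreal (weight_mass (3 / 2)) * (\<integral>\<^sup>+k. ennreal (sob_weight (3 / 2) k * (cmod (f k r))\<^sup>2) \<partial>lborel) \<partial>lborel) = ennreal (weight_mass (3 / 2)) * wnorm (3 / 2) f"
    unfolding wnorm_def by (rule nn_integral_cmult) measurable
  also have "(\<integral>\<^sup>+r. ennreal 2 * ennreal ((cmod (dcut T f2 y r))\<^sup>2) \<partial>lborel) = ennreal 2 * (\<integral>\<^sup>+r. ennreal ((cmod (dcut T f2 y r))\<^sup>2) \<partial>lborel)"
    by (rule nn_integral_cmult) measurable
  also have "\<dots> \<le> ennreal 2 * (ennreal kato_const * wnorm (3 / 2) f)"
  proof -
    have "wnorm (- 1 / 2) f2 \<le> wnorm (3 / 2) f"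
      unfolding wnorm_def
    proof (intro nn_integral_mono ennreal_leI)
      fix t k
      have "sob_weight (- 1 / 2) k * (k\<^sup>2)\<^sup>2 \<le> sob_weight (- 1 / 2) k * (1 + k\<^sup>2)\<^sup>2"
        by (intro mult_left_mono power_mono) auto
      also have "(1 + k\<^sup>2)\<^sup>2 = sob_weight 2 k" unfolding sob_weight_def using powr_realpow[of "1 + k\<^sup>2" 2] one_plus_norm_pos[of k] by simp
      also have "sob_weight (- 1 / 2) k * sob_weight 2 k = sob_weight (3 / 2) k" by (simp only: sob_weight_def powr_add[symmetric]) simp
      finally have "sob_weight (- 1 / 2) k * (k\<^sup>2)\<^sup>2 \<le> sob_weight (3 / 2) k" .
      from mult_right_mono[OF this, of "(cmod (f k t))\<^sup>2"]
      show "sob_weight (- 1 / 2) k * (cmod (f2 k t))\<^sup>2 \<le> sob_weight (3 / 2) k * (cmod (f k t))\<^sup>2"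
        by (simp add: f2_def norm_mult norm_power power_mult_distrib mult.assoc)
    qed
    then show ?thesis by (intro mult_left_mono order_trans[OF g2.kato_duhamel]) auto
  qed
  finally have "(\<integral>\<^sup>+r. ennreal ((cmod (DD y r))\<^sup>2) \<partial>lborel) \<le> ennreal 2 * (ennreal (weight_mass (3 / 2)) * wnorm (3 / 2) f) + ennreal 2 * (ennreal kato_const * wnorm (3 / 2) f)"
    by (simp add: add_mono)
  also have "\<dots> = (ennreal 2 * ennreal (weight_mass (3 / 2)) + ennreal 2 * ennreal kato_const) * wnorm (3 / 2) f"
    by (simp only: distrib_right mult.assoc)
  also have "ennreal 2 * ennreal (weight_mass (3 / 2)) + ennreal 2 * ennreal kato_const = ennreal time_H1_const"
  proof -
    have "ennreal 2 * ennreal (weight_mass (3 / 2)) = ennreal (2 * weight_mass (3 / 2))"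
      by (rule ennreal_mult[symmetric]) (use weight_mass_nonneg in auto)
    moreover have "ennreal 2 * ennreal kato_const = ennreal (2 * kato_const)"
      by (rule ennreal_mult[symmetric]) (use kato_const_nonneg in auto)
    ultimately show ?thesis unfolding time_H1_const_def
      using weight_mass_nonneg[of "3/2"] kato_const_nonneg by (simp only: ennreal_plus mult_nonneg_nonneg zero_le_numeral)
  qed
  finally show ?thesis .
qed

lemma time_H1:
  "(\<integral>\<^sup>+\<tau>. ennreal (\<tau>\<^sup>2 * (cmod (fourier (reflect T (dcut T f y)) \<tau>))\<^sup>2) \<partial>lborel) \<le> ennreal (8 * pi * time_H1_const) * wnorm (3 / 2) f"
proof -
  have "(\<integral>\<^sup>+\<tau>. ennreal (\<tau>\<^sup>2 * (cmod (fourier (reflect T (dcut T f y)) \<tau>))\<^sup>2) \<partial>lborel) \<le> ennreal (8 * pi) * (\<integral>\<^sup>+t. ennreal ((cmod (DD y t))\<^sup>2) \<partial>lborel)"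
    by (rule reflect_H1[OF less_imp_le[OF T0] DD_integrable _ dcut_primitive dcut_integrable]) (auto simp: DD_def)
  also have "\<dots> \<le> ennreal (8 * pi) * (ennreal time_H1_const * wnorm (3 / 2) f)"
    by (intro mult_left_mono DD_bound) auto
  also have "\<dots> = (ennreal (8 * pi) * ennreal time_H1_const) * wnorm (3 / 2) f" by (rule mult.assoc[symmetric])
  also have "ennreal (8 * pi) * ennreal time_H1_const = ennreal (8 * pi * time_H1_const)"
    using weight_mass_nonneg[of "3/2"] kato_const_nonneg by (intro ennreal_mult[symmetric]) (auto simp: time_H1_const_def)
  finally show ?thesis .
qed

end

subsection \<open>Interpolation\<close>

definition vhat :: "real \<Rightarrow> (real \<Rightarrow> real \<Rightarrow> complex) \<Rightarrow> real \<Rightarrow> real \<Rightarrow> complex" where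
  "vhat T f y = fourier (reflect T (dcut T f y))"

lemma (in time_data) vhat_measurable [measurable]: "vhat T f y \<in> borel_measurable borel"
  unfolding vhat_def by (intro fourier_measurable) (simp add: borel_measurable_integrable[OF fourier_reflect(1)[OF dcut_integrable], simplified])

lemma (in time_data) vhat_L2:
  "(\<integral>\<^sup>+\<tau>. ennreal ((cmod (vhat T f y \<tau>))\<^sup>2) \<partial>lborel) \<le> ennreal (8 * pi * kato_const) * wnorm (- 1 / 2) f"
proof -
  have "(\<integral>\<^sup>+\<tau>. ennreal ((cmod (vhat T f y \<tau>))\<^sup>2) \<partial>lborel) \<le> ennreal (8 * pi) * (\<integral>\<^sup>+t. ennreal ((cmod (dcut T f y t))\<^sup>2) \<partial>lborel)"
    unfolding vhat_def by (rule reflect_L2[OF dcut_integrable])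
  also have "\<dots> \<le> ennreal (8 * pi) * (ennreal kato_const * wnorm (- 1 / 2) f)"
    by (intro mult_left_mono kato_duhamel) auto
  also have "\<dots> = (ennreal (8 * pi) * ennreal kato_const) * wnorm (- 1 / 2) f" by (rule mult.assoc[symmetric])
  also have "ennreal (8 * pi) * ennreal kato_const = ennreal (8 * pi * kato_const)"
    using kato_const_nonneg by (intro ennreal_mult[symmetric]) auto
  finally show ?thesis .
qed

text \<open>A crude bound uniform in \<tau>; in \<open>time_endpoint\<close> it shows that the
  high-frequency part disappears pointwise in the limit.\<close>

lemma (in time_data) vhat_mass: "ennreal (cmod (vhat T f y \<tau>)) \<le> 2 * mass f"
proof -
  have "ennreal (cmod (vhat T f y \<tau>)) \<le> (\<integral>\<^sup>+t. ennreal (cmod (reflect T (dcut T f y) t)) \<partial>lborel)"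
    unfolding vhat_def fourier_def
    by (rule order_trans[OF ennreal_norm_integral]) (auto intro!: nn_integral_mono simp: norm_mult)
  also have "\<dots> \<le> (\<integral>\<^sup>+t. indicator {0..T} t * mass f + indicator {T..2*T} t * mass f \<partial>lborel)"
  proof (rule nn_integral_mono)
    fix t
    have b: "ennreal (cmod (dcut T f y r)) \<le> indicator {0..T} r * mass f" for r
      using dA_bound by (auto simp: dcut_def indicator_def)
    have "ennreal (cmod (reflect T (dcut T f y) t)) \<le> ennreal (cmod (dcut T f y t) + cmod (dcut T f y (2 * T - t)))"
      unfolding reflect_def by (intro ennreal_leI norm_triangle_ineq)
    also have "\<dots> = ennreal (cmod (dcut T f y t)) + ennreal (cmod (dcut T f y (2 * T - t)))" by (rule ennreal_plus) auto
    also have "\<dots> \<le> indicator {0..T} t * mass f + indicator {0..T} (2 * T - t) * mass f" by (intro add_mono b)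
    also have "(indicator {0..T} (2 * T - t) :: ennreal) = indicator {T..2*T} t" by (auto simp: indicator_def)
    finally show "ennreal (cmod (reflect T (dcut T f y) t)) \<le> indicator {0..T} t * mass f + indicator {T..2*T} t * mass f" .
  qed
  also have "\<dots> = ennreal T * mass f + ennreal T * mass f"
    using T0 by (subst nn_integral_add, simp, simp, subst nn_integral_multc, simp, subst nn_integral_multc, simp, simp)
  also have "\<dots> \<le> 1 * mass f + 1 * mass f" using T1 T0 by (intro add_mono mult_right_mono) auto
  finally show ?thesis by (simp add: mult_2)
qed

text \<open>Additivity of the Bochner integral needs both summands integrable. For the time integral
  in \<open>du\<close> this is known for almost every k, so the sum formula is obtained almost
  everywhere in k first and everywhere only after integration over k.\<close>

lemma vhat_add:
  assumes "time_data T f" "time_data T g"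
  shows "vhat T (\<lambda>k t. f k t + g k t) y \<tau> = vhat T f y \<tau> + vhat T g y \<tau>"
proof -
  interpret f: time_data T f by fact
  interpret g: time_data T g by fact
  have m: "case_prod (\<lambda>k t. f k t + g k t) \<in> borel_measurable (borel \<Otimes>\<^sub>M borel)"
    unfolding case_prod_beta' by measurable
  have "integrable (lborel \<Otimes>\<^sub>M lborel) (\<lambda>z. case_prod f z + case_prod g z)"
    using f.f_int g.f_int by (rule Bochner_Integration.integrable_add)
  then have i: "integrable (lborel \<Otimes>\<^sub>M lborel) (case_prod (\<lambda>k t. f k t + g k t))" by (simp add: case_prod_beta')
  interpret s: time_data T "\<lambda>k t. f k t + g k t"
    using f.T0 f.T1 m i f.f_out g.f_out by unfold_locales auto
  have du: "AE k in lborel. du (\<lambda>k t. f k t + g k t) k t = du f k t + du g k t" for t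
    using f.AE_integrable_time g.AE_integrable_time
  proof eventually_elim
    case (elim k)
    let ?e = "\<lambda>t'. exp (- \<i> * complex_of_real (k\<^sup>2 * (t - t')))"
    have i1: "integrable lborel (\<lambda>t'. if 0 \<le> t' \<and> t' \<le> t then ?e t' * f k t' else 0)"
      by (rule Bochner_Integration.integrable_bound[OF elim(1)]) (auto simp: norm_mult)
    have i2: "integrable lborel (\<lambda>t'. if 0 \<le> t' \<and> t' \<le> t then ?e t' * g k t' else 0)"
      by (rule Bochner_Integration.integrable_bound[OF elim(2)]) (auto simp: norm_mult)
    show ?case unfolding du_def Bochner_Integration.integral_add[OF i1 i2, symmetric]
      by (intro Bochner_Integration.integral_cong) (auto simp: distrib_left)
  qed
  have dA: "dA (\<lambda>k t. f k t + g k t) y t = dA f y t + dA g y t" for t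
  proof -
    have e: "integrable lborel (\<lambda>k. exp (\<i> * complex_of_real (k * y)) * b k)" if "integrable lborel b" for b
      using integrable_exp_mult[OF that, of "\<lambda>k. - (k * y)"] by simp
    have "dA (\<lambda>k t. f k t + g k t) y t = (LINT k|lborel. exp (\<i> * complex_of_real (k * y)) * du f k t + exp (\<i> * complex_of_real (k * y)) * du g k t)"
      unfolding dA_def
    proof (rule integral_cong_AE)
      show "AE k in lborel. exp (\<i> * complex_of_real (k * y)) * du (\<lambda>k t. f k t + g k t) k t = exp (\<i> * complex_of_real (k * y)) * du f k t + exp (\<i> * complex_of_real (k * y)) * du g k t"
        using du[of t] by eventually_elim (simp add: distrib_left)
    qed measurable
    then show ?thesis unfolding dA_def
      by (simp only: Bochner_Integration.integral_add[OF e[OF f.du_integrable] e[OF g.du_integrable]])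
  qed
  have r: "reflect T (dcut T (\<lambda>k t. f k t + g k t) y) t = reflect T (dcut T f y) t + reflect T (dcut T g y) t" for t
    unfolding reflect_def dcut_def dA by auto
  have e: "integrable lborel (\<lambda>t. exp (- \<i> * complex_of_real (\<tau> \<bullet> t)) * b t)" if "integrable lborel b" for b
    using integrable_exp_mult[OF that, of "\<lambda>t. \<tau> \<bullet> t"] by simp
  show ?thesis
    unfolding vhat_def fourier_def r distrib_left
    by (rule Bochner_Integration.integral_add[OF e[OF fourier_reflect(1)[OF f.dcut_integrable]] e[OF fourier_reflect(1)[OF g.dcut_integrable]]])
qed

definition lowfreq :: "real \<Rightarrow> (real \<Rightarrow> real \<Rightarrow> complex) \<Rightarrow> real \<Rightarrow> real \<Rightarrow> complex" where
  "lowfreq R f k t = (if \<bar>k\<bar> \<le> R then f k t else 0)"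

definition highfreq :: "real \<Rightarrow> (real \<Rightarrow> real \<Rightarrow> complex) \<Rightarrow> real \<Rightarrow> real \<Rightarrow> complex" where
  "highfreq R f k t = (if \<bar>k\<bar> \<le> R then 0 else f k t)"

context time_data
begin

lemma lowfreq_data:
  assumes "R \<ge> 0" shows "time_data_bounded T (lowfreq R f) R"
proof -
  have m: "case_prod (lowfreq R f) \<in> borel_measurable (borel \<Otimes>\<^sub>M borel)"
    unfolding lowfreq_def[abs_def] case_prod_beta' by measurable
  have "integrable (lborel \<Otimes>\<^sub>M lborel) (case_prod (lowfreq R f))"
    by (rule Bochner_Integration.integrable_bound[OF f_int]) (use m in \<open>auto simp: lowfreq_def\<close>)
  then show ?thesis using assms T0 T1 m f_out by unfold_locales (auto simp: lowfreq_def)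
qed

lemma highfreq_data: "time_data T (highfreq R f)"
proof -
  have m: "case_prod (highfreq R f) \<in> borel_measurable (borel \<Otimes>\<^sub>M borel)"
    unfolding highfreq_def[abs_def] case_prod_beta' by measurable
  have "integrable (lborel \<Otimes>\<^sub>M lborel) (case_prod (highfreq R f))"
    by (rule Bochner_Integration.integrable_bound[OF f_int]) (use m in \<open>auto simp: highfreq_def\<close>)
  then show ?thesis using T0 T1 m f_out by unfold_locales (auto simp: highfreq_def)
qed

lemma vhat_split:
  assumes "R \<ge> 0"
  shows "vhat T f y \<tau> = vhat T (lowfreq R f) y \<tau> + vhat T (highfreq R f) y \<tau>"
proof -
  have "(\<lambda>k t. lowfreq R f k t + highfreq R f k t) = f" by (intro ext) (simp add: lowfreq_def highfreq_def)
  then show ?thesis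
    using vhat_add[OF time_data_bounded.axioms(1)[OF lowfreq_data[OF assms]] highfreq_data[of R], of y \<tau>] by simp
qed

lemma wnorm_mono: "r \<le> s \<Longrightarrow> wnorm r f \<le> wnorm s f"
  unfolding wnorm_def by (intro nn_integral_mono ennreal_leI mult_right_mono sob_weight_mono) auto

end

lemma lowfreq_wnorm_le: "wnorm r (lowfreq R f) \<le> wnorm r f"
  unfolding wnorm_def by (intro nn_integral_mono ennreal_leI mult_left_mono) (auto simp: lowfreq_def)

lemma sum_two_sided_geometric:
  fixes \<theta> :: real
  assumes "0 < \<theta>" "\<theta> < 1"
  defines "h J j \<equiv> (if J \<le> j then \<theta> ^ (j - J) else \<theta> ^ (J - j))"
  shows "summable (h J)" "suminf (h J) \<le> 2 / (1 - \<theta>)"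
proof -
  have s: "(\<lambda>j. h J (j + J)) = (\<lambda>j. \<theta> ^ j)" by (auto simp: h_def)
  have g: "summable (\<lambda>j. \<theta> ^ j)" using assms by (intro summable_geometric) auto
  show sm: "summable (h J)" using g s by (metis summable_iff_shift)
  have "suminf (h J) = (\<Sum>j. h J (j + J)) + (\<Sum>j<J. h J j)" by (rule suminf_split_initial_segment[OF sm])
  also have "(\<Sum>j. h J (j + J)) = 1 / (1 - \<theta>)" unfolding s using assms by (intro suminf_geometric) auto
  also have "(\<Sum>j<J. h J j) \<le> 1 / (1 - \<theta>)"
  proof -
    have "(\<Sum>j<J. h J j) \<le> (\<Sum>j<J. \<theta> ^ (J - Suc j))"
    proof (rule sum_mono)
      fix j assume "j \<in> {..<J}"
      then have "h J j = \<theta> ^ (J - j)" "J - Suc j \<le> J - j" by (auto simp: h_def)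
      then show "h J j \<le> \<theta> ^ (J - Suc j)" using assms by (simp add: power_decreasing)
    qed
    also have "\<dots> = (\<Sum>j<J. \<theta> ^ j)" by (rule sum.nat_diff_reindex)
    also have "\<dots> \<le> (\<Sum>j. \<theta> ^ j)" using g assms by (intro sum_le_suminf) auto
    also have "\<dots> = 1 / (1 - \<theta>)" using assms by (intro suminf_geometric) auto
    finally show ?thesis .
  qed
  finally show "suminf (h J) \<le> 2 / (1 - \<theta>)" by simp
qed

text \<open>
  For \<open>\<tau>\<close> of size \<open>4\<^sup>j\<close>, frequencies up to \<open>2\<^sup>j\<close> are treated by the bound on the time derivative, which costs
  \<open>\<tau>\<^sup>-\<^sup>2\<close>, and the others by Kato smoothing.
\<close>

definition dyadic_weight :: "nat \<Rightarrow> real \<Rightarrow> real" where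
  "dyadic_weight j k = (if \<bar>k\<bar> \<le> 2 ^ j then sob_weight (3 / 2) k / 16 ^ j else sob_weight (- 1 / 2) k)"

lemma dyadic_weight_nonneg [simp]: "dyadic_weight j k \<ge> 0"
  by (simp add: dyadic_weight_def)

text \<open>For fixed k the terms peak near the index J with 2^J about |k|, where both branches are
  of size (1 + k^2)^s at most up to a constant. To the right of J they decay with ratio q =
  2^(2s-3), to the left with ratio 2^(-2s-1), so the sum is controlled by the peak. That q < 1 uses
  s < 3/2, which is why the endpoint is treated separately.\<close>

lemma dyadic_sum:
  assumes s: "0 \<le> s" "s < 3 / 2"
  shows "\<exists>K\<ge>0. \<forall>k. (\<Sum>j. ennreal ((2 powr (2 * s + 1)) ^ j * dyadic_weight j k)) \<le> ennreal (K * sob_weight s k)"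
proof -
  define p where "p = 2 * s + 1"
  define P where "P = 2 powr p"
  define q where "q = P / 16"
  define \<theta> where "\<theta> = max q (1 / P)"
  have P: "2 powr 0 < P" "P < 2 powr 4" unfolding P_def p_def by (intro powr_less_mono; use s in simp)+
  then have P1: "1 < P" "P < 16" by auto
  have \<theta>: "0 < \<theta>" "\<theta> < 1" unfolding \<theta>_def q_def using P1 by auto
  have q4: "q = 2 powr (p - 4)" unfolding q_def P_def by (simp add: powr_diff)
  define h where "h J j = (if J \<le> j then \<theta> ^ (j - J) else \<theta> ^ (J - j))" for J j :: nat
  have pw: "(2 powr a) ^ J = (2 ^ J) powr a" for a :: real and J :: nat
  proof -
    have "(2 powr a) ^ J = (2 powr a) powr (real J)" by (rule powr_realpow[symmetric]) simp
    also have "\<dots> = (2 powr real J) powr a" by (simp only: powr_powr mult.commute)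
    also have "2 powr real J = (2::real) ^ J" by (rule powr_realpow) simp
    finally show ?thesis .
  qed
  have main: "(\<Sum>j. ennreal (P ^ j * dyadic_weight j k)) \<le> ennreal (16 * (2 / (1 - \<theta>)) * sob_weight s k)" for k
  proof -
    \<comment> \<open>For |k| <= 1 this is 0 and only the first branch of the weight occurs;
      otherwise 2^(J-1) < |k| <= 2^J.\<close>
    define J where "J = (LEAST j. \<bar>k\<bar> \<le> 2 ^ j)"
    obtain n :: nat where "\<bar>k\<bar> < 2 ^ n" using real_arch_pow[of 2 "\<bar>k\<bar>"] by auto
    then have J: "\<bar>k\<bar> \<le> 2 ^ J" unfolding J_def by (rule LeastI[of "\<lambda>j. \<bar>k\<bar> \<le> 2 ^ j" n, OF less_imp_le])
    have J': "2 ^ j < \<bar>k\<bar>" if "j < J" for j using not_less_Least[of j "\<lambda>j. \<bar>k\<bar> \<le> 2 ^ j"] that unfolding J_def by auto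
    define X where "X = 1 + k\<^sup>2"
    have X1: "X \<ge> 1" unfolding X_def by simp
    have w: "sob_weight r k = X powr r" for r unfolding sob_weight_def X_def by simp
    \<comment> \<open>The first branch at j = J. It comes from (1 + k^2)/2 <= 4^J, which is reversed
      by the negative exponent (p-4)/2; the constant 16 absorbs the resulting power of 2.\<close>
    have a: "q ^ J * X powr (3 / 2) \<le> 16 * X powr s"
    proof -
      have "X / 2 \<le> (2 ^ J)\<^sup>2"
      proof -
        have "k\<^sup>2 \<le> (2 ^ J)\<^sup>2" using J by (metis abs_ge_zero power2_abs power_mono)
        moreover have "1 \<le> ((2::real) ^ J)\<^sup>2" by (simp add: one_le_power)
        moreover have "(1 + a) / 2 \<le> b" if "a \<le> b" "1 \<le> b" for a b :: real using that by simp
        ultimately show ?thesis unfolding X_def by blast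
      qed
      then have "((2 ^ J)\<^sup>2) powr ((p - 4) / 2) \<le> (X / 2) powr ((p - 4) / 2)"
        using X1 s by (intro powr_mono2') (auto simp: p_def)
      moreover have "((2 ^ J)\<^sup>2) powr ((p - 4) / 2) = q ^ J"
      proof -
        have e: "((2::real) ^ J)\<^sup>2 = (2 ^ J) powr (real 2)" by (rule powr_realpow[symmetric]) simp
        have r: "real 2 * ((p - 4) / 2) = p - 4" by (simp add: field_simps)
        show ?thesis unfolding q4 pw e powr_powr r ..
      qed
      moreover have "(X / 2) powr ((p - 4) / 2) \<le> 16 * X powr ((p - 4) / 2)"
      proof -
        have "(X / 2) powr ((p - 4) / 2) = X powr ((p - 4) / 2) * 2 powr ((4 - p) / 2)"
        proof -
          have m: "(4 - p) / 2 = - ((p - 4) / 2)" by (simp only: minus_divide_left minus_diff_eq)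
          show ?thesis unfolding m powr_minus powr_divide by (rule divide_inverse)
        qed
        also have "\<dots> \<le> X powr ((p - 4) / 2) * 2 powr 4" using s by (intro mult_left_mono powr_mono) (auto simp: p_def)
        finally show ?thesis by (simp add: mult.commute)
      qed
      ultimately have "q ^ J \<le> 16 * X powr ((p - 4) / 2)" by simp
      then have "q ^ J * X powr (3 / 2) \<le> 16 * X powr ((p - 4) / 2) * X powr (3 / 2)" by (rule mult_right_mono) simp
      also have "\<dots> = 16 * X powr ((p - 4) / 2 + 3 / 2)" by (simp add: powr_add)
      also have "(p - 4) / 2 + 3 / 2 = s" unfolding p_def by (simp add: field_simps)
      finally show ?thesis .
    qed
    \<comment> \<open>The second branch extrapolated to j = J, from 2^J <= 2 |k| <= 2 sqrt (1 +
      k^2); here P < 16 leads to the same constant.\<close>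
    have b: "P ^ J * X powr (- 1 / 2) \<le> 16 * X powr s" if "J > 0"
    proof -
      have "2 ^ (J - 1) < \<bar>k\<bar>" using J'[of "J - 1"] that by simp
      then have "2 ^ J \<le> 2 * \<bar>k\<bar>" using that by (cases J) auto
      also have "\<bar>k\<bar> \<le> sqrt X" unfolding X_def by (intro real_le_rsqrt) simp
      finally have "2 ^ J \<le> 2 * sqrt X" by simp
      then have "(2 ^ J) powr p \<le> (2 * sqrt X) powr p" using s by (intro powr_mono2) (auto simp: p_def)
      also have "\<dots> = P * X powr (p / 2)"
        using X1 by (simp add: powr_mult P_def powr_half_sqrt[symmetric] powr_powr)
      also have "\<dots> \<le> 16 * X powr (p / 2)" using P1 by (intro mult_right_mono) auto
      finally have "P ^ J \<le> 16 * X powr (p / 2)" unfolding P_def pw .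
      then have "P ^ J * X powr (- 1 / 2) \<le> 16 * X powr (p / 2) * X powr (- 1 / 2)" by (rule mult_right_mono) simp
      also have "\<dots> = 16 * X powr (p / 2 + - 1 / 2)" by (simp only: powr_add mult.assoc)
      also have "p / 2 + - 1 / 2 = s" unfolding p_def by (simp add: field_simps)
      finally show ?thesis .
    qed
    have term_le: "P ^ j * dyadic_weight j k \<le> (16 * sob_weight s k) * h J j" for j
    proof (cases "J \<le> j")
      case True
      have "(2::real) ^ J \<le> 2 ^ j" using True by (intro power_increasing) auto
      then have "\<bar>k\<bar> \<le> 2 ^ j" using J by linarith
      then have "P ^ j * dyadic_weight j k = q ^ j * X powr (3 / 2)"
        by (simp add: dyadic_weight_def w q_def power_divide)
      also have "q ^ j = q ^ (j - J) * q ^ J" using True by (simp add: power_add[symmetric])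
      also have "q ^ (j - J) * q ^ J * X powr (3 / 2) = q ^ (j - J) * (q ^ J * X powr (3 / 2))" by simp
      also have "\<dots> \<le> \<theta> ^ (j - J) * (16 * X powr s)"
      proof (rule mult_mono[OF _ a])
        show "q ^ (j - J) \<le> \<theta> ^ (j - J)" using P1 by (intro power_mono) (auto simp: \<theta>_def q_def)
      qed (use \<theta> P1 in \<open>auto simp: q_def\<close>)
      finally show ?thesis using True by (simp add: h_def w mult_ac)
    next
      case False
      then have "\<not> \<bar>k\<bar> \<le> 2 ^ j" using J'[of j] by simp
      then have d: "P ^ j * dyadic_weight j k = P ^ j * X powr (- 1 / 2)" by (simp add: dyadic_weight_def w)
      have "P ^ J = P ^ (J - j) * P ^ j" using False by (simp add: power_add[symmetric])
      then have e: "P ^ j = (1 / P) ^ (J - j) * P ^ J" using P1 by (simp add: power_divide)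
      have "P ^ j * dyadic_weight j k = (1 / P) ^ (J - j) * (P ^ J * X powr (- 1 / 2))"
        unfolding d by (subst e) (rule mult.assoc)
      also have "\<dots> \<le> \<theta> ^ (J - j) * (16 * X powr s)"
      proof (rule mult_mono[OF _ b])
        show "(1 / P) ^ (J - j) \<le> \<theta> ^ (J - j)" using P1 by (intro power_mono) (auto simp: \<theta>_def)
      qed (use \<theta> P1 False in auto)
      finally show ?thesis using False by (simp add: h_def w mult_ac)
    qed
    note g = sum_two_sided_geometric[OF \<theta>, of J, folded h_def]
    have h0: "0 \<le> h J j" for j using \<theta> by (simp add: h_def)
    have "(\<Sum>j. ennreal (P ^ j * dyadic_weight j k)) \<le> (\<Sum>j. ennreal ((16 * sob_weight s k) * h J j))"
      by (intro suminf_le ennreal_leI term_le) auto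
    also have "\<dots> = ennreal (\<Sum>j. (16 * sob_weight s k) * h J j)"
      using g(1) h0 by (intro suminf_ennreal2 summable_mult) auto
    also have "(\<Sum>j. (16 * sob_weight s k) * h J j) = (16 * sob_weight s k) * suminf (h J)"
      by (rule suminf_mult[OF g(1)])
    also have "ennreal \<dots> \<le> ennreal ((16 * sob_weight s k) * (2 / (1 - \<theta>)))"
      by (intro ennreal_leI mult_left_mono g(2)) auto
    finally show ?thesis by (simp add: mult_ac)
  qed
  show ?thesis
    using main \<theta> unfolding P_def p_def by (intro exI[of _ "16 * (2 / (1 - \<theta>))"]) auto
qed


definition time_const :: real where
  "time_const = 8 * pi * time_H1_const"

lemma time_const: "0 \<le> time_const" "8 * pi * kato_const \<le> time_const"
proof -
  have "kato_const \<le> time_H1_const" using weight_mass_nonneg[of "3/2"] kato_const_nonneg by (simp add: time_H1_const_def)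
  then show "8 * pi * kato_const \<le> time_const" unfolding time_const_def by (intro mult_left_mono) auto
  then show "0 \<le> time_const" using kato_const_nonneg by (intro order_trans[OF _ \<open>8 * pi * kato_const \<le> time_const\<close>]) auto
qed

lemma wnorm_swap_cmult:
  assumes m[measurable]: "case_prod f \<in> borel_measurable (borel \<Otimes>\<^sub>M borel)" and c: "c \<ge> 0"
  shows "ennreal c * wnorm r f = (\<integral>\<^sup>+t. \<integral>\<^sup>+k. ennreal (c * sob_weight r k * (cmod (f k t))\<^sup>2) \<partial>lborel \<partial>lborel)"
proof -
  have "(\<integral>\<^sup>+t. \<integral>\<^sup>+k. ennreal (c * sob_weight r k * (cmod (f k t))\<^sup>2) \<partial>lborel \<partial>lborel)
    = (\<integral>\<^sup>+t. \<integral>\<^sup>+k. ennreal c * ennreal (sob_weight r k * (cmod (f k t))\<^sup>2) \<partial>lborel \<partial>lborel)"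
    using c by (simp only: mult.assoc ennreal_mult sob_weight_nonneg mult_nonneg_nonneg zero_le_power2)
  also have "\<dots> = (\<integral>\<^sup>+t. ennreal c * (\<integral>\<^sup>+k. ennreal (sob_weight r k * (cmod (f k t))\<^sup>2) \<partial>lborel) \<partial>lborel)"
    by (intro nn_integral_cong nn_integral_cmult) measurable
  also have "\<dots> = ennreal c * wnorm r f"
    unfolding wnorm_def by (rule nn_integral_cmult) measurable
  finally show ?thesis ..
qed

context time_data
begin

lemma dyadic_wnorm:
  "ennreal (1 / 16 ^ j) * wnorm (3 / 2) (lowfreq (2 ^ j) f) + wnorm (- 1 / 2) (highfreq (2 ^ j) f)
    = (\<integral>\<^sup>+t. \<integral>\<^sup>+k. ennreal (dyadic_weight j k * (cmod (f k t))\<^sup>2) \<partial>lborel \<partial>lborel)"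
proof -
  interpret lo: time_data_bounded T "lowfreq (2 ^ j) f" "2 ^ j" by (rule lowfreq_data) simp
  interpret hi: time_data T "highfreq (2 ^ j) f" by (rule highfreq_data)
  have [measurable]: "dyadic_weight j \<in> borel_measurable borel" unfolding dyadic_weight_def[abs_def] by measurable
  have "ennreal (1 / 16 ^ j) * wnorm (3 / 2) (lowfreq (2 ^ j) f) + wnorm (- 1 / 2) (highfreq (2 ^ j) f) =
    (\<integral>\<^sup>+t. \<integral>\<^sup>+k. ennreal (1 / 16 ^ j * sob_weight (3 / 2) k * (cmod (lowfreq (2 ^ j) f k t))\<^sup>2) \<partial>lborel \<partial>lborel) +
    (\<integral>\<^sup>+t. \<integral>\<^sup>+k. ennreal (sob_weight (- 1 / 2) k * (cmod (highfreq (2 ^ j) f k t))\<^sup>2) \<partial>lborel \<partial>lborel)"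
    by (subst wnorm_swap_cmult[OF lo.f_meas]) (simp_all add: wnorm_def)
  also have "\<dots> = (\<integral>\<^sup>+t. (\<integral>\<^sup>+k. ennreal (1 / 16 ^ j * sob_weight (3 / 2) k * (cmod (lowfreq (2 ^ j) f k t))\<^sup>2) \<partial>lborel) +
    (\<integral>\<^sup>+k. ennreal (sob_weight (- 1 / 2) k * (cmod (highfreq (2 ^ j) f k t))\<^sup>2) \<partial>lborel) \<partial>lborel)"
    by (rule nn_integral_add[symmetric]) measurable
  also have "\<dots> = (\<integral>\<^sup>+t. \<integral>\<^sup>+k. ennreal (dyadic_weight j k * (cmod (f k t))\<^sup>2) \<partial>lborel \<partial>lborel)"
  proof (rule nn_integral_cong)
    fix t
    have "(\<integral>\<^sup>+k. ennreal (1 / 16 ^ j * sob_weight (3 / 2) k * (cmod (lowfreq (2 ^ j) f k t))\<^sup>2) \<partial>lborel) +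
      (\<integral>\<^sup>+k. ennreal (sob_weight (- 1 / 2) k * (cmod (highfreq (2 ^ j) f k t))\<^sup>2) \<partial>lborel) =
      (\<integral>\<^sup>+k. ennreal (1 / 16 ^ j * sob_weight (3 / 2) k * (cmod (lowfreq (2 ^ j) f k t))\<^sup>2) + ennreal (sob_weight (- 1 / 2) k * (cmod (highfreq (2 ^ j) f k t))\<^sup>2) \<partial>lborel)"
      by (rule nn_integral_add[symmetric]) measurable
    also have "\<dots> = (\<integral>\<^sup>+k. ennreal (dyadic_weight j k * (cmod (f k t))\<^sup>2) \<partial>lborel)"
      by (intro nn_integral_cong) (auto simp: dyadic_weight_def lowfreq_def highfreq_def)
    finally show "(\<integral>\<^sup>+k. ennreal (1 / 16 ^ j * sob_weight (3 / 2) k * (cmod (lowfreq (2 ^ j) f k t))\<^sup>2) \<partial>lborel) +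
      (\<integral>\<^sup>+k. ennreal (sob_weight (- 1 / 2) k * (cmod (highfreq (2 ^ j) f k t))\<^sup>2) \<partial>lborel) = (\<integral>\<^sup>+k. ennreal (dyadic_weight j k * (cmod (f k t))\<^sup>2) \<partial>lborel)" .
  qed
  finally show ?thesis .
qed

text \<open>On the band, 1 + \<tau>^2 <= 32 * 16^j bounds the time weight, and 1 <= \<tau>^2 / 16^j
  trades the low-frequency part for its time derivative. The constant 64 is 32 times the 2 from
  squaring a sum.\<close>

lemma band_estimate:
  assumes m: "0 \<le> m" "m \<le> 1"
  shows "(\<integral>\<^sup>+\<tau>. indicator {\<tau>. 4 ^ j \<le> \<bar>\<tau>\<bar> \<and> \<bar>\<tau>\<bar> < 4 ^ Suc j} \<tau> * ennreal (sob_weight m \<tau> * (cmod (vhat T f y \<tau>))\<^sup>2) \<partial>lborel)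
    \<le> ennreal (64 * time_const) * (\<integral>\<^sup>+t. \<integral>\<^sup>+k. ennreal ((16 powr m) ^ j * dyadic_weight j k * (cmod (f k t))\<^sup>2) \<partial>lborel \<partial>lborel)"
proof -
  interpret lo: time_data_bounded T "lowfreq (2 ^ j) f" "2 ^ j" by (rule lowfreq_data) simp
  interpret hi: time_data T "highfreq (2 ^ j) f" by (rule highfreq_data)
  have [measurable]: "dyadic_weight j \<in> borel_measurable borel" unfolding dyadic_weight_def[abs_def] by measurable
  let ?lo = "vhat T (lowfreq (2 ^ j) f) y" and ?hi = "vhat T (highfreq (2 ^ j) f) y"
  let ?c = "64 * (16 powr m) ^ j"
  have "(\<integral>\<^sup>+\<tau>. indicator {\<tau>. 4 ^ j \<le> \<bar>\<tau>\<bar> \<and> \<bar>\<tau>\<bar> < 4 ^ Suc j} \<tau> * ennreal (sob_weight m \<tau> * (cmod (vhat T f y \<tau>))\<^sup>2) \<partial>lborel)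
    \<le> (\<integral>\<^sup>+\<tau>. ennreal ?c * (ennreal (1 / 16 ^ j) * ennreal (\<tau>\<^sup>2 * (cmod (?lo \<tau>))\<^sup>2) + ennreal ((cmod (?hi \<tau>))\<^sup>2)) \<partial>lborel)"
  proof (rule nn_integral_mono)
    fix \<tau> :: real
    show "indicator {\<tau>. 4 ^ j \<le> \<bar>\<tau>\<bar> \<and> \<bar>\<tau>\<bar> < 4 ^ Suc j} \<tau> * ennreal (sob_weight m \<tau> * (cmod (vhat T f y \<tau>))\<^sup>2)
      \<le> ennreal ?c * (ennreal (1 / 16 ^ j) * ennreal (\<tau>\<^sup>2 * (cmod (?lo \<tau>))\<^sup>2) + ennreal ((cmod (?hi \<tau>))\<^sup>2))"
    proof (cases "4 ^ j \<le> \<bar>\<tau>\<bar> \<and> \<bar>\<tau>\<bar> < 4 ^ Suc j")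
      case True
      have sq: "((4::real) ^ n)\<^sup>2 = 16 ^ n" for n
      proof -
        have "((4::real) ^ n)\<^sup>2 = (4\<^sup>2) ^ n" by (simp only: power_mult[symmetric] mult.commute)
        then show ?thesis by simp
      qed
      have "(4 ^ j)\<^sup>2 \<le> \<bar>\<tau>\<bar>\<^sup>2" using True by (intro power_mono) auto
      then have l: "16 ^ j \<le> \<tau>\<^sup>2" by (simp add: sq)
      have "\<bar>\<tau>\<bar>\<^sup>2 \<le> (4 ^ Suc j)\<^sup>2" using True by (intro power_mono) auto
      then have u: "\<tau>\<^sup>2 \<le> 16 ^ Suc j" by (simp only: sq power2_abs)
      have "1 + \<tau>\<^sup>2 \<le> 32 * 16 ^ j"
      proof -
        have "(1::real) \<le> 16 ^ j" by (rule one_le_power) simp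
        moreover have "\<tau>\<^sup>2 \<le> 16 * 16 ^ j" using u by simp
        moreover have "1 + a \<le> 32 * b" if "1 \<le> b" "a \<le> 16 * b" for a b :: real using that by simp
        ultimately show ?thesis by blast
      qed
      then have "sob_weight m \<tau> \<le> (32 * 16 ^ j) powr m"
        unfolding sob_weight_def using m by (intro powr_mono2) auto
      also have "\<dots> = 32 powr m * (16 ^ j) powr m" by (simp add: powr_mult)
      also have "(16 ^ j) powr m = (16 powr m) ^ j"
      proof -
        have "(16 powr m) ^ j = (16 powr m) powr (real j)" by (rule powr_realpow[symmetric]) simp
        also have "\<dots> = (16 powr real j) powr m" by (simp only: powr_powr mult.commute)
        also have "16 powr real j = (16::real) ^ j" by (rule powr_realpow) simp
        finally show ?thesis ..
      qed
      also have "32 powr m \<le> 32 powr 1" using m by (intro powr_mono) auto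
      finally have w: "sob_weight m \<tau> \<le> 32 * (16 powr m) ^ j" by (simp add: mult_right_mono)
      have "(cmod (vhat T f y \<tau>))\<^sup>2 \<le> 2 * (cmod (?lo \<tau>))\<^sup>2 + 2 * (cmod (?hi \<tau>))\<^sup>2"
        unfolding vhat_split[of "2 ^ j", simplified] by (rule cmod_add_square)
      also have "(cmod (?lo \<tau>))\<^sup>2 \<le> 1 / 16 ^ j * (\<tau>\<^sup>2 * (cmod (?lo \<tau>))\<^sup>2)"
        using mult_right_mono[OF l, of "(cmod (?lo \<tau>))\<^sup>2"] by (simp add: field_simps)
      finally have "(cmod (vhat T f y \<tau>))\<^sup>2 \<le> 2 * (1 / 16 ^ j * (\<tau>\<^sup>2 * (cmod (?lo \<tau>))\<^sup>2) + (cmod (?hi \<tau>))\<^sup>2)" by simp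
      then have "sob_weight m \<tau> * (cmod (vhat T f y \<tau>))\<^sup>2 \<le> (32 * (16 powr m) ^ j) * (2 * (1 / 16 ^ j * (\<tau>\<^sup>2 * (cmod (?lo \<tau>))\<^sup>2) + (cmod (?hi \<tau>))\<^sup>2))"
        using w by (intro mult_mono) auto
      also have "\<dots> = ?c * (1 / 16 ^ j * (\<tau>\<^sup>2 * (cmod (?lo \<tau>))\<^sup>2) + (cmod (?hi \<tau>))\<^sup>2)" by (simp add: algebra_simps)
      finally have "ennreal (sob_weight m \<tau> * (cmod (vhat T f y \<tau>))\<^sup>2) \<le> ennreal (?c * (1 / 16 ^ j * (\<tau>\<^sup>2 * (cmod (?lo \<tau>))\<^sup>2) + (cmod (?hi \<tau>))\<^sup>2))"
        by (rule ennreal_leI)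
      also have "\<dots> = ennreal ?c * ennreal (1 / 16 ^ j * (\<tau>\<^sup>2 * (cmod (?lo \<tau>))\<^sup>2) + (cmod (?hi \<tau>))\<^sup>2)"
        by (rule ennreal_mult) auto
      also have "ennreal (1 / 16 ^ j * (\<tau>\<^sup>2 * (cmod (?lo \<tau>))\<^sup>2) + (cmod (?hi \<tau>))\<^sup>2) = ennreal (1 / 16 ^ j * (\<tau>\<^sup>2 * (cmod (?lo \<tau>))\<^sup>2)) + ennreal ((cmod (?hi \<tau>))\<^sup>2)"
        by (rule ennreal_plus) auto
      also have "ennreal (1 / 16 ^ j * (\<tau>\<^sup>2 * (cmod (?lo \<tau>))\<^sup>2)) = ennreal (1 / 16 ^ j) * ennreal (\<tau>\<^sup>2 * (cmod (?lo \<tau>))\<^sup>2)"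
        by (rule ennreal_mult) auto
      finally show ?thesis using True by simp
    next
      case False
      then have "indicator {\<tau>. 4 ^ j \<le> \<bar>\<tau>\<bar> \<and> \<bar>\<tau>\<bar> < 4 ^ Suc j} \<tau> = (0::ennreal)" by (simp add: indicator_def)
      then show ?thesis by simp
    qed
  qed
  also have "\<dots> = ennreal ?c * (\<integral>\<^sup>+\<tau>. ennreal (1 / 16 ^ j) * ennreal (\<tau>\<^sup>2 * (cmod (?lo \<tau>))\<^sup>2) + ennreal ((cmod (?hi \<tau>))\<^sup>2) \<partial>lborel)"
    by (rule nn_integral_cmult) measurable
  also have "(\<integral>\<^sup>+\<tau>. ennreal (1 / 16 ^ j) * ennreal (\<tau>\<^sup>2 * (cmod (?lo \<tau>))\<^sup>2) + ennreal ((cmod (?hi \<tau>))\<^sup>2) \<partial>lborel)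
    = (\<integral>\<^sup>+\<tau>. ennreal (1 / 16 ^ j) * ennreal (\<tau>\<^sup>2 * (cmod (?lo \<tau>))\<^sup>2) \<partial>lborel) + (\<integral>\<^sup>+\<tau>. ennreal ((cmod (?hi \<tau>))\<^sup>2) \<partial>lborel)"
    by (rule nn_integral_add) measurable
  also have "(\<integral>\<^sup>+\<tau>. ennreal (1 / 16 ^ j) * ennreal (\<tau>\<^sup>2 * (cmod (?lo \<tau>))\<^sup>2) \<partial>lborel) = ennreal (1 / 16 ^ j) * (\<integral>\<^sup>+\<tau>. ennreal (\<tau>\<^sup>2 * (cmod (?lo \<tau>))\<^sup>2) \<partial>lborel)"
    by (rule nn_integral_cmult) measurable
  also have "ennreal ?c * (ennreal (1 / 16 ^ j) * (\<integral>\<^sup>+\<tau>. ennreal (\<tau>\<^sup>2 * (cmod (?lo \<tau>))\<^sup>2) \<partial>lborel) + (\<integral>\<^sup>+\<tau>. ennreal ((cmod (?hi \<tau>))\<^sup>2) \<partial>lborel))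
    \<le> ennreal ?c * (ennreal (1 / 16 ^ j) * (ennreal time_const * wnorm (3 / 2) (lowfreq (2 ^ j) f)) + ennreal time_const * wnorm (- 1 / 2) (highfreq (2 ^ j) f))"
  proof (intro mult_left_mono add_mono)
    show "(\<integral>\<^sup>+\<tau>. ennreal (\<tau>\<^sup>2 * (cmod (?lo \<tau>))\<^sup>2) \<partial>lborel) \<le> ennreal time_const * wnorm (3 / 2) (lowfreq (2 ^ j) f)"
      using lo.time_H1[of y] unfolding vhat_def time_const_def .
    show "(\<integral>\<^sup>+\<tau>. ennreal ((cmod (?hi \<tau>))\<^sup>2) \<partial>lborel) \<le> ennreal time_const * wnorm (- 1 / 2) (highfreq (2 ^ j) f)"
      by (rule order_trans[OF hi.vhat_L2]) (intro mult_right_mono ennreal_leI time_const, simp)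
  qed auto
  also have "\<dots> = (ennreal ?c * ennreal time_const) * (ennreal (1 / 16 ^ j) * wnorm (3 / 2) (lowfreq (2 ^ j) f) + wnorm (- 1 / 2) (highfreq (2 ^ j) f))"
    by (simp only: distrib_left mult_ac)
  also have "ennreal ?c * ennreal time_const = ennreal (64 * time_const) * ennreal ((16 powr m) ^ j)"
    using time_const(1) by (simp add: ennreal_mult[symmetric] mult_ac del: ennreal_mult')
  also have "ennreal (64 * time_const) * ennreal ((16 powr m) ^ j) * (ennreal (1 / 16 ^ j) * wnorm (3 / 2) (lowfreq (2 ^ j) f) + wnorm (- 1 / 2) (highfreq (2 ^ j) f))
    = ennreal (64 * time_const) * (\<integral>\<^sup>+t. \<integral>\<^sup>+k. ennreal ((16 powr m) ^ j) * ennreal (dyadic_weight j k * (cmod (f k t))\<^sup>2) \<partial>lborel \<partial>lborel)"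
    unfolding dyadic_wnorm mult.assoc
    by (intro arg_cong2[where f = "(*)"] refl, subst nn_integral_cmult[symmetric], measurable, intro nn_integral_cong nn_integral_cmult[symmetric], measurable)
  also have "(\<integral>\<^sup>+t. \<integral>\<^sup>+k. ennreal ((16 powr m) ^ j) * ennreal (dyadic_weight j k * (cmod (f k t))\<^sup>2) \<partial>lborel \<partial>lborel)
    = (\<integral>\<^sup>+t. \<integral>\<^sup>+k. ennreal ((16 powr m) ^ j * dyadic_weight j k * (cmod (f k t))\<^sup>2) \<partial>lborel \<partial>lborel)"
    by (intro nn_integral_cong) (simp add: ennreal_mult[symmetric] mult.assoc)
  finally show ?thesis .
qed

end

text \<open>Each band of \<tau> uses its own splitting of the data, so adding the bands amounts to
  adding the weights, and \<open>dyadic_sum\<close> applies because 16^m = 2^(2s+1). The values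
  |\<tau>| < 1 lie in no band; there the time weight is at most 2 and \<open>vhat_L2\<close>
  suffices.\<close>

lemma time_interpolation:
  assumes s: "0 \<le> s" "s < 3 / 2"
  shows "\<exists>C\<ge>0. \<forall>T f y. time_data T f \<longrightarrow>
    (\<integral>\<^sup>+\<tau>. ennreal (sob_weight ((2 * s + 1) / 4) \<tau> * (cmod (vhat T f y \<tau>))\<^sup>2) \<partial>lborel) \<le> ennreal C * wnorm s f"
proof -
  define m where "m = (2 * s + 1) / 4"
  have m: "0 \<le> m" "m \<le> 1" unfolding m_def using s by auto
  have Pm: "16 powr m = 2 powr (2 * s + 1)"
  proof -
    have "(16::real) = 2 powr 4" by simp
    then have "16 powr m = (2 powr 4) powr m" by simp
    also have "\<dots> = 2 powr (4 * m)" by (rule powr_powr)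
    finally show ?thesis by (simp add: m_def)
  qed
  obtain K where K: "K \<ge> 0" "\<And>k. (\<Sum>j. ennreal ((16 powr m) ^ j * dyadic_weight j k)) \<le> ennreal (K * sob_weight s k)"
    using dyadic_sum[OF s] unfolding Pm by blast
  show ?thesis
  proof (intro exI[of _ "2 * time_const + 64 * time_const * K"] conjI allI impI)
    show "0 \<le> 2 * time_const + 64 * time_const * K" using time_const(1) K(1) by simp
    fix T f y assume "time_data T f"
    then interpret time_data T f .
    let ?X = "\<lambda>\<tau>. ennreal (sob_weight m \<tau> * (cmod (vhat T f y \<tau>))\<^sup>2)"
    let ?B = "\<lambda>j. {\<tau>::real. 4 ^ j \<le> \<bar>\<tau>\<bar> \<and> \<bar>\<tau>\<bar> < 4 ^ Suc j}"
    let ?W = "\<lambda>j k t. ennreal ((16 powr m) ^ j * dyadic_weight j k * (cmod (f k t))\<^sup>2)"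
    have [measurable]: "dyadic_weight j \<in> borel_measurable borel" for j unfolding dyadic_weight_def[abs_def] by measurable
    have [measurable]: "?B j \<in> sets borel" for j by measurable
    have "(\<integral>\<^sup>+\<tau>. ?X \<tau> \<partial>lborel) \<le> (\<integral>\<^sup>+\<tau>. ennreal 2 * ennreal ((cmod (vhat T f y \<tau>))\<^sup>2) + (\<Sum>j. indicator (?B j) \<tau> * ?X \<tau>) \<partial>lborel)"
    proof (rule nn_integral_mono)
      fix \<tau> :: real
      show "?X \<tau> \<le> ennreal 2 * ennreal ((cmod (vhat T f y \<tau>))\<^sup>2) + (\<Sum>j. indicator (?B j) \<tau> * ?X \<tau>)"
      proof (cases "\<bar>\<tau>\<bar> < 1")
        case True
        have "sob_weight m \<tau> \<le> sob_weight 1 \<tau>" using m by (intro sob_weight_mono)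
        also have "\<dots> = 1 + \<tau>\<^sup>2" unfolding sob_weight_def using one_plus_norm_pos[of \<tau>] by simp
        also have "\<dots> \<le> 2" using True by (simp add: abs_square_le_1)
        finally have "?X \<tau> \<le> ennreal (2 * (cmod (vhat T f y \<tau>))\<^sup>2)" by (intro ennreal_leI mult_right_mono) auto
        also have "\<dots> = ennreal 2 * ennreal ((cmod (vhat T f y \<tau>))\<^sup>2)" by (rule ennreal_mult) auto
        finally show ?thesis by (simp add: add_increasing2)
      next
        case False
        define j where "j = (LEAST j. \<bar>\<tau>\<bar> < 4 ^ Suc j)"
        obtain n :: nat where n: "\<bar>\<tau>\<bar> < 4 ^ n" using real_arch_pow[of 4 "\<bar>\<tau>\<bar>"] by auto
        then have "\<bar>\<tau>\<bar> < 4 ^ Suc n" by (rule order_less_le_trans) simp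
        then have u: "\<bar>\<tau>\<bar> < 4 ^ Suc j" unfolding j_def by (rule LeastI[of "\<lambda>j. \<bar>\<tau>\<bar> < 4 ^ Suc j" n])
        have l: "4 ^ j \<le> \<bar>\<tau>\<bar>"
        proof (cases j)
          case 0 then show ?thesis using False by simp
        next
          case (Suc i)
          then have "i < j" by simp
          then have "\<not> \<bar>\<tau>\<bar> < 4 ^ Suc i" unfolding j_def by (rule not_less_Least)
          then show ?thesis using Suc by simp
        qed
        have "?X \<tau> = (\<Sum>i\<in>{j}. indicator (?B i) \<tau> * ?X \<tau>)" using u l by simp
        also have "\<dots> \<le> (\<Sum>j. indicator (?B j) \<tau> * ?X \<tau>)" by (rule sum_le_suminf) auto
        finally show ?thesis by (simp add: add_increasing)
      qed
    qed
    also have "\<dots> = (\<integral>\<^sup>+\<tau>. ennreal 2 * ennreal ((cmod (vhat T f y \<tau>))\<^sup>2) \<partial>lborel) + (\<integral>\<^sup>+\<tau>. (\<Sum>j. indicator (?B j) \<tau> * ?X \<tau>) \<partial>lborel)"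
      by (rule nn_integral_add) measurable
    also have "(\<integral>\<^sup>+\<tau>. ennreal 2 * ennreal ((cmod (vhat T f y \<tau>))\<^sup>2) \<partial>lborel) = ennreal 2 * (\<integral>\<^sup>+\<tau>. ennreal ((cmod (vhat T f y \<tau>))\<^sup>2) \<partial>lborel)"
      by (rule nn_integral_cmult) measurable
    also have "\<dots> \<le> ennreal 2 * (ennreal time_const * wnorm s f)"
    proof (intro mult_left_mono)
      have "(\<integral>\<^sup>+\<tau>. ennreal ((cmod (vhat T f y \<tau>))\<^sup>2) \<partial>lborel) \<le> ennreal (8 * pi * kato_const) * wnorm (- 1 / 2) f" by (rule vhat_L2)
      also have "\<dots> \<le> ennreal time_const * wnorm s f"
        using s by (intro mult_mono ennreal_leI time_const wnorm_mono) auto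
      finally show "(\<integral>\<^sup>+\<tau>. ennreal ((cmod (vhat T f y \<tau>))\<^sup>2) \<partial>lborel) \<le> ennreal time_const * wnorm s f" .
    qed simp
    also have "(\<integral>\<^sup>+\<tau>. (\<Sum>j. indicator (?B j) \<tau> * ?X \<tau>) \<partial>lborel) = (\<Sum>j. \<integral>\<^sup>+\<tau>. indicator (?B j) \<tau> * ?X \<tau> \<partial>lborel)"
      by (rule nn_integral_suminf) measurable
    also have "\<dots> \<le> (\<Sum>j. ennreal (64 * time_const) * (\<integral>\<^sup>+t. \<integral>\<^sup>+k. ?W j k t \<partial>lborel \<partial>lborel))"
      by (intro suminf_le band_estimate m) auto
    also have "\<dots> = ennreal (64 * time_const) * (\<Sum>j. \<integral>\<^sup>+t. \<integral>\<^sup>+k. ?W j k t \<partial>lborel \<partial>lborel)"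
      by (rule ennreal_suminf_cmult)
    also have "(\<Sum>j. \<integral>\<^sup>+t. \<integral>\<^sup>+k. ?W j k t \<partial>lborel \<partial>lborel) = (\<integral>\<^sup>+t. (\<Sum>j. \<integral>\<^sup>+k. ?W j k t \<partial>lborel) \<partial>lborel)"
      by (rule nn_integral_suminf[symmetric]) measurable
    also have "\<dots> = (\<integral>\<^sup>+t. \<integral>\<^sup>+k. (\<Sum>j. ?W j k t) \<partial>lborel \<partial>lborel)"
      by (intro nn_integral_cong nn_integral_suminf[symmetric]) measurable
    also have "\<dots> \<le> (\<integral>\<^sup>+t. \<integral>\<^sup>+k. ennreal (K * sob_weight s k * (cmod (f k t))\<^sup>2) \<partial>lborel \<partial>lborel)"
    proof (intro nn_integral_mono)
      fix t k
      have "(\<Sum>j. ?W j k t) = (\<Sum>j. ennreal ((16 powr m) ^ j * dyadic_weight j k) * ennreal ((cmod (f k t))\<^sup>2))"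
        by (intro arg_cong[where f = suminf] ext ennreal_mult) auto
      also have "\<dots> = (\<Sum>j. ennreal ((16 powr m) ^ j * dyadic_weight j k)) * ennreal ((cmod (f k t))\<^sup>2)"
        by (rule ennreal_suminf_multc)
      also have "\<dots> \<le> ennreal (K * sob_weight s k) * ennreal ((cmod (f k t))\<^sup>2)" by (intro mult_right_mono K(2)) auto
      also have "\<dots> = ennreal (K * sob_weight s k * (cmod (f k t))\<^sup>2)" using K(1) by (intro ennreal_mult[symmetric]) auto
      finally show "(\<Sum>j. ?W j k t) \<le> ennreal (K * sob_weight s k * (cmod (f k t))\<^sup>2)" .
    qed
    also have "\<dots> = ennreal K * wnorm s f" by (rule wnorm_swap_cmult[OF f_meas K(1), symmetric])
    finally have "(\<integral>\<^sup>+\<tau>. ?X \<tau> \<partial>lborel) \<le> ennreal 2 * (ennreal time_const * wnorm s f) + ennreal (64 * time_const) * (ennreal K * wnorm s f)"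
      by (simp add: add_mono mult_left_mono)
    also have "\<dots> = (ennreal 2 * ennreal time_const + ennreal (64 * time_const) * ennreal K) * wnorm s f"
      by (simp only: distrib_right mult.assoc)
    also have "ennreal 2 * ennreal time_const + ennreal (64 * time_const) * ennreal K = ennreal (2 * time_const + 64 * time_const * K)"
    proof -
      have "ennreal 2 * ennreal time_const = ennreal (2 * time_const)" by (rule ennreal_mult[symmetric]) (use time_const in auto)
      moreover have "ennreal (64 * time_const) * ennreal K = ennreal (64 * time_const * K)" by (rule ennreal_mult[symmetric]) (use time_const K in auto)
      moreover have "ennreal (2 * time_const) + ennreal (64 * time_const * K) = ennreal (2 * time_const + 64 * time_const * K)"
        by (rule ennreal_plus[symmetric]) (use time_const K in auto)
      ultimately show ?thesis by simp
    qed
    finally show "(\<integral>\<^sup>+\<tau>. ennreal (sob_weight ((2 * s + 1) / 4) \<tau> * (cmod (vhat T f y \<tau>))\<^sup>2) \<partial>lborel) \<le> ennreal (2 * time_const + 64 * time_const * K) * wnorm s f"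
      unfolding m_def .
  qed
qed

text \<open>At s = 3/2 the dyadic sum diverges for data that do not vanish, but the exponent in time
  is exactly 1 and the bound on the time derivative serves all frequencies at once. It is known for
  bounded frequency support, with a constant free of the support, and Fatou's lemma carries it to
  the limit.\<close>

lemma time_endpoint:
  assumes "time_data T f"
  shows "(\<integral>\<^sup>+\<tau>. ennreal (sob_weight 1 \<tau> * (cmod (vhat T f y \<tau>))\<^sup>2) \<partial>lborel) \<le> ennreal (2 * time_const) * wnorm (3 / 2) f"
proof -
  interpret time_data T f by fact
  let ?lo = "\<lambda>n. vhat T (lowfreq (real n) f) y" and ?hi = "\<lambda>n. vhat T (highfreq (real n) f) y"
  have lod: "time_data_bounded T (lowfreq (real n) f) (real n)" for n by (rule lowfreq_data) simp
  have lom[measurable]: "?lo n \<in> borel_measurable borel" for n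
    using time_data.vhat_measurable[OF time_data_bounded.axioms(1)[OF lod]] .
  \<comment> \<open>The frequency tails of integrable data vanish in L^1; with
    \<open>vhat_mass\<close> this gives convergence at every \<tau>, as Fatou's lemma
    requires.\<close>
  have mass0: "(\<lambda>n. mass (highfreq (real n) f)) \<longlonglongrightarrow> 0"
  proof -
    have hm: "case_prod (highfreq (real n) f) \<in> borel_measurable (lborel \<Otimes>\<^sub>M lborel)" for n
      using time_data.f_meas[OF highfreq_data[of "real n"]] by simp
    have e: "mass g = (\<integral>\<^sup>+z. ennreal (cmod (case_prod g z)) \<partial>(lborel \<Otimes>\<^sub>M lborel))" if [measurable]: "case_prod g \<in> borel_measurable (lborel \<Otimes>\<^sub>M lborel)" for g
    proof -
      have "(\<integral>\<^sup>+k. \<integral>\<^sup>+t. ennreal (cmod (case_prod g (k, t))) \<partial>lborel \<partial>lborel) = (\<integral>\<^sup>+z. ennreal (cmod (case_prod g z)) \<partial>(lborel \<Otimes>\<^sub>M lborel))"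
        by (rule lborel.nn_integral_fst) measurable
      then show ?thesis by (simp add: mass_def)
    qed
    have "(\<lambda>n. \<integral>\<^sup>+z. ennreal (cmod (case_prod (highfreq (real n) f) z)) \<partial>(lborel \<Otimes>\<^sub>M lborel)) \<longlonglongrightarrow> (\<integral>\<^sup>+z. (0::ennreal) \<partial>(lborel \<Otimes>\<^sub>M (lborel :: real measure) :: (real \<times> real) measure))"
    proof (rule nn_integral_dominated_convergence[where w = "\<lambda>z. ennreal (cmod (case_prod f z))"])
      show "(\<integral>\<^sup>+z. ennreal (cmod (case_prod f z)) \<partial>(lborel \<Otimes>\<^sub>M lborel)) < \<infinity>"
        using f_int unfolding integrable_iff_bounded by simp
      show "AE z in lborel \<Otimes>\<^sub>M lborel. (\<lambda>n. ennreal (cmod (case_prod (highfreq (real n) f) z))) \<longlonglongrightarrow> 0"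
      proof (rule AE_I2)
        fix z :: "real \<times> real"
        obtain N :: nat where N: "\<bar>fst z\<bar> \<le> real N" using real_arch_simple by blast
        have "eventually (\<lambda>n. ennreal (cmod (case_prod (highfreq (real n) f) z)) = 0) sequentially"
          using eventually_ge_at_top[of N] by eventually_elim (use N in \<open>auto simp: highfreq_def case_prod_beta'\<close>)
        then show "(\<lambda>n. ennreal (cmod (case_prod (highfreq (real n) f) z))) \<longlonglongrightarrow> 0" by (rule tendsto_eventually)
      qed
    qed (use hm f_meas in \<open>auto simp: highfreq_def\<close>)
    then show ?thesis unfolding e[OF hm] by simp
  qed
  have lim: "(\<lambda>n. ?lo n \<tau>) \<longlonglongrightarrow> vhat T f y \<tau>" for \<tau>
  proof -
    have "(\<lambda>n. 2 * mass (highfreq (real n) f)) \<longlonglongrightarrow> 2 * 0"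
      using mass0 by (intro ennreal_tendsto_cmult) auto
    then have l: "(\<lambda>n. 2 * mass (highfreq (real n) f)) \<longlonglongrightarrow> 0" by simp
    have "(\<lambda>n. ennreal (cmod (?hi n \<tau>))) \<longlonglongrightarrow> 0"
    proof (rule tendsto_sandwich[OF _ _ tendsto_const l])
      show "\<forall>\<^sub>F n in sequentially. 0 \<le> ennreal (cmod (?hi n \<tau>))" by (intro always_eventually allI) simp
      show "\<forall>\<^sub>F n in sequentially. ennreal (cmod (?hi n \<tau>)) \<le> 2 * mass (highfreq (real n) f)"
        by (intro always_eventually allI time_data.vhat_mass[OF highfreq_data])
    qed
    then have "(\<lambda>n. cmod (?hi n \<tau>)) \<longlonglongrightarrow> 0"
      using tendsto_ennreal_iff[of "\<lambda>n. cmod (?hi n \<tau>)" sequentially 0] by simp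
    then have "(\<lambda>n. ?hi n \<tau>) \<longlonglongrightarrow> 0" by (rule tendsto_norm_zero_cancel)
    then have "(\<lambda>n. vhat T f y \<tau> - ?hi n \<tau>) \<longlonglongrightarrow> vhat T f y \<tau> - 0" by (intro tendsto_diff tendsto_const)
    moreover have "vhat T f y \<tau> - ?hi n \<tau> = ?lo n \<tau>" for n using vhat_split[of "real n" y \<tau>] by simp
    ultimately show ?thesis by simp
  qed
  show ?thesis
  proof (rule nn_integral_fatou_bound[where u = "\<lambda>n \<tau>. ennreal (sob_weight 1 \<tau> * (cmod (?lo n \<tau>))\<^sup>2)"])
    show "(\<lambda>n. ennreal (sob_weight 1 \<tau> * (cmod (?lo n \<tau>))\<^sup>2)) \<longlonglongrightarrow> ennreal (sob_weight 1 \<tau> * (cmod (vhat T f y \<tau>))\<^sup>2)" for \<tau>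
      by (intro tendsto_ennrealI tendsto_mult tendsto_const tendsto_power tendsto_norm lim)
    fix n
    interpret lo: time_data_bounded T "lowfreq (real n) f" "real n" by (rule lod)
    have "(\<integral>\<^sup>+\<tau>. ennreal (sob_weight 1 \<tau> * (cmod (?lo n \<tau>))\<^sup>2) \<partial>lborel) = (\<integral>\<^sup>+\<tau>. ennreal ((cmod (?lo n \<tau>))\<^sup>2) + ennreal (\<tau>\<^sup>2 * (cmod (?lo n \<tau>))\<^sup>2) \<partial>lborel)"
    proof (rule nn_integral_cong)
      fix \<tau> :: real
      have "sob_weight 1 \<tau> * (cmod (?lo n \<tau>))\<^sup>2 = (cmod (?lo n \<tau>))\<^sup>2 + \<tau>\<^sup>2 * (cmod (?lo n \<tau>))\<^sup>2"
        unfolding sob_weight_def using one_plus_norm_pos[of \<tau>] by (simp add: distrib_right)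
      then show "ennreal (sob_weight 1 \<tau> * (cmod (?lo n \<tau>))\<^sup>2) = ennreal ((cmod (?lo n \<tau>))\<^sup>2) + ennreal (\<tau>\<^sup>2 * (cmod (?lo n \<tau>))\<^sup>2)"
        by (simp add: ennreal_plus[symmetric] del: ennreal_plus)
    qed
    also have "\<dots> = (\<integral>\<^sup>+\<tau>. ennreal ((cmod (?lo n \<tau>))\<^sup>2) \<partial>lborel) + (\<integral>\<^sup>+\<tau>. ennreal (\<tau>\<^sup>2 * (cmod (?lo n \<tau>))\<^sup>2) \<partial>lborel)"
      by (rule nn_integral_add) measurable
    also have "\<dots> \<le> ennreal time_const * wnorm (3 / 2) f + ennreal time_const * wnorm (3 / 2) f"
    proof (rule add_mono)
      have "(\<integral>\<^sup>+\<tau>. ennreal ((cmod (?lo n \<tau>))\<^sup>2) \<partial>lborel) \<le> ennreal (8 * pi * kato_const) * wnorm (- 1 / 2) (lowfreq (real n) f)" by (rule lo.vhat_L2)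
      also have "\<dots> \<le> ennreal time_const * wnorm (3 / 2) (lowfreq (real n) f)"
        by (intro mult_mono ennreal_leI time_const lo.wnorm_mono) auto
      also have "\<dots> \<le> ennreal time_const * wnorm (3 / 2) f" by (intro mult_left_mono lowfreq_wnorm_le) auto
      finally show "(\<integral>\<^sup>+\<tau>. ennreal ((cmod (?lo n \<tau>))\<^sup>2) \<partial>lborel) \<le> ennreal time_const * wnorm (3 / 2) f" .
      have "(\<integral>\<^sup>+\<tau>. ennreal (\<tau>\<^sup>2 * (cmod (?lo n \<tau>))\<^sup>2) \<partial>lborel) \<le> ennreal time_const * wnorm (3 / 2) (lowfreq (real n) f)"
        using lo.time_H1[of y] unfolding vhat_def time_const_def .
      also have "\<dots> \<le> ennreal time_const * wnorm (3 / 2) f" by (intro mult_left_mono lowfreq_wnorm_le) auto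
      finally show "(\<integral>\<^sup>+\<tau>. ennreal (\<tau>\<^sup>2 * (cmod (?lo n \<tau>))\<^sup>2) \<partial>lborel) \<le> ennreal time_const * wnorm (3 / 2) f" .
    qed
    also have "\<dots> = (ennreal time_const + ennreal time_const) * wnorm (3 / 2) f" by (rule distrib_right[symmetric])
    also have "ennreal time_const + ennreal time_const = ennreal (2 * time_const)"
      using time_const(1) by (subst ennreal_plus[symmetric]) auto
    finally show "(\<integral>\<^sup>+\<tau>. ennreal (sob_weight 1 \<tau> * (cmod (?lo n \<tau>))\<^sup>2) \<partial>lborel) \<le> ennreal (2 * time_const) * wnorm (3 / 2) f" .
  qed measurable
qed

theorem time_smoothing:
  assumes s: "0 \<le> s" "s \<le> 3 / 2"
  shows "\<exists>C\<ge>0. \<forall>T f y. time_data T f \<longrightarrow>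
    (\<integral>\<^sup>+\<tau>. ennreal (sob_weight ((2 * s + 1) / 4) \<tau> * (cmod (vhat T f y \<tau>))\<^sup>2) \<partial>lborel) \<le> ennreal C * wnorm s f"
proof (cases "s < 3 / 2")
  case True then show ?thesis by (rule time_interpolation[OF s(1)])
next
  case False
  then have s: "s = 3 / 2" using s by simp
  have e: "(2 * (3 / 2) + 1) / 4 = (1::real)" by simp
  show ?thesis unfolding s e
    using time_endpoint time_const(1) by (intro exI[of _ "2 * time_const"]) auto
qed

section \<open>Restrictions to lines\<close>

lemma nn_integral_fatou_bound_AE:
  assumes [measurable]: "\<And>n. u n \<in> borel_measurable M"
    and lim: "AE x in M. (\<lambda>n. u n x) \<longlonglongrightarrow> v x" and le: "eventually (\<lambda>n::nat. (\<integral>\<^sup>+x. u n x \<partial>M) \<le> (X::ennreal)) sequentially"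
  shows "(\<integral>\<^sup>+x. v x \<partial>M) \<le> X"
proof -
  have "AE x in M. v x = liminf (\<lambda>n. u n x)"
    using lim by eventually_elim (simp add: lim_imp_Liminf[symmetric])
  then have "(\<integral>\<^sup>+x. v x \<partial>M) = (\<integral>\<^sup>+x. liminf (\<lambda>n. u n x) \<partial>M)" by (rule nn_integral_cong_AE)
  also have "\<dots> \<le> liminf (\<lambda>n. \<integral>\<^sup>+x. u n x \<partial>M)" by (rule nn_integral_liminf) measurable
  also have "\<dots> \<le> liminf (\<lambda>n::nat. X)" by (rule Liminf_mono[OF le])
  finally show ?thesis by (simp add: Liminf_const)
qed

lemma continuous_AE_zero:
  fixes f :: "real \<Rightarrow> complex"
  assumes c: "continuous_on UNIV f" and ae: "AE x in lborel. f x = 0"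
  shows "f x = 0"
proof (rule ccontr)
  assume "f x \<noteq> 0"
  let ?U = "{x. f x \<noteq> 0}"
  have op: "open ?U" using c by (intro open_Collect_neq continuous_on_const)
  have "?U \<in> null_sets lborel"
    using ae op by (subst AE_iff_null_sets) auto
  then have "negligible ?U" by (simp add: negligible_iff_null_sets null_sets_completionI)
  then show False using open_not_negligible[OF op] \<open>f x \<noteq> 0\<close> by auto
qed

text \<open>Both candidates pair equally with all \<psi>, hence agree for almost every y, hence for
  every y by the continuity that \<open>has_restrictions\<close> demands.\<close>

lemma has_restrictions_unique:
  assumes v: "has_restrictions u v" and v': "has_restrictions u v'" and \<phi>: "schwartz \<phi>"
  shows "v y \<phi> = v' y \<phi>"
proof -
  define f where "f y = v y \<phi> - v' y \<phi>" for y
  have c: "continuous_on UNIV (\<lambda>y. v y \<phi>)" "continuous_on UNIV (\<lambda>y. v' y \<phi>)"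
    using v v' \<phi> unfolding has_restrictions_def by blast+
  have fc: "continuous_on UNIV f" unfolding f_def[abs_def] by (intro continuous_intros c)
  have "AE y in lborel. f y = 0"
  proof (rule schwartz_separates)
    show "f \<in> borel_measurable borel" by (rule borel_measurable_continuous_onI[OF fc])
    fix \<psi> :: "real \<Rightarrow> complex" assume \<psi>: "schwartz \<psi>"
    have i: "integrable lborel (\<lambda>y. v y \<phi> * \<psi> y)" "integrable lborel (\<lambda>y. v' y \<phi> * \<psi> y)"
      and e: "u (\<lambda>(x\<^sub>1, x\<^sub>2). \<phi> x\<^sub>1 * \<psi> x\<^sub>2) = (LINT y|lborel. v y \<phi> * \<psi> y)"
        "u (\<lambda>(x\<^sub>1, x\<^sub>2). \<phi> x\<^sub>1 * \<psi> x\<^sub>2) = (LINT y|lborel. v' y \<phi> * \<psi> y)"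
      using v v' \<phi> \<psi> unfolding has_restrictions_def by blast+
    show "integrable lborel (\<lambda>y. f y * \<psi> y)" unfolding f_def left_diff_distrib using i by (rule Bochner_Integration.integrable_diff)
    show "(LINT y|lborel. f y * \<psi> y) = 0"
      unfolding f_def left_diff_distrib using e by (simp only: Bochner_Integration.integral_diff[OF i]) simp
  qed
  from continuous_AE_zero[OF fc this, of y] show ?thesis by (simp add: f_def)
qed

section \<open>Inverting the partial Fourier transform on the strip\<close>

lemma square_integrable_compact_integrable:
  fixes h :: "real \<Rightarrow> complex"
  assumes [measurable]: "h \<in> borel_measurable borel"
    and fin: "(\<integral>\<^sup>+k. ennreal ((cmod (h k))\<^sup>2) \<partial>lborel) < \<infinity>" and out: "\<And>k. \<bar>k\<bar> > R \<Longrightarrow> h k = 0"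
  shows "integrable lborel h"
proof (rule integrableI_bounded)
  have "(\<integral>\<^sup>+k. ennreal (norm (h k)) \<partial>lborel) \<le> (\<integral>\<^sup>+k. indicator {-\<bar>R\<bar>..\<bar>R\<bar>} k + ennreal ((cmod (h k))\<^sup>2) \<partial>lborel)"
  proof (rule nn_integral_mono)
    fix k :: real
    show "ennreal (norm (h k)) \<le> indicator {-\<bar>R\<bar>..\<bar>R\<bar>} k + ennreal ((cmod (h k))\<^sup>2)"
    proof (cases "\<bar>k\<bar> \<le> \<bar>R\<bar>")
      case True
      have "cmod (h k) \<le> 1 + (cmod (h k))\<^sup>2"
        using sum_squares_bound[of 1 "cmod (h k)"] norm_ge_zero[of "h k"] unfolding power_one mult_1_right by linarith
      then have "ennreal (cmod (h k)) \<le> ennreal (1 + (cmod (h k))\<^sup>2)" by (rule ennreal_leI)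
      also have "\<dots> = 1 + ennreal ((cmod (h k))\<^sup>2)" by (subst ennreal_plus) auto
      finally show ?thesis using True by (simp add: indicator_def abs_le_iff)
    next
      case False
      then have "h k = 0" by (intro out) auto
      then show ?thesis by simp
    qed
  qed
  also have "\<dots> = (\<integral>\<^sup>+k. indicator {-\<bar>R\<bar>..\<bar>R\<bar>} k \<partial>lborel) + (\<integral>\<^sup>+k. ennreal ((cmod (h k))\<^sup>2) \<partial>lborel)"
    by (rule nn_integral_add) measurable
  also have "\<dots> < \<infinity>" using fin by simp
  finally show "(\<integral>\<^sup>+k. ennreal (norm (h k)) \<partial>lborel) < \<infinity>" .
qed simp

text \<open>The weights force |a j| <= sqrt S * 2^(-j/2). Applied to increments of a sequence, this
  turns bounds on square integrals into pointwise convergence.\<close>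

lemma summable_of_weighted_squares:
  fixes a :: "nat \<Rightarrow> complex"
  assumes "(\<Sum>j. ennreal (2 ^ j * (cmod (a j))\<^sup>2)) \<noteq> \<infinity>"
  shows "summable a"
proof (rule summable_comparison_test)
  have sm: "summable (\<lambda>j. 2 ^ j * (cmod (a j))\<^sup>2)" using assms by (intro summable_suminf_not_top) auto
  define S where "S = (\<Sum>j. 2 ^ j * (cmod (a j))\<^sup>2)"
  have "cmod (a j) \<le> sqrt S * sqrt (1/2) ^ j" for j
  proof -
    have "2 ^ j * (cmod (a j))\<^sup>2 \<le> S" unfolding S_def using sum_le_suminf[OF sm, of "{j}"] by simp
    then have "(cmod (a j))\<^sup>2 \<le> S * (1/2) ^ j" by (simp add: power_one_over field_simps)
    then have "cmod (a j) \<le> sqrt (S * (1/2) ^ j)" by (rule real_le_rsqrt)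
    then show ?thesis by (simp add: real_sqrt_mult real_sqrt_power)
  qed
  then show "\<exists>N. \<forall>n\<ge>N. norm (a n) \<le> sqrt S * sqrt (1/2) ^ n" by auto
  show "summable (\<lambda>n. sqrt S * sqrt (1/2) ^ n)"
    by (intro summable_mult summable_geometric) (simp add: real_sqrt_divide)
qed

lemma strip_L2I:
  assumes gm: "g \<in> borel_measurable borel"
    and f: "(\<integral>\<^sup>+t. \<integral>\<^sup>+x. indicator {0..T} t * ennreal ((cmod (g (x, t)))\<^sup>2) \<partial>lborel \<partial>lborel) < \<infinity>"
  shows "g \<in> strip_L2 T"
proof -
  have [measurable]: "g \<in> borel_measurable (borel \<Otimes>\<^sub>M borel)" using gm by (simp add: borel_prod)
  have "(\<integral>\<^sup>+z. ennreal (indicator (UNIV \<times> {0..T}) z * (cmod (g z))\<^sup>2) \<partial>(lborel \<Otimes>\<^sub>M lborel)) = (\<integral>\<^sup>+t. \<integral>\<^sup>+x. ennreal (indicator (UNIV \<times> {0..T}) (x, t) * (cmod (g (x, t)))\<^sup>2) \<partial>lborel \<partial>lborel)"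
    by (rule lborel_pair.nn_integral_snd[symmetric]) measurable
  also have "\<dots> = (\<integral>\<^sup>+t. \<integral>\<^sup>+x. indicator {0..T} t * ennreal ((cmod (g (x, t)))\<^sup>2) \<partial>lborel \<partial>lborel)"
    by (intro nn_integral_cong) (auto simp: indicator_def)
  also have "\<dots> < \<infinity>" by (rule f)
  finally have "integrable (lborel \<Otimes>\<^sub>M lborel) (\<lambda>z. indicator (UNIV \<times> {0..T}) z * (cmod (g z))\<^sup>2)"
    by (intro integrableI_nonneg) auto
  then have "integrable lborel (\<lambda>z. indicator (UNIV \<times> {0..T}) z * (cmod (g z))\<^sup>2)" by (simp only: lborel_prod)
  then show ?thesis using gm unfolding strip_L2_def set_integrable_def by simp
qed

text \<open>
  The functions \<open>g\<^sub>j\<close> are the inverse transforms of truncations at frequency \<open>r j\<close>. The rate of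
  convergence of the \<open>r j\<close> makes them converge almost everywhere, so that the limit is jointly measurable.
\<close>

lemma partial_inverse_fourier:
  fixes H :: "real \<Rightarrow> real \<Rightarrow> complex"
  assumes [measurable]: "case_prod H \<in> borel_measurable (borel \<Otimes>\<^sub>M borel)"
    and fin: "(\<integral>\<^sup>+t. \<integral>\<^sup>+k. indicator {0..T} t * ennreal ((cmod (H k t))\<^sup>2) \<partial>lborel \<partial>lborel) < \<infinity>"
  shows "\<exists>g \<in> strip_L2 T. AE t in lborel. t \<in> {0..T} \<longrightarrow>
    (\<forall>\<phi>. schwartz \<phi> \<longrightarrow> inverse_fourier (\<lambda>k. H k t) \<phi> = regular (\<lambda>x. g (x, t)) \<phi>)"
proof -
  have [measurable]: "(\<lambda>k. H k t) \<in> borel_measurable borel" for t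
  proof -
    have "(\<lambda>k. case_prod H (k, t)) \<in> borel_measurable borel" by measurable
    then show ?thesis by simp
  qed
  \<comment> \<open>The energy at time t in the frequencies above n, which measures the error of
    truncating there.\<close>
  define q where "q n t = (\<integral>\<^sup>+k. indicator {0..T} t * (indicator {k. \<bar>k\<bar> > real n} k * ennreal ((cmod (H k t))\<^sup>2)) \<partial>lborel)" for n :: nat and t
  have [measurable]: "{k::real. \<bar>k\<bar> > real n} \<in> sets borel" for n by measurable
  have [measurable]: "q n \<in> borel_measurable borel" for n unfolding q_def[abs_def] by measurable
  define Nt where "Nt t = (\<integral>\<^sup>+k. indicator {0..T} t * ennreal ((cmod (H k t))\<^sup>2) \<partial>lborel)" for t
  have [measurable]: "Nt \<in> borel_measurable borel" unfolding Nt_def[abs_def] by measurable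
  have AEN: "AE t in lborel. Nt t \<noteq> \<infinity>" using fin unfolding Nt_def by (intro nn_integral_noteq_infinite) auto
  have qN: "q n t \<le> Nt t" for n t
    unfolding q_def Nt_def by (intro nn_integral_mono mult_left_mono) (auto simp: indicator_def)
  have qlim: "(\<lambda>n. q n t) \<longlonglongrightarrow> 0" if "Nt t \<noteq> \<infinity>" for t
  proof -
    have "(\<lambda>n. q n t) \<longlonglongrightarrow> (\<integral>\<^sup>+k. 0 \<partial>(lborel :: real measure))"
      unfolding q_def
    proof (rule nn_integral_dominated_convergence[where w = "\<lambda>k. indicator {0..T} t * ennreal ((cmod (H k t))\<^sup>2)"])
      show "(\<integral>\<^sup>+k. indicator {0..T} t * ennreal ((cmod (H k t))\<^sup>2) \<partial>lborel) < \<infinity>" using that unfolding Nt_def by (simp add: less_top)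
      show "AE k in lborel. (\<lambda>n. indicator {0..T} t * (indicator {k. \<bar>k\<bar> > real n} k * ennreal ((cmod (H k t))\<^sup>2))) \<longlonglongrightarrow> 0"
      proof (rule AE_I2)
        fix k :: real
        obtain N :: nat where N: "\<bar>k\<bar> \<le> real N" using real_arch_simple by blast
        have "eventually (\<lambda>n. indicator {0..T} t * (indicator {k. \<bar>k\<bar> > real n} k * ennreal ((cmod (H k t))\<^sup>2)) = 0) sequentially"
          using eventually_ge_at_top[of N] by eventually_elim (use N in \<open>auto simp: indicator_def\<close>)
        then show "(\<lambda>n. indicator {0..T} t * (indicator {k. \<bar>k\<bar> > real n} k * ennreal ((cmod (H k t))\<^sup>2))) \<longlonglongrightarrow> 0" by (rule tendsto_eventually)
      qed
      show "AE k in lborel. indicator {0..T} t * (indicator {k. \<bar>k\<bar> > real n} k * ennreal ((cmod (H k t))\<^sup>2)) \<le> indicator {0..T} t * ennreal ((cmod (H k t))\<^sup>2)" for n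
        by (intro AE_I2) (auto simp: indicator_def)
    qed measurable
    then show ?thesis by simp
  qed
  have Qlim: "(\<lambda>n. \<integral>\<^sup>+t. q n t \<partial>lborel) \<longlonglongrightarrow> 0"
  proof -
    have "(\<lambda>n. \<integral>\<^sup>+t. q n t \<partial>lborel) \<longlonglongrightarrow> (\<integral>\<^sup>+t. 0 \<partial>(lborel :: real measure))"
    proof (rule nn_integral_dominated_convergence[where w = Nt])
      show "(\<integral>\<^sup>+t. Nt t \<partial>lborel) < \<infinity>" using fin unfolding Nt_def .
      show "AE t in lborel. (\<lambda>n. q n t) \<longlonglongrightarrow> 0" using AEN by eventually_elim (rule qlim)
      show "AE t in lborel. q n t \<le> Nt t" for n by (intro AE_I2 qN)
    qed measurable
    then show ?thesis by simp
  qed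
  have "\<exists>n. (\<integral>\<^sup>+t. q n t \<partial>lborel) < ennreal ((1/8) ^ j)" for j :: nat
  proof -
    have "eventually (\<lambda>n. (\<integral>\<^sup>+t. q n t \<partial>lborel) < ennreal ((1/8) ^ j)) sequentially"
      using Qlim by (rule order_tendstoD(2)) simp
    then show ?thesis by (auto simp: eventually_sequentially)
  qed
  \<comment> \<open>The rate 8^-j leaves room for the factor 4^j in \<open>S\<close>. For almost
    every t the tails at that time are then of order 4^-j, which in turn leaves room for the factor
    2^j in the convergence in x.\<close>
  then obtain r where r: "\<And>j. (\<integral>\<^sup>+t. q (r j) t \<partial>lborel) < ennreal ((1/8) ^ j)" by metis
  define S where "S t = (\<Sum>j. ennreal (4 ^ j) * q (r j) t)" for t
  have AES: "AE t in lborel. S t \<noteq> \<infinity>"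
  proof (rule nn_integral_noteq_infinite)
    show "S \<in> borel_measurable lborel" unfolding S_def[abs_def] by measurable
    have "(\<integral>\<^sup>+t. S t \<partial>lborel) = (\<Sum>j. \<integral>\<^sup>+t. ennreal (4 ^ j) * q (r j) t \<partial>lborel)"
      unfolding S_def by (rule nn_integral_suminf) measurable
    also have "\<dots> = (\<Sum>j. ennreal (4 ^ j) * (\<integral>\<^sup>+t. q (r j) t \<partial>lborel))"
      by (intro arg_cong[where f = suminf] ext nn_integral_cmult) measurable
    also have "\<dots> \<le> (\<Sum>j. ennreal ((1/2) ^ j))"
    proof (rule suminf_le)
      fix j
      have "ennreal (4 ^ j) * (\<integral>\<^sup>+t. q (r j) t \<partial>lborel) \<le> ennreal (4 ^ j) * ennreal ((1/8) ^ j)"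
        by (intro mult_left_mono less_imp_le[OF r]) simp
      also have "\<dots> = ennreal (4 ^ j * (1/8) ^ j)" by (rule ennreal_mult[symmetric]) auto
      also have "(4::real) ^ j * (1/8) ^ j = (1/2) ^ j"
      proof -
        have "(4::real) ^ j * (1/8) ^ j = (4 * (1/8)) ^ j" by (rule power_mult_distrib[symmetric])
        then show ?thesis by simp
      qed
      finally show "ennreal (4 ^ j) * (\<integral>\<^sup>+t. q (r j) t \<partial>lborel) \<le> ennreal ((1/2) ^ j)" .
    qed auto
    also have "\<dots> < \<infinity>" by (subst suminf_ennreal2) (auto simp: summable_geometric)
    finally show "(\<integral>\<^sup>+t. S t \<partial>lborel) \<noteq> \<infinity>" by simp
  qed
  define h where "h j k t = (if \<bar>k\<bar> \<le> real (r j) then H k t else 0)" for j k t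
  have [measurable]: "case_prod (h j) \<in> borel_measurable (borel \<Otimes>\<^sub>M borel)" for j
    unfolding h_def[abs_def] by measurable
  define gj where "gj j x t = (LINT k|lborel. exp (- \<i> * complex_of_real (- x * k)) * h j k t) / complex_of_real (2 * pi)" for j x t
  have [measurable]: "case_prod (gj j) \<in> borel_measurable (borel \<Otimes>\<^sub>M borel)" for j
    unfolding gj_def by measurable
  define g where "g z = lim (\<lambda>j. gj j (fst z) (snd z))" for z
  have gm': "g \<in> borel_measurable (borel \<Otimes>\<^sub>M borel)" unfolding g_def[abs_def] by (rule borel_measurable_lim_metric) measurable
  then have gm: "g \<in> borel_measurable borel" by (simp add: borel_prod)
  note [measurable] = gm'
  have [measurable]: "(\<lambda>x. gj j x t) \<in> borel_measurable borel" for j t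
  proof -
    have "(\<lambda>x. case_prod (gj j) (x, t)) \<in> borel_measurable borel" by measurable
    then show ?thesis by simp
  qed
  have [measurable]: "(\<lambda>x. g (x, t)) \<in> borel_measurable borel" for t by measurable
  \<comment> \<open>The times with infinite energy or infinite \<open>S t\<close> form a null set;
    for the others everything below runs with t fixed.\<close>
  have good: "(\<integral>\<^sup>+x. ennreal ((cmod (g (x, t)))\<^sup>2) \<partial>lborel) \<le> Nt t \<and>
      (\<forall>\<phi>. schwartz \<phi> \<longrightarrow> inverse_fourier (\<lambda>k. H k t) \<phi> = regular (\<lambda>x. g (x, t)) \<phi>)"
    if t: "t \<in> {0..T}" and Nf: "Nt t \<noteq> \<infinity>" and Sf: "S t \<noteq> \<infinity>" for t
  proof -
    have Nlt: "Nt t < \<infinity>" using Nf by (simp add: less_top)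
    have N1: "Nt t = (\<integral>\<^sup>+k. ennreal ((cmod (H k t))\<^sup>2) \<partial>lborel)" unfolding Nt_def using t by simp
    have Hi: "integrable lborel (\<lambda>k. sob_weight 0 k * (cmod (H k t))\<^sup>2)"
      using Nf unfolding N1 by (intro integrableI_nonneg) (auto simp: less_top)
    have [measurable]: "(\<lambda>k. h j k t) \<in> borel_measurable borel" for j unfolding h_def by measurable
    have hN: "(\<integral>\<^sup>+k. ennreal ((cmod (h j k t))\<^sup>2) \<partial>lborel) \<le> Nt t" for j
      unfolding N1 by (intro nn_integral_mono) (auto simp: h_def)
    have hi: "integrable lborel (\<lambda>k. h j k t)" for j
    proof (rule square_integrable_compact_integrable[where R = "real (r j)"])
      show "(\<integral>\<^sup>+k. ennreal ((cmod (h j k t))\<^sup>2) \<partial>lborel) < \<infinity>" by (rule le_less_trans[OF hN Nlt])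
    qed (auto simp: h_def)
    have gjf: "gj j x t = fourier (\<lambda>k. h j k t) (- x) / complex_of_real (2 * pi)" for j x
      unfolding gj_def fourier_def by simp
    have pl: "(\<integral>\<^sup>+x. ennreal ((cmod (fourier b (- x) / complex_of_real (2 * pi)))\<^sup>2) \<partial>lborel) \<le> (\<integral>\<^sup>+k. ennreal ((cmod (b k))\<^sup>2) \<partial>lborel)"
      if b: "integrable lborel b" for b :: "real \<Rightarrow> complex"
    proof -
      have bm: "fourier b \<in> borel_measurable borel" using b by (intro fourier_measurable) (auto dest: borel_measurable_integrable)
      have "(\<integral>\<^sup>+x. ennreal ((cmod (fourier b (- x) / complex_of_real (2 * pi)))\<^sup>2) \<partial>lborel) = (\<integral>\<^sup>+x. ennreal ((cmod (fourier b x / complex_of_real (2 * pi)))\<^sup>2) \<partial>lborel)"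
        by (rule nn_integral_minus_real[of "\<lambda>x. ennreal ((cmod (fourier b x / complex_of_real (2 * pi)))\<^sup>2)"]) (use bm in measurable)
      also have "\<dots> = (\<integral>\<^sup>+x. ennreal (1 / (2 * pi)\<^sup>2) * ennreal ((cmod (fourier b x))\<^sup>2) \<partial>lborel)"
      proof (rule nn_integral_cong)
        fix x
        have "(cmod (fourier b x / complex_of_real (2 * pi)))\<^sup>2 = 1 / (2 * pi)\<^sup>2 * (cmod (fourier b x))\<^sup>2"
          by (simp add: norm_divide norm_mult power_divide)
        then show "ennreal ((cmod (fourier b x / complex_of_real (2 * pi)))\<^sup>2) = ennreal (1 / (2 * pi)\<^sup>2) * ennreal ((cmod (fourier b x))\<^sup>2)"
          by (simp only:) (rule ennreal_mult, auto)
      qed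
      also have "\<dots> = ennreal (1 / (2 * pi)\<^sup>2) * (\<integral>\<^sup>+x. ennreal ((cmod (fourier b x))\<^sup>2) \<partial>lborel)"
        by (rule nn_integral_cmult) (use bm in measurable)
      also have "\<dots> \<le> ennreal (1 / (2 * pi)\<^sup>2) * (ennreal (2 * pi) * (\<integral>\<^sup>+k. ennreal ((cmod (b k))\<^sup>2) \<partial>lborel))"
        by (intro mult_left_mono plancherel_le b) simp
      also have "\<dots> = (ennreal (1 / (2 * pi)\<^sup>2) * ennreal (2 * pi)) * (\<integral>\<^sup>+k. ennreal ((cmod (b k))\<^sup>2) \<partial>lborel)" by (rule mult.assoc[symmetric])
      also have "ennreal (1 / (2 * pi)\<^sup>2) * ennreal (2 * pi) = ennreal (1 / (2 * pi)\<^sup>2 * (2 * pi))" by (rule ennreal_mult[symmetric]) auto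
      also have "1 / (2 * pi)\<^sup>2 * (2 * pi) = 1 / (2 * pi)" by (simp add: power2_eq_square)
      also have "ennreal (1 / (2 * pi)) * (\<integral>\<^sup>+k. ennreal ((cmod (b k))\<^sup>2) \<partial>lborel) \<le> 1 * (\<integral>\<^sup>+k. ennreal ((cmod (b k))\<^sup>2) \<partial>lborel)"
        using pi_gt3 by (intro mult_right_mono) (auto simp: ennreal_le_1)
      finally show ?thesis by simp
    qed
    have gN: "(\<integral>\<^sup>+x. ennreal ((cmod (gj j x t))\<^sup>2) \<partial>lborel) \<le> Nt t" for j
      unfolding gjf by (rule order_trans[OF pl[OF hi] hN])
    have diff: "(\<integral>\<^sup>+x. ennreal ((cmod (gj i x t - gj j x t))\<^sup>2) \<partial>lborel) \<le> q (r i) t + q (r j) t" for i j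
    proof -
      have "gj i x t - gj j x t = fourier (\<lambda>k. h i k t - h j k t) (- x) / complex_of_real (2 * pi)" for x
      proof -
        have e: "integrable lborel (\<lambda>k. exp (- \<i> * complex_of_real ((- x) \<bullet> k)) * h j k t)" for j
          using integrable_exp_mult[OF hi[of j], of "\<lambda>k. (- x) \<bullet> k"] by simp
        have "fourier (\<lambda>k. h i k t - h j k t) (- x) = fourier (\<lambda>k. h i k t) (- x) - fourier (\<lambda>k. h j k t) (- x)"
          unfolding fourier_def right_diff_distrib by (rule Bochner_Integration.integral_diff[OF e e])
        then show ?thesis unfolding gjf by (simp add: diff_divide_distrib)
      qed
      then have "(\<integral>\<^sup>+x. ennreal ((cmod (gj i x t - gj j x t))\<^sup>2) \<partial>lborel) \<le> (\<integral>\<^sup>+k. ennreal ((cmod (h i k t - h j k t))\<^sup>2) \<partial>lborel)"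
        using pl[of "\<lambda>k. h i k t - h j k t"] hi by simp
      also have "\<dots> \<le> (\<integral>\<^sup>+k. indicator {0..T} t * (indicator {k. \<bar>k\<bar> > real (r i)} k * ennreal ((cmod (H k t))\<^sup>2))
          + indicator {0..T} t * (indicator {k. \<bar>k\<bar> > real (r j)} k * ennreal ((cmod (H k t))\<^sup>2)) \<partial>lborel)"
        using t by (intro nn_integral_mono) (auto simp: h_def indicator_def)
      also have "\<dots> = q (r i) t + q (r j) t" unfolding q_def by (rule nn_integral_add) measurable
      finally show ?thesis .
    qed
    have qS: "ennreal (4 ^ j) * q (r j) t \<le> S t" for j
    proof -
      have "(\<Sum>i\<in>{j}. ennreal (4 ^ i) * q (r i) t) \<le> S t" unfolding S_def by (rule sum_le_suminf) auto
      then show ?thesis by simp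
    qed
    obtain s0 where s0: "S t = ennreal s0" "s0 \<ge> 0" using Sf by (cases "S t") auto
    have qb: "q (r j) t \<le> ennreal (s0 / 4 ^ j)" for j
    proof -
      have "q (r j) t = ennreal (1 / 4 ^ j) * (ennreal (4 ^ j) * q (r j) t)"
        by (simp only: mult.assoc[symmetric]) (subst ennreal_mult[symmetric], auto)
      also have "\<dots> \<le> ennreal (1 / 4 ^ j) * ennreal s0" using qS s0 by (intro mult_left_mono) auto
      also have "\<dots> = ennreal (s0 / 4 ^ j)" using s0 by (subst ennreal_mult[symmetric]) auto
      finally show ?thesis .
    qed
    have conv: "AE x in lborel. (\<lambda>j. gj j x t) \<longlonglongrightarrow> g (x, t)"
    proof -
      have "(\<integral>\<^sup>+x. (\<Sum>j. ennreal (2 ^ j * (cmod (gj (Suc j) x t - gj j x t))\<^sup>2)) \<partial>lborel) = (\<Sum>j. \<integral>\<^sup>+x. ennreal (2 ^ j * (cmod (gj (Suc j) x t - gj j x t))\<^sup>2) \<partial>lborel)"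
        by (rule nn_integral_suminf) measurable
      also have "\<dots> \<le> (\<Sum>j. ennreal (2 * s0 * (1/2) ^ j))"
      proof (rule suminf_le)
        fix j
        have "(\<integral>\<^sup>+x. ennreal (2 ^ j * (cmod (gj (Suc j) x t - gj j x t))\<^sup>2) \<partial>lborel) = (\<integral>\<^sup>+x. ennreal (2 ^ j) * ennreal ((cmod (gj (Suc j) x t - gj j x t))\<^sup>2) \<partial>lborel)"
          by (intro nn_integral_cong ennreal_mult) auto
        also have "\<dots> = ennreal (2 ^ j) * (\<integral>\<^sup>+x. ennreal ((cmod (gj (Suc j) x t - gj j x t))\<^sup>2) \<partial>lborel)"
          by (rule nn_integral_cmult) measurable
        also have "\<dots> \<le> ennreal (2 ^ j) * (ennreal (s0 / 4 ^ j) + ennreal (s0 / 4 ^ j))"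
        proof (intro mult_left_mono order_trans[OF diff] add_mono qb)
          have "q (r (Suc j)) t \<le> ennreal (s0 / 4 ^ Suc j)" by (rule qb)
          also have "\<dots> \<le> ennreal (s0 / 4 ^ j)" using s0 by (intro ennreal_leI divide_left_mono) auto
          finally show "q (r (Suc j)) t \<le> ennreal (s0 / 4 ^ j)" .
        qed simp
        also have "\<dots> = ennreal (2 ^ j * (s0 / 4 ^ j + s0 / 4 ^ j))"
          using s0 by (subst ennreal_plus[symmetric], simp, simp, subst ennreal_mult[symmetric]) auto
        also have "2 ^ j * (s0 / 4 ^ j + s0 / 4 ^ j) = 2 * s0 * (1/2) ^ j"
        proof -
          have "(4::real) ^ j = 2 ^ j * 2 ^ j" by (simp add: power_mult_distrib[symmetric])
          then show ?thesis by (simp add: power_one_over field_simps)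
        qed
        finally show "(\<integral>\<^sup>+x. ennreal (2 ^ j * (cmod (gj (Suc j) x t - gj j x t))\<^sup>2) \<partial>lborel) \<le> ennreal (2 * s0 * (1/2) ^ j)" .
      qed auto
      also have "\<dots> < \<infinity>"
        using s0 by (subst suminf_ennreal2) (auto intro!: summable_mult summable_geometric)
      finally have "AE x in lborel. (\<Sum>j. ennreal (2 ^ j * (cmod (gj (Suc j) x t - gj j x t))\<^sup>2)) \<noteq> \<infinity>"
        by (intro nn_integral_noteq_infinite) auto
      then show ?thesis
      proof eventually_elim
        case (elim x)
        then have "summable (\<lambda>j. gj (Suc j) x t - gj j x t)" by (rule summable_of_weighted_squares)
        then have "convergent (\<lambda>n. \<Sum>j<n. gj (Suc j) x t - gj j x t)" by (simp add: summable_iff_convergent)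
        then have "convergent (\<lambda>n. gj n x t - gj 0 x t)" by (simp only: sum_lessThan_telescope[of "\<lambda>j. gj j x t"])
        then have "convergent (\<lambda>n. (gj n x t - gj 0 x t) + gj 0 x t)" by (intro convergent_add convergent_const)
        then have "convergent (\<lambda>n. gj n x t)" by simp
        then show ?case unfolding g_def by (simp add: convergent_LIMSEQ_iff)
      qed
    qed
    have gL2: "(\<integral>\<^sup>+x. ennreal ((cmod (g (x, t)))\<^sup>2) \<partial>lborel) \<le> Nt t"
    proof (rule nn_integral_fatou_bound_AE[where u = "\<lambda>j x. ennreal ((cmod (gj j x t))\<^sup>2)"])
      show "AE x in lborel. (\<lambda>j. ennreal ((cmod (gj j x t))\<^sup>2)) \<longlonglongrightarrow> ennreal ((cmod (g (x, t)))\<^sup>2)"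
        using conv by eventually_elim (intro tendsto_ennrealI tendsto_power tendsto_norm)
    qed (use gN in auto)
    have dist: "(\<integral>\<^sup>+x. ennreal ((cmod (g (x, t) - gj j x t))\<^sup>2) \<partial>lborel) \<le> ennreal (2 * s0 / 4 ^ j)" for j
    proof (rule nn_integral_fatou_bound_AE[where u = "\<lambda>i x. ennreal ((cmod (gj i x t - gj j x t))\<^sup>2)"])
      show "AE x in lborel. (\<lambda>i. ennreal ((cmod (gj i x t - gj j x t))\<^sup>2)) \<longlonglongrightarrow> ennreal ((cmod (g (x, t) - gj j x t))\<^sup>2)"
        using conv by eventually_elim (intro tendsto_ennrealI tendsto_power tendsto_norm tendsto_diff tendsto_const)
      show "eventually (\<lambda>i. (\<integral>\<^sup>+x. ennreal ((cmod (gj i x t - gj j x t))\<^sup>2) \<partial>lborel) \<le> ennreal (2 * s0 / 4 ^ j)) sequentially"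
        using eventually_ge_at_top[of j]
      proof eventually_elim
        case (elim i)
        have "q (r i) t \<le> ennreal (s0 / 4 ^ i)" by (rule qb)
        also have "\<dots> \<le> ennreal (s0 / 4 ^ j)" using s0 elim by (intro ennreal_leI divide_left_mono) auto
        finally have "q (r i) t + q (r j) t \<le> ennreal (s0 / 4 ^ j) + ennreal (s0 / 4 ^ j)" using qb by (intro add_mono)
        also have "\<dots> = ennreal (2 * s0 / 4 ^ j)" using s0 by (subst ennreal_plus[symmetric]) auto
        finally show ?case using diff order_trans by blast
      qed
    qed measurable
    have "inverse_fourier (\<lambda>k. H k t) \<phi> = regular (\<lambda>x. g (x, t)) \<phi>" if \<phi>: "schwartz \<phi>" for \<phi>
    proof -
      have [measurable]: "\<phi> \<in> borel_measurable borel" by (rule schwartz_measurable[OF \<phi>])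
      have [measurable]: "fourier \<phi> \<in> borel_measurable borel" by (rule fourier_measurable) simp
      have \<phi>i: "integrable lborel \<phi>" by (rule schwartz_integrable[OF \<phi>])
      have \<phi>2: "(\<integral>\<^sup>+x. ennreal ((cmod (\<phi> x))\<^sup>2) \<partial>lborel) < \<infinity>"
      proof -
        obtain C where "\<forall>x. (1 + norm x) ^ (DIM(real) + nat \<lceil>\<bar>0::real\<bar>\<rceil>) * cmod (\<phi> x) \<le> C" using schwartz_decay[OF \<phi>] by blast
        then have "(1 + norm x) ^ (DIM(real) + nat \<lceil>\<bar>0::real\<bar>\<rceil>) * cmod (\<phi> x) \<le> C" for x by blast
        from weight_decay_square_integrable[OF _ this] have "integrable lborel (\<lambda>x. (cmod (\<phi> x))\<^sup>2)" by simp
        then show ?thesis by (simp add: integrable_iff_bounded)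
      qed
      \<comment> \<open>The pairing identity holds for each truncation and is passed to the limit on
        both sides: here by dominated convergence in k, and in \<open>L2\<close> by Cauchy-Schwarz
        against \<phi>.\<close>
      have L1: "(\<lambda>j. LINT k|lborel. h j k t * fourier \<phi> (- k)) \<longlonglongrightarrow> (LINT k|lborel. H k t * fourier \<phi> (- k))"
      proof (rule integral_dominated_convergence[where w = "\<lambda>k. cmod (H k t * fourier \<phi> (- k))"])
        show "integrable lborel (\<lambda>k. cmod (H k t * fourier \<phi> (- k)))"
          using inverse_fourier_pairing[OF _ Hi \<phi>] by simp
        show "AE k in lborel. norm (h j k t * fourier \<phi> (- k)) \<le> cmod (H k t * fourier \<phi> (- k))" for j
          by (intro AE_I2) (simp add: h_def)
        have "AE k in lborel. (\<lambda>j. (cmod (h j k t - H k t))\<^sup>2) \<longlonglongrightarrow> 0"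
        proof -
          have "(\<integral>\<^sup>+k. (\<Sum>j. ennreal ((cmod (h j k t - H k t))\<^sup>2)) \<partial>lborel) = (\<Sum>j. \<integral>\<^sup>+k. ennreal ((cmod (h j k t - H k t))\<^sup>2) \<partial>lborel)"
            by (rule nn_integral_suminf) measurable
          also have "\<dots> \<le> (\<Sum>j. ennreal (s0 * (1/4) ^ j))"
          proof (rule suminf_le)
            fix j
            have "(\<integral>\<^sup>+k. ennreal ((cmod (h j k t - H k t))\<^sup>2) \<partial>lborel) \<le> q (r j) t"
              unfolding q_def using t by (intro nn_integral_mono) (auto simp: h_def indicator_def)
            also have "\<dots> \<le> ennreal (s0 * (1/4) ^ j)" using qb[of j] by (simp add: power_one_over)
            finally show "(\<integral>\<^sup>+k. ennreal ((cmod (h j k t - H k t))\<^sup>2) \<partial>lborel) \<le> ennreal (s0 * (1/4) ^ j)" .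
          qed auto
          also have "\<dots> < \<infinity>" using s0 by (subst suminf_ennreal2) (auto intro!: summable_mult summable_geometric)
          finally have "AE k in lborel. (\<Sum>j. ennreal ((cmod (h j k t - H k t))\<^sup>2)) \<noteq> \<infinity>"
            by (intro nn_integral_noteq_infinite) auto
          then show ?thesis
          proof eventually_elim
            case (elim k)
            then have "summable (\<lambda>j. (cmod (h j k t - H k t))\<^sup>2)" by (intro summable_suminf_not_top) auto
            then show ?case by (rule summable_LIMSEQ_zero)
          qed
        qed
        then show "AE k in lborel. (\<lambda>j. h j k t * fourier \<phi> (- k)) \<longlonglongrightarrow> H k t * fourier \<phi> (- k)"
        proof eventually_elim
          case (elim k)
          from tendsto_real_sqrt[OF elim] have "(\<lambda>j. cmod (h j k t - H k t)) \<longlonglongrightarrow> 0" by simp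
          then have "(\<lambda>j. h j k t - H k t) \<longlonglongrightarrow> 0" by (rule tendsto_norm_zero_cancel)
          then have "(\<lambda>j. h j k t) \<longlonglongrightarrow> H k t" by (simp add: LIM_zero_iff)
          then show ?case by (intro tendsto_mult tendsto_const)
        qed
      qed measurable
      have eqj: "(LINT x|lborel. gj j x t * \<phi> x) = (LINT k|lborel. h j k t * fourier \<phi> (- k)) / complex_of_real (2 * pi)" for j
      proof -
        let ?K = "\<lambda>x k. (exp (- \<i> * complex_of_real (- x * k)) * h j k t) * \<phi> x"
        have "(LINT x|lborel. gj j x t * \<phi> x) = (LINT x|lborel. (LINT k|lborel. ?K x k) / complex_of_real (2 * pi))"
          unfolding gj_def by (simp only: integral_mult_left_zero times_divide_eq_left)
        also have "\<dots> = (LINT x|lborel. LINT k|lborel. ?K x k) / complex_of_real (2 * pi)" by (rule integral_divide_zero)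
        also have "(LINT x|lborel. LINT k|lborel. ?K x k) = (LINT k|lborel. LINT x|lborel. ?K x k)"
          by (rule fubini_prod_bound(2)[symmetric, where A = "\<lambda>x. cmod (\<phi> x)" and B = "\<lambda>k. cmod (h j k t)"])
             (use \<phi>i hi in \<open>auto simp: norm_mult\<close>)
        also have "\<dots> = (LINT k|lborel. h j k t * fourier \<phi> (- k))"
        proof (intro Bochner_Integration.integral_cong refl)
          fix k
          have "(LINT x|lborel. ?K x k) = (LINT x|lborel. h j k t * (exp (- \<i> * complex_of_real ((- k) \<bullet> x)) * \<phi> x))"
            by (intro Bochner_Integration.integral_cong refl) (simp add: mult_ac)
          then show "(LINT x|lborel. ?K x k) = h j k t * fourier \<phi> (- k)" unfolding fourier_def by (simp only: integral_mult_right_zero)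
        qed
        finally show ?thesis .
      qed
      have prod_i: "integrable lborel (\<lambda>x. a x * \<phi> x)" if [measurable]: "a \<in> borel_measurable borel" and a: "(\<integral>\<^sup>+x. ennreal ((cmod (a x))\<^sup>2) \<partial>lborel) < \<infinity>" for a
      proof (rule integrableI_bounded)
        have "(\<integral>\<^sup>+x. ennreal (norm (a x * \<phi> x)) \<partial>lborel) \<le> (\<integral>\<^sup>+x. ennreal ((cmod (a x))\<^sup>2) + ennreal ((cmod (\<phi> x))\<^sup>2) \<partial>lborel)"
        proof (rule nn_integral_mono)
          fix x
          have "cmod (a x) * cmod (\<phi> x) \<le> (cmod (a x))\<^sup>2 + (cmod (\<phi> x))\<^sup>2" using amgm_weight[of 1 "cmod (a x)" "cmod (\<phi> x)"] by simp
          then have "ennreal (norm (a x * \<phi> x)) \<le> ennreal ((cmod (a x))\<^sup>2 + (cmod (\<phi> x))\<^sup>2)" by (intro ennreal_leI) (simp add: norm_mult)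
          also have "\<dots> = ennreal ((cmod (a x))\<^sup>2) + ennreal ((cmod (\<phi> x))\<^sup>2)" by (rule ennreal_plus) auto
          finally show "ennreal (norm (a x * \<phi> x)) \<le> ennreal ((cmod (a x))\<^sup>2) + ennreal ((cmod (\<phi> x))\<^sup>2)" .
        qed
        also have "\<dots> = (\<integral>\<^sup>+x. ennreal ((cmod (a x))\<^sup>2) \<partial>lborel) + (\<integral>\<^sup>+x. ennreal ((cmod (\<phi> x))\<^sup>2) \<partial>lborel)" by (rule nn_integral_add) measurable
        also have "\<dots> < \<infinity>" using a \<phi>2 by simp
        finally show "(\<integral>\<^sup>+x. ennreal (norm (a x * \<phi> x)) \<partial>lborel) < \<infinity>" .
      qed measurable
      have gfin: "(\<integral>\<^sup>+x. ennreal ((cmod (g (x, t)))\<^sup>2) \<partial>lborel) < \<infinity>" by (rule le_less_trans[OF gL2 Nlt])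
      have gjfin: "(\<integral>\<^sup>+x. ennreal ((cmod (gj j x t))\<^sup>2) \<partial>lborel) < \<infinity>" for j by (rule le_less_trans[OF gN Nlt])
      have L2: "(\<lambda>j. LINT x|lborel. gj j x t * \<phi> x) \<longlonglongrightarrow> (LINT x|lborel. g (x, t) * \<phi> x)"
      proof -
        obtain p2 where p2: "(\<integral>\<^sup>+x. ennreal ((cmod (\<phi> x))\<^sup>2) \<partial>lborel) = ennreal p2" "p2 \<ge> 0" using \<phi>2 by (cases "(\<integral>\<^sup>+x. ennreal ((cmod (\<phi> x))\<^sup>2) \<partial>lborel)") auto
        have b: "cmod ((LINT x|lborel. g (x, t) * \<phi> x) - (LINT x|lborel. gj j x t * \<phi> x)) \<le> sqrt (2 * s0 * p2) * (1/2) ^ j" for j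
        proof -
          have "(LINT x|lborel. g (x, t) * \<phi> x) - (LINT x|lborel. gj j x t * \<phi> x) = (LINT x|lborel. (g (x, t) - gj j x t) * \<phi> x)"
            unfolding left_diff_distrib by (rule Bochner_Integration.integral_diff[symmetric]) (use prod_i gfin gjfin in auto)
          then have "ennreal (cmod ((LINT x|lborel. g (x, t) * \<phi> x) - (LINT x|lborel. gj j x t * \<phi> x))) \<le> (\<integral>\<^sup>+x. ennreal (cmod (g (x, t) - gj j x t)) * ennreal (cmod (\<phi> x)) \<partial>lborel)"
            using ennreal_norm_integral[of lborel "\<lambda>x. (g (x, t) - gj j x t) * \<phi> x"] by (simp add: norm_mult ennreal_mult)
          then have "(ennreal (cmod ((LINT x|lborel. g (x, t) * \<phi> x) - (LINT x|lborel. gj j x t * \<phi> x))))\<^sup>2 \<le> (\<integral>\<^sup>+x. ennreal (cmod (g (x, t) - gj j x t)) * ennreal (cmod (\<phi> x)) \<partial>lborel)\<^sup>2"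
            by (intro power_mono) auto
          also have "\<dots> \<le> (\<integral>\<^sup>+x. (ennreal (cmod (g (x, t) - gj j x t)))\<^sup>2 \<partial>lborel) * (\<integral>\<^sup>+x. (ennreal (cmod (\<phi> x)))\<^sup>2 \<partial>lborel)"
            by (rule Cauchy_Schwarz_nn_integral) measurable
          also have "\<dots> \<le> ennreal (2 * s0 / 4 ^ j) * ennreal p2"
            using dist[of j] p2 by (intro mult_mono) (auto simp: ennreal_square)
          also have "\<dots> = ennreal (2 * s0 / 4 ^ j * p2)" using s0 p2 by (intro ennreal_mult[symmetric]) auto
          finally have "(cmod ((LINT x|lborel. g (x, t) * \<phi> x) - (LINT x|lborel. gj j x t * \<phi> x)))\<^sup>2 \<le> 2 * s0 / 4 ^ j * p2"
            using s0 p2 by (simp add: ennreal_square ennreal_le_iff)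
          then have "cmod ((LINT x|lborel. g (x, t) * \<phi> x) - (LINT x|lborel. gj j x t * \<phi> x)) \<le> sqrt (2 * s0 / 4 ^ j * p2)" by (rule real_le_rsqrt)
          also have "2 * s0 / 4 ^ j * p2 = 2 * s0 * p2 * ((1/2) ^ j)\<^sup>2"
          proof -
            have "((1/2::real) ^ j)\<^sup>2 = 1 / 4 ^ j"
            proof -
              have "((1/2::real) ^ j)\<^sup>2 = ((1/2)\<^sup>2) ^ j" by (simp only: power_mult[symmetric] mult.commute)
              then show ?thesis by (simp add: power2_eq_square power_one_over)
            qed
            then show ?thesis by simp
          qed
          also have "sqrt (2 * s0 * p2 * ((1/2) ^ j)\<^sup>2) = sqrt (2 * s0 * p2) * (1/2) ^ j" by (simp add: real_sqrt_mult)
          finally show ?thesis .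
        qed
        have "(\<lambda>j. sqrt (2 * s0 * p2) * (1/2::real) ^ j) \<longlonglongrightarrow> sqrt (2 * s0 * p2) * 0"
          by (intro tendsto_mult tendsto_const LIMSEQ_power_zero) auto
        then have lim0: "(\<lambda>j. sqrt (2 * s0 * p2) * (1/2::real) ^ j) \<longlonglongrightarrow> 0" by simp
        have "(\<lambda>j. (LINT x|lborel. g (x, t) * \<phi> x) - (LINT x|lborel. gj j x t * \<phi> x)) \<longlonglongrightarrow> 0"
          by (rule Lim_null_comparison[OF always_eventually lim0]) (use b in blast)
        from tendsto_diff[OF tendsto_const this, of "LINT x|lborel. g (x, t) * \<phi> x"] show ?thesis by simp
      qed
      have "(\<lambda>j. LINT x|lborel. gj j x t * \<phi> x) \<longlonglongrightarrow> (LINT k|lborel. H k t * fourier \<phi> (- k)) / complex_of_real (2 * pi)"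
        unfolding eqj by (intro tendsto_divide L1 tendsto_const) simp
      then have "(LINT x|lborel. g (x, t) * \<phi> x) = (LINT k|lborel. H k t * fourier \<phi> (- k)) / complex_of_real (2 * pi)"
        using L2 LIMSEQ_unique by blast
      then show ?thesis unfolding inverse_fourier_def regular_def by simp
    qed
    then show ?thesis using gL2 by blast
  qed
  have "g \<in> strip_L2 T"
  proof -
    have "(\<integral>\<^sup>+t. \<integral>\<^sup>+x. indicator {0..T} t * ennreal ((cmod (g (x, t)))\<^sup>2) \<partial>lborel \<partial>lborel) \<le> (\<integral>\<^sup>+t. Nt t \<partial>lborel)"
    proof (rule nn_integral_mono_AE)
      show "AE t in lborel. (\<integral>\<^sup>+x. indicator {0..T} t * ennreal ((cmod (g (x, t)))\<^sup>2) \<partial>lborel) \<le> Nt t"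
        using AEN AES
      proof eventually_elim
        case (elim t)
        show ?case
        proof (cases "t \<in> {0..T}")
          case True then show ?thesis using good[OF True elim] by simp
        qed simp
      qed
    qed
    also have "\<dots> < \<infinity>" using fin unfolding Nt_def .
    finally show ?thesis by (rule strip_L2I[OF gm])
  qed
  moreover have "AE t in lborel. t \<in> {0..T} \<longrightarrow> (\<forall>\<phi>. schwartz \<phi> \<longrightarrow> inverse_fourier (\<lambda>k. H k t) \<phi> = regular (\<lambda>x. g (x, t)) \<phi>)"
    using AEN AES by eventually_elim (use good in blast)
  ultimately show ?thesis by blast
qed

section \<open>Traces of the Duhamel integral on the lines x2 = y\<close>

lemma integrable_pair_bound:
  fixes f :: "'a::euclidean_space \<times> 'b::euclidean_space \<Rightarrow> complex"
  assumes m: "f \<in> borel_measurable borel" and A: "integrable lborel A" and B: "integrable lborel B"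
    and le: "\<And>x y. cmod (f (x, y)) \<le> A x * B y"
  shows "integrable lborel f"
proof -
  have "integrable (lborel \<Otimes>\<^sub>M lborel) (case_prod (\<lambda>x y. f (x, y)))"
    by (rule fubini_prod_bound(1)[OF _ A B le]) (use m in \<open>simp add: borel_prod\<close>)
  then show ?thesis by (simp add: lborel_prod)
qed

lemma integrable_pair_bound_real:
  fixes f :: "'a::euclidean_space \<times> 'b::euclidean_space \<Rightarrow> real"
  assumes m: "f \<in> borel_measurable borel" and A: "integrable lborel A" and B: "integrable lborel B"
    and le: "\<And>x y. \<bar>f (x, y)\<bar> \<le> A x * B y"
  shows "integrable lborel f"
proof -
  have "integrable lborel (\<lambda>z. complex_of_real (f z))"
    by (rule integrable_pair_bound[OF _ A B]) (use m le in auto)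
  from integrable_Re[OF this] show ?thesis by simp
qed

lemma lborel_pair_integral:
  fixes f :: "'a::euclidean_space \<times> 'b::euclidean_space \<Rightarrow> complex"
  assumes "integrable lborel f"
  shows "(LINT z|lborel. f z) = (LINT x|lborel. LINT y|lborel. f (x, y))"
proof -
  have "integrable (lborel \<Otimes>\<^sub>M lborel) f" using assms by (simp add: lborel_prod)
  from lborel_pair.integral_fst'[OF this] show ?thesis by (simp add: lborel_prod)
qed

lemma lborel_pair_nn_integral:
  fixes f :: "'a::euclidean_space \<times> 'b::euclidean_space \<Rightarrow> ennreal"
  assumes "f \<in> borel_measurable borel"
  shows "(\<integral>\<^sup>+z. f z \<partial>lborel) = (\<integral>\<^sup>+x. \<integral>\<^sup>+y. f (x, y) \<partial>lborel \<partial>lborel)"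
proof -
  have "f \<in> borel_measurable (lborel \<Otimes>\<^sub>M lborel)" using assms by (simp add: borel_prod lborel_prod)
  from lborel.nn_integral_fst[OF this] show ?thesis by (simp add: lborel_prod)
qed

lemma sob_weight_le_pair:
  fixes k l :: real
  assumes "s \<ge> 0" shows "sob_weight s k \<le> sob_weight s (k, l)" "sob_weight s l \<le> sob_weight s (k, l)"
  unfolding sob_weight_def using assms by (auto intro!: powr_mono2 simp: norm_Pair add_nonneg_nonneg)

context duhamel_data
begin

text \<open>The inverse transform in the second frequency at the point y, that is, the Fourier
  transform in x1 of the trace on the line x2 = y.\<close>

definition line_hat :: "real \<Rightarrow> real \<Rightarrow> real \<Rightarrow> complex" where
  "line_hat y k t = (LINT l|lborel. exp (\<i> * complex_of_real (l * y)) * duh (k, l) t) / complex_of_real (2 * pi)"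

lemma duh_slice_measurable [measurable]: "(\<lambda>l. duh (k, l) t) \<in> borel_measurable borel"
  using measurable_compose[OF _ duh_measurable_fst, of "\<lambda>l. (k, l)" borel t] by simp

lemma line_hat_measurable [measurable]: "case_prod (line_hat y) \<in> borel_measurable (borel \<Otimes>\<^sub>M borel)"
proof -
  have "(\<lambda>w. ((fst (fst w), snd w), snd (fst w))) \<in> ((borel \<Otimes>\<^sub>M borel) \<Otimes>\<^sub>M borel :: ((real \<times> real) \<times> real) measure) \<rightarrow>\<^sub>M (borel \<Otimes>\<^sub>M borel) \<Otimes>\<^sub>M borel"
    by measurable
  then have "(\<lambda>w::(real \<times> real) \<times> real. ((fst (fst w), snd w), snd (fst w))) \<in> borel \<rightarrow>\<^sub>M borel" by (simp only: borel_prod)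
  from measurable_compose[OF this duh_measurable]
  have [measurable]: "(\<lambda>w. duh (fst (fst w), snd w) (snd (fst w))) \<in> borel_measurable ((borel \<Otimes>\<^sub>M borel) \<Otimes>\<^sub>M borel)"
    by (simp add: borel_prod)
  have e: "case_prod (line_hat y) = (\<lambda>z. (LINT l|lborel. exp (\<i> * complex_of_real (snd (z, l) * y)) * (\<lambda>w. duh (fst (fst w), snd w) (snd (fst w))) (z, l)) / complex_of_real (2 * pi))"
    unfolding line_hat_def by (simp add: case_prod_beta')
  show ?thesis unfolding e by measurable
qed

lemma line_hat_measurable_fst [measurable]: "(\<lambda>k. line_hat y k t) \<in> borel_measurable borel"
proof -
  have "(\<lambda>k. case_prod (line_hat y) (k, t)) \<in> borel_measurable borel" by measurable
  then show ?thesis by simp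
qed

lemma line_hat_pointwise:
  assumes s: "s > 1 / 2"
  shows "ennreal ((cmod (line_hat y k t))\<^sup>2) \<le> ennreal (weight_mass s) * (\<integral>\<^sup>+l. ennreal (sob_weight s (k, l) * (cmod (duh (k, l) t))\<^sup>2) \<partial>lborel)"
proof -
  let ?I = "LINT l|lborel. exp (\<i> * complex_of_real (l * y)) * duh (k, l) t"
  have "cmod (line_hat y k t) = cmod ?I / (2 * pi)" unfolding line_hat_def by (simp add: norm_divide norm_mult)
  also have "\<dots> \<le> cmod ?I / 1" using pi_gt3 by (intro divide_left_mono) auto
  finally have "ennreal (cmod (line_hat y k t)) \<le> ennreal (cmod ?I)" by (intro ennreal_leI) simp
  also have "\<dots> \<le> (\<integral>\<^sup>+l. ennreal (cmod (exp (\<i> * complex_of_real (l * y)) * duh (k, l) t)) \<partial>lborel)" by (rule ennreal_norm_integral)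
  also have "\<dots> = (\<integral>\<^sup>+l. ennreal (cmod (duh (k, l) t)) \<partial>lborel)" by (simp add: norm_mult)
  finally have "(ennreal (cmod (line_hat y k t)))\<^sup>2 \<le> (\<integral>\<^sup>+l. ennreal (cmod (duh (k, l) t)) \<partial>lborel)\<^sup>2" by (intro power_mono) auto
  also have "\<dots> \<le> ennreal (weight_mass s) * (\<integral>\<^sup>+l. ennreal (sob_weight s l * (cmod (duh (k, l) t))\<^sup>2) \<partial>lborel)"
    by (rule weight_cauchy_schwarz[OF _ s]) measurable
  also have "\<dots> \<le> ennreal (weight_mass s) * (\<integral>\<^sup>+l. ennreal (sob_weight s (k, l) * (cmod (duh (k, l) t))\<^sup>2) \<partial>lborel)"
    by (intro mult_left_mono nn_integral_mono ennreal_leI mult_right_mono sob_weight_le_pair) (use s in auto)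
  finally show ?thesis by (simp add: ennreal_square)
qed

text \<open>The smoothness kept by a trace is not tracked; square integrability, uniform in y, is
  what \<open>inverse_fourier\<close> and the strip ask for.\<close>

lemma line_hat_L2:
  assumes s: "s > 1 / 2" and t: "t \<ge> 0"
  shows "(\<integral>\<^sup>+k. ennreal ((cmod (line_hat y k t))\<^sup>2) \<partial>lborel) \<le> ennreal (weight_mass s) * ennreal ((t * K)\<^sup>2)"
    and "integrable lborel (\<lambda>k. sob_weight 0 k * (cmod (line_hat y k t))\<^sup>2)"
proof -
  have m: "(\<lambda>z::real \<times> real. ennreal (sob_weight s z * (cmod (duh z t))\<^sup>2)) \<in> borel_measurable borel" by measurable
  then have [measurable]: "(\<lambda>z::real \<times> real. ennreal (sob_weight s z * (cmod (duh z t))\<^sup>2)) \<in> borel_measurable (borel \<Otimes>\<^sub>M borel)" by (simp add: borel_prod)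
  have [measurable]: "(\<lambda>k. \<integral>\<^sup>+l. ennreal (sob_weight s (k, l) * (cmod (duh (k, l) t))\<^sup>2) \<partial>lborel) \<in> borel_measurable borel"
    by measurable
  have "(\<integral>\<^sup>+k. ennreal ((cmod (line_hat y k t))\<^sup>2) \<partial>lborel) \<le> (\<integral>\<^sup>+k. ennreal (weight_mass s) * (\<integral>\<^sup>+l. ennreal (sob_weight s (k, l) * (cmod (duh (k, l) t))\<^sup>2) \<partial>lborel) \<partial>lborel)"
    by (intro nn_integral_mono line_hat_pointwise s)
  also have "\<dots> = ennreal (weight_mass s) * (\<integral>\<^sup>+k. \<integral>\<^sup>+l. ennreal (sob_weight s (k, l) * (cmod (duh (k, l) t))\<^sup>2) \<partial>lborel \<partial>lborel)"
    by (rule nn_integral_cmult) measurable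
  also have "(\<integral>\<^sup>+k. \<integral>\<^sup>+l. ennreal (sob_weight s (k, l) * (cmod (duh (k, l) t))\<^sup>2) \<partial>lborel \<partial>lborel) = (\<integral>\<^sup>+z. ennreal (sob_weight s z * (cmod (duh z t))\<^sup>2) \<partial>lborel)"
    by (rule lborel_pair_nn_integral[OF m, symmetric])
  also have "ennreal (weight_mass s) * (\<integral>\<^sup>+z. ennreal (sob_weight s z * (cmod (duh z t))\<^sup>2) \<partial>lborel) \<le> ennreal (weight_mass s) * ennreal ((t * K)\<^sup>2)"
    by (intro mult_left_mono duh_bound t) auto
  finally show b: "(\<integral>\<^sup>+k. ennreal ((cmod (line_hat y k t))\<^sup>2) \<partial>lborel) \<le> ennreal (weight_mass s) * ennreal ((t * K)\<^sup>2)" .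
  have "\<dots> < \<infinity>" by (simp add: ennreal_mult_less_top)
  with b have "(\<integral>\<^sup>+k. ennreal ((cmod (line_hat y k t))\<^sup>2) \<partial>lborel) < \<infinity>" by (rule le_less_trans)
  then show "integrable lborel (\<lambda>k. sob_weight 0 k * (cmod (line_hat y k t))\<^sup>2)"
    by (intro integrableI_nonneg) auto
qed

text \<open>The test function gives no decay in the second frequency. The weight of exponent -s
  supplies it, being integrable in that variable because s > 1/2.\<close>

lemma duh_line_integrable:
  assumes s: "s > 1 / 2" and \<phi>: "schwartz (\<phi> :: real \<Rightarrow> complex)"
  shows "integrable lborel (\<lambda>z. duh z t * fourier \<phi> (- fst z))"
proof (rule duh_pairing(1))
  have [measurable]: "fourier \<phi> \<in> borel_measurable borel" by (intro fourier_measurable schwartz_measurable \<phi>)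
  show m[measurable]: "(\<lambda>z::real \<times> real. fourier \<phi> (- fst z)) \<in> borel_measurable borel"
    by (rule measurable_compose[of "\<lambda>z::real \<times> real. - fst z" borel borel]) (auto intro!: borel_measurable_continuous_onI continuous_intros)
  show "integrable lborel (\<lambda>k::real \<times> real. sob_weight (- s) k * (cmod (fourier \<phi> (- fst k)))\<^sup>2)"
  proof (rule integrable_pair_bound_real)
    show "(\<lambda>k::real \<times> real. sob_weight (- s) k * (cmod (fourier \<phi> (- fst k)))\<^sup>2) \<in> borel_measurable borel"
      by measurable
    show "integrable lborel (\<lambda>k. sob_weight 0 k * (cmod (fourier \<phi> (- k)))\<^sup>2)" by (rule fourier_weight_integrable[OF \<phi>])
    show "integrable lborel (\<lambda>l::real. sob_weight (- s) l)" by (rule integrable_sob_weight_real[OF s])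
    show "\<bar>sob_weight (- s) (x, y) * (cmod (fourier \<phi> (- fst (x, y))))\<^sup>2\<bar> \<le> sob_weight 0 x * (cmod (fourier \<phi> (- x)))\<^sup>2 * sob_weight (- s) y" for x y :: real
    proof -
      have "sob_weight (- s) (x, y) \<le> sob_weight (- s) y"
        unfolding sob_weight_minus using sob_weight_le_pair(2)[of s y x] sob_weight_pos[of s y] s by (intro divide_left_mono) (auto simp: sob_weight_pos)
      then have "sob_weight (- s) (x, y) * (cmod (fourier \<phi> (- x)))\<^sup>2 \<le> sob_weight (- s) y * (cmod (fourier \<phi> (- x)))\<^sup>2"
        by (rule mult_right_mono) simp
      then show ?thesis by (simp add: abs_mult mult.commute)
    qed
  qed
qed

lemma line_pairing:
  assumes s: "s > 1 / 2" and \<phi>: "schwartz \<phi>"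
  shows "inverse_fourier (\<lambda>k. line_hat y k t) \<phi> =
    (LINT z|lborel. exp (\<i> * complex_of_real (snd z * y)) * (duh z t * fourier \<phi> (- fst z))) / complex_of_real ((2 * pi)\<^sup>2)"
proof -
  let ?e = "\<lambda>l. exp (\<i> * complex_of_real (l * y))"
  have [measurable]: "fourier \<phi> \<in> borel_measurable borel" by (intro fourier_measurable schwartz_measurable \<phi>)
  have i: "integrable lborel (\<lambda>z. ?e (snd z) * (duh z t * fourier \<phi> (- fst z)))"
  proof (rule Bochner_Integration.integrable_bound[OF duh_line_integrable[OF s \<phi>, of t]])
    have "(\<lambda>z::real \<times> real. fourier \<phi> (- fst z)) \<in> borel_measurable borel"
      by (rule measurable_compose[of "\<lambda>z::real \<times> real. - fst z" borel borel]) (auto intro!: borel_measurable_continuous_onI continuous_intros)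
    moreover have "(\<lambda>z::real \<times> real. ?e (snd z)) \<in> borel_measurable borel"
      by (auto intro!: borel_measurable_continuous_onI continuous_intros)
    ultimately show "(\<lambda>z. ?e (snd z) * (duh z t * fourier \<phi> (- fst z))) \<in> borel_measurable lborel" by simp
  qed (auto simp: norm_mult)
  have "(LINT z|lborel. ?e (snd z) * (duh z t * fourier \<phi> (- fst z))) = (LINT k|lborel. LINT l|lborel. ?e l * (duh (k, l) t * fourier \<phi> (- k)))"
    using lborel_pair_integral[OF i] by simp
  also have "\<dots> = (LINT k|lborel. complex_of_real (2 * pi) * (line_hat y k t * fourier \<phi> (- k)))"
  proof (intro Bochner_Integration.integral_cong refl)
    fix k
    have "(LINT l|lborel. ?e l * (duh (k, l) t * fourier \<phi> (- k))) = (LINT l|lborel. ?e l * duh (k, l) t) * fourier \<phi> (- k)"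
      unfolding mult.assoc[symmetric] by (rule integral_mult_left_zero)
    then show "(LINT l|lborel. ?e l * (duh (k, l) t * fourier \<phi> (- k))) = complex_of_real (2 * pi) * (line_hat y k t * fourier \<phi> (- k))"
      unfolding line_hat_def by simp
  qed
  also have "\<dots> = complex_of_real (2 * pi) * (LINT k|lborel. line_hat y k t * fourier \<phi> (- k))" by (rule integral_mult_right_zero)
  finally show ?thesis unfolding inverse_fourier_def by (simp add: power2_eq_square)
qed

text \<open>The traces are written down on the Fourier side and then verified. Continuity in y is
  dominated convergence based on \<open>duh_line_integrable\<close>; pairing with \<psi>(y) turns
  exp(i l y) into \<open>fourier \<psi> (- l)\<close>, which reproduces the Duhamel integral on
  products \<phi>(x1) \<psi>(x2).\<close>

lemma duhamel_has_restrictions: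
  assumes s: "s > 1 / 2" and t: "t \<in> {0..T}"
  shows "has_restrictions (duhamel F t) (\<lambda>y. inverse_fourier (\<lambda>k. line_hat y k t))"
  unfolding has_restrictions_def
proof (intro conjI allI impI)
  show "tempered (inverse_fourier (\<lambda>k. line_hat y k t))" for y
    using t by (intro tempered_inverse_fourier[where s = 0] line_hat_L2 s) auto
  fix \<phi> :: "real \<Rightarrow> complex" assume \<phi>: "schwartz \<phi>"
  define \<Phi> where "\<Phi> z = duh z t * fourier \<phi> (- fst z)" for z :: "real \<times> real"
  have \<Phi>i: "integrable lborel \<Phi>" unfolding \<Phi>_def[abs_def] by (rule duh_line_integrable[OF s \<phi>])
  then have [measurable]: "\<Phi> \<in> borel_measurable borel" using borel_measurable_integrable by fastforce
  define P where "P y = (LINT z|lborel. exp (\<i> * complex_of_real (snd z * y)) * \<Phi> z)" for y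
  have v: "inverse_fourier (\<lambda>k. line_hat y k t) \<phi> = P y / complex_of_real ((2 * pi)\<^sup>2)" for y
    unfolding line_pairing[OF s \<phi>] P_def \<Phi>_def ..
  have em: "(\<lambda>z::real \<times> real. exp (\<i> * complex_of_real (snd z * y))) \<in> borel_measurable borel" for y
    by (auto intro!: borel_measurable_continuous_onI continuous_intros)
  note [measurable] = em
  have Pc: "continuous_on UNIV P"
    unfolding continuous_on_sequentially
  proof (intro ballI allI impI)
    fix x :: "nat \<Rightarrow> real" and a assume "(\<forall>n. x n \<in> UNIV) \<and> x \<longlonglongrightarrow> a"
    then have x: "x \<longlonglongrightarrow> a" by blast
    have "(\<lambda>n. P (x n)) \<longlonglongrightarrow> P a"
      unfolding P_def
    proof (rule integral_dominated_convergence[where w = "\<lambda>z. cmod (\<Phi> z)"])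
      show "AE z in lborel. (\<lambda>n. exp (\<i> * complex_of_real (snd z * x n)) * \<Phi> z) \<longlonglongrightarrow> exp (\<i> * complex_of_real (snd z * a)) * \<Phi> z"
        using x by (intro AE_I2 tendsto_intros)
      show "integrable lborel (\<lambda>z. cmod (\<Phi> z))" using \<Phi>i by simp
      have gm: "(\<lambda>z. exp (\<i> * complex_of_real (snd z * y)) * \<Phi> z) \<in> borel_measurable lborel" for y
        using em[of y] by simp
      show "(\<lambda>z. exp (\<i> * complex_of_real (snd z * a)) * \<Phi> z) \<in> borel_measurable lborel"
        "(\<lambda>z. exp (\<i> * complex_of_real (snd z * x n)) * \<Phi> z) \<in> borel_measurable lborel" for n by (rule gm)+
    qed (simp add: norm_mult)
    then show "(P \<circ> x) \<longlonglongrightarrow> P a" by (simp add: comp_def)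
  qed
  have vc: "continuous_on UNIV (\<lambda>y. P y / complex_of_real ((2 * pi)\<^sup>2))" by (intro continuous_on_divide Pc continuous_on_const) simp
  show "continuous_on UNIV (\<lambda>y. inverse_fourier (\<lambda>k. line_hat y k t) \<phi>)" unfolding v by (rule vc)
  fix \<psi> :: "real \<Rightarrow> complex" assume \<psi>: "schwartz \<psi>"
  have [measurable]: "\<phi> \<in> borel_measurable borel" "\<psi> \<in> borel_measurable borel" using \<phi> \<psi> by (auto intro: schwartz_measurable)
  have \<phi>i: "integrable lborel \<phi>" and \<psi>i: "integrable lborel \<psi>" using \<phi> \<psi> by (auto intro: schwartz_integrable)
  have [measurable]: "P \<in> borel_measurable borel" by (rule borel_measurable_continuous_onI[OF Pc])
  define I where "I = (LINT z|lborel. cmod (\<Phi> z))"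
  have Pb: "cmod (P y) \<le> I" for y
    unfolding P_def I_def by (rule order_trans[OF integral_norm_bound]) (simp add: norm_mult)
  have P\<psi>: "integrable lborel (\<lambda>y. P y * \<psi> y)"
  proof (rule Bochner_Integration.integrable_bound[where f = "\<lambda>y. complex_of_real I * \<psi> y"])
    show "integrable lborel (\<lambda>y. complex_of_real I * \<psi> y)" using \<psi>i by simp
    show "AE y in lborel. cmod (P y * \<psi> y) \<le> cmod (complex_of_real I * \<psi> y)"
      using Pb by (intro AE_I2) (auto simp: norm_mult intro!: mult_right_mono intro: order_trans[OF _ abs_ge_self])
  qed measurable
  show "integrable lborel (\<lambda>y. inverse_fourier (\<lambda>k. line_hat y k t) \<phi> * \<psi> y)"
    unfolding v times_divide_eq_left using P\<psi> by (rule integrable_divide)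
  have "duhamel F t (\<lambda>(x\<^sub>1, x\<^sub>2). \<phi> x\<^sub>1 * \<psi> x\<^sub>2) = (LINT z|lborel. duh z t * (fourier \<phi> (- fst z) * fourier \<psi> (- snd z))) / complex_of_real ((2 * pi)\<^sup>2)"
  proof (rule duhamel_eq[OF t])
    have [measurable]: "fourier \<phi> \<in> borel_measurable borel" "fourier \<psi> \<in> borel_measurable borel" by (auto intro!: fourier_measurable)
    have "(\<lambda>z::real \<times> real. fourier \<phi> (- fst z)) \<in> borel_measurable borel"
      by (rule measurable_compose[of "\<lambda>z::real \<times> real. - fst z" borel borel]) (auto intro!: borel_measurable_continuous_onI continuous_intros)
    moreover have "(\<lambda>z::real \<times> real. fourier \<psi> (- snd z)) \<in> borel_measurable borel"
      by (rule measurable_compose[of "\<lambda>z::real \<times> real. - snd z" borel borel]) (auto intro!: borel_measurable_continuous_onI continuous_intros)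
    ultimately show m[measurable]: "(\<lambda>z::real \<times> real. fourier \<phi> (- fst z) * fourier \<psi> (- snd z)) \<in> borel_measurable borel" by measurable
    show "integrable lborel (\<lambda>k. sob_weight (- s) k * (cmod (fourier \<phi> (- fst k) * fourier \<psi> (- snd k)))\<^sup>2)"
    proof (rule integrable_pair_bound_real)
      show "integrable lborel (\<lambda>k. sob_weight 0 k * (cmod (fourier \<phi> (- k)))\<^sup>2)" "integrable lborel (\<lambda>k. sob_weight 0 k * (cmod (fourier \<psi> (- k)))\<^sup>2)"
        by (rule fourier_weight_integrable[OF \<phi>], rule fourier_weight_integrable[OF \<psi>])
      show "\<bar>sob_weight (- s) (x, y) * (cmod (fourier \<phi> (- fst (x, y)) * fourier \<psi> (- snd (x, y))))\<^sup>2\<bar> \<le> sob_weight 0 x * (cmod (fourier \<phi> (- x)))\<^sup>2 * (sob_weight 0 y * (cmod (fourier \<psi> (- y)))\<^sup>2)" for x y :: real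
      proof -
        have "sob_weight (- s) (x, y) \<le> sob_weight 0 (x, y)" using s by (intro sob_weight_mono) auto
        then have "sob_weight (- s) (x, y) * ((cmod (fourier \<phi> (- x)))\<^sup>2 * (cmod (fourier \<psi> (- y)))\<^sup>2) \<le> 1 * ((cmod (fourier \<phi> (- x)))\<^sup>2 * (cmod (fourier \<psi> (- y)))\<^sup>2)"
          by (intro mult_right_mono) auto
        then show ?thesis by (simp add: abs_mult norm_mult power_mult_distrib)
      qed
    qed measurable
    fix k :: "real \<times> real"
    let ?f = "\<lambda>z. exp (\<i> * complex_of_real (k \<bullet> z)) * (case z of (x\<^sub>1, x\<^sub>2) \<Rightarrow> \<phi> x\<^sub>1 * \<psi> x\<^sub>2)"
    have "integrable lborel ?f"
    proof (rule integrable_pair_bound)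
      have "(\<lambda>z::real \<times> real. case z of (x\<^sub>1, x\<^sub>2) \<Rightarrow> \<phi> x\<^sub>1 * \<psi> x\<^sub>2) \<in> borel_measurable (borel \<Otimes>\<^sub>M borel)" by measurable
      then have "(\<lambda>z::real \<times> real. case z of (x\<^sub>1, x\<^sub>2) \<Rightarrow> \<phi> x\<^sub>1 * \<psi> x\<^sub>2) \<in> borel_measurable borel" by (simp add: borel_prod)
      then show "?f \<in> borel_measurable borel" by measurable
      show "integrable lborel (\<lambda>x. cmod (\<phi> x))" "integrable lborel (\<lambda>x. cmod (\<psi> x))" using \<phi>i \<psi>i by auto
    qed (auto simp: norm_mult)
    from lborel_pair_integral[OF this]
    have "(LINT x|lborel. ?f x) = (LINT x|lborel. LINT y|lborel. (exp (\<i> * complex_of_real (fst k * x)) * \<phi> x) * (exp (\<i> * complex_of_real (snd k * y)) * \<psi> y))"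
      by (simp add: inner_prod_def distrib_left exp_add mult_ac)
    also have "\<dots> = (LINT x|lborel. exp (\<i> * complex_of_real (fst k * x)) * \<phi> x) * (LINT y|lborel. exp (\<i> * complex_of_real (snd k * y)) * \<psi> y)"
      by (simp only: integral_mult_right_zero integral_mult_left_zero)
    also have "\<dots> = fourier \<phi> (- fst k) * fourier \<psi> (- snd k)" by (simp add: fourier_def)
    finally show "(LINT x|lborel. ?f x) = fourier \<phi> (- fst k) * fourier \<psi> (- snd k)" .
  qed
  also have "(LINT z|lborel. duh z t * (fourier \<phi> (- fst z) * fourier \<psi> (- snd z))) = (LINT y|lborel. P y * \<psi> y)"
  proof -
    let ?K = "\<lambda>z y. (exp (\<i> * complex_of_real (snd z * y)) * \<Phi> z) * \<psi> y"
    have "(LINT y|lborel. P y * \<psi> y) = (LINT y|lborel. LINT z|lborel. ?K z y)"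
      unfolding P_def by (simp only: integral_mult_left_zero)
    also have "\<dots> = (LINT z|lborel. LINT y|lborel. ?K z y)"
    proof (rule fubini_prod_bound(2)[where A = "\<lambda>z. cmod (\<Phi> z)" and B = "\<lambda>y. cmod (\<psi> y)"])
      have "(\<lambda>w::(real \<times> real) \<times> real. exp (\<i> * complex_of_real (snd (fst w) * snd w))) \<in> borel_measurable borel"
        by (auto intro!: borel_measurable_continuous_onI continuous_intros)
      then have [measurable]: "(\<lambda>w::(real \<times> real) \<times> real. exp (\<i> * complex_of_real (snd (fst w) * snd w))) \<in> borel_measurable (borel \<Otimes>\<^sub>M borel)" by (simp add: borel_prod)
      show "case_prod ?K \<in> borel_measurable (borel \<Otimes>\<^sub>M borel)" unfolding case_prod_beta' by measurable
    qed (use \<Phi>i \<psi>i in \<open>auto simp: norm_mult\<close>)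
    also have "\<dots> = (LINT z|lborel. duh z t * (fourier \<phi> (- fst z) * fourier \<psi> (- snd z)))"
    proof (intro Bochner_Integration.integral_cong refl)
      fix z
      have "(LINT y|lborel. ?K z y) = (LINT y|lborel. \<Phi> z * (exp (- \<i> * complex_of_real ((- snd z) \<bullet> y)) * \<psi> y))"
        by (intro Bochner_Integration.integral_cong refl) (simp add: mult_ac)
      also have "\<dots> = \<Phi> z * fourier \<psi> (- snd z)" unfolding fourier_def by (rule integral_mult_right_zero)
      finally show "(LINT y|lborel. ?K z y) = duh z t * (fourier \<phi> (- fst z) * fourier \<psi> (- snd z))" by (simp add: \<Phi>_def)
    qed
    finally show ?thesis ..
  qed
  also have "(LINT y|lborel. P y * \<psi> y) / complex_of_real ((2 * pi)\<^sup>2) = (LINT y|lborel. inverse_fourier (\<lambda>k. line_hat y k t) \<phi> * \<psi> y)"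
    unfolding v times_divide_eq_left by (rule integral_divide_zero[symmetric])
  finally show "duhamel F t (\<lambda>(x\<^sub>1, x\<^sub>2). \<phi> x\<^sub>1 * \<psi> x\<^sub>2) = (LINT y|lborel. inverse_fourier (\<lambda>k. line_hat y k t) \<phi> * \<psi> y)" .
qed

lemma line_hat_strip:
  assumes s: "s > 1 / 2"
  shows "(\<integral>\<^sup>+t. \<integral>\<^sup>+k. indicator {0..T} t * ennreal ((cmod (line_hat y k t))\<^sup>2) \<partial>lborel \<partial>lborel) < \<infinity>"
proof -
  have "(\<integral>\<^sup>+t. \<integral>\<^sup>+k. indicator {0..T} t * ennreal ((cmod (line_hat y k t))\<^sup>2) \<partial>lborel \<partial>lborel) \<le> (\<integral>\<^sup>+t. indicator {0..T} t * (ennreal (weight_mass s) * ennreal ((T * K)\<^sup>2)) \<partial>lborel)"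
  proof (rule nn_integral_mono)
    fix t :: real
    show "(\<integral>\<^sup>+k. indicator {0..T} t * ennreal ((cmod (line_hat y k t))\<^sup>2) \<partial>lborel) \<le> indicator {0..T} t * (ennreal (weight_mass s) * ennreal ((T * K)\<^sup>2))"
    proof (cases "t \<in> {0..T}")
      case True
      then have t: "t \<ge> 0" by simp
      have "(\<integral>\<^sup>+k. ennreal ((cmod (line_hat y k t))\<^sup>2) \<partial>lborel) \<le> ennreal (weight_mass s) * ennreal ((t * K)\<^sup>2)" by (rule line_hat_L2(1)[OF s t])
      also have "\<dots> \<le> ennreal (weight_mass s) * ennreal ((T * K)\<^sup>2)"
        using True K0 by (intro mult_left_mono ennreal_leI power_mono mult_right_mono) auto
      finally show ?thesis using True by simp
    qed simp
  qed
  also have "\<dots> = ennreal T * (ennreal (weight_mass s) * ennreal ((T * K)\<^sup>2))"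
    using T0 by (subst nn_integral_multc) auto
  also have "\<dots> < \<infinity>" by (simp add: ennreal_mult_less_top)
  finally show ?thesis .
qed

lemma slice_exists:
  assumes s: "s > 1 / 2"
  shows "\<exists>g. is_slice T (duhamel F) y g"
proof -
  obtain g where g: "g \<in> strip_L2 T"
    and ae: "AE t in lborel. t \<in> {0..T} \<longrightarrow> (\<forall>\<phi>. schwartz \<phi> \<longrightarrow> inverse_fourier (\<lambda>k. line_hat y k t) \<phi> = regular (\<lambda>x. g (x, t)) \<phi>)"
    using partial_inverse_fourier[OF line_hat_measurable line_hat_strip[OF s]] by blast
  have "AE t in lborel. t \<in> {0..T} \<longrightarrow> (\<exists>v. has_restrictions (duhamel F t) v \<and> (\<forall>\<phi>. schwartz \<phi> \<longrightarrow> v y \<phi> = regular (\<lambda>x. g (x, t)) \<phi>))"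
    using ae by eventually_elim (use duhamel_has_restrictions[OF s] in blast)
  then show ?thesis unfolding is_slice_def using g by blast
qed

text \<open>Two arbitrary objects have to be identified: \<open>w\<close> is any slice and
  \<open>partial_fourier\<close> is a choice. Uniqueness of restrictions determines the first and
  uniqueness of transforms the second, for almost every t and then almost every k. The norm of
  \<open>B_space\<close> works at fixed k, hence the exchange at the end.\<close>

lemma partial_fourier_slice:
  assumes s: "s > 1 / 2" and w: "is_slice T (duhamel F) y w"
  shows "AE k in lborel. AE t in lborel. t \<in> {0..T} \<longrightarrow> partial_fourier T w (k, t) = line_hat y k t"
proof -
  have ae: "AE t in lborel. t \<in> {0..T} \<longrightarrow> has_fourier (regular (\<lambda>x. w (x, t))) (\<lambda>k. line_hat y k t)"
    using w[unfolded is_slice_def, THEN conjunct2]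
  proof eventually_elim
    case (elim t)
    show ?case
    proof
      assume t: "t \<in> {0..T}"
      then obtain v where v: "has_restrictions (duhamel F t) v" and vy: "\<And>\<phi>. schwartz \<phi> \<Longrightarrow> v y \<phi> = regular (\<lambda>x. w (x, t)) \<phi>"
        using elim by blast
      have "has_fourier (regular (\<lambda>x. w (x, t))) (\<lambda>k. line_hat y k t) = has_fourier (inverse_fourier (\<lambda>k. line_hat y k t)) (\<lambda>k. line_hat y k t)"
      proof (rule has_fourier_cong)
        fix \<phi> :: "real \<Rightarrow> complex" assume \<phi>: "schwartz \<phi>"
        show "regular (\<lambda>x. w (x, t)) \<phi> = inverse_fourier (\<lambda>k. line_hat y k t) \<phi>"
          using has_restrictions_unique[OF v duhamel_has_restrictions[OF s t] \<phi>, of y] vy[OF \<phi>] by simp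
      qed
      then show "has_fourier (regular (\<lambda>x. w (x, t))) (\<lambda>k. line_hat y k t)"
        using has_fourier_inverse_fourier[OF line_hat_measurable_fst line_hat_L2(2)[OF s]] t by simp
    qed
  qed
  let ?Q = "\<lambda>P. P \<in> strip_L2 T \<and> (AE t in lborel. t \<in> {0..T} \<longrightarrow> has_fourier (regular (\<lambda>x. w (x, t))) (\<lambda>k. P (k, t)))"
  \<comment> \<open>\<open>line_hat\<close> is a witness for the choice in
    \<open>partial_fourier\<close>, so the chosen function has the defining property.\<close>
  have "?Q (case_prod (line_hat y))"
  proof (intro conjI strip_L2I)
    show "case_prod (line_hat y) \<in> borel_measurable borel" using line_hat_measurable by (simp add: borel_prod)
  qed (use line_hat_strip[OF s] ae in simp_all)
  then have "?Q (partial_fourier T w)" unfolding partial_fourier_def by (rule someI[where P = ?Q])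
  then have "partial_fourier T w \<in> borel_measurable borel" and ae2: "AE t in lborel. t \<in> {0..T} \<longrightarrow> has_fourier (regular (\<lambda>x. w (x, t))) (\<lambda>k. partial_fourier T w (k, t))"
    unfolding strip_L2_def by auto
  then have [measurable]: "partial_fourier T w \<in> borel_measurable (borel \<Otimes>\<^sub>M borel)" by (simp add: borel_prod)
  have "AE t in lborel. AE k in lborel. t \<in> {0..T} \<longrightarrow> partial_fourier T w (k, t) = line_hat y k t"
    using ae ae2
  proof eventually_elim
    case (elim t)
    show ?case
    proof (cases "t \<in> {0..T}")
      case True
      then have "AE k in lborel. partial_fourier T w (k, t) = line_hat y k t" using elim by (intro has_fourier_unique) auto
      then show ?thesis by eventually_elim simp
    next
      case False
      then show ?thesis by (intro AE_I2) blast
    qed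
  qed
  \<comment> \<open>Exchanging almost every t with almost every k requires a measurable exceptional
    set; here the joint measurability of both functions enters.\<close>
  moreover have "{z \<in> space (lborel \<Otimes>\<^sub>M lborel). snd z \<in> {0..T} \<longrightarrow> partial_fourier T w (fst z, snd z) = line_hat y (fst z) (snd z)} \<in> sets (lborel \<Otimes>\<^sub>M lborel)"
  proof -
    have [measurable]: "(\<lambda>z. line_hat y (fst z) (snd z)) \<in> borel_measurable (borel \<Otimes>\<^sub>M borel)" using line_hat_measurable by (simp add: case_prod_beta')
    show ?thesis by measurable
  qed
  ultimately show ?thesis
    by (rule lborel_pair.AE_commute[where P = "\<lambda>k t. t \<in> {0..T} \<longrightarrow> partial_fourier T w (k, t) = line_hat y k t", THEN iffD2, rotated])
qed

end

text \<open>The reflected solution is an admissible competitor in the infimum: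
  \<open>dA_bound\<close> makes it bounded, which together with integrability puts it in L^2, and by
  \<open>regular_L1\<close> its transform is \<open>vhat\<close>.\<close>

lemma (in time_data) interval_norm_le:
  assumes fin: "(\<integral>\<^sup>+\<tau>. ennreal (sob_weight m \<tau> * (cmod (vhat T f y \<tau>))\<^sup>2) \<partial>lborel) \<le> X" and X: "X < \<infinity>"
    and h: "AE t in lborel. t \<in> {0..T} \<longrightarrow> h t = dA f y t"
  shows "(sobolev_interval_norm m T h)\<^sup>2 \<le> X"
proof -
  define v where "v = reflect T (dcut T f y)"
  have vi: "integrable lborel v" unfolding v_def by (rule fourier_reflect(1)[OF dcut_integrable])
  then have vm[measurable]: "v \<in> borel_measurable borel" using borel_measurable_integrable by fastforce
  obtain B where B: "mass f = ennreal B" "B \<ge> 0" using mass_finite by (cases "mass f") auto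
  have dB: "cmod (dcut T f y t) \<le> B" for t
    using dA_bound[of y t] B by (auto simp: dcut_def ennreal_le_iff)
  have vB: "cmod (v t) \<le> 2 * B" for t
    unfolding v_def reflect_def using norm_triangle_ineq[of "dcut T f y t" "dcut T f y (2 * T - t)"] dB[of t] dB[of "2 * T - t"] by linarith
  have v2: "integrable lborel (\<lambda>t. (cmod (v t))\<^sup>2)"
  proof (rule Bochner_Integration.integrable_bound[where f = "\<lambda>t. 2 * B * cmod (v t)"])
    show "integrable lborel (\<lambda>t. 2 * B * cmod (v t))" using vi by simp
    show "AE t in lborel. norm ((cmod (v t))\<^sup>2) \<le> norm (2 * B * cmod (v t))"
      using vB B by (intro AE_I2) (auto simp: power2_eq_square abs_mult intro!: mult_right_mono)
  qed measurable
  have V: "fourier v = vhat T f y" by (simp add: v_def vhat_def)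
  have wi: "integrable lborel (\<lambda>\<tau>. sob_weight m \<tau> * (cmod (fourier v \<tau>))\<^sup>2)"
    unfolding V by (intro integrableI_nonneg) (use le_less_trans[OF fin X] in auto)
  have S: "regular v \<in> sobolev m" by (rule sobolevI[OF regular_L1(1)[OF vi] regular_L1(2)[OF vi] wi])
  have "AE t in lborel. t \<in> {0<..<T} \<longrightarrow> v t = h t"
    using h by eventually_elim (auto simp: v_def reflect_def dcut_def)
  then have "sobolev_interval_norm m T h \<le> ennreal (sobolev_norm m (regular v))"
    unfolding sobolev_interval_norm_def using vm v2 S by (intro INF_lower) blast
  then have "(sobolev_interval_norm m T h)\<^sup>2 \<le> (ennreal (sobolev_norm m (regular v)))\<^sup>2" by (intro power_mono) auto
  also have "\<dots> = ennreal ((sobolev_norm m (regular v))\<^sup>2)" by (rule ennreal_power[OF sobolev_norm_nonneg])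
  also have "(sobolev_norm m (regular v))\<^sup>2 = (LINT \<tau>|lborel. sob_weight m \<tau> * (cmod (fourier v \<tau>))\<^sup>2)"
    unfolding sobolev_norm_eq[OF regular_L1(2)[OF vi]] by (intro real_sqrt_pow2 integral_nonneg_AE) auto
  also have "ennreal \<dots> = (\<integral>\<^sup>+\<tau>. ennreal (sob_weight m \<tau> * (cmod (fourier v \<tau>))\<^sup>2) \<partial>lborel)"
    by (intro nn_integral_eq_integral[symmetric] wi) auto
  also have "\<dots> \<le> X" unfolding V by (rule fin)
  finally show ?thesis .
qed

section \<open>Estimates at a fixed first frequency and integration over it\<close>

context duhamel_data
begin

text \<open>The share of the first frequency k in the squared norm of the data in L^2 of time with
  values in H^s.\<close>

definition freq_mass :: "real \<Rightarrow> ennreal" where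
  "freq_mass k = (\<integral>\<^sup>+t. \<integral>\<^sup>+l. ennreal (sob_weight s (k, l) * (cmod (G ((k, l), t)))\<^sup>2) \<partial>lborel \<partial>lborel)"

text \<open>The factor \<open>e\<^bsup>ik\<^sup>2t\<^esup>\<close> removes the propagator in the first variable.\<close>

definition freq_data :: "real \<Rightarrow> real \<Rightarrow> real \<Rightarrow> complex" where
  "freq_data k l t = - \<i> / complex_of_real (2 * pi) * exp (\<i> * complex_of_real (k\<^sup>2 * t)) * G ((k, l), t)"

lemma G_measurable3 [measurable]: "(\<lambda>z. G ((fst (fst z), snd z), snd (fst z))) \<in> borel_measurable ((borel \<Otimes>\<^sub>M borel) \<Otimes>\<^sub>M borel)"
  by (rule measurable_compose[OF _ G_meas]) (simp add: borel_prod[symmetric])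

lemma weighted_G_measurable [measurable]:
  "(\<lambda>z. ennreal (sob_weight s (fst (fst z), snd z) * (cmod (G ((fst (fst z), snd z), snd (fst z))))\<^sup>2)) \<in> borel_measurable ((borel \<Otimes>\<^sub>M borel) \<Otimes>\<^sub>M borel)"
proof -
  have "(\<lambda>z. sob_weight s (fst (fst z), snd z :: real)) \<in> borel_measurable ((borel \<Otimes>\<^sub>M borel :: (real \<times> real) measure) \<Otimes>\<^sub>M borel)"
    by (rule measurable_compose[OF _ sob_weight_measurable]) (simp add: borel_prod[symmetric])
  then show ?thesis by measurable
qed

lemma inner_freq_measurable [measurable]:
  "(\<lambda>z. \<integral>\<^sup>+l. ennreal (sob_weight s (fst z, l) * (cmod (G ((fst z, l), snd z)))\<^sup>2) \<partial>lborel) \<in> borel_measurable (borel \<Otimes>\<^sub>M borel)"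
proof -
  have "(\<lambda>z. \<integral>\<^sup>+l. (\<lambda>w. ennreal (sob_weight s (fst (fst w), snd w) * (cmod (G ((fst (fst w), snd w), snd (fst w))))\<^sup>2)) (z, l) \<partial>lborel) \<in> borel_measurable (borel \<Otimes>\<^sub>M borel)"
    by (rule lborel.borel_measurable_nn_integral_fst) (use weighted_G_measurable in simp)
  then show ?thesis by simp
qed

lemma freq_mass_measurable [measurable]: "freq_mass \<in> borel_measurable borel"
proof -
  have "(\<lambda>k. \<integral>\<^sup>+t. (\<lambda>z. \<integral>\<^sup>+l. ennreal (sob_weight s (fst z, l) * (cmod (G ((fst z, l), snd z)))\<^sup>2) \<partial>lborel) (k, t) \<partial>lborel) \<in> borel_measurable borel"
    by (rule lborel.borel_measurable_nn_integral_fst) (use inner_freq_measurable in simp)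
  then show ?thesis unfolding freq_mass_def[abs_def] by simp
qed

text \<open>The origin of sqrt T: at each time the squared norm is at most K^2, and it is integrated
  over an interval of length T.\<close>

lemma freq_mass_total: "(\<integral>\<^sup>+k. freq_mass k \<partial>lborel) \<le> ennreal (T * K\<^sup>2)"
proof -
  have "(\<integral>\<^sup>+k. freq_mass k \<partial>lborel) = (\<integral>\<^sup>+t. \<integral>\<^sup>+k. \<integral>\<^sup>+l. ennreal (sob_weight s (k, l) * (cmod (G ((k, l), t)))\<^sup>2) \<partial>lborel \<partial>lborel \<partial>lborel)"
    unfolding freq_mass_def
    by (rule lborel_pair.Fubini'[symmetric]) (use inner_freq_measurable in \<open>simp add: case_prod_beta'\<close>)
  also have "\<dots> = (\<integral>\<^sup>+t. \<integral>\<^sup>+z. ennreal (sob_weight s z * (cmod (G (z, t)))\<^sup>2) \<partial>lborel \<partial>lborel)"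
  proof (rule nn_integral_cong)
    fix t
    have [measurable]: "(\<lambda>z. G (z, t)) \<in> borel_measurable borel"
      using measurable_compose[OF _ G_meas, of "\<lambda>z. (z, t)" borel] by simp
    have "(\<lambda>z. ennreal (sob_weight s z * (cmod (G (z, t)))\<^sup>2)) \<in> borel_measurable borel" by measurable
    from lborel_pair_nn_integral[OF this]
    show "(\<integral>\<^sup>+k. \<integral>\<^sup>+l. ennreal (sob_weight s (k, l) * (cmod (G ((k, l), t)))\<^sup>2) \<partial>lborel \<partial>lborel) = (\<integral>\<^sup>+z. ennreal (sob_weight s z * (cmod (G (z, t)))\<^sup>2) \<partial>lborel)" by simp
  qed
  also have "\<dots> \<le> (\<integral>\<^sup>+t. indicator {0..T} t * ennreal (K\<^sup>2) \<partial>lborel)"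
    using G_bound G_outside by (intro nn_integral_mono) (auto simp: indicator_def)
  also have "\<dots> = ennreal T * ennreal (K\<^sup>2)" using T0 by (subst nn_integral_multc) auto
  also have "\<dots> = ennreal (T * K\<^sup>2)" using T0 by (intro ennreal_mult[symmetric]) auto
  finally show ?thesis .
qed

lemma freq_data_measurable [measurable]: "case_prod (freq_data k) \<in> borel_measurable (borel \<Otimes>\<^sub>M borel)"
proof -
  have [measurable]: "(\<lambda>z. G ((k, fst z), snd z)) \<in> borel_measurable (borel \<Otimes>\<^sub>M borel)"
    by (rule measurable_compose[OF _ G_meas]) (simp add: borel_prod[symmetric])
  show ?thesis unfolding freq_data_def case_prod_beta' by measurable
qed

lemma freq_data_norm: "cmod (freq_data k l t) \<le> cmod (G ((k, l), t))"
proof -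
  have "cmod (freq_data k l t) = cmod (G ((k, l), t)) / (2 * pi)"
    by (simp add: freq_data_def norm_mult norm_divide)
  also have "\<dots> \<le> cmod (G ((k, l), t)) / 1" using pi_gt3 by (intro divide_left_mono) auto
  finally show ?thesis by simp
qed

text \<open>The weight in (k,l) dominates the weight in l alone and the weight in k alone. The first
  fact serves \<open>B_sq1\<close>; the second serves \<open>B_sq2\<close>, where the factor (1 +
  k^2)^s uses up the weight and leaves data measured in L^2.\<close>

lemma freq_data_wnorm:
  assumes "s \<ge> 0"
  shows "wnorm s (freq_data k) \<le> freq_mass k" "ennreal ((1 + k\<^sup>2) powr s) * wnorm 0 (freq_data k) \<le> freq_mass k"
proof -
  have sq: "(cmod (freq_data k l t))\<^sup>2 \<le> (cmod (G ((k, l), t)))\<^sup>2" for l t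
    by (intro power_mono freq_data_norm) auto
  show "wnorm s (freq_data k) \<le> freq_mass k"
    unfolding wnorm_def freq_mass_def
    by (intro nn_integral_mono ennreal_leI mult_mono sq sob_weight_le_pair assms) auto
  have "ennreal ((1 + k\<^sup>2) powr s) * wnorm 0 (freq_data k) = (\<integral>\<^sup>+t. \<integral>\<^sup>+l. ennreal ((1 + k\<^sup>2) powr s * sob_weight 0 l * (cmod (freq_data k l t))\<^sup>2) \<partial>lborel \<partial>lborel)"
    by (rule wnorm_swap_cmult[OF freq_data_measurable]) simp
  also have "\<dots> \<le> freq_mass k"
    unfolding freq_mass_def
  proof (intro nn_integral_mono ennreal_leI mult_mono sq)
    fix l :: real
    show "(1 + k\<^sup>2) powr s * sob_weight 0 l \<le> sob_weight s (k, l)"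
      using sob_weight_le_pair(1)[OF assms, of k l] by (simp add: sob_weight_def[of s k])
  qed auto
  finally show "ennreal ((1 + k\<^sup>2) powr s) * wnorm 0 (freq_data k) \<le> freq_mass k" .
qed

text \<open>Finite \<open>freq_mass\<close> is a weighted square integral; Young's inequality
  against the weight of exponent -s, integrable for s > 1/2, turns it into integrability in
  (l,t).\<close>

lemma freq_time_data:
  assumes s: "s > 1 / 2" and M: "freq_mass k < \<infinity>"
  shows "time_data T (freq_data k)"
proof
  show "0 < T" "T < 1" by (rule T0 T1)+
  show "case_prod (freq_data k) \<in> borel_measurable (borel \<Otimes>\<^sub>M borel)" by measurable
  show "freq_data k l t = 0" if "t \<notin> {0..T}" for l t unfolding freq_data_def using G_outside[OF that] by simp
  show "integrable (lborel \<Otimes>\<^sub>M lborel) (case_prod (freq_data k))"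
  proof (rule integrable_pair_nn)
    have [measurable]: "(\<lambda>l. freq_data k l t) \<in> borel_measurable borel" for t
    proof -
      have "(\<lambda>l. case_prod (freq_data k) (l, t)) \<in> borel_measurable borel" by measurable
      then show ?thesis by simp
    qed
    have W: "(\<integral>\<^sup>+l. ennreal (sob_weight (- s) (l :: real)) \<partial>lborel) = ennreal (weight_mass s)"
      unfolding weight_mass_def by (intro nn_integral_eq_integral integrable_sob_weight_real s) auto
    have "(\<integral>\<^sup>+t. \<integral>\<^sup>+l. ennreal (cmod (freq_data k l t)) \<partial>lborel \<partial>lborel) \<le>
      (\<integral>\<^sup>+t. (\<integral>\<^sup>+l. ennreal (sob_weight s l * (cmod (freq_data k l t))\<^sup>2) \<partial>lborel) + indicator {0..T} t * ennreal (weight_mass s) \<partial>lborel)"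
    proof (rule nn_integral_mono)
      fix t
      show "(\<integral>\<^sup>+l. ennreal (cmod (freq_data k l t)) \<partial>lborel) \<le> (\<integral>\<^sup>+l. ennreal (sob_weight s l * (cmod (freq_data k l t))\<^sup>2) \<partial>lborel) + indicator {0..T} t * ennreal (weight_mass s)"
      proof (cases "t \<in> {0..T}")
        case True
        have "(\<integral>\<^sup>+l. ennreal (cmod (freq_data k l t)) \<partial>lborel) \<le> (\<integral>\<^sup>+l. ennreal (sob_weight s l * (cmod (freq_data k l t))\<^sup>2) + ennreal (sob_weight (- s) l) \<partial>lborel)"
        proof (rule nn_integral_mono)
          fix l :: real
          have "cmod (freq_data k l t) \<le> sob_weight s l * (cmod (freq_data k l t))\<^sup>2 + sob_weight (- s) l"
            using amgm_weight[OF sob_weight_pos[of s l], of "cmod (freq_data k l t)" 1] by (simp add: sob_weight_minus)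
          then have "ennreal (cmod (freq_data k l t)) \<le> ennreal (sob_weight s l * (cmod (freq_data k l t))\<^sup>2 + sob_weight (- s) l)" by (rule ennreal_leI)
          also have "\<dots> = ennreal (sob_weight s l * (cmod (freq_data k l t))\<^sup>2) + ennreal (sob_weight (- s) l)" by (rule ennreal_plus) auto
          finally show "ennreal (cmod (freq_data k l t)) \<le> ennreal (sob_weight s l * (cmod (freq_data k l t))\<^sup>2) + ennreal (sob_weight (- s) l)" .
        qed
        also have "\<dots> = (\<integral>\<^sup>+l. ennreal (sob_weight s l * (cmod (freq_data k l t))\<^sup>2) \<partial>lborel) + (\<integral>\<^sup>+l. ennreal (sob_weight (- s) (l :: real)) \<partial>lborel)"
          by (rule nn_integral_add) measurable
        finally show ?thesis using True W by simp
      next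
        case False
        then show ?thesis unfolding freq_data_def by (simp add: G_outside)
      qed
    qed
    also have "\<dots> = wnorm s (freq_data k) + (\<integral>\<^sup>+t. indicator {0..T} t * ennreal (weight_mass s) \<partial>lborel)"
      unfolding wnorm_def by (rule nn_integral_add) measurable
    also have "(\<integral>\<^sup>+t. indicator {0..T} t * ennreal (weight_mass s) \<partial>lborel) = ennreal T * ennreal (weight_mass s)"
      using T0 by (subst nn_integral_multc) auto
    also have "wnorm s (freq_data k) + ennreal T * ennreal (weight_mass s) < \<infinity>"
      using le_less_trans[OF freq_data_wnorm(1) M] s by (simp add: ennreal_mult_less_top)
    finally show "(\<integral>\<^sup>+t. \<integral>\<^sup>+l. ennreal (cmod (freq_data k l t)) \<partial>lborel \<partial>lborel) < \<infinity>" .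
  qed measurable
qed

text \<open>Since norm (k,l)^2 = k^2 + l^2, the factor exp(i k^2 t') in the data turns the
  one-dimensional propagator into the two-dimensional one, up to exp(i k^2 t), which is exactly the
  modulation in the norm of \<open>B_space\<close>.\<close>

lemma freq_du: "du (freq_data k) l t = exp (\<i> * complex_of_real (k\<^sup>2 * t)) / complex_of_real (2 * pi) * duh (k, l) t"
proof -
  let ?c = "exp (\<i> * complex_of_real (k\<^sup>2 * t)) / complex_of_real (2 * pi) * (- \<i>)"
  have "du (freq_data k) l t = (LINT t'|lborel. ?c * (if 0 \<le> t' \<and> t' \<le> t then exp (- \<i> * complex_of_real ((norm (k, l))\<^sup>2 * (t - t'))) * G ((k, l), t') else 0))"
    unfolding du_def
  proof (intro Bochner_Integration.integral_cong refl)
    fix t'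
    have "exp (- \<i> * complex_of_real (l\<^sup>2 * (t - t'))) * exp (\<i> * complex_of_real (k\<^sup>2 * t')) = exp (\<i> * complex_of_real (k\<^sup>2 * t)) * exp (- \<i> * complex_of_real ((norm (k, l))\<^sup>2 * (t - t')))"
      unfolding exp_add[symmetric] by (rule arg_cong[where f = exp]) (simp add: norm_Pair algebra_simps)
    then have "exp (- \<i> * complex_of_real (l\<^sup>2 * (t - t'))) * freq_data k l t' = ?c * (exp (- \<i> * complex_of_real ((norm (k, l))\<^sup>2 * (t - t'))) * G ((k, l), t'))"
      unfolding freq_data_def by (simp only: mult_ac times_divide_eq_right times_divide_eq_left minus_mult_left[symmetric] minus_mult_right[symmetric] mult_minus_left mult_minus_right)
    then show "(if 0 \<le> t' \<and> t' \<le> t then exp (- \<i> * complex_of_real (l\<^sup>2 * (t - t'))) * freq_data k l t' else 0) =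
      ?c * (if 0 \<le> t' \<and> t' \<le> t then exp (- \<i> * complex_of_real ((norm (k, l))\<^sup>2 * (t - t'))) * G ((k, l), t') else 0)"
      by (simp only: if_distrib[where f = "\<lambda>x. ?c * x"] mult_zero_right)
  qed
  also have "\<dots> = ?c * (LINT t'|lborel. (if 0 \<le> t' \<and> t' \<le> t then exp (- \<i> * complex_of_real ((norm (k, l))\<^sup>2 * (t - t'))) * G ((k, l), t') else 0))"
    by (rule integral_mult_right_zero)
  also have "\<dots> = exp (\<i> * complex_of_real (k\<^sup>2 * t)) / complex_of_real (2 * pi) * duh (k, l) t"
    unfolding duh_def by (rule mult.assoc)
  finally show ?thesis .
qed

lemma freq_dA: "dA (freq_data k) y t = exp (\<i> * complex_of_real (k\<^sup>2 * t)) * line_hat y k t"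
proof -
  let ?c = "exp (\<i> * complex_of_real (k\<^sup>2 * t)) / complex_of_real (2 * pi)"
  have "dA (freq_data k) y t = (LINT l|lborel. ?c * (exp (\<i> * complex_of_real (l * y)) * duh (k, l) t))"
    unfolding dA_def freq_du by (intro Bochner_Integration.integral_cong refl) (simp only: mult_ac)
  also have "\<dots> = ?c * (LINT l|lborel. exp (\<i> * complex_of_real (l * y)) * duh (k, l) t)" by (rule integral_mult_right_zero)
  finally show ?thesis unfolding line_hat_def by simp
qed

text \<open>The exponents \<open>m\<close> and \<open>r\<close> are left open because the two parts
  of the norm use the pairs ((2s+1)/4, s) and (1/4, 0). By \<open>freq_mass_total\<close> almost
  every k has finite \<open>freq_mass\<close>, so that its data form a
  \<open>time_data\<close>.\<close>

lemma slice_time_norm: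
  assumes s: "s > 1 / 2" and r: "0 \<le> r" "r \<le> s" and C: "0 \<le> C"
    and smooth: "\<forall>f y. time_data T f \<longrightarrow> (\<integral>\<^sup>+\<tau>. ennreal (sob_weight m \<tau> * (cmod (vhat T f y \<tau>))\<^sup>2) \<partial>lborel) \<le> ennreal C * wnorm r f"
    and w: "is_slice T (duhamel F) y w"
  shows "AE k in lborel. (B_time_norm m T w k)\<^sup>2 \<le> ennreal C * wnorm r (freq_data k)"
proof -
  have "AE k in lborel. freq_mass k \<noteq> \<infinity>"
    by (rule nn_integral_noteq_infinite) (use le_less_trans[OF freq_mass_total ennreal_less_top] in \<open>auto simp: less_top[symmetric]\<close>)
  then show ?thesis using partial_fourier_slice[OF s w]
  proof eventually_elim
    case (elim k)
    then have M: "freq_mass k < \<infinity>" by (simp add: less_top)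
    interpret time_data T "freq_data k" by (rule freq_time_data[OF s M])
    have "wnorm r (freq_data k) < \<infinity>" using le_less_trans[OF order_trans[OF wnorm_mono[OF r(2)] freq_data_wnorm(1)] M] s by simp
    then have X: "ennreal C * wnorm r (freq_data k) < \<infinity>" by (simp add: ennreal_mult_less_top)
    show ?case
      unfolding B_time_norm_def
    proof (rule interval_norm_le[OF smooth[rule_format, of "freq_data k" y] X])
      show "time_data T (freq_data k)" by (rule freq_time_data[OF s M])
      show "AE t in lborel. t \<in> {0..T} \<longrightarrow> exp (\<i> * complex_of_real (k\<^sup>2 * t)) * partial_fourier T w (k, t) = dA (freq_data k) y t"
        using elim(2) by eventually_elim (simp add: freq_dA)
    qed
  qed
qed

lemma slice_bound:
  assumes s: "1 / 2 < s"
    and C1: "0 \<le> C\<^sub>1" "\<forall>f y. time_data T f \<longrightarrow> (\<integral>\<^sup>+\<tau>. ennreal (sob_weight ((2 * s + 1) / 4) \<tau> * (cmod (vhat T f y \<tau>))\<^sup>2) \<partial>lborel) \<le> ennreal C\<^sub>1 * wnorm s f"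
    and C2: "0 \<le> C\<^sub>2" "\<forall>f y. time_data T f \<longrightarrow> (\<integral>\<^sup>+\<tau>. ennreal (sob_weight (1 / 4) \<tau> * (cmod (vhat T f y \<tau>))\<^sup>2) \<partial>lborel) \<le> ennreal C\<^sub>2 * wnorm 0 f"
    and w: "is_slice T (duhamel F) y w"
  shows "w \<in> B_space s T" "B_norm s T w \<le> (sqrt C\<^sub>1 + sqrt C\<^sub>2) * sqrt T * K"
proof -
  have s0: "s \<ge> 0" using s by simp
  have tot: "(\<integral>\<^sup>+k. ennreal C * freq_mass k \<partial>lborel) \<le> ennreal (C * (T * K\<^sup>2))" if "C \<ge> 0" for C
  proof -
    have "(\<integral>\<^sup>+k. ennreal C * freq_mass k \<partial>lborel) = ennreal C * (\<integral>\<^sup>+k. freq_mass k \<partial>lborel)" by (rule nn_integral_cmult) measurable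
    also have "\<dots> \<le> ennreal C * ennreal (T * K\<^sup>2)" by (intro mult_left_mono freq_mass_total) simp
    also have "\<dots> = ennreal (C * (T * K\<^sup>2))" using T0 that by (intro ennreal_mult[symmetric]) auto
    finally show ?thesis .
  qed
  have "B_sq1 s T w \<le> (\<integral>\<^sup>+k. ennreal C\<^sub>1 * freq_mass k \<partial>lborel)"
    unfolding B_sq1_def
  proof (rule nn_integral_mono_AE)
    show "AE k in lborel. (B_time_norm ((2 * s + 1) / 4) T w k)\<^sup>2 \<le> ennreal C\<^sub>1 * freq_mass k"
      using slice_time_norm[OF s s0 order_refl C1 w]
      by eventually_elim (erule order_trans, intro mult_left_mono freq_data_wnorm s0, simp)
  qed
  then have b1: "B_sq1 s T w \<le> ennreal (C\<^sub>1 * (T * K\<^sup>2))" using tot[OF C1(1)] order_trans by blast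
  have "B_sq2 s T w \<le> (\<integral>\<^sup>+k. ennreal C\<^sub>2 * freq_mass k \<partial>lborel)"
    unfolding B_sq2_def
  proof (rule nn_integral_mono_AE)
    show "AE k in lborel. ennreal ((1 + k\<^sup>2) powr s) * (B_time_norm (1 / 4) T w k)\<^sup>2 \<le> ennreal C\<^sub>2 * freq_mass k"
      using slice_time_norm[OF s order_refl s0 C2 w]
    proof eventually_elim
      case (elim k)
      have "ennreal ((1 + k\<^sup>2) powr s) * (B_time_norm (1 / 4) T w k)\<^sup>2 \<le> ennreal ((1 + k\<^sup>2) powr s) * (ennreal C\<^sub>2 * wnorm 0 (freq_data k))"
        by (intro mult_left_mono elim) simp
      also have "\<dots> = ennreal C\<^sub>2 * (ennreal ((1 + k\<^sup>2) powr s) * wnorm 0 (freq_data k))" by (rule mult.left_commute)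
      also have "\<dots> \<le> ennreal C\<^sub>2 * freq_mass k" by (intro mult_left_mono freq_data_wnorm s0) simp
      finally show ?case .
    qed
  qed
  then have b2: "B_sq2 s T w \<le> ennreal (C\<^sub>2 * (T * K\<^sup>2))" using tot[OF C2(1)] order_trans by blast
  show "w \<in> B_space s T"
    using w le_less_trans[OF b1 ennreal_less_top] le_less_trans[OF b2 ennreal_less_top]
    unfolding B_space_def is_slice_def by simp
  have e: "sqrt (enn2real b) \<le> sqrt C * sqrt T * K" if "b \<le> ennreal (C * (T * K\<^sup>2))" "C \<ge> 0" for b C
  proof -
    have "enn2real b \<le> C * (T * K\<^sup>2)" using T0 that by (intro enn2real_leI) auto
    then have "sqrt (enn2real b) \<le> sqrt (C * (T * K\<^sup>2))" by (rule real_sqrt_le_mono)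
    also have "\<dots> = sqrt C * sqrt T * K" using K0 by (simp add: real_sqrt_mult)
    finally show ?thesis .
  qed
  show "B_norm s T w \<le> (sqrt C\<^sub>1 + sqrt C\<^sub>2) * sqrt T * K"
    unfolding B_norm_def using e[OF b1 C1(1)] e[OF b2 C2(1)] by (simp add: distrib_right)
qed

end

text \<open>The constants of \<open>time_smoothing\<close> are fixed before T and F appear, so the
  final constant depends on s alone.\<close>

lemma duhamel_slice_estimate:
  assumes s: "1 / 2 < s" "s \<le> 3 / 2"
  shows "\<exists>c>0. \<forall>(T::real) (F :: real \<Rightarrow> (real \<times> real) distribution). 0 < T \<and> T < 1 \<and> continuous_sobolev T s F \<longrightarrow>
    (\<forall>x\<^sub>2. \<exists>g. is_slice T (duhamel F) x\<^sub>2 g) \<and>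
    (\<forall>w :: real \<Rightarrow> real \<times> real \<Rightarrow> complex. (\<forall>x\<^sub>2. is_slice T (duhamel F) x\<^sub>2 (w x\<^sub>2)) \<longrightarrow>
      (\<forall>x\<^sub>2. w x\<^sub>2 \<in> B_space s T) \<and>
      bdd_above (range (\<lambda>x\<^sub>2. B_norm s T (w x\<^sub>2))) \<and>
      (SUP x\<^sub>2. B_norm s T (w x\<^sub>2)) \<le> c * sqrt T * (SUP t\<in>{0..T}. sobolev_norm s (F t)))"
proof -
  obtain C\<^sub>1 where C1: "C\<^sub>1 \<ge> 0" "\<forall>T f y. time_data T f \<longrightarrow> (\<integral>\<^sup>+\<tau>. ennreal (sob_weight ((2 * s + 1) / 4) \<tau> * (cmod (vhat T f y \<tau>))\<^sup>2) \<partial>lborel) \<le> ennreal C\<^sub>1 * wnorm s f"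
    using time_smoothing[of s] s by auto
  obtain C\<^sub>2 where C2: "C\<^sub>2 \<ge> 0" "\<forall>T f y. time_data T f \<longrightarrow> (\<integral>\<^sup>+\<tau>. ennreal (sob_weight ((2 * 0 + 1) / 4) \<tau> * (cmod (vhat T f y \<tau>))\<^sup>2) \<partial>lborel) \<le> ennreal C\<^sub>2 * wnorm 0 f"
    using time_smoothing[of 0] by auto
  have e: "(2 * 0 + 1) / 4 = (1 / 4 :: real)" by simp
  note C2 = C2[unfolded e]
  show ?thesis
  \<comment> \<open>The summand 1 secures positivity, since \<open>C\<^sub>1\<close> and
    \<open>C\<^sub>2\<close> are only known to be nonnegative.\<close>
  proof (intro exI[of _ "sqrt C\<^sub>1 + sqrt C\<^sub>2 + 1"] conjI allI impI)
    show "0 < sqrt C\<^sub>1 + sqrt C\<^sub>2 + 1" using C1(1) C2(1) by (simp add: add_nonneg_pos)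
    fix T :: real and F :: "real \<Rightarrow> (real \<times> real) distribution" assume "0 < T \<and> T < 1 \<and> continuous_sobolev T s F"
    then have T: "0 < T" "T < 1" and F: "continuous_sobolev T s F" by auto
    let ?K = "SUP t\<in>{0..T}. sobolev_norm s (F t)"
    obtain G where "duhamel_data s T ?K F G" using duhamel_data_exists[OF F T] by blast
    then interpret duhamel_data s T ?K F G .
    show "\<exists>g. is_slice T (duhamel F) x\<^sub>2 g" for x\<^sub>2 by (rule slice_exists[OF s(1)])
    fix w :: "real \<Rightarrow> real \<times> real \<Rightarrow> complex" assume w: "\<forall>x\<^sub>2. is_slice T (duhamel F) x\<^sub>2 (w x\<^sub>2)"
    have c1: "\<forall>f y. time_data T f \<longrightarrow> (\<integral>\<^sup>+\<tau>. ennreal (sob_weight ((2 * s + 1) / 4) \<tau> * (cmod (vhat T f y \<tau>))\<^sup>2) \<partial>lborel) \<le> ennreal C\<^sub>1 * wnorm s f" using C1(2) by blast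
    have c2: "\<forall>f y. time_data T f \<longrightarrow> (\<integral>\<^sup>+\<tau>. ennreal (sob_weight (1 / 4) \<tau> * (cmod (vhat T f y \<tau>))\<^sup>2) \<partial>lborel) \<le> ennreal C\<^sub>2 * wnorm 0 f" using C2(2) by blast
    have b: "w x\<^sub>2 \<in> B_space s T" "B_norm s T (w x\<^sub>2) \<le> (sqrt C\<^sub>1 + sqrt C\<^sub>2) * sqrt T * ?K" for x\<^sub>2
      by (rule slice_bound[OF s(1) C1(1) c1 C2(1) c2 w[rule_format]])+
    have "(sqrt C\<^sub>1 + sqrt C\<^sub>2) * sqrt T * ?K \<le> (sqrt C\<^sub>1 + sqrt C\<^sub>2 + 1) * sqrt T * ?K"
      using K0 T by (intro mult_right_mono) auto
    then have b': "B_norm s T (w x\<^sub>2) \<le> (sqrt C\<^sub>1 + sqrt C\<^sub>2 + 1) * sqrt T * ?K" for x\<^sub>2 using b(2) order_trans by blast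
    show "w x\<^sub>2 \<in> B_space s T" for x\<^sub>2 by (rule b(1))
    show "bdd_above (range (\<lambda>x\<^sub>2. B_norm s T (w x\<^sub>2)))" using b' by (intro bdd_aboveI2)
    show "(SUP x\<^sub>2. B_norm s T (w x\<^sub>2)) \<le> (sqrt C\<^sub>1 + sqrt C\<^sub>2 + 1) * sqrt T * ?K" using b' by (intro cSUP_least) auto
  qed
qed

theorem theorem3p3:
  "(\<forall>(s::real) (T::real) (F :: real \<Rightarrow> (real \<times> real) distribution).
      0 < T \<and> T < 1 \<and> continuous_sobolev T s F \<longrightarrow>
        (\<forall>t\<in>{0..T}. duhamel F t \<in> sobolev s) \<and>
        bdd_above ((\<lambda>t. sobolev_norm s (duhamel F t)) ` {0..T}) \<and>
        (SUP t\<in>{0..T}. sobolev_norm s (duhamel F t)) \<le> T * (SUP t\<in>{0..T}. sobolev_norm s (F t)))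
   \<and>
   (\<forall>s::real. 1 / 2 < s \<and> s \<le> 3 / 2 \<longrightarrow>
      (\<exists>c>0. \<forall>(T::real) (F :: real \<Rightarrow> (real \<times> real) distribution).
         0 < T \<and> T < 1 \<and> continuous_sobolev T s F \<longrightarrow>
           (\<forall>x\<^sub>2. \<exists>g. is_slice T (duhamel F) x\<^sub>2 g) \<and>
           (\<forall>w :: real \<Rightarrow> real \<times> real \<Rightarrow> complex.
              (\<forall>x\<^sub>2. is_slice T (duhamel F) x\<^sub>2 (w x\<^sub>2)) \<longrightarrow>
                (\<forall>x\<^sub>2. w x\<^sub>2 \<in> B_space s T) \<and>
                bdd_above (range (\<lambda>x\<^sub>2. B_norm s T (w x\<^sub>2))) \<and>
                (SUP x\<^sub>2. B_norm s T (w x\<^sub>2)) \<le> c * sqrt T * (SUP t\<in>{0..T}. sobolev_norm s (F t)))))"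
proof (intro conjI allI impI)
  fix s T :: real and F :: "real \<Rightarrow> (real \<times> real) distribution"
  assume "0 < T \<and> T < 1 \<and> continuous_sobolev T s F"
  then have F: "continuous_sobolev T s F" and T: "0 < T" "T < 1" by auto
  show "\<forall>t\<in>{0..T}. duhamel F t \<in> sobolev s"
    "bdd_above ((\<lambda>t. sobolev_norm s (duhamel F t)) ` {0..T})"
    "(SUP t\<in>{0..T}. sobolev_norm s (duhamel F t)) \<le> T * (SUP t\<in>{0..T}. sobolev_norm s (F t))"
    by (rule duhamel_sobolev_estimate[OF F T])+
qed (rule duhamel_slice_estimate; erule conjE; assumption)

end
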